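(* Let $E:=[-1,1]$ and $D:=\widehat{\mathbb C}\setminus E$. Let $F=\bigsqcup_{j=1}^p F_j\subset\mathbb R$ be a finite union of disjoint closed intervals whose convex hull $\widehat F$ lies on the real line strictly to the right of $E$ (so $\widehat F\cap E=\varnothing$). Let $\sigma$ be a positive Borel measure with support $S(\sigma)=F$ and $\sigma'(t)=d\sigma/dt>0$ almost everywhere on $F$, and put $h(z)=\widehat\sigma(z):=\int_F\frac{d\sigma(t)}{z-t}$. Define $$f_1(z):=\frac1{(z^2-1)^{1/2}},\qquad f_2(z):=\frac1\pi\int_{-1}^1\frac{h(x)}{z-x}\frac{dx}{\sqrt{1-x^2}},\qquad z\in D.$$ For $n\in\mathbb N$ let $q_{2n}\not\equiv0$ be a polynomial of degree $\le 2n$ with real coefficients such that, for some real polynomials $p_{2n,1},p_{2n,2}$ of degree $\le 2n-1$, $$(q_{2n}f_1-p_{2n,1})(z)=O(z^{-n-1}),\quad (q_{2n}f_2-p_{2n,2})(z)=O(z^{-n-1}),\quad z\to\infty$$ (Hermite--Padé polynomials of type II), normalized to be monic. Then $\deg q_{2n}=2n$ for all sufficiently large $n$, all zeros of $q_{2n}$ lie in $(-1,1)$, and $$\lim_{n\to\infty}\log\frac1{|q_{2n}(z)|^{1/n}}=U^{\lambda_F}(z)-\int_F\log\frac1{|\varphi(z)-\varphi(t)|}\,d\lambda_F(t)-2\log|\varphi(z)|+\log2$$ uniformly on compact subsets of $\mathbb C\setminus E$, where $\lambda_F$ is the equilibrium measure described in the context.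
   Context: The branch of $(z^2-1)^{1/2}$ is chosen with $(z^2-1)^{1/2}/z\to1$ as $z\to\infty$; for $x\in(-1,1)$, $\sqrt{1-x^2}>0$. $\varphi(z):=z+(z^2-1)^{1/2}$ is the inverse Joukowsky function on $D$ (real-valued on $\mathbb R\setminus E$, $|\varphi|>1$ on $D$). $U^\mu(z):=\int\log\frac1{|z-t|}\,d\mu(t)$ is the logarithmic potential. The measure $\lambda_F$ is the unique probability measure on $F$ (with finite logarithmic energy) minimizing the energy $$J(\mu)=\iint_{F\times F}\log\frac{|1-\varphi(x)\varphi(t)|}{|x-t|^2}\,d\mu(x)\,d\mu(t)+2\int_F\log|\varphi(x)|\,d\mu(x)$$ over all probability measures $\mu$ supported on $F$. Equivalently, on the Riemann surface $\mathfrak R_2$ of $w^2=z^2-1$ with $\Phi(\mathbf z)=z+w$, sheets $z^{(0)}=(z,(z^2-1)^{1/2})$, $z^{(1)}=(z,-(z^2-1)^{1/2})$, external field $V(\mathbf z)=-\log|\Phi(\mathbf z)|$ and kernel $\log\bigl(|1-1/(\Phi(\mathbf z)\Phi(\mathbf t))|/|z-t|^2\bigr)$, $\lambda_F$ is the projection to $F$ of the equilibrium measure on the lifted compact set $F^{(1)}$ in the first sheet. *)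

theory Defs
  imports "HOL-Analysis.Analysis" "HOL-Library.Landau_Symbols"
          "HOL-Computational_Algebra.Polynomial"
begin

text \<open>Branch of (z^2-1)^{1/2} analytic on C minus [-1,1] with (z^2-1)^{1/2}/z -> 1 at infinity.\<close>
definition sqz :: "complex \<Rightarrow> complex" where
  "sqz z = csqrt (z - 1) * csqrt (z + 1)"

definition phi :: "complex \<Rightarrow> complex" where
  "phi z = z + sqz z"

definition Eint :: "complex set" where
  "Eint = complex_of_real ` {-1..1}"

definition msupport :: "real measure \<Rightarrow> real set" where
  "msupport \<sigma> = {x. \<forall>e>0. emeasure \<sigma> (ball x e) > 0}"

definition admissible_F :: "real set \<Rightarrow> bool" where
  "admissible_F F \<longleftrightarrow> (\<exists>p::nat. \<exists>a b :: nat \<Rightarrow> real. p \<ge> 1 \<and>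
      (\<forall>j<p. a j < b j) \<and> (\<forall>j. Suc j < p \<longrightarrow> b j < a (Suc j)) \<and>
      1 < a 0 \<and> F = (\<Union>j<p. {a j..b j}))"

definition pos_density_at :: "real measure \<Rightarrow> real \<Rightarrow> bool" where
  "pos_density_at \<sigma> t \<longleftrightarrow>
     (\<exists>D>0. ((\<lambda>e. measure \<sigma> {t - e..t + e} / (2 * e)) \<longlongrightarrow> D) (at_right 0))"

definition cauchy_tr :: "real measure \<Rightarrow> complex \<Rightarrow> complex" where
  "cauchy_tr \<sigma> z = (\<integral>t. 1 / (z - complex_of_real t) \<partial>\<sigma>)"

definition f1 :: "complex \<Rightarrow> complex" where
  "f1 z = 1 / sqz z"

definition f2 :: "real measure \<Rightarrow> complex \<Rightarrow> complex" where
  "f2 \<sigma> z = (1 / pi) * (LINT x:{-1<..<1}|lborel.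
      cauchy_tr \<sigma> (complex_of_real x) / (z - complex_of_real x) / complex_of_real (sqrt (1 - x\<^sup>2)))"

definition prob_on :: "real set \<Rightarrow> real measure \<Rightarrow> bool" where
  "prob_on F \<mu> \<longleftrightarrow> sets \<mu> = sets borel \<and> emeasure \<mu> UNIV = 1 \<and> emeasure \<mu> (- F) = 0"

definition finite_log_energy :: "real measure \<Rightarrow> bool" where
  "finite_log_energy \<mu> \<longleftrightarrow> (\<forall>x. emeasure \<mu> {x} = 0) \<and>
     integrable (\<mu> \<Otimes>\<^sub>M \<mu>) (\<lambda>xt. ln \<bar>fst xt - snd xt\<bar>)"

definition Jen :: "real measure \<Rightarrow> real" where
  "Jen \<mu> = (\<integral>xt. ln (cmod (1 - phi (of_real (fst xt)) * phi (of_real (snd xt)))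
                    / \<bar>fst xt - snd xt\<bar>\<^sup>2) \<partial>(\<mu> \<Otimes>\<^sub>M \<mu>))
          + 2 * (\<integral>x. ln (cmod (phi (of_real x))) \<partial>\<mu>)"

definition is_equilibrium :: "real set \<Rightarrow> real measure \<Rightarrow> bool" where
  "is_equilibrium F lF \<longleftrightarrow> prob_on F lF \<and> finite_log_energy lF \<and>
     (\<forall>\<mu>. prob_on F \<mu> \<and> finite_log_energy \<mu> \<longrightarrow> Jen lF \<le> Jen \<mu>)"

definition logpot :: "real measure \<Rightarrow> complex \<Rightarrow> real" where
  "logpot \<mu> z = (\<integral>t. ln (1 / cmod (z - complex_of_real t)) \<partial>\<mu>)"

abbreviation cpoly :: "real poly \<Rightarrow> complex \<Rightarrow> complex" where
  "cpoly q z \<equiv> poly (map_poly complex_of_real q) z"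

end

theory Submission
  imports Defs "HOL-Probability.Probability"
begin

text \<open>The approximation conditions say that \<open>q = q\<^sub>2\<^sub>n\<close> is orthogonal to \<open>x\<^sup>k\<close>, \<open>k < n\<close>, with respect to the
  arcsine measure, and that its Cauchy transform is orthogonal to \<open>t\<^sup>k\<close> with respect to \<open>\<sigma>\<close>. Hence the
  Cauchy transform vanishes at \<open>n\<close> points \<open>S\<close> to the right of \<open>E\<close>, and \<open>q\<close> is the Bernstein--Szego polynomial
  \<open>4\<^sup>-\<^sup>n (u\<^sup>2\<^sup>n H(1/u) + u\<^sup>-\<^sup>2\<^sup>n H(u))\<close>, \<open>z = (u + 1/u) / 2\<close>, where \<open>H\<close> has the zeros \<open>\<phi>(s)\<close>, \<open>s \<in> S\<close>. This locates the
  zeros of \<open>q\<close> and reduces the asymptotics to the limit distribution of \<open>S\<close>. The points \<open>S\<close> are the zeros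
  of a polynomial orthogonal with respect to \<open>\<sigma>\<close> times a weight that depends on \<open>S\<close> itself; by Heine's formula
  and large deviation estimates for the energy, every limit of their distributions minimizes the
  logarithmic energy in the external field generated by that limit. The first-order conditions
  of this problem and of \<open>\<lambda>\<^sub>F\<close> combine, by positive definiteness of the kernels, to the equality
  of the limit and \<open>\<lambda>\<^sub>F\<close>.\<close>

subsection \<open>The Joukowsky map\<close>

text \<open>The weight in the orthogonality relation of \<open>S\<close> depends on \<open>n\<close>
  and on \<open>S\<close> itself, so no fixed extremal problem is available in advance. The way out
  is to freeze it: along a subsequence the empirical measures converge, the fields they generate
  converge uniformly (the kernel \<open>ln (1 - 1 / (tau x * tau t))\<close> is smooth on
  \<open>F\<close>), and only the limiting field enters the large deviation estimate. Since the
  density of \<sigma> is merely positive almost everywhere, the lower bound for the partition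
  integral is taken over measures dominated by \<sigma>, which have to be shown dense in energy.
  Finally, compact subsets of the complement of \<open>E\<close> may meet \<open>F\<close>; there
  the two integrals of the limit formula are singular, and their separate convergence is a property
  of the equilibrium measure that needs proof.\<close>

definition tau :: "real \<Rightarrow> real" where
  "tau t = t + sqrt (t\<^sup>2 - 1)"

lemma tau_ge: "1 \<le> t \<Longrightarrow> t \<le> tau t"
  unfolding tau_def by (simp add: one_le_power)

lemma tau_gt1: "1 < t \<Longrightarrow> 1 < tau t"
  using tau_ge[of t] by linarith

lemma tau_pos: "1 \<le> t \<Longrightarrow> 0 < tau t"
  using tau_ge[of t] by linarith

lemma tau_mult: "1 \<le> t \<Longrightarrow> tau t * (t - sqrt (t\<^sup>2 - 1)) = 1"
  unfolding tau_def by (simp add: algebra_simps power2_eq_square[symmetric] one_le_power)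

lemma inverse_tau: "1 \<le> t \<Longrightarrow> 1 / tau t = t - sqrt (t\<^sup>2 - 1)"
  using tau_mult[of t] tau_pos[of t] by (simp add: field_simps)

lemma tau_add_inverse: "1 \<le> t \<Longrightarrow> tau t + 1 / tau t = 2 * t"
  by (simp add: inverse_tau) (simp add: tau_def)

text \<open>Subtract two instances of 2 t = tau t + 1 / tau t and factor. On [a, b] with a > 1 the
  second factor stays away from 0, so the singular behaviour of ln |t - s| is entirely that of ln
  |tau t - tau s|.\<close>

lemma tau_diff: "1 \<le> s \<Longrightarrow> 1 \<le> t \<Longrightarrow> t - s = (tau t - tau s) * (1 - 1 / (tau t * tau s)) / 2"
proof -
  assume "1 \<le> s" "1 \<le> t"
  then have "2 * (t - s) = (tau t + 1 / tau t) - (tau s + 1 / tau s)" by (simp add: tau_add_inverse)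
  also have "... = (tau t - tau s) * (1 - 1 / (tau t * tau s))"
    using tau_pos[OF \<open>1 \<le> s\<close>] tau_pos[OF \<open>1 \<le> t\<close>] by (simp add: field_simps)
  finally show ?thesis by simp
qed

lemma tau_expand: "1 \<le> s \<Longrightarrow> s \<le> t \<Longrightarrow> t - s \<le> tau t - tau s"
  unfolding tau_def by (simp add: power_mono)

lemma tau_mono: "1 \<le> s \<Longrightarrow> s \<le> t \<Longrightarrow> tau s \<le> tau t"
  using tau_expand[of s t] by linarith

lemma tau_measurable [measurable]: "tau \<in> borel_measurable borel"
  unfolding tau_def by measurable

lemma continuous_on_tau [continuous_intros]: "continuous_on A f \<Longrightarrow> continuous_on A (\<lambda>x. tau (f x))"
  unfolding tau_def by (intro continuous_intros)

lemma sqz_real: "1 \<le> t \<Longrightarrow> sqz (complex_of_real t) = complex_of_real (sqrt (t\<^sup>2 - 1))"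
proof -
  assume t: "1 \<le> t"
  have 1: "complex_of_real t - 1 = complex_of_real (t - 1)" "complex_of_real t + 1 = complex_of_real (t + 1)" by simp_all
  have "sqrt (t - 1) * sqrt (t + 1) = sqrt (t\<^sup>2 - 1)" by (simp add: real_sqrt_mult[symmetric] algebra_simps power2_eq_square)
  then show ?thesis unfolding sqz_def 1 using t by (subst (1 2) of_real_sqrt[symmetric]) (auto simp flip: of_real_mult)
qed

lemma phi_real: "1 \<le> t \<Longrightarrow> phi (of_real t) = of_real (tau t)"
  by (simp add: phi_def sqz_real tau_def)

lemma f1_real: "1 \<le> t \<Longrightarrow> f1 (complex_of_real t) = complex_of_real (1 / sqrt (t\<^sup>2 - 1))"
  by (simp add: f1_def sqz_real)

lemma sqz_square: "sqz z * sqz z = z\<^sup>2 - 1"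
proof -
  have "sqz z * sqz z = (csqrt (z - 1))\<^sup>2 * (csqrt (z + 1))\<^sup>2" by (simp only: sqz_def power2_eq_square ac_simps)
  also have "... = (z - 1) * (z + 1)" by (simp only: power2_csqrt)
  finally show ?thesis by (simp add: algebra_simps power2_eq_square)
qed

lemma phi_mult: "phi z * (z - sqz z) = 1"
  unfolding phi_def using sqz_square[of z] by (simp add: algebra_simps power2_eq_square)

lemma phi_nonzero: "phi z \<noteq> 0"
  using phi_mult[of z] by auto

lemma inverse_phi: "1 / phi z = z - sqz z"
  using phi_mult[of z] phi_nonzero[of z] by (simp add: field_simps)

lemma phi_add_inverse: "phi z + 1 / phi z = 2 * z"
  by (simp add: inverse_phi) (simp add: phi_def)

lemma phi_diff: "z - w = (phi z - phi w) * (1 - 1 / (phi z * phi w)) / 2"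
proof -
  have "2 * (z - w) = (phi z + 1 / phi z) - (phi w + 1 / phi w)" by (simp add: phi_add_inverse)
  also have "... = (phi z - phi w) * (1 - 1 / (phi z * phi w))"
    using phi_nonzero[of z] phi_nonzero[of w] by (simp add: field_simps)
  finally show ?thesis by (metis nonzero_mult_div_cancel_left zero_neq_numeral)
qed

text \<open>With \<open>a\<close> and \<open>b\<close> the two square roots, z is half of a^2 + b^2
  and \<open>sqz z\<close> is their product, so Re (sqz z * cnj z) is a nonnegative multiple of Re
  (a * cnj b). Both roots lie in the closed right half plane and on the same side of the real axis,
  which makes this nonnegative. Hence |z - sqz z| is at most |z + sqz z|, and the product of the two
  moduli is 1.\<close>

lemma norm_phi_ge_1: "1 \<le> cmod (phi z)"
proof -
  define a b where "a = csqrt (z - 1)" and "b = csqrt (z + 1)"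
  have zab: "z = (a\<^sup>2 + b\<^sup>2) / 2" "sqz z = a * b" by (simp_all add: a_def b_def sqz_def)
  have re: "0 \<le> Re a" "0 \<le> Re b" by (simp_all only: a_def b_def Re_csqrt)
  have im: "0 \<le> Im a * Im b"
  proof (cases "Im z = 0")
    case True
    then have i: "Im (z - 1) = 0" "Im (z + 1) = 0" by auto
    have "0 \<le> Im a \<and> 0 \<le> Im b"
      unfolding a_def b_def using i complex_Re_le_cmod[of "z - 1"] complex_Re_le_cmod[of "z + 1"] by (simp add: csqrt.sel)
    then show ?thesis by simp
  next
    case False
    have "sgn (Im a) = sgn (Im z) * 1 \<or> Im a = 0" "sgn (Im b) = sgn (Im z) * 1 \<or> Im b = 0"
      unfolding a_def b_def using False complex_Re_le_cmod[of "z - 1"] complex_Re_le_cmod[of "z + 1"] by (auto simp: csqrt.sel sgn_mult sgn_if zero_less_mult_iff split: if_splits)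
    then show ?thesis by (auto simp: sgn_if zero_le_mult_iff split: if_splits)
  qed
  have "Re (a * cnj b) \<ge> 0" using re im by simp
  moreover have "Re (a * b * cnj (a\<^sup>2 + b\<^sup>2)) = ((Re a)\<^sup>2 + (Im a)\<^sup>2 + (Re b)\<^sup>2 + (Im b)\<^sup>2) * Re (a * cnj b)"
    by (simp add: algebra_simps power2_eq_square)
  ultimately have "0 \<le> Re (a * b * cnj (a\<^sup>2 + b\<^sup>2))" by simp
  then have nonneg: "0 \<le> Re (sqz z * cnj z)" unfolding zab(2) by (subst zab(1)) (simp add: complex_cnj_divide)
  have "(cmod (z + sqz z))\<^sup>2 - (cmod (z - sqz z))\<^sup>2 = 4 * Re (sqz z * cnj z)"
    by (simp only: cmod_power2) (simp add: algebra_simps power2_eq_square)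
  with nonneg have "(cmod (z - sqz z))\<^sup>2 \<le> (cmod (phi z))\<^sup>2" unfolding phi_def by linarith
  then have "cmod (z - sqz z) \<le> cmod (phi z)" using power2_le_imp_le by (metis norm_ge_zero)
  moreover have "cmod (phi z) * cmod (z - sqz z) = 1" using phi_mult[of z] by (metis norm_mult norm_one)
  ultimately have "1 \<le> (cmod (phi z))\<^sup>2" by (metis mult_left_mono norm_ge_zero power2_eq_square)
  then show ?thesis by (simp add: power2_nonneg_ge_1_iff)
qed

text \<open>Write \<open>phi z = r w\<close> with |w| = 1. The point (w + 1 / w) / 2 = Re w of E is
  within (|u - w| + |1 / u - 1 / w|) / 2 of z, where u = phi z, and both terms are at most r - 1.
  The quantitative form yields |phi| > 1 off E and also a uniform lower bound on compact
  sets.\<close>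

lemma dist_Eint_le:
  obtains e where "e \<in> Eint" "cmod (z - e) \<le> cmod (phi z) - 1"
proof -
  define u r w where "u = phi z" and "r = cmod u" and "w = u / of_real r"
  have u: "u \<noteq> 0" "1 \<le> r" by (simp_all add: u_def r_def norm_phi_ge_1 phi_nonzero)
  have w: "cmod w = 1" using u by (simp add: w_def r_def norm_divide)
  then have wi: "1 / w = cnj w" by (simp add: complex_div_cnj[of 1])
  have uw: "u = of_real r * w" using u by (simp add: w_def)
  have "cmod (w + cnj w) \<le> 2" using norm_triangle_ineq[of w "cnj w"] w by simp
  then have "\<bar>Re w\<bar> \<le> 1" using abs_Re_le_cmod[of w] w by simp
  then have 1: "complex_of_real (Re w) \<in> Eint" unfolding Eint_def by (intro imageI) auto
  have "complex_of_real (Re w) = (w + 1 / w) / 2" by (simp add: wi complex_add_cnj)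
  moreover have "z = (u + 1 / u) / 2" by (simp add: u_def phi_add_inverse)
  ultimately have "z - complex_of_real (Re w) = ((u - w) + (1 / u - 1 / w)) / 2" by (simp add: field_simps)
  then have "cmod (z - of_real (Re w)) = cmod ((u - w) + (1 / u - 1 / w)) / 2" by (simp only: norm_divide norm_numeral)
  then have "cmod (z - of_real (Re w)) \<le> (cmod (u - w) + cmod (1 / u - 1 / w)) / 2"
    using norm_triangle_ineq[of "u - w" "1 / u - 1 / w"] by simp
  moreover have "u - w = of_real (r - 1) * w" by (simp add: uw algebra_simps)
  then have cmod_uw: "cmod (u - w) = r - 1" using u w by (simp only: norm_mult norm_of_real) simp
  moreover have "1 / u - 1 / w = (1 / w) * of_real (1 / r - 1)" using u w by (simp add: uw field_simps)
  then have inv: "cmod (1 / u - 1 / w) = \<bar>1 / r - 1\<bar>" using w by (simp only: norm_mult norm_of_real norm_divide) simp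
  moreover have "cmod (1 / u - 1 / w) \<le> r - 1" unfolding inv
  proof -
    have "0 \<le> (r - 1)\<^sup>2 / r" using u by simp
    also have "... = r - 1 - (1 - 1 / r)" using u by (simp add: field_simps power2_eq_square)
    finally have "1 - 1 / r \<le> r - 1" by simp
    moreover have "1 / r \<le> 1" using u by simp
    ultimately show "\<bar>1 / r - 1\<bar> \<le> r - 1" by simp
  qed
  ultimately have "cmod (z - of_real (Re w)) \<le> ((r - 1) + (r - 1)) / 2"
    by (simp only: cmod_uw) (meson add_left_mono divide_right_mono order_trans zero_le_numeral)
  then have "cmod (z - of_real (Re w)) \<le> r - 1" by simp
  with 1 that show ?thesis by (auto simp: r_def u_def)
qed

lemma norm_phi_gt_1: "z \<notin> Eint \<Longrightarrow> 1 < cmod (phi z)"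
proof -
  assume z: "z \<notin> Eint"
  obtain e where e: "e \<in> Eint" "cmod (z - e) \<le> cmod (phi z) - 1" by (rule dist_Eint_le)
  have "0 < cmod (z - e)" using z e(1) by auto
  with e(2) show ?thesis by linarith
qed

subsection \<open>The arcsine measure\<close>

text \<open>Normalized to mass 1, so that \<open>f1\<close> is its Cauchy transform and the factor 1
  / pi together with the root in \<open>f2\<close> is absorbed.\<close>

definition arcs :: "real measure" where
  "arcs = density lborel (\<lambda>x. ennreal (indicator {-1<..<1} x * (1 / (pi * sqrt (1 - x\<^sup>2)))))"

lemma sets_arcs [simp, measurable_cong]: "sets arcs = sets borel"
  by (simp add: arcs_def)

lemma space_arcs [simp]: "space arcs = UNIV"
  by (simp add: arcs_def)

lemma integral_arcs:
  fixes f :: "real \<Rightarrow> 'a::{banach, second_countable_topology}"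
  assumes [measurable]: "f \<in> borel_measurable borel"
  shows "(LINT x|arcs. f x) = (LINT x:{-1<..<1}|lborel. (1 / (pi * sqrt (1 - x\<^sup>2))) *\<^sub>R f x)"
  unfolding arcs_def set_lebesgue_integral_def
  by (subst integral_density) (auto simp: abs_square_le_1 indicator_def intro!: AE_I2 Bochner_Integration.integral_cong)

lemma sqrt_one_minus_pos: "-1 < x \<Longrightarrow> x < 1 \<Longrightarrow> 0 < sqrt (1 - x\<^sup>2)" for x :: real
  by (simp add: abs_square_less_1)

text \<open>The integrand is unbounded at both end points; the fundamental theorem for nonnegative
  integrands on an open interval delivers integrability together with the value.\<close>

lemma arcsine_density:
  "set_integrable lborel {-1<..<1} (\<lambda>x. 1 / sqrt (1 - x\<^sup>2))"
  "(LINT x:{-1<..<1}|lborel. 1 / sqrt (1 - x\<^sup>2)) = pi"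
proof -
  have d: "DERIV arcsin x :> 1 / sqrt (1 - x\<^sup>2)" if "ereal (-1) < ereal x" "ereal x < ereal 1" for x
    using DERIV_arcsin[of x] that by (simp add: inverse_eq_divide)
  have c: "isCont (\<lambda>x. 1 / sqrt (1 - x\<^sup>2)) x" if "ereal (-1) < ereal x" "ereal x < ereal 1" for x
    using that sqrt_one_minus_pos[of x] by (intro continuous_intros) auto
  have cont: "continuous_on {-1..1} arcsin" by (rule continuous_on_arcsin')
  have l1: "((arcsin \<circ> real_of_ereal) \<longlongrightarrow> arcsin (-1)) (at_right (ereal (-1)))"
    unfolding ereal_tendsto_simps by (rule continuous_on_Icc_at_rightD[OF cont]) simp
  have l2: "((arcsin \<circ> real_of_ereal) \<longlongrightarrow> arcsin 1) (at_left (ereal 1))"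
    unfolding ereal_tendsto_simps by (rule continuous_on_Icc_at_leftD[OF cont]) simp
  have nn: "AE x in lborel. ereal (-1) < ereal x \<longrightarrow> ereal x < ereal 1 \<longrightarrow> 0 \<le> 1 / sqrt (1 - x\<^sup>2)"
    by (auto simp: abs_square_le_1 intro!: AE_I2)
  have nn': "\<And>x. ereal (-1) < ereal x \<Longrightarrow> ereal x < ereal 1 \<Longrightarrow> 0 \<le> 1 / sqrt (1 - x\<^sup>2)" by (auto simp: abs_square_le_1)
  have lt: "ereal (-1) < ereal 1" by simp
  note * = interval_integral_FTC_nonneg[OF lt d c _ l1 l2]
  have "set_integrable lborel (einterval (ereal (-1)) (ereal 1)) (\<lambda>x. 1 / sqrt (1 - x\<^sup>2))"
    by (rule *(1)) (use nn nn' in auto)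
  then show "set_integrable lborel {-1<..<1} (\<lambda>x. 1 / sqrt (1 - x\<^sup>2))" by (simp add: einterval_eq)
  have "(LBINT x=ereal (-1)..ereal 1. 1 / sqrt (1 - x\<^sup>2)) = arcsin 1 - arcsin (-1)" by (rule *(2)) (use nn nn' in auto)
  then show "(LINT x:{-1<..<1}|lborel. 1 / sqrt (1 - x\<^sup>2)) = pi" by (simp add: interval_lebesgue_integral_def einterval_eq)
qed

lemma prob_space_arcs: "prob_space arcs"
proof
  have int: "integrable lborel (\<lambda>x. indicator {-1<..<1} x *\<^sub>R (1 / sqrt (1 - x\<^sup>2)) :: real)"
    using arcsine_density(1) unfolding set_integrable_def .
  have "emeasure arcs (space arcs) = (\<integral>\<^sup>+x. ennreal (1 / pi * (indicator {-1<..<1} x *\<^sub>R (1 / sqrt (1 - x\<^sup>2)))) \<partial>lborel)"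
    unfolding arcs_def by (subst emeasure_density) (auto intro!: nn_integral_cong simp: indicator_def)
  also have "... = ennreal (LINT x|lborel. 1 / pi * (indicator {-1<..<1} x *\<^sub>R (1 / sqrt (1 - x\<^sup>2))))"
    by (intro nn_integral_eq_integral integrable_mult_right int)
       (auto simp: indicator_def abs_square_le_1 intro!: AE_I2)
  also have "... = ennreal (1 / pi * pi)"
    using arcsine_density(2) unfolding set_lebesgue_integral_def by (simp only: integral_mult_right_zero)
  finally show "emeasure arcs (space arcs) = 1" by simp
qed

interpretation arcs: prob_space arcs by (rule prob_space_arcs)

lemma measure_arcs_UNIV [simp]: "measure arcs UNIV = 1"
  using arcs.prob_space by simp

lemma AE_arcs: "AE x in arcs. -1 < x \<and> x < 1"
  unfolding arcs_def by (subst AE_density) (auto simp: indicator_def intro!: AE_I2)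

lemma integrable_arcs_bounded:
  fixes f :: "real \<Rightarrow> 'a::{banach, second_countable_topology}"
  assumes "f \<in> borel_measurable borel" "\<And>x. -1 < x \<Longrightarrow> x < 1 \<Longrightarrow> norm (f x) \<le> B"
  shows "integrable arcs f" using assms AE_arcs by (intro arcs.integrable_const_bound[of _ B]) auto

lemma norm_integral_arcs_le:
  fixes f :: "real \<Rightarrow> 'a::{banach, second_countable_topology}"
  assumes "f \<in> borel_measurable borel" "\<And>x. -1 < x \<Longrightarrow> x < 1 \<Longrightarrow> norm (f x) \<le> B"
  shows "norm (LINT x|arcs. f x) \<le> B"
proof -
  have "norm (LINT x|arcs. f x) \<le> (LINT x|arcs. norm (f x))" by (rule integral_norm_bound)
  also have "... \<le> (LINT x|arcs. B)" using assms AE_arcs integrable_arcs_bounded[OF assms] by (intro integral_mono_AE) auto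
  finally show ?thesis by (simp add: arcs.prob_space)
qed

lemma integrable_arcs_cont:
  fixes f :: "real \<Rightarrow> real"
  assumes "f \<in> borel_measurable borel" "continuous_on {-1..1} f"
  shows "integrable arcs f"
proof -
  have "compact (f ` {-1..1})" using assms(2) by (intro compact_continuous_image) auto
  then obtain B where "\<And>y. y \<in> f ` {-1..1} \<Longrightarrow> norm y \<le> B" using compact_imp_bounded bounded_iff by metis
  then show ?thesis by (intro integrable_arcs_bounded[of _ B]) (use assms in auto)
qed

section \<open>Chebyshev polynomials and their integrals against the arcsine measure\<close>

fun cheb :: "nat \<Rightarrow> real poly" where
  "cheb 0 = 1"
| "cheb (Suc 0) = [:0, 1:]"
| "cheb (Suc (Suc n)) = [:0, 2:] * cheb (Suc n) - cheb n"

lemma poly_cheb_rec: "poly (cheb (Suc (Suc n))) x = 2 * x * poly (cheb (Suc n)) x - poly (cheb n) x"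
  by simp

lemma cos_add_two: "cos ((real n + 2) * t) = 2 * cos t * cos ((real n + 1) * t) - cos (real n * t)"
proof -
  have "(real n + 2) * t = (real n + 1) * t + t" "real n * t = (real n + 1) * t - t" by (simp_all add: algebra_simps)
  then show ?thesis by (simp only: cos_add cos_diff) (simp add: algebra_simps)
qed

lemma cheb_cos: "poly (cheb n) (cos t) = cos (real n * t)"
proof (induction n rule: cheb.induct)
  case (3 n)
  then show ?case unfolding poly_cheb_rec using cos_add_two[of n t] by (simp add: algebra_simps)
qed auto

lemma cheb_degree_lead: "degree (cheb n) = n \<and> (n \<ge> 1 \<longrightarrow> lead_coeff (cheb n) = 2 ^ (n - 1))"
proof (induction n rule: cheb.induct)
  case (3 n)
  then have d: "degree (cheb n) = n" "degree (cheb (Suc n)) = Suc n" "lead_coeff (cheb (Suc n)) = 2 ^ n" by auto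
  have ne: "cheb (Suc n) \<noteq> 0" using d by auto
  have d1: "degree ([:0, 2:] * cheb (Suc n)) = Suc (Suc n)" using ne d by (subst degree_mult_eq) auto
  have lt: "degree (- cheb n) < degree ([:0, 2:] * cheb (Suc n))" using d d1 by simp
  have e: "cheb (Suc (Suc n)) = [:0, 2:] * cheb (Suc n) + - cheb n" by simp
  have deg: "degree (cheb (Suc (Suc n))) = Suc (Suc n)" unfolding e using degree_add_eq_left[OF lt] d1 by simp
  have "lead_coeff (cheb (Suc (Suc n))) = lead_coeff (- cheb n + [:0, 2:] * cheb (Suc n))" by simp
  also have "... = lead_coeff ([:0, 2:] * cheb (Suc n))" by (rule lead_coeff_add_le[OF lt])
  also have "... = 2 * 2 ^ n" unfolding lead_coeff_mult using d by simp
  finally show ?case using deg by simp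
qed auto

lemma cpoly_add: "cpoly (p + q) z = cpoly p z + cpoly q z"
proof -
  have "map_poly complex_of_real (p + q) = map_poly complex_of_real p + map_poly complex_of_real q"
    by (intro poly_eqI) (simp add: coeff_map_poly)
  then show ?thesis by simp
qed

lemma cpoly_mult: "cpoly (p * q) z = cpoly p z * cpoly q z"
proof -
  have "map_poly complex_of_real (p * q) = map_poly complex_of_real p * map_poly complex_of_real q"
    by (intro poly_eqI) (simp add: coeff_map_poly coeff_mult)
  then show ?thesis by simp
qed

lemma cpoly_pCons: "cpoly (pCons a p) z = of_real a + z * cpoly p z"
  by (simp add: map_poly_pCons)

lemma cpoly_smult: "cpoly (smult a p) z = of_real a * cpoly p z"
  using cpoly_mult[of "[:a:]" p z] by (simp add: cpoly_pCons)

lemma cpoly_diff: "cpoly (p - q) z = cpoly p z - cpoly q z"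
  using cpoly_add[of p "smult (-1) q" z] cpoly_smult[of "-1" q z] by simp

lemma cpoly_of_real: "cpoly p (of_real x) = of_real (poly p x)"
  by (induction p) (simp_all add: cpoly_pCons)

text \<open>T_n(cos t) = cos (n t), continued to complex arguments through u = exp (i t). The
  recurrence alone proves it, for u inside the unit disc as well as outside.\<close>

lemma cheb_complex:
  assumes "u \<noteq> (0::complex)"
  shows "2 * cpoly (cheb n) ((u + 1 / u) / 2) = u ^ n + (1 / u) ^ n"
proof (induction n rule: cheb.induct)
  case (2) show ?case by (simp add: map_poly_pCons)
next
  case (3 n)
  let ?z = "(u + 1 / u) / 2" and ?v = "1 / u"
  have uv: "u * ?v = 1" using assms by simp
  have "cpoly (cheb (Suc (Suc n))) ?z = 2 * ?z * cpoly (cheb (Suc n)) ?z - cpoly (cheb n) ?z"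
    by (simp add: cpoly_diff cpoly_mult cpoly_pCons del: mult_pCons_left)
  then have "2 * cpoly (cheb (Suc (Suc n))) ?z = (u + ?v) * (2 * cpoly (cheb (Suc n)) ?z) - 2 * cpoly (cheb n) ?z"
    by (simp add: algebra_simps)
  also have "... = (u + ?v) * (u ^ Suc n + ?v ^ Suc n) - (u ^ n + ?v ^ n)" by (simp only: 3)
  also have "... = u ^ Suc (Suc n) + ?v ^ Suc (Suc n) + (u * ?v) * u ^ n + (u * ?v) * ?v ^ n - (u ^ n + ?v ^ n)"
    by (simp only: power_Suc) algebra
  also have "... = u ^ Suc (Suc n) + ?v ^ Suc (Suc n)" by (simp only: uv) simp
  finally show ?case .
qed auto

lemma abs_cheb_le_1: "-1 \<le> x \<Longrightarrow> x \<le> 1 \<Longrightarrow> \<bar>poly (cheb n) x\<bar> \<le> 1"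
  using cheb_cos[of n "arccos x"] abs_cos_le_one by (metis cos_arccos)

lemma borel_measurable_poly [measurable]: "poly (p :: real poly) \<in> borel_measurable borel"
  by (intro borel_measurable_continuous_onI continuous_intros)

lemma integrable_arcs_poly: "integrable arcs (poly p)"
  by (intro integrable_arcs_cont) (auto intro!: continuous_intros)

text \<open>In the variable arccos x the integrand is a cosine, so - sin (m arccos x) / m is an
  antiderivative; it vanishes at both end points.\<close>

lemma integral_arcs_cheb:
  assumes "m \<ge> 1"
  shows "(LINT x|arcs. poly (cheb m) x) = 0"
proof -
  define f where "f x = poly (cheb m) x / sqrt (1 - x\<^sup>2)" for x
  define F where "F x = - (sin (real m * arccos x) / real m)" for x
  have d: "(F has_vector_derivative f x) (at x)" if "ereal (-1) < ereal x" "ereal x < ereal 1" for x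
  proof -
    have x: "-1 < x" "x < 1" using that by auto
    have s: "sqrt (1 - x\<^sup>2) \<noteq> 0" using sqrt_one_minus_pos[OF x] by simp
    have "DERIV F x :> - (cos (real m * arccos x) * (real m * inverse (- sqrt (1 - x\<^sup>2))) / real m)" unfolding F_def using x
      by (auto intro!: derivative_eq_intros DERIV_arccos)
    also have "- (cos (real m * arccos x) * (real m * inverse (- sqrt (1 - x\<^sup>2))) / real m) = f x"
      using assms s cheb_cos[of m "arccos x"] x by (simp add: f_def field_simps)
    finally show ?thesis by (simp add: has_real_derivative_iff_has_vector_derivative)
  qed
  have c: "isCont f x" if "ereal (-1) < ereal x" "ereal x < ereal 1" for x
    unfolding f_def using that sqrt_one_minus_pos[of x] by (intro continuous_intros) auto
  have cont: "continuous_on {-1..1} F" unfolding F_def using assms by (intro continuous_intros continuous_on_arccos') auto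
  have l1: "((F \<circ> real_of_ereal) \<longlongrightarrow> F (-1)) (at_right (ereal (-1)))"
    unfolding ereal_tendsto_simps by (rule continuous_on_Icc_at_rightD[OF cont]) simp
  have l2: "((F \<circ> real_of_ereal) \<longlongrightarrow> F 1) (at_left (ereal 1))"
    unfolding ereal_tendsto_simps by (rule continuous_on_Icc_at_leftD[OF cont]) simp
  have int: "set_integrable lborel {-1<..<1} f" unfolding f_def
    apply (rule set_integrable_bound[OF arcsine_density(1)])
    subgoal by (auto simp: set_borel_measurable_def)
    subgoal by (auto intro!: AE_I2 simp: abs_square_le_1 abs_cheb_le_1 divide_right_mono)
    done
  have "(LBINT x=ereal (-1)..ereal 1. f x) = F 1 - F (-1)"
    by (rule interval_integral_FTC_integrable[OF _ d c _ l1 l2]) (use int in \<open>auto simp: einterval_eq\<close>)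
  also have "... = 0" by (simp add: F_def)
  finally have 0: "(LINT x:{-1<..<1}|lborel. f x) = 0" by (simp add: interval_lebesgue_integral_def einterval_eq)
  have "(LINT x|arcs. poly (cheb m) x) = (LINT x:{-1<..<1}|lborel. (1 / pi) * f x)"
    by (subst integral_arcs) (auto simp: f_def)
  also have "... = 0" using 0 by simp
  finally show ?thesis .
qed

text \<open>x T_m = (T_(m+1) + T_(m-1)) / 2 trades one power of x for two neighbouring indices; as k
  < m, the index never comes down to 0.\<close>

lemma integral_arcs_power_cheb:
  assumes "k < m"
  shows "(LINT x|arcs. x ^ k * poly (cheb m) x) = 0" using assms
proof (induction k arbitrary: m)
  case 0
  then show ?case using integral_arcs_cheb[of m] by simp
next
  case (Suc k)
  then obtain l where m: "m = Suc l" "k < l" by (cases m) auto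
  have i: "integrable arcs (\<lambda>x. x ^ k * poly (cheb j) x)" for j
    by (intro integrable_arcs_cont) (auto intro!: continuous_intros)
  have eq: "x ^ Suc k * poly (cheb m) x = (x ^ k * poly (cheb (Suc (Suc l))) x + x ^ k * poly (cheb l) x) / 2" for x
    by (simp add: m poly_cheb_rec algebra_simps)
  have "(LINT x|arcs. x ^ Suc k * poly (cheb m) x)
     = ((LINT x|arcs. x ^ k * poly (cheb (Suc (Suc l))) x) + (LINT x|arcs. x ^ k * poly (cheb l) x)) / 2"
    unfolding eq using i by (simp del: cheb.simps)
  also have "... = 0" using Suc.IH[of l] Suc.IH[of "Suc (Suc l)"] m by simp
  finally show ?case .
qed

text \<open>The moments \<open>c m\<close> satisfy the Chebyshev recurrence, whose solutions are combinations of
  \<open>tau t ^ m\<close> and \<open>tau t ^ (- m)\<close>; boundedness excludes the first one, and the initial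
  condition \<open>c 1 = t * c 0 - 1\<close> fixes the constant.\<close>

lemma integral_arcs_cheb_cauchy:
  assumes t: "1 < t"
  shows "(LINT x|arcs. poly (cheb m) x / (t - x)) = (1 / tau t) ^ m / sqrt (t\<^sup>2 - 1)"
proof -
  define c where "c m = (LINT x|arcs. poly (cheb m) x / (t - x))" for m
  have i: "integrable arcs (\<lambda>x. poly (cheb j) x / (t - x))" for j
    by (intro integrable_arcs_cont) (use t in \<open>auto intro!: continuous_intros\<close>)
  have bnd: "\<bar>c m\<bar> \<le> 1 / (t - 1)" for m
  proof -
    have "norm (poly (cheb m) x / (t - x)) \<le> 1 / (t - 1)" if "-1 < x" "x < 1" for x
      using abs_cheb_le_1[of x m] that t by (simp add: frac_le)
    then show ?thesis unfolding c_def real_norm_def[symmetric] by (intro norm_integral_arcs_le) auto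
  qed
  have rec: "c (Suc (Suc m)) = 2 * t * c (Suc m) - c m" for m
  proof -
    have "poly (cheb (Suc (Suc m))) x / (t - x) = 2 * t * (poly (cheb (Suc m)) x / (t - x)) - poly (cheb m) x / (t - x)
       - 2 * poly (cheb (Suc m)) x" if "-1 < x \<and> x < 1" for x
    proof -
      have "poly (cheb (Suc (Suc m))) x = 2 * t * poly (cheb (Suc m)) x - poly (cheb m) x - 2 * poly (cheb (Suc m)) x * (t - x)"
        by (simp add: poly_cheb_rec algebra_simps del: cheb.simps)
      then show ?thesis using that t by (simp add: diff_divide_distrib del: cheb.simps)
    qed
    then have "c (Suc (Suc m)) = (LINT x|arcs. 2 * t * (poly (cheb (Suc m)) x / (t - x)) - poly (cheb m) x / (t - x)
       - 2 * poly (cheb (Suc m)) x)" unfolding c_def using AE_arcs by (intro integral_cong_AE) auto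
    also have "... = 2 * t * c (Suc m) - c m - 2 * (LINT x|arcs. poly (cheb (Suc m)) x)"
      unfolding c_def using i integrable_arcs_poly by (simp del: cheb.simps times_divide_eq_right)
    finally show ?thesis using integral_arcs_cheb[of "Suc m"] by simp
  qed
  have c1: "c (Suc 0) = t * c 0 - 1"
  proof -
    have "c (Suc 0) = (LINT x|arcs. t * (poly (cheb 0) x / (t - x)) - 1)"
      unfolding c_def using AE_arcs t by (intro integral_cong_AE) (auto simp: field_simps)
    also have "... = t * c 0 - 1" unfolding c_def using i[of 0] by (simp del: times_divide_eq_right mult_1_right)
    finally show ?thesis .
  qed
  define r where "r = 1 / tau t"
  have tt: "1 < tau t" using tau_gt1[OF t] .
  have r: "tau t + r = 2 * t" "tau t * r = 1" using tau_add_inverse[of t] t tt by (auto simp: r_def)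
  have step: "c (Suc (Suc m)) - r * c (Suc m) = tau t * (c (Suc m) - r * c m)" for m
  proof -
    have "c (Suc (Suc m)) = (tau t + r) * c (Suc m) - (tau t * r) * c m" by (simp add: rec r)
    then show ?thesis by (simp add: algebra_simps)
  qed
  have pow: "c (Suc m) - r * c m = tau t ^ m * (c (Suc 0) - r * c 0)" for m by (induction m) (simp_all add: step)
  have zero: "c (Suc 0) - r * c 0 = 0"
  proof (rule ccontr)
    assume ne: "c (Suc 0) - r * c 0 \<noteq> 0"
    have rl: "\<bar>r\<bar> \<le> 1" using tt by (simp add: r_def)
    obtain m where "2 * (1 / (t - 1)) / \<bar>c (Suc 0) - r * c 0\<bar> < tau t ^ m" using real_arch_pow[OF tt] by blast
    then have "2 * (1 / (t - 1)) < tau t ^ m * \<bar>c (Suc 0) - r * c 0\<bar>" using ne by (subst (asm) pos_divide_less_eq) auto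
    also have "... = \<bar>c (Suc m) - r * c m\<bar>" unfolding pow[of m] using tt by (simp add: abs_mult)
    also have "... \<le> \<bar>c (Suc m)\<bar> + \<bar>r\<bar> * \<bar>c m\<bar>" by (simp add: abs_mult[symmetric])
    also have "... \<le> 1 / (t - 1) + 1 * (1 / (t - 1))" using bnd rl by (intro add_mono mult_mono) auto
    finally show False by simp
  qed
  have geo: "c m = r ^ m * c 0" for m
  proof (induction m)
    case (Suc m)
    then show ?case using pow[of m] zero by simp
  qed simp
  have "r * c 0 = t * c 0 - 1" using zero c1 by simp
  then have "(t - r) * c 0 = 1" by (simp add: algebra_simps)
  moreover have "t - r = sqrt (t\<^sup>2 - 1)" using inverse_tau[of t] t by (simp add: r_def)
  ultimately have "sqrt (t\<^sup>2 - 1) * c 0 = 1" by simp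
  moreover from this have "sqrt (t\<^sup>2 - 1) \<noteq> 0" by (intro notI) simp
  ultimately have "c 0 = 1 / sqrt (t\<^sup>2 - 1)" by (simp add: eq_divide_eq mult.commute)
  with geo[of m] show ?thesis by (simp add: c_def r_def)
qed

subsection \<open>Orthogonality relations\<close>

lemma poly_eventually_small_imp_0:
  fixes p :: "real poly"
  assumes "\<And>z. z \<ge> X \<Longrightarrow> \<bar>poly p z\<bar> \<le> C / z" 
  shows "p = 0"
proof -
  have lim: "((\<lambda>z. poly p z) \<longlongrightarrow> 0) at_top"
  proof (rule Lim_null_comparison)
    show "\<forall>\<^sub>F z in at_top. norm (poly p z) \<le> C / z"
      by (rule eventually_mono[OF eventually_ge_at_top[of X]]) (use assms in auto)
    show "((\<lambda>z. C / z) \<longlongrightarrow> 0) at_top"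
      by (intro tendsto_divide_0[OF tendsto_const] filterlim_at_top_imp_at_infinity filterlim_ident)
  qed
  have "degree p = 0"
  proof (rule ccontr)
    assume "degree p \<noteq> 0"
    then have "filterlim (poly p) at_infinity at_top"
      using filterlim_compose[OF filterlim_poly_at_infinity filterlim_at_top_imp_at_infinity[OF filterlim_ident]] by auto
    then show False using not_tendsto_and_filterlim_at_infinity[OF _ lim] by simp
  qed
  then obtain a where p: "p = [:a:]" by (meson degree_eq_zeroE)
  then have "a = 0" using lim by simp (metis LIM_unique tendsto_const tendsto_unique trivial_limit_at_top_linorder)
  with p show ?thesis by simp
qed

text \<open>The difference quotient of q is a polynomial in z whose coefficients are polynomials in
  x, and integration over x keeps it a polynomial in z. It is the polynomial part of q times a
  Cauchy transform, obtained by Horner's scheme.\<close>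

lemma cauchy_difference_quotient_poly:
  fixes q :: "real poly"
  assumes [measurable]: "\<psi> \<in> borel_measurable borel" and b: "\<And>x. -1 < x \<Longrightarrow> x < 1 \<Longrightarrow> \<bar>\<psi> x\<bar> \<le> B"
  shows "\<exists>S. \<forall>z>1. (LINT x|arcs. \<psi> x * ((poly q z - poly q x) / (z - x))) = poly S z"
proof (induction q)
  case 0
  show ?case by (intro exI[of _ 0]) simp
next
  case (pCons a q)
  then obtain S where S: "\<And>z. z > 1 \<Longrightarrow> (LINT x|arcs. \<psi> x * ((poly q z - poly q x) / (z - x))) = poly S z" by blast
  define m where "m = (LINT x|arcs. \<psi> x * poly q x)"
  have ic: "integrable arcs (\<lambda>x. \<psi> x * f x)" if [measurable]: "f \<in> borel_measurable borel" and "continuous_on {-1..1} f" for f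
  proof -
    have "compact (f ` {-1..1})" using that(2) by (intro compact_continuous_image) auto
    then obtain D where D: "\<And>y. y \<in> f ` {-1..1} \<Longrightarrow> norm y \<le> D" using compact_imp_bounded bounded_iff by metis
    have "norm (\<psi> x * f x) \<le> B * D" if "-1 < x" "x < 1" for x
      unfolding norm_mult using b[OF that] D[of "f x"] that by (intro mult_mono) auto
    then show ?thesis by (intro integrable_arcs_bounded[of _ "B * D"]) auto
  qed
  have "(LINT x|arcs. \<psi> x * ((poly (pCons a q) z - poly (pCons a q) x) / (z - x))) = poly (pCons m S) z" if z: "z > 1" for z
  proof -
    have "(LINT x|arcs. \<psi> x * ((poly (pCons a q) z - poly (pCons a q) x) / (z - x)))
        = (LINT x|arcs. z * (\<psi> x * ((poly q z - poly q x) / (z - x))) + \<psi> x * poly q x)"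
    proof (rule integral_cong_AE)
      show "AE x in arcs. \<psi> x * ((poly (pCons a q) z - poly (pCons a q) x) / (z - x)) =
        z * (\<psi> x * ((poly q z - poly q x) / (z - x))) + \<psi> x * poly q x" using AE_arcs
      proof eventually_elim
        case (elim x)
        then have "poly (pCons a q) z - poly (pCons a q) x = z * (poly q z - poly q x) + (z - x) * poly q x" "z - x \<noteq> 0"
          using z by (auto simp: algebra_simps)
        then show ?case by (simp add: add_divide_distrib distrib_left)
      qed
    qed measurable
    also have "... = z * poly S z + m"
    proof -
      have "integrable arcs (\<lambda>x. \<psi> x * ((poly q z - poly q x) / (z - x)))" "integrable arcs (\<lambda>x. \<psi> x * poly q x)"
        using z by (intro ic; force intro!: continuous_intros)+
      then show ?thesis using S[OF z] by (simp add: m_def del: times_divide_eq_right)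
    qed
    finally show ?thesis by simp
  qed
  then show ?case by blast
qed

text \<open>Up to a polynomial, q times the Cauchy transform of \<psi> is the Cauchy transform of q
  \<psi>, which is O(1 / z). The decay forces that polynomial to be p, so the transform of q \<psi>
  itself is O(z^(-n-1)), and its first n expansion coefficients, the moments, vanish.\<close>

lemma cauchy_decay_imp_orthogonal:
  fixes q p :: "real poly"
  assumes [measurable]: "\<psi> \<in> borel_measurable borel" and b: "\<And>x. -1 < x \<Longrightarrow> x < 1 \<Longrightarrow> \<bar>\<psi> x\<bar> \<le> B"
    and decay: "\<And>z. z \<ge> X \<Longrightarrow> \<bar>poly q z * (LINT x|arcs. \<psi> x / (z - x)) - poly p z\<bar> \<le> C / z ^ (n + 1)"
    and k: "k < n"
  shows "(LINT x|arcs. poly q x * \<psi> x * x ^ k) = 0"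
proof -
  define \<xi> where "\<xi> x = poly q x * \<psi> x" for x
  have [measurable]: "\<xi> \<in> borel_measurable borel" unfolding \<xi>_def by measurable
  have B0: "0 \<le> B" using b[of 0] by simp
  have "compact (poly q ` {-1..1})" by (intro compact_continuous_image continuous_intros) auto
  then obtain D where D: "\<And>y. y \<in> poly q ` {-1..1} \<Longrightarrow> norm y \<le> D" using compact_imp_bounded bounded_iff by metis
  have D0: "0 \<le> D" using D[of "poly q 0"] norm_ge_zero[of "poly q 0"] by fastforce
  define A where "A = D * B"
  have A0: "0 \<le> A" by (simp add: A_def B0 D0)
  have \<xi>b: "\<bar>\<xi> x\<bar> \<le> A" if "-1 < x" "x < 1" for x
    unfolding \<xi>_def abs_mult A_def using b[OF that] D[of "poly q x"] that D0 by (intro mult_mono) auto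
  define I where "I j z = (LINT x|arcs. \<xi> x * x ^ j / (z - x))" for j and z :: real
  define m where "m j = (LINT x|arcs. \<xi> x * x ^ j)" for j
  have \<xi>jb: "\<bar>\<xi> x * x ^ j\<bar> \<le> A" if "-1 < x" "x < 1" for x j
  proof -
    have "\<bar>x ^ j\<bar> \<le> 1" using that by (simp add: power_abs power_le_one)
    then have "\<bar>\<xi> x\<bar> * \<bar>x ^ j\<bar> \<le> A * 1" using \<xi>b[OF that] A0 by (intro mult_mono) auto
    then show ?thesis by (simp add: abs_mult)
  qed
  have Ib0: "norm (\<xi> x * x ^ j / (z - x)) \<le> A / (z - 1)" if "1 < z" "-1 < x" "x < 1" for j x z
    using \<xi>jb[OF that(2,3), of j] that A0 by (simp add: frac_le)
  have Ii: "integrable arcs (\<lambda>x. \<xi> x * x ^ j / (z - x))" if "1 < z" for j z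
    by (rule integrable_arcs_bounded[of _ "A / (z - 1)"]) (use Ib0 that in auto)
  have mi: "integrable arcs (\<lambda>x. \<xi> x * x ^ j)" for j by (rule integrable_arcs_bounded[of _ A]) (use \<xi>jb in auto)
  have Ib: "\<bar>I j z\<bar> \<le> A / (z - 1)" if "1 < z" for j z
    unfolding I_def real_norm_def[symmetric] using that Ib0 by (intro norm_integral_arcs_le) auto
  have Irec: "z * I j z = m j + I (Suc j) z" if "1 < z" for j z
  proof -
    have "z * I j z = (LINT x|arcs. z * (\<xi> x * x ^ j / (z - x)))" by (simp add: I_def del: times_divide_eq_right)
    also have "... = (LINT x|arcs. \<xi> x * x ^ j + \<xi> x * x ^ Suc j / (z - x))"
    proof (rule integral_cong_AE)
      show "AE x in arcs. z * (\<xi> x * x ^ j / (z - x)) = \<xi> x * x ^ j + \<xi> x * x ^ Suc j / (z - x)" using AE_arcs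
      proof eventually_elim
        case (elim x)
        then have "z - x \<noteq> 0" using that by auto
        then show ?case by (simp add: field_simps)
      qed
    qed measurable
    also have "... = m j + I (Suc j) z" unfolding m_def I_def by (rule Bochner_Integration.integral_add[OF mi Ii[OF that]])
    finally show ?thesis .
  qed
  obtain S where S: "\<And>z. z > 1 \<Longrightarrow> (LINT x|arcs. \<psi> x * ((poly q z - poly q x) / (z - x))) = poly S z"
    using cauchy_difference_quotient_poly[of \<psi> B q] b by auto
  have split: "poly q z * (LINT x|arcs. \<psi> x / (z - x)) = poly S z + I 0 z" if z: "1 < z" for z
  proof -
    have i1: "integrable arcs (\<lambda>x. \<psi> x * ((poly q z - poly q x) / (z - x)))"
    proof (rule integrable_arcs_bounded[of _ "B * ((\<bar>poly q z\<bar> + D) / (z - 1))"])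
      show "norm (\<psi> x * ((poly q z - poly q x) / (z - x))) \<le> B * ((\<bar>poly q z\<bar> + D) / (z - 1))" if x: "-1 < x" "x < 1" for x
      proof -
        have "\<bar>poly q z - poly q x\<bar> \<le> \<bar>poly q z\<bar> + D" using D[of "poly q x"] x by fastforce
        then have "\<bar>poly q z - poly q x\<bar> / (z - x) \<le> (\<bar>poly q z\<bar> + D) / (z - 1)" using x z D0 by (intro frac_le) auto
        then show ?thesis unfolding norm_mult using b[OF x] x z B0 by (intro mult_mono) auto
      qed
    qed measurable
    have "poly q z * (LINT x|arcs. \<psi> x / (z - x)) = (LINT x|arcs. poly q z * (\<psi> x / (z - x)))" by (simp del: times_divide_eq_right)
    also have "... = (LINT x|arcs. \<psi> x * ((poly q z - poly q x) / (z - x)) + \<xi> x * x ^ 0 / (z - x))"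
    proof (rule integral_cong_AE)
      show "AE x in arcs. poly q z * (\<psi> x / (z - x)) = \<psi> x * ((poly q z - poly q x) / (z - x)) + \<xi> x * x ^ 0 / (z - x)"
        using AE_arcs
      proof eventually_elim
        case (elim x)
        then have "z - x \<noteq> 0" using z by auto
        then show ?case by (simp add: \<xi>_def right_diff_distrib diff_divide_distrib mult.commute)
      qed
    qed measurable
    also have "... = poly S z + I 0 z" using i1 Ii[OF z, of 0] S[OF z] unfolding I_def by simp
    finally show ?thesis .
  qed
  have C: "\<bar>C\<bar> / z ^ j \<le> \<bar>C\<bar> / z" if "1 < z" "j \<ge> 1" for z :: real and j :: nat
    using that self_le_power[of z j] by (intro divide_left_mono) (auto intro!: mult_pos_pos)
  have dec: "\<bar>poly (S - p) z + I 0 z\<bar> \<le> \<bar>C\<bar> / z ^ (n + 1)" if "X \<le> z" "1 < z" for z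
  proof -
    have "\<bar>poly (S - p) z + I 0 z\<bar> \<le> C / z ^ (n + 1)" using decay[OF that(1)] split[OF that(2)] by (simp add: algebra_simps)
    also have "... \<le> \<bar>C\<bar> / z ^ (n + 1)" using that by (intro divide_right_mono) auto
    finally show ?thesis .
  qed
  have "S - p = 0"
  proof (rule poly_eventually_small_imp_0[of "max X 2" _ "\<bar>C\<bar> + 2 * A"])
    fix z assume "max X 2 \<le> z"
    then have z: "X \<le> z" "2 \<le> z" by auto
    have "\<bar>poly (S - p) z\<bar> \<le> \<bar>poly (S - p) z + I 0 z\<bar> + \<bar>I 0 z\<bar>" by linarith
    also have "... \<le> \<bar>C\<bar> / z + A / (z - 1)" using dec[of z] C[of z "n + 1"] Ib[of z 0] z by linarith
    also have "A / (z - 1) \<le> A / (z / 2)" using z A0 by (intro divide_left_mono) auto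
    finally show "\<bar>poly (S - p) z\<bar> \<le> (\<bar>C\<bar> + 2 * A) / z" by (simp add: add_divide_distrib mult.commute)
  qed
  then have dec0: "\<bar>I 0 z\<bar> \<le> \<bar>C\<bar> / z ^ (n + 1)" if "X \<le> z" "1 < z" for z using dec[OF that] by simp
  \<comment> \<open>As long as the lower moments vanish, z^j I_0 equals I_j. Then m_j = z I_j -
    I_(j+1) is O(1 / z) and, being constant, is 0.\<close>
  have "m j = 0" if "j < n" for j using that
  proof (induction j rule: less_induct)
    case (less j)
    have shift: "z ^ i * I 0 z = I i z" if "1 < z" "i \<le> j" for z i using that(2)
    proof (induction i)
      case (Suc i)
      then have "z ^ Suc i * I 0 z = z * I i z" by simp
      also have "... = I (Suc i) z" using Irec[OF that(1), of i] less.IH[of i] Suc.prems less.prems by simp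
      finally show ?case .
    qed simp
    have "\<bar>m j\<bar> \<le> (\<bar>C\<bar> + 2 * A) / z" if "max X 2 \<le> z" for z
    proof -
      have z: "X \<le> z" "2 \<le> z" using that by auto
      have "m j = z * I j z - I (Suc j) z" using Irec[of z j] z by simp
      also have "z * I j z = z ^ Suc j * I 0 z" using shift[of z j] z by simp
      finally have "\<bar>m j\<bar> \<le> z ^ Suc j * \<bar>I 0 z\<bar> + \<bar>I (Suc j) z\<bar>"
        using z abs_triangle_ineq4[of "z ^ Suc j * I 0 z" "I (Suc j) z"] by (simp add: abs_mult)
      also have "z ^ Suc j * \<bar>I 0 z\<bar> \<le> z ^ Suc j * (\<bar>C\<bar> / z ^ (n + 1))" using dec0[of z] z by (intro mult_left_mono) auto
      also have "z ^ Suc j * (\<bar>C\<bar> / z ^ (n + 1)) = \<bar>C\<bar> / z ^ (n - j)"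
      proof -
        have "z ^ (n + 1) = z ^ Suc j * z ^ (n - j)" using less.prems by (simp flip: power_add)
        then show ?thesis using z by simp
      qed
      also have "... \<le> \<bar>C\<bar> / z" using C[of z "n - j"] z less.prems by simp
      also have "\<bar>I (Suc j) z\<bar> \<le> A / (z - 1)" using Ib[of z "Suc j"] z by simp
      also have "A / (z - 1) \<le> A / (z / 2)" using z A0 by (intro divide_left_mono) auto
      finally show ?thesis by (simp add: add_divide_distrib mult.commute)
    qed
    then have "[:m j:] = 0" by (intro poly_eventually_small_imp_0[of "max X 2"]) auto
    then show ?case by simp
  qed
  with k show ?thesis by (simp add: m_def \<xi>_def)
qed

lemma f2_real:
  assumes z: "1 < z" and [measurable_cong]: "sets \<sigma> = sets borel" and "finite_measure \<sigma>"
  shows "f2 \<sigma> (of_real z) = of_real (LINT x|arcs. (LINT t|\<sigma>. 1 / (x - t)) / (z - x))"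
proof -
  interpret finite_measure \<sigma> by fact
  define h where "h x = (LINT t|\<sigma>. 1 / (x - t))" for x :: real
  have [measurable]: "h \<in> borel_measurable borel" unfolding h_def by measurable
  have ct: "cauchy_tr \<sigma> (of_real x) = of_real (h x)" for x
  proof -
    have "cauchy_tr \<sigma> (of_real x) = (LINT t|\<sigma>. of_real (1 / (x - t)))" unfolding cauchy_tr_def by simp
    also have "... = of_real (h x)" unfolding h_def by (rule integral_complex_of_real)
    finally show ?thesis .
  qed
  have "f2 \<sigma> (of_real z) = (1 / pi) * (LINT x|lborel. complex_of_real (indicator {-1<..<1} x *\<^sub>R (h x / (z - x) / sqrt (1 - x\<^sup>2))))"
    unfolding f2_def set_lebesgue_integral_def ct by (simp add: scaleR_conv_of_real)
  also have "... = complex_of_real (1 / pi * (LINT x|lborel. indicator {-1<..<1} x *\<^sub>R (h x / (z - x) / sqrt (1 - x\<^sup>2))))"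
    by (subst integral_complex_of_real) simp
  also have "1 / pi * (LINT x|lborel. indicator {-1<..<1} x *\<^sub>R (h x / (z - x) / sqrt (1 - x\<^sup>2))) = (LINT x|arcs. h x / (z - x))"
    by (subst integral_arcs) (auto simp: set_lebesgue_integral_def integral_mult_right_zero[symmetric] simp del: integral_mult_right_zero intro!: Bochner_Integration.integral_cong)
  finally show ?thesis by (simp add: h_def)
qed

text \<open>Passage to the real axis, where all functions in the approximation conditions are real
  and moments can be extracted by real estimates.\<close>

lemma bigo_at_infinity_realD:
  fixes f :: "complex \<Rightarrow> complex" and g :: "real \<Rightarrow> real"
  assumes "f \<in> O[at_infinity](\<lambda>z. 1 / z ^ m)" and "\<And>z. z > 1 \<Longrightarrow> f (of_real z) = of_real (g z)"
  obtains X C where "\<And>z. z \<ge> X \<Longrightarrow> \<bar>g z\<bar> \<le> C / z ^ m"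
proof -
  obtain c where "\<forall>\<^sub>F z in at_infinity. norm (f z) \<le> c * norm (1 / z ^ m)" using landau_o.bigE[OF assms(1)] by blast
  then obtain b where b: "\<And>z. b \<le> norm z \<Longrightarrow> norm (f z) \<le> c * norm (1 / z ^ m)" unfolding eventually_at_infinity by blast
  show ?thesis
  proof (rule that[of "max b 2" c])
    fix z :: real assume z: "max b 2 \<le> z"
    then have "norm (f (of_real z)) \<le> c * norm (1 / complex_of_real z ^ m)" by (intro b) auto
    then show "\<bar>g z\<bar> \<le> c / z ^ m" using z assms(2)[of z] by (simp add: norm_divide norm_power)
  qed
qed

text \<open>The first relation is the decay lemma for \<psi> = 1; the second is the decay lemma for
  the Cauchy transform of \<sigma>, followed by Fubini, which applies because t >= a > 1 keeps the
  kernel 1 / (x - t) bounded on E.\<close>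

lemma hermite_pade_orthogonality:
  fixes \<sigma> :: "real measure" and q p1 p2 :: "real poly"
  assumes sets [measurable_cong]: "sets \<sigma> = sets borel" and fin: "finite_measure \<sigma>"
    and a: "1 < a" "AE t in \<sigma>. a \<le> t"
    and hp: "(\<lambda>z. cpoly q z * f1 z - cpoly p1 z) \<in> O[at_infinity](\<lambda>z. 1 / z ^ (n + 1))"
       "(\<lambda>z. cpoly q z * f2 \<sigma> z - cpoly p2 z) \<in> O[at_infinity](\<lambda>z. 1 / z ^ (n + 1))"
    and k: "k < n"
  shows "(LINT x|arcs. poly q x * x ^ k) = 0"
    and "(LINT t|\<sigma>. (LINT x|arcs. poly q x / (t - x)) * t ^ k) = 0"
proof -
  let ?P = "arcs \<Otimes>\<^sub>M \<sigma>"
  interpret s: finite_measure \<sigma> by fact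
  interpret p: pair_sigma_finite arcs \<sigma> ..
  define h where "h x = (LINT t|\<sigma>. 1 / (x - t))" for x :: real
  have [measurable]: "h \<in> borel_measurable borel" unfolding h_def by measurable
  have hb: "\<bar>h x\<bar> \<le> measure \<sigma> UNIV * (1 / (a - 1))" if "x < 1" for x
  proof -
    have le: "AE t in \<sigma>. norm (1 / (x - t)) \<le> 1 / (a - 1)" using a(2)
    proof eventually_elim
      case (elim t)
      then have "norm (1 / (x - t)) = 1 / (t - x)" using that a(1) by simp
      then show ?case using elim that a(1) by (simp add: frac_le)
    qed
    have "\<bar>h x\<bar> \<le> (LINT t|\<sigma>. norm (1 / (x - t)))" unfolding h_def real_norm_def[symmetric] by (rule integral_norm_bound)
    also have "... \<le> (LINT t|\<sigma>. 1 / (a - 1))"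
      using le a(1) by (intro integral_mono_AE s.integrable_const_bound[of _ "1 / (a - 1)"]) auto
    also have "... = measure \<sigma> UNIV * (1 / (a - 1))" using sets_eq_imp_space_eq[OF sets] by simp
    finally show ?thesis .
  qed
  have orth: "(LINT x|arcs. poly q x * x ^ j) = 0" if j: "j < n" for j
  proof -
    have r: "cpoly q (of_real z) * f1 (of_real z) - cpoly p1 (of_real z) =
       of_real (poly q z * (LINT x|arcs. 1 / (z - x)) - poly p1 z)" if "1 < z" for z
      using that integral_arcs_cheb_cauchy[of z 0] by (simp add: cpoly_of_real f1_real)
    obtain X C where "\<And>z. z \<ge> X \<Longrightarrow> \<bar>poly q z * (LINT x|arcs. 1 / (z - x)) - poly p1 z\<bar> \<le> C / z ^ (n + 1)"
      using bigo_at_infinity_realD[OF hp(1) r] by blast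
    then show ?thesis using cauchy_decay_imp_orthogonal[of "\<lambda>_. 1" 1 X q p1 C n j] j by simp
  qed
  then show "(LINT x|arcs. poly q x * x ^ k) = 0" using k .
  have r: "cpoly q (of_real z) * f2 \<sigma> (of_real z) - cpoly p2 (of_real z) =
     of_real (poly q z * (LINT x|arcs. h x / (z - x)) - poly p2 z)" if "1 < z" for z
    using that by (simp add: cpoly_of_real f2_real[OF _ sets fin] h_def)
  obtain X C where "\<And>z. z \<ge> X \<Longrightarrow> \<bar>poly q z * (LINT x|arcs. h x / (z - x)) - poly p2 z\<bar> \<le> C / z ^ (n + 1)"
    using bigo_at_infinity_realD[OF hp(2) r] by blast
  then have "(LINT x|arcs. poly q x * h x * x ^ k) = 0" by (rule cauchy_decay_imp_orthogonal[rotated 2]) (use hb k in auto)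
  also have "(LINT x|arcs. poly q x * h x * x ^ k) = (LINT x|arcs. (LINT t|\<sigma>. poly q x * x ^ k / (x - t)))"
    by (simp add: h_def integral_mult_right_zero[symmetric] mult_ac del: integral_mult_right_zero)
  also have "... = (LINT t|\<sigma>. (LINT x|arcs. poly q x * x ^ k / (x - t)))"
  proof (rule p.Fubini_integral[symmetric])
    have "compact (poly q ` {-1..1})" by (intro compact_continuous_image continuous_intros) auto
    then obtain D where D: "\<And>y. y \<in> poly q ` {-1..1} \<Longrightarrow> norm y \<le> D" using compact_imp_bounded bounded_iff by metis
    interpret f: finite_measure "?P" by (rule finite_measure_pair_measure) (auto intro: arcs.finite_measure_axioms fin)
    show "integrable ?P (\<lambda>(x, t). poly q x * x ^ k / (x - t))"
    proof (rule f.integrable_const_bound[of _ "D * 1 / (a - 1)"])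
      have "AE z in ?P. -1 < fst z \<and> fst z < 1 \<and> a \<le> snd z"
      proof (rule p.AE_pair_measure)
        show "{x \<in> space ?P. - 1 < fst x \<and> fst x < 1 \<and> a \<le> snd x} \<in> sets ?P" by measurable
        show "AE x in arcs. AE y in \<sigma>. - 1 < fst (x, y) \<and> fst (x, y) < 1 \<and> a \<le> snd (x, y)" using AE_arcs
        proof eventually_elim
          case (elim x)
          show ?case using a(2) by eventually_elim (use elim in auto)
        qed
      qed
      then show "AE z in ?P. norm (case z of (x, t) \<Rightarrow> poly q x * x ^ k / (x - t)) \<le> D * 1 / (a - 1)"
      proof eventually_elim
        case (elim z)
        obtain x t where z: "z = (x, t)" by force
        have xt: "-1 < x" "x < 1" "a \<le> t" using elim z by auto
        have "\<bar>poly q x\<bar> * \<bar>x ^ k\<bar> \<le> D * 1"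
          using D[of "poly q x"] xt by (intro mult_mono) (auto simp: power_abs power_le_one)
        then have "\<bar>poly q x * x ^ k\<bar> / \<bar>x - t\<bar> \<le> D * 1 / (a - 1)" using xt a(1) D[of "poly q 0"] norm_ge_zero[of "poly q 0"]
          by (intro frac_le) (auto simp: abs_mult intro: order_trans[of 0 "\<bar>poly q 0\<bar>"])
        then show ?case by (simp add: z)
      qed
    qed measurable
  qed
  also have "... = (LINT t|\<sigma>. - ((LINT x|arcs. poly q x / (t - x)) * t ^ k))"
  proof (rule integral_cong_AE)
    show "AE t in \<sigma>. (LINT x|arcs. poly q x * x ^ k / (x - t)) = - ((LINT x|arcs. poly q x / (t - x)) * t ^ k)" using a(2)
    proof eventually_elim
      case (elim t)
      then have t: "1 < t" using a by simp
      have ii: "integrable arcs (\<lambda>x. poly q x * x ^ i / (x - t))" for i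
        by (intro integrable_arcs_cont) (use t in \<open>auto intro!: continuous_intros\<close>)
      \<comment> \<open>x^(i+1) / (x - t) = x^i + t x^i / (x - t). The first term is annihilated by
        the relation already proved, so each power of x may be replaced by the same power of
        t.\<close>
      have "(LINT x|arcs. poly q x * x ^ i / (x - t)) = t ^ i * (LINT x|arcs. poly q x / (x - t))" if "i \<le> k" for i
        using that
      proof (induction i)
        case (Suc i)
        have "(LINT x|arcs. poly q x * x ^ Suc i / (x - t)) = (LINT x|arcs. poly q x * x ^ i + t * (poly q x * x ^ i / (x - t)))"
        proof (rule integral_cong_AE)
          show "AE x in arcs. poly q x * x ^ Suc i / (x - t) = poly q x * x ^ i + t * (poly q x * x ^ i / (x - t))"
            using AE_arcs
          proof eventually_elim
            case (elim x)
            then have "x - t \<noteq> 0" using t by auto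
            then show ?case by (simp add: field_simps)
          qed
        qed measurable
        also have "... = (LINT x|arcs. poly q x * x ^ i) + t * (LINT x|arcs. poly q x * x ^ i / (x - t))"
        proof -
          have "integrable arcs (\<lambda>x. poly q x * x ^ i)" by (intro integrable_arcs_cont) (auto intro!: continuous_intros)
          then show ?thesis using ii[of i] by (simp del: times_divide_eq_right)
        qed
        also have "... = t ^ Suc i * (LINT x|arcs. poly q x / (x - t))" using Suc orth[of i] k by simp
        finally show ?case .
      qed simp
      from this[of k] have "(LINT x|arcs. poly q x * x ^ k / (x - t)) = t ^ k * (LINT x|arcs. - (poly q x / (t - x)))"
        by (simp add: minus_divide_right)
      then show ?case by simp
    qed
  qed measurable
  finally show "(LINT t|\<sigma>. (LINT x|arcs. poly q x / (t - x)) * t ^ k) = 0" by simp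
qed

subsection \<open>Bernstein--Szego form of the polynomials\<close>

lemma nonzero_constant_sign:
  fixes R :: "real \<Rightarrow> real"
  assumes "connected I" "continuous_on I R" "\<And>x. x \<in> I \<Longrightarrow> R x \<noteq> 0"
  shows "(\<forall>x\<in>I. 0 < R x) \<or> (\<forall>x\<in>I. R x < 0)"
proof (rule ccontr)
  assume "\<not> ?thesis"
  then obtain x y where "x \<in> I" "y \<in> I" "R x \<le> 0" "0 \<le> R y" by (auto simp: not_less)
  moreover have "connected (R ` I)" using assms by (intro connected_continuous_image)
  ultimately have "0 \<in> R ` I" by (meson connectedD_interval imageI)
  with assms(3) show False by force
qed

text \<open>Induction on the number of zeros, splitting off the largest zero z: to the right of z
  the sign is constant, and z joins S, with \<open>e\<close> negated, when that sign contradicts the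
  one required by the zeros further left. Multiplicities never enter, R being merely
  continuous.\<close>

lemma sign_changes_polynomial:
  fixes R :: "real \<Rightarrow> real"
  assumes cont: "continuous_on {a..} R"
  shows "finite {x\<in>{a..<b}. R x = 0} \<Longrightarrow> \<exists>S e. S \<subseteq> {x\<in>{a..<b}. R x = 0} \<and> (e = 1 \<or> e = -1) \<and>
      (\<forall>x\<in>{a..<b}. 0 \<le> e * R x * (\<Prod>s\<in>S. (x - s)))"
proof (induction "card {x\<in>{a..<b}. R x = 0}" arbitrary: b rule: less_induct)
  case less
  let ?Z = "{x\<in>{a..<b}. R x = 0}"
  show ?case
  proof (cases "?Z = {}")
    case True
    have "(\<forall>x\<in>{a..<b}. 0 < R x) \<or> (\<forall>x\<in>{a..<b}. R x < 0)"
      by (intro nonzero_constant_sign continuous_on_subset[OF cont]) (use True in auto)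
    then show ?thesis
    proof
      assume "\<forall>x\<in>{a..<b}. 0 < R x"
      then show ?thesis by (intro exI[of _ "{}"] exI[of _ 1]) (auto intro: less_imp_le)
    next
      assume "\<forall>x\<in>{a..<b}. R x < 0"
      then show ?thesis by (intro exI[of _ "{}"] exI[of _ "-1"]) (auto intro: less_imp_le)
    qed
  next
    case False
    define z where "z = Max ?Z"
    have zZ: "z \<in> ?Z" unfolding z_def using False less.prems by (rule Max_in[rotated])
    then have z: "a \<le> z" "z < b" "R z = 0" by auto
    have zmax: "x \<le> z" if "x \<in> ?Z" for x unfolding z_def using that less.prems by (rule Max_ge[rotated])
    have sub: "{x\<in>{a..<z}. R x = 0} \<subseteq> ?Z - {z}" using z by auto
    have fin: "finite {x\<in>{a..<z}. R x = 0}" using sub less.prems by (meson finite_Diff finite_subset)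
    have "card {x\<in>{a..<z}. R x = 0} \<le> card (?Z - {z})" using sub less.prems by (intro card_mono) auto
    also have "... < card ?Z" using zZ less.prems by (intro card_Diff1_less)
    finally obtain S e where S: "S \<subseteq> {x\<in>{a..<z}. R x = 0}" "e = 1 \<or> e = -1"
      and pos: "\<And>x. x \<in> {a..<z} \<Longrightarrow> 0 \<le> e * R x * (\<Prod>s\<in>S. (x - s))" using less.hyps[OF _ fin] by blast
    have finS: "finite S" using S fin finite_subset by blast
    have zS: "z \<notin> S" using S by auto
    have Spos: "0 < (\<Prod>s\<in>S. (x - s))" if "z \<le> x" for x using S that by (intro prod_pos) auto
    have "R x \<noteq> 0" if "x \<in> {z<..<b}" for x using zmax[of x] that z by auto
    then have "(\<forall>x\<in>{z<..<b}. 0 < R x) \<or> (\<forall>x\<in>{z<..<b}. R x < 0)"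
      using z by (intro nonzero_constant_sign continuous_on_subset[OF cont]) auto
    then have "(\<forall>x\<in>{z<..<b}. 0 \<le> e * R x) \<or> (\<forall>x\<in>{z<..<b}. e * R x \<le> 0)" using S(2) by (auto intro: less_imp_le)
    then show ?thesis
    proof
      assume *: "\<forall>x\<in>{z<..<b}. 0 \<le> e * R x"
      have "0 \<le> e * R x * (\<Prod>s\<in>S. (x - s))" if "x \<in> {a..<b}" for x
      proof -
        consider "x < z" | "x = z" | "z < x" by linarith
        then show ?thesis
        proof cases
          case 3
          then have "0 \<le> e * R x" using * that by auto
          then show ?thesis using Spos[of x] 3 by (rule_tac mult_nonneg_nonneg) auto
        qed (use that pos z in auto)
      qed
      then show ?thesis using S sub by (intro exI[of _ S] exI[of _ e]) auto
    next
      assume *: "\<forall>x\<in>{z<..<b}. e * R x \<le> 0"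
      have "0 \<le> (- e) * R x * (\<Prod>s\<in>insert z S. (x - s))" if "x \<in> {a..<b}" for x
      proof -
        have eq: "(- e) * R x * (\<Prod>s\<in>insert z S. (x - s)) = (e * R x * (\<Prod>s\<in>S. (x - s))) * (z - x)"
          using finS zS by (simp add: algebra_simps)
        consider "x < z" | "x = z" | "z < x" by linarith
        then show ?thesis
        proof cases
          case 1
          then show ?thesis unfolding eq using pos[of x] that by (rule_tac mult_nonneg_nonneg) auto
        next
          case 3
          then have "e * R x \<le> 0" using * that by auto
          then have "e * R x * (\<Prod>s\<in>S. (x - s)) \<le> 0" using Spos[of x] 3 by (rule_tac mult_nonpos_nonneg) auto
          then show ?thesis unfolding eq using 3 by (rule_tac mult_nonpos_nonpos) auto
        qed (use z in simp)
      qed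
      then show ?thesis using S z sub zZ by (intro exI[of _ "insert z S"] exI[of _ "-e"]) auto
    qed
  qed
qed

lemma orthogonal_powers_imp_orthogonal_poly:
  fixes q p :: "real poly"
  assumes orth: "\<And>k. k < n \<Longrightarrow> (LINT x|arcs. poly q x * x ^ k) = 0" and "p = 0 \<or> degree p < n"
  shows "(LINT x|arcs. poly q x * poly p x) = 0"
proof (cases "p = 0")
  case False
  have i: "integrable arcs (\<lambda>x. poly q x * x ^ k)" for k by (intro integrable_arcs_cont) (auto intro!: continuous_intros)
  have "(LINT x|arcs. poly q x * poly p x) = (LINT x|arcs. (\<Sum>k\<le>degree p. coeff p k * (poly q x * x ^ k)))"
    by (intro Bochner_Integration.integral_cong refl) (simp add: poly_altdef[of p] sum_distrib_left mult_ac)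
  also have "... = (\<Sum>k\<le>degree p. coeff p k * (LINT x|arcs. poly q x * x ^ k))"
    using i by (subst Bochner_Integration.integral_sum) auto
  also have "... = 0" using orth assms(2) False by (intro sum.neutral) auto
  finally show ?thesis .
qed simp

lemma degree_prod_linear_le:
  fixes f g :: "'i \<Rightarrow> 'b::comm_semiring_1"
  shows "degree (\<Prod>s\<in>S. [:f s, g s:]) \<le> card S"
proof (induction S rule: infinite_finite_induct)
  case (insert s S)
  have "degree (\<Prod>s\<in>insert s S. [:f s, g s:]) \<le> degree [:f s, g s:] + degree (\<Prod>s\<in>S. [:f s, g s:])"
    unfolding prod.insert[OF insert.hyps] by (rule degree_mult_le)
  also have "... \<le> 1 + card S" using insert by (intro add_mono) auto
  finally show ?case using insert by simp
qed auto

text \<open>By partial fractions p / prod (s - x) is a polynomial of degree < n plus a combination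
  of the functions 1 / (s - x), and q is orthogonal to every piece. So q satisfies n + card S
  orthogonality relations with respect to one weight that is positive on E. The induction removes
  one pole at a time.\<close>

lemma orthogonal_partial_fractions:
  fixes q p :: "real poly"
  assumes orth: "\<And>k. k < n \<Longrightarrow> (LINT x|arcs. poly q x * x ^ k) = 0"
    and "finite S" "\<And>s. s \<in> S \<Longrightarrow> 1 < s" "\<And>s. s \<in> S \<Longrightarrow> (LINT x|arcs. poly q x / (s - x)) = 0"
    and "p = 0 \<or> degree p < n + card S"
  shows "(LINT x|arcs. poly q x * (poly p x / (\<Prod>s\<in>S. (s - x)))) = 0" using assms(2-5)
proof (induction S arbitrary: p rule: finite_induct)
  case empty
  then show ?case using orthogonal_powers_imp_orthogonal_poly[of n q p] orth by simp
next
  case (insert s S)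
  define Q where "Q = (\<Prod>r\<in>S. [:r, -1:])"
  have Q: "poly Q x = (\<Prod>r\<in>S. (r - x))" for x by (simp add: Q_def poly_prod)
  have dQ: "degree Q \<le> card S" unfolding Q_def by (rule degree_prod_linear_le)
  have Qs: "poly Q s \<noteq> 0" unfolding Q using insert.hyps by auto
  \<comment> \<open>The constant that makes p - c Q vanish at s, so that the factor s - x
    cancels.\<close>
  define c where "c = poly p s / poly Q s"
  have "poly (p - smult c Q) s = 0" using Qs by (simp add: c_def)
  then obtain p1' where "p - smult c Q = [:- s, 1:] * p1'" unfolding poly_eq_0_iff_dvd by (elim dvdE)
  then have p1: "p - smult c Q = [:s, -1:] * (- p1')" by simp
  have d1: "- p1' = 0 \<or> degree (- p1') < n + card S"
  proof (cases "p1' = 0")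
    case False
    have "Suc (degree (- p1')) = degree ([:s, -1:] * (- p1'))" using False by (subst degree_mult_eq) auto
    also have "... \<le> max (degree p) (degree (smult c Q))" unfolding p1[symmetric] by (rule degree_diff_le_max)
    also have "... \<le> n + card S" using insert.prems(3) insert.hyps dQ by (auto intro: order_trans[OF degree_smult_le])
    finally show ?thesis by simp
  qed simp
  have pos: "0 < (\<Prod>r\<in>S. (r - x))" if "x \<le> 1" for x using insert.prems that by (intro prod_pos) force
  have ne: "(\<Prod>r\<in>S. (r - x)) \<noteq> 0" if "x \<le> 1" for x using pos[OF that] by simp
  have s1: "1 < s" using insert.prems by auto
  have IH: "(LINT x|arcs. poly q x * (poly (- p1') x / (\<Prod>s\<in>S. s - x))) = 0" using insert.prems d1 by (intro insert.IH) auto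
  have i1: "integrable arcs (\<lambda>x. poly q x * (poly (- p1') x / (\<Prod>s\<in>S. s - x)))"
    by (intro integrable_arcs_cont) (auto intro!: continuous_intros simp: ne)
  have i2: "integrable arcs (\<lambda>x. poly q x / (s - x))"
    by (intro integrable_arcs_cont) (use s1 in \<open>auto intro!: continuous_intros\<close>)
  have "(LINT x|arcs. poly q x * (poly p x / (\<Prod>s\<in>insert s S. s - x)))
    = (LINT x|arcs. poly q x * (poly (- p1') x / (\<Prod>s\<in>S. s - x)) + c * (poly q x / (s - x)))"
  proof (rule integral_cong_AE)
    show "AE x in arcs. poly q x * (poly p x / (\<Prod>s\<in>insert s S. s - x))
      = poly q x * (poly (- p1') x / (\<Prod>s\<in>S. s - x)) + c * (poly q x / (s - x))" using AE_arcs
    proof eventually_elim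
      case (elim x)
      define P where "P = (\<Prod>s\<in>S. s - x)"
      have ne: "P \<noteq> 0" "s - x \<noteq> 0" using pos[of x] elim s1 by (auto simp: P_def)
      have "poly p x = poly (p - smult c Q) x + c * P" by (simp add: Q P_def)
      also have "... = (s - x) * poly (- p1') x + c * P" unfolding p1 by (simp add: algebra_simps)
      finally have "poly p x = (s - x) * poly (- p1') x + c * P" .
      moreover have "(\<Prod>s\<in>insert s S. s - x) = (s - x) * P" using insert.hyps by (simp add: P_def)
      ultimately have "poly p x / (\<Prod>s\<in>insert s S. s - x) = poly (- p1') x / P + c / (s - x)"
        using ne by (simp add: diff_divide_distrib)
      then show ?case by (simp add: P_def right_diff_distrib mult.commute)
    qed
  qed measurable
  also have "... = 0" using i1 i2 IH insert.prems by (simp del: times_divide_eq_right)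
  finally show ?case .
qed

text \<open>The integrand is nonnegative, so p vanishes almost everywhere for a measure that ignores
  finite sets, whereas a nonzero polynomial has only finitely many zeros.\<close>

lemma poly_zero_of_integral_zero:
  fixes p :: "real poly"
  assumes [measurable]: "g \<in> borel_measurable borel" and g: "\<And>x. -1 \<le> x \<Longrightarrow> x \<le> 1 \<Longrightarrow> 0 < g x" "continuous_on {-1..1} g"
    and int: "(LINT x|arcs. poly p x * (poly p x * g x)) = 0"
  shows "p = 0"
proof (rule ccontr)
  assume "p \<noteq> 0"
  then have fin: "finite {x. poly p x = 0}" by (rule poly_roots_finite)
  have i: "integrable arcs (\<lambda>x. poly p x * (poly p x * g x))"
    by (intro integrable_arcs_cont) (auto intro!: continuous_intros g(2))
  have "AE x in arcs. 0 \<le> poly p x * (poly p x * g x)"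
    using AE_arcs by eventually_elim (simp add: g(1) less_imp_le mult.assoc[symmetric])
  then have "AE x in arcs. poly p x * (poly p x * g x) = 0" using integral_nonneg_eq_0_iff_AE[OF i] int by simp
  then have "AE x in arcs. x \<in> {x. poly p x = 0}" using AE_arcs
  proof eventually_elim
    case (elim x)
    then have "0 < g x" using g(1)[of x] by simp
    then show ?case using elim by simp
  qed
  moreover have "AE x in arcs. x \<notin> {x. poly p x = 0}" unfolding arcs_def
  proof (subst AE_density)
    have "AE x in lborel. x \<notin> {x. poly p x = 0}" using fin by (intro AE_not_in finite_imp_null_set_lborel)
    then show "AE x in lborel. 0 < ennreal (indicator {-1<..<1} x * (1 / (pi * sqrt (1 - x\<^sup>2)))) \<longrightarrow> x \<notin> {x. poly p x = 0}"
      by eventually_elim simp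
  qed measurable
  ultimately have "AE x in arcs. False" by eventually_elim simp
  then show False by simp
qed

section \<open>Bernstein--Szego polynomials with prescribed zeros of the Cauchy transform\<close>

lemma poly_altdef_le: "degree p \<le> n \<Longrightarrow> poly p x = (\<Sum>i\<le>n. coeff p i * x ^ i)"
  for x :: "'a::comm_semiring_1" unfolding poly_altdef by (intro sum.mono_neutral_left) (auto simp: coeff_eq_0)

text \<open>The normalization H(0) = 1 is what makes 4^n the leading coefficient of
  \<open>bspoly n S\<close>.\<close>

definition Hpoly :: "real set \<Rightarrow> real poly" where
  "Hpoly S = (\<Prod>s\<in>S. [:1, - 1 / tau s:])"

text \<open>The form u^(2n) H(1/u) + u^(-2n) H(u), expanded in the Chebyshev basis. All indices 2 n
  - j with j <= n are at least n, so orthogonality to lower powers can be read off term by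
  term.\<close>

definition bspoly :: "nat \<Rightarrow> real set \<Rightarrow> real poly" where
  "bspoly n S = (\<Sum>j\<le>n. smult (2 * coeff (Hpoly S) j) (cheb (2 * n - j)))"

lemma poly_Hpoly: "poly (Hpoly S) v = (\<Prod>s\<in>S. (1 - v / tau s))"
  by (simp add: Hpoly_def poly_prod)

lemma cpoly_Hpoly: "cpoly (Hpoly S) v = (\<Prod>s\<in>S. (1 - v / complex_of_real (tau s)))"
proof (induction S rule: infinite_finite_induct)
  case (insert s S)
  then have "Hpoly (insert s S) = [:1, - 1 / tau s:] * Hpoly S" by (simp add: Hpoly_def)
  then show ?case using insert by (simp add: cpoly_mult cpoly_pCons del: mult_pCons_left)
qed (simp_all add: Hpoly_def)

lemma degree_Hpoly: "degree (Hpoly S) \<le> card S"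
  unfolding Hpoly_def by (rule degree_prod_linear_le)

lemma coeff_0_Hpoly: "coeff (Hpoly S) 0 = 1"
  using poly_Hpoly[of S 0] by (simp add: poly_0_coeff_0)

lemma bspoly_orthogonal:
  assumes "k < n"
  shows "(LINT x|arcs. poly (bspoly n S) x * x ^ k) = 0"
proof -
  have i: "integrable arcs (\<lambda>x. x ^ k * poly (cheb j) x)" for j
    by (intro integrable_arcs_cont) (auto intro!: continuous_intros)
  have "(LINT x|arcs. poly (bspoly n S) x * x ^ k)
    = (LINT x|arcs. (\<Sum>j\<le>n. 2 * coeff (Hpoly S) j * (x ^ k * poly (cheb (2 * n - j)) x)))"
    by (simp add: bspoly_def poly_sum sum_distrib_left sum_distrib_right mult_ac)
  also have "... = (\<Sum>j\<le>n. 2 * coeff (Hpoly S) j * (LINT x|arcs. x ^ k * poly (cheb (2 * n - j)) x))"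
    using i by (subst Bochner_Integration.integral_sum) auto
  also have "... = 0" using assms by (intro sum.neutral) (auto intro!: integral_arcs_power_cheb)
  finally show ?thesis .
qed

text \<open>The Cauchy transform of T_m is tau t ^ (-m) over the root of t^2 - 1, so the Chebyshev
  expansion reassembles H at \<open>tau t\<close>. For S to the right of E, the transform therefore
  vanishes there exactly on S.\<close>

lemma bspoly_cauchy:
  assumes t: "1 < t" and S: "finite S" "card S = n"
  shows "(LINT x|arcs. poly (bspoly n S) x / (t - x)) = 2 / sqrt (t\<^sup>2 - 1) * (1 / tau t) ^ (2 * n) * poly (Hpoly S) (tau t)"
proof -
  have i: "integrable arcs (\<lambda>x. poly (cheb j) x / (t - x))" for j
    by (intro integrable_arcs_cont) (use t in \<open>auto intro!: continuous_intros\<close>)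
  have tt: "0 < tau t" using t by (intro tau_pos) simp
  have "(LINT x|arcs. poly (bspoly n S) x / (t - x))
    = (LINT x|arcs. (\<Sum>j\<le>n. 2 * coeff (Hpoly S) j * (poly (cheb (2 * n - j)) x / (t - x))))"
    by (simp add: bspoly_def poly_sum sum_divide_distrib mult_ac)
  also have "... = (\<Sum>j\<le>n. 2 * coeff (Hpoly S) j * (LINT x|arcs. poly (cheb (2 * n - j)) x / (t - x)))"
    using i by (subst Bochner_Integration.integral_sum) (auto simp del: times_divide_eq_right)
  also have "... = (\<Sum>j\<le>n. 2 / sqrt (t\<^sup>2 - 1) * (1 / tau t) ^ (2 * n) * (coeff (Hpoly S) j * tau t ^ j))"
  proof (intro sum.cong refl)
    fix j assume "j \<in> {..n}"
    then have "(1 / tau t) ^ (2 * n) * tau t ^ j = (1 / tau t) ^ (2 * n - j) * ((1 / tau t) ^ j * tau t ^ j)"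
      by (simp flip: power_add mult.assoc)
    also have "(1 / tau t) ^ j * tau t ^ j = 1" using tt by (simp flip: power_mult_distrib)
    finally have "(1 / tau t) ^ (2 * n - j) = (1 / tau t) ^ (2 * n) * tau t ^ j" by simp
    then show "2 * coeff (Hpoly S) j * (LINT x|arcs. poly (cheb (2 * n - j)) x / (t - x))
       = 2 / sqrt (t\<^sup>2 - 1) * (1 / tau t) ^ (2 * n) * (coeff (Hpoly S) j * tau t ^ j)"
      by (simp only: integral_arcs_cheb_cauchy[OF t]) simp
  qed
  also have "... = 2 / sqrt (t\<^sup>2 - 1) * (1 / tau t) ^ (2 * n) * (\<Sum>j\<le>n. coeff (Hpoly S) j * tau t ^ j)"
    by (simp only: sum_distrib_left)
  also have "(\<Sum>j\<le>n. coeff (Hpoly S) j * tau t ^ j) = poly (Hpoly S) (tau t)"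
    using degree_Hpoly[of S] S by (intro poly_altdef_le[symmetric]) simp
  finally show ?thesis .
qed

lemma cpoly_bspoly:
  assumes u: "u \<noteq> 0" and S: "finite S" "card S = n"
  shows "cpoly (bspoly n S) ((u + 1 / u) / 2) = u ^ (2 * n) * cpoly (Hpoly S) (1 / u) + (1 / u) ^ (2 * n) * cpoly (Hpoly S) u"
proof -
  let ?z = "(u + 1 / u) / 2"
  have H: "cpoly (Hpoly S) v = (\<Sum>j\<le>n. of_real (coeff (Hpoly S) j) * v ^ j)" for v
  proof -
    have "degree (map_poly complex_of_real (Hpoly S)) \<le> n" using degree_Hpoly[of S] S by (simp add: degree_map_poly)
    then show ?thesis by (subst poly_altdef_le[of _ n]) (simp_all add: coeff_map_poly)
  qed
  have sum: "cpoly (sum f A) ?z = (\<Sum>j\<in>A. cpoly (f j) ?z)" for f :: "nat \<Rightarrow> real poly" and A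
    by (induction A rule: infinite_finite_induct) (simp_all add: cpoly_add)
  have "cpoly (bspoly n S) ?z = (\<Sum>j\<le>n. of_real (coeff (Hpoly S) j) * (2 * cpoly (cheb (2 * n - j)) ?z))"
    unfolding bspoly_def sum cpoly_smult by (simp add: mult_ac)
  also have "... = (\<Sum>j\<le>n. u ^ (2 * n) * (of_real (coeff (Hpoly S) j) * (1 / u) ^ j) + (1 / u) ^ (2 * n) * (of_real (coeff (Hpoly S) j) * u ^ j))"
  proof (intro sum.cong refl)
    fix j assume j: "j \<in> {..n}"
    have e: "v ^ (2 * n) * w ^ j = v ^ (2 * n - j)" if "v * w = 1" for v w :: complex
    proof -
      have "v ^ (2 * n) * w ^ j = v ^ (2 * n - j) * (v * w) ^ j"
        using j by (simp add: power_mult_distrib flip: power_add mult.assoc)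
      then show ?thesis using that by simp
    qed
    have "2 * cpoly (cheb (2 * n - j)) ?z = u ^ (2 * n) * (1 / u) ^ j + (1 / u) ^ (2 * n) * u ^ j"
      unfolding cheb_complex[OF u] using e[of u "1 / u"] e[of "1 / u" u] u by simp
    then show "of_real (coeff (Hpoly S) j) * (2 * cpoly (cheb (2 * n - j)) ?z)
      = u ^ (2 * n) * (of_real (coeff (Hpoly S) j) * (1 / u) ^ j) + (1 / u) ^ (2 * n) * (of_real (coeff (Hpoly S) j) * u ^ j)"
      by (simp add: algebra_simps)
  qed
  also have "... = u ^ (2 * n) * cpoly (Hpoly S) (1 / u) + (1 / u) ^ (2 * n) * cpoly (Hpoly S) u"
    unfolding H by (simp only: sum.distrib sum_distrib_left)
  finally show ?thesis .
qed

lemma bspoly_degree_lead: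
  assumes n: "1 \<le> n"
  shows "degree (bspoly n S) \<le> 2 * n" "coeff (bspoly n S) (2 * n) = 4 ^ n"
proof -
  show "degree (bspoly n S) \<le> 2 * n" unfolding bspoly_def
  proof (rule degree_sum_le)
    show "degree (smult (2 * coeff (Hpoly S) j) (cheb (2 * n - j))) \<le> 2 * n" for j
      using cheb_degree_lead[of "2 * n - j"] by (intro order_trans[OF degree_smult_le]) simp
  qed simp
  have "coeff (cheb (2 * n - j)) (2 * n) = 0" if "0 < j" for j
    using cheb_degree_lead[of "2 * n - j"] that n by (intro coeff_eq_0) simp
  then have "coeff (bspoly n S) (2 * n) = (\<Sum>j\<le>n. if j = 0 then 2 * coeff (cheb (2 * n)) (2 * n) else 0)"
    unfolding bspoly_def coeff_sum by (intro sum.cong) (auto simp: coeff_0_Hpoly)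
  also have "... = 2 * 2 ^ (2 * n - 1)"
  proof -
    have "degree (cheb (2 * n)) = 2 * n" "lead_coeff (cheb (2 * n)) = 2 ^ (2 * n - 1)"
      using cheb_degree_lead[of "2 * n"] n by auto
    then have "coeff (cheb (2 * n)) (2 * n) = 2 ^ (2 * n - 1)" by metis
    then show ?thesis by simp
  qed
  also have "... = 2 ^ (2 * n)" using n by (simp flip: power_Suc)
  finally show "coeff (bspoly n S) (2 * n) = 4 ^ n" by (simp add: power_mult)
qed

text \<open>Up to a constant factor, the Cauchy transform of \<open>bspoly n S\<close> at t is the
  product of all t - s times this weight: \<open>poly (Hpoly S) (tau t)\<close> has the factors 1 -
  tau t / tau s, and \<open>tau_diff\<close> turns tau t - tau s into 2 (t - s) / (1 - 1 / (tau t *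
  tau s)). This is how the weight comes to depend on S.\<close>

definition zero_weight :: "nat \<Rightarrow> real set \<Rightarrow> real \<Rightarrow> real" where
  "zero_weight n S t = (1 / tau t) ^ (2 * n) / (sqrt (t\<^sup>2 - 1) * (\<Prod>s\<in>S. (1 - 1 / (tau t * tau s))))"

text \<open>The zeros of the Cauchy transform R are counted from both sides: more than n of them
  would make q orthogonal to itself for a positive weight, and fewer than n sign changes would
  contradict the orthogonality of R to polynomials with respect to \<sigma>. Once n zeros are fixed,
  q is determined: two polynomials obeying the same relations, with equal top coefficients, differ
  by one of degree < 2 n that is orthogonal to itself.\<close>

lemma nikishin_structure:
  fixes \<sigma> :: "real measure" and q :: "real poly"
  assumes sets [measurable_cong]: "sets \<sigma> = sets borel" and fin: "finite_measure \<sigma>"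
    and ab: "1 < a" "a \<le> b" "AE t in \<sigma>. a \<le> t \<and> t \<le> b"
    and infsupp: "\<And>A. finite A \<Longrightarrow> \<not> (AE t in \<sigma>. t \<in> A)"
    and n: "1 \<le> n" and deg: "degree q \<le> 2 * n" and monic: "lead_coeff q = 1"
    and orth: "\<And>k. k < n \<Longrightarrow> (LINT x|arcs. poly q x * x ^ k) = 0"
    and orthR: "\<And>k. k < n \<Longrightarrow> (LINT t|\<sigma>. (LINT x|arcs. poly q x / (t - x)) * t ^ k) = 0"
  obtains S where "finite S" "card S = n" "S \<subseteq> {a..b}" "q = smult (1 / 4 ^ n) (bspoly n S)"
    "\<And>k. k < n \<Longrightarrow> (LINT t|\<sigma>. (\<Prod>s\<in>S. (t - s)) * t ^ k *
        zero_weight n S t) = 0"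
proof -
  interpret s: finite_measure \<sigma> by fact
  define R where "R t = (LINT x|arcs. poly q x / (t - x))" for t
  have q0: "q \<noteq> 0" using monic by auto
  have posS: "0 < (\<Prod>s\<in>S. (s - x))" if "S \<subseteq> {1<..}" "x \<le> 1" for S and x :: real using that by (intro prod_pos) force
  have gS: "continuous_on {-1..1} (\<lambda>x. 1 / (\<Prod>s\<in>S. (s - x)))" if "S \<subseteq> {1<..}" for S :: "real set"
    using posS[OF that] by (intro continuous_intros) force
  have few: "card S \<le> n" if S: "finite S" "S \<subseteq> {1<..}" "\<And>s. s \<in> S \<Longrightarrow> R s = 0" for S
  proof (rule ccontr)
    assume "\<not> card S \<le> n"
    then have "(LINT x|arcs. poly q x * (poly q x / (\<Prod>s\<in>S. (s - x)))) = 0"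
      using S deg by (intro orthogonal_partial_fractions[OF orth]) (auto simp: R_def)
    then have "q = 0" using posS[OF S(2)] gS[OF S(2)]
      by (intro poly_zero_of_integral_zero[of "\<lambda>x. 1 / (\<Prod>s\<in>S. (s - x))"]) auto
    with q0 show False by simp
  qed
  have contR: "continuous_on {a..} R"
  proof -
    have "compact (poly q ` {-1..1})" by (intro compact_continuous_image continuous_intros) auto
    then obtain D where D: "\<And>y. y \<in> poly q ` {-1..1} \<Longrightarrow> norm y \<le> D" using compact_imp_bounded bounded_iff by metis
    have D0: "0 \<le> D" using D[of "poly q 0"] norm_ge_zero[of "poly q 0"] by fastforce
    have "isCont R t" if t: "1 < t" for t unfolding continuous_at_sequentially comp_def
    proof (intro allI impI)
      fix X assume X: "X \<longlonglongrightarrow> t"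
      define c where "c = (1 + t) / 2"
      have c: "1 < c" "c < t" using t by (auto simp: c_def)
      have ev: "\<forall>\<^sub>F n in sequentially. c < X n" using X c by (intro order_tendstoD)
      then obtain N where N: "\<And>n. N \<le> n \<Longrightarrow> c < X n" unfolding eventually_sequentially by blast
      have "(\<lambda>n. R (X (n + N))) \<longlonglongrightarrow> R t" unfolding R_def
      proof (rule integral_dominated_convergence[where w = "\<lambda>_. D / (c - 1)"])
        show "AE x in arcs. (\<lambda>n. poly q x / (X (n + N) - x)) \<longlonglongrightarrow> poly q x / (t - x)" using AE_arcs
        proof eventually_elim
          case (elim x)
          have "(\<lambda>n. X (n + N)) \<longlonglongrightarrow> t" using X by (rule LIMSEQ_ignore_initial_segment)
          then show ?case using elim t by (intro tendsto_intros) auto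
        qed
        show "AE x in arcs. norm (poly q x / (X (n + N) - x)) \<le> D / (c - 1)" for n using AE_arcs
        proof eventually_elim
          case (elim x)
          show ?case using D[of "poly q x"] elim c N[of "n + N"] D0 by (simp add: frac_le)
        qed
      qed auto
      then show "(\<lambda>n. R (X n)) \<longlonglongrightarrow> R t" by (rule LIMSEQ_offset)
    qed
    then show ?thesis using ab by (intro continuous_at_imp_continuous_on) auto
  qed
  \<comment> \<open>The sign lemma excludes the right end point, while b may belong to the support;
    hence the interval is extended beyond b. Zeros in (b, b + 1) may slip in and are ruled out at
    the end.\<close>
  define Z where "Z = {x\<in>{a..<b+1}. R x = 0}"
  have finZ: "finite Z"
  proof (rule ccontr)
    assume "infinite Z"
    then obtain T where "T \<subseteq> Z" "card T = Suc n" "finite T" using infinite_arbitrarily_large by metis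
    then show False using few[of T] ab by (force simp: Z_def)
  qed
  obtain S0 e where S0: "S0 \<subseteq> Z" "e = 1 \<or> e = -1"
    and sgn: "\<And>x. x \<in> {a..<b+1} \<Longrightarrow> 0 \<le> e * R x * (\<Prod>s\<in>S0. (x - s))"
    using sign_changes_polynomial[OF contR, of "b + 1"] finZ unfolding Z_def by blast
  have finS0: "finite S0" using S0 finZ finite_subset by blast
  have [measurable]: "R \<in> borel_measurable borel" unfolding R_def by measurable
  have "compact (R ` {a..b})" by (intro compact_continuous_image continuous_on_subset[OF contR]) auto
  then obtain B where B: "\<And>y. y \<in> R ` {a..b} \<Longrightarrow> norm y \<le> B" using compact_imp_bounded bounded_iff by metis
  have Ri: "integrable \<sigma> (\<lambda>t. R t * poly P t)" for P :: "real poly"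
  proof -
    have "compact (poly P ` {a..b})" by (intro compact_continuous_image continuous_intros) auto
    then obtain D where D: "\<And>y. y \<in> poly P ` {a..b} \<Longrightarrow> norm y \<le> D" using compact_imp_bounded bounded_iff by metis
    show ?thesis
    proof (rule s.integrable_const_bound[of _ "B * D"])
      show "AE t in \<sigma>. norm (R t * poly P t) \<le> B * D" using ab(3)
      proof eventually_elim
        case (elim t)
        then have "norm (R t) \<le> B" "norm (poly P t) \<le> D" using B[of "R t"] D[of "poly P t"] by auto
        then show ?case unfolding norm_mult by (intro mult_mono) (auto intro: order_trans[OF norm_ge_zero])
      qed
    qed measurable
  qed
  have orthRP: "(LINT t|\<sigma>. R t * poly P t) = 0" if "degree P < n" for P :: "real poly"
  proof -
    have "(LINT t|\<sigma>. R t * poly P t) = (LINT t|\<sigma>. (\<Sum>k\<le>degree P. coeff P k * (R t * t ^ k)))"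
      by (simp add: poly_altdef sum_distrib_left mult_ac)
    also have "... = (\<Sum>k\<le>degree P. coeff P k * (LINT t|\<sigma>. R t * t ^ k))"
    proof -
      have "integrable \<sigma> (\<lambda>t. R t * t ^ k)" for k using Ri[of "monom 1 k"] by (simp add: poly_monom)
      then show ?thesis by (subst Bochner_Integration.integral_sum) auto
    qed
    also have "... = 0" using orthR that by (intro sum.neutral) (auto simp: R_def)
    finally show ?thesis .
  qed
  \<comment> \<open>With fewer sign changes, the product over S0 would be an admissible test
    polynomial against which R has constant sign. The vanishing integral would then concentrate
    \<sigma> on the finite set Z.\<close>
  have cardS0: "n \<le> card S0"
  proof (rule ccontr)
    assume less: "\<not> n \<le> card S0"
    define P where "P = (\<Prod>s\<in>S0. [:- s, 1:])"
    have P: "poly P t = (\<Prod>s\<in>S0. (t - s))" for t by (simp add: P_def poly_prod)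
    have "degree P < n" using degree_prod_linear_le[of uminus "\<lambda>_. 1" S0] less by (simp add: P_def)
    then have "(LINT t|\<sigma>. e * (R t * poly P t)) = 0" using orthRP by simp
    moreover have "AE t in \<sigma>. 0 \<le> e * (R t * poly P t)" using ab(3) by eventually_elim (use sgn in \<open>simp add: P mult.assoc\<close>)
    ultimately have "AE t in \<sigma>. e * (R t * poly P t) = 0"
      using integral_nonneg_eq_0_iff_AE[of \<sigma> "\<lambda>t. e * (R t * poly P t)"] Ri[of P] by simp
    then have "AE t in \<sigma>. t \<in> Z" using ab(3)
    proof eventually_elim
      case (elim t)
      then have "R t = 0 \<or> t \<in> S0" using S0(2) finS0 by (auto simp: P)
      then show ?case using elim S0(1) by (auto simp: Z_def)
    qed
    with infsupp[OF finZ] show False by simp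
  qed
  obtain S where S: "S \<subseteq> S0" "card S = n" "finite S" using cardS0 obtain_subset_with_card_n by metis
  have SZ: "S \<subseteq> Z" using S S0 by auto
  have S1: "S \<subseteq> {1<..}" using SZ ab by (force simp: Z_def)
  define q' where "q' = bspoly n S"
  have orth': "(LINT x|arcs. poly q' x / (s - x)) = 0" if "s \<in> S" for s
  proof -
    have "poly (Hpoly S) (tau s) = 0"
      unfolding poly_Hpoly using that S tau_pos[of s] S1 by (intro prod_zero) (auto intro!: bexI[of _ s])
    then show ?thesis using that S1 S by (subst q'_def, subst bspoly_cauchy) auto
  qed
  define c where "c = coeff q (2 * n) / 4 ^ n"
  \<comment> \<open>\<open>c\<close> matches the coefficients of x^(2n), so deg p < 2 n = n + card
    S, and both q and q' are orthogonal to p for the weight 1 / prod (s - x). Subtracting, p is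
    orthogonal to itself.\<close>
  define p where "p = q - smult c q'"
  have pdeg: "p = 0 \<or> degree p < 2 * n"
  proof -
    have "degree p \<le> 2 * n" unfolding p_def q'_def
      using deg bspoly_degree_lead(1)[OF n] by (intro degree_diff_le order_trans[OF degree_smult_le])
    moreover have "coeff p (2 * n) = 0" using bspoly_degree_lead(2)[OF n] by (simp add: p_def q'_def c_def)
    ultimately show ?thesis by (metis leading_coeff_0_iff nat_less_le)
  qed
  have intp: "(LINT x|arcs. poly r x * (poly p x / (\<Prod>s\<in>S. (s - x)))) = 0" if "r = q \<or> r = q'" for r
    using that S S1 SZ pdeg orth orth' bspoly_orthogonal[of _ n S]
    by (intro orthogonal_partial_fractions[of n]) (auto simp: R_def Z_def q'_def mult_2)
  have neS: "(\<Prod>s\<in>S. (s - x)) \<noteq> 0" if "x \<le> 1" for x using posS[OF S1 that] by simp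
  have "(LINT x|arcs. poly p x * (poly p x * (1 / (\<Prod>s\<in>S. (s - x)))))
     = (LINT x|arcs. poly q x * (poly p x / (\<Prod>s\<in>S. (s - x))) - c * (poly q' x * (poly p x / (\<Prod>s\<in>S. (s - x)))))"
    by (intro Bochner_Integration.integral_cong refl) (simp add: p_def diff_divide_distrib algebra_simps)
  also have "... = 0"
  proof -
    have "integrable arcs (\<lambda>x. poly r x * (poly p x / (\<Prod>s\<in>S. (s - x))))" for r :: "real poly"
      by (intro integrable_arcs_cont) (auto intro!: continuous_intros simp: neS)
    then show ?thesis using intp[of q] intp[of q'] by (simp del: times_divide_eq_right)
  qed
  finally have "p = 0" using posS[OF S1] gS[OF S1] by (intro poly_zero_of_integral_zero[of "\<lambda>x. 1 / (\<Prod>s\<in>S. (s - x))"]) auto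
  then have qc: "q = smult c q'" by (simp add: p_def)
  have c0: "c \<noteq> 0" using qc q0 by auto
  have "coeff q' (2 * n) \<noteq> 0" unfolding q'_def using bspoly_degree_lead(2)[OF n] by simp
  then have "degree q' = 2 * n" using bspoly_degree_lead(1)[OF n, of S] by (metis le_antisym le_degree q'_def)
  then have "lead_coeff q = c * 4 ^ n" using qc c0 bspoly_degree_lead(2)[OF n, of S] by (simp add: q'_def)
  then have c: "c = 1 / 4 ^ n" using monic by (simp add: field_simps)
  define w where "w t = zero_weight n S t" for t
  note w_def = w_def[unfolded zero_weight_def]
  define K where "K = c * 2 * (\<Prod>s\<in>S. (- 2 / tau s))"
  have taus: "1 < tau s" if "s \<in> S" for s using that S1 by (intro tau_gt1) auto
  have K0: "K \<noteq> 0" using c S taus by (force simp: K_def)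
  have Rw: "R t = K * ((\<Prod>s\<in>S. (t - s)) * w t)" if t: "1 < t" for t
  proof -
    have "R t = c * (LINT x|arcs. poly q' x / (t - x))"
      unfolding R_def qc by (simp add: times_divide_eq_right[symmetric] del: times_divide_eq_right)
    also have "... = c * (2 / sqrt (t\<^sup>2 - 1) * (1 / tau t) ^ (2 * n) * poly (Hpoly S) (tau t))"
      unfolding q'_def using t S by (subst bspoly_cauchy) auto
    also have "poly (Hpoly S) (tau t) = (\<Prod>s\<in>S. (- 2 / tau s) * ((t - s) / (1 - 1 / (tau t * tau s))))" unfolding poly_Hpoly
    proof (intro prod.cong refl)
      fix s assume s: "s \<in> S"
      have tt: "1 < tau t" using t by (rule tau_gt1)
      have "1 < tau t * tau s" using taus[OF s] tt by (metis less_1_mult)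
      then have ne: "1 - 1 / (tau t * tau s) \<noteq> 0" by simp
      have "t - s = (tau t - tau s) * (1 - 1 / (tau t * tau s)) / 2" using t s S1 by (intro tau_diff) auto
      then have "(t - s) / (1 - 1 / (tau t * tau s)) = (tau t - tau s) / 2" using ne by simp
      then show "1 - tau t / tau s = (- 2 / tau s) * ((t - s) / (1 - 1 / (tau t * tau s)))"
        using taus[OF s] by (simp only:) (simp add: field_simps)
    qed
    also have "c * (2 / sqrt (t\<^sup>2 - 1) * (1 / tau t) ^ (2 * n) * ...) = K * ((\<Prod>s\<in>S. (t - s)) * w t)"
      unfolding K_def w_def prod.distrib prod_dividef by (simp add: field_simps)
    finally show ?thesis .
  qed
  show ?thesis
  proof (rule that[of S])
    show "S \<subseteq> {a..b}"
    proof
      fix s assume s: "s \<in> S"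
      show "s \<in> {a..b}"
      proof (rule ccontr)
        assume "s \<notin> {a..b}"
        then have sb: "b < s" using s SZ by (auto simp: Z_def)
        \<comment> \<open>For a zero s > b, the test polynomial without the factor t - s turns the
          integrand into (s - t) w P^2. This has one sign on [a, b], although its integral is
          0.\<close>
        define P where "P = (\<Prod>r\<in>S - {s}. [:- r, 1:])"
        have P: "poly P t = (\<Prod>r\<in>S - {s}. (t - r))" for t by (simp add: P_def poly_prod)
        have "degree P \<le> card (S - {s})" unfolding P_def by (rule degree_prod_linear_le)
        then have "degree P < n" using s S n by (simp add: card_Diff_singleton)
        then have 0: "(LINT t|\<sigma>. - (R t * poly P t / K)) = 0" using orthRP by simp
        have w_pos: "0 < w t" if "1 < t" for t
        proof -
          have "1 / (tau t * tau r) < 1" if "r \<in> S" for r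
          proof -
            have "1 < tau t * tau r" using taus[OF that] tau_gt1[OF \<open>1 < t\<close>] by (metis less_1_mult)
            then show ?thesis by (subst divide_less_eq_1_pos) auto
          qed
          then have "0 < (\<Prod>s\<in>S. (1 - 1 / (tau t * tau s)))" by (intro prod_pos) auto
          moreover have "0 < sqrt (t\<^sup>2 - 1)" using that by (simp add: one_less_power)
          moreover have "0 < tau t" using that by (intro tau_pos) simp
          ultimately show ?thesis unfolding w_def by (intro divide_pos_pos mult_pos_pos) auto
        qed
        have eq: "- (R t * poly P t / K) = (s - t) * w t * (poly P t)\<^sup>2" if "1 < t" for t
        proof -
          have "(\<Prod>s\<in>S. (t - s)) = (t - s) * poly P t" unfolding P using s S by (subst prod.remove[of S s]) auto
          then have "R t = K * (((t - s) * poly P t) * w t)" using Rw[OF that] by (simp only:)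
          then have "R t * poly P t / K = ((t - s) * poly P t) * w t * poly P t" using K0 by simp
          then show ?thesis by (simp only:) (simp add: power2_eq_square algebra_simps)
        qed
        have "AE t in \<sigma>. 0 \<le> - (R t * poly P t / K)" using ab(3)
        proof eventually_elim
          case (elim t)
          then have "1 < t" using ab by simp
          then show ?case unfolding eq[OF \<open>1 < t\<close>] using elim sb w_pos[of t] by (intro mult_nonneg_nonneg) auto
        qed
        then have "AE t in \<sigma>. - (R t * poly P t / K) = 0"
          using integral_nonneg_eq_0_iff_AE[of \<sigma> "\<lambda>t. - (R t * poly P t / K)"] Ri[of P] 0 by simp
        then have "AE t in \<sigma>. t \<in> S" using ab(3)
        proof eventually_elim
          case (elim t)
          then have t: "1 < t" using ab by simp
          have "(s - t) * w t * (poly P t)\<^sup>2 = 0" using elim eq[OF t] by simp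
          then have "poly P t = 0" using sb elim w_pos[OF t] by auto
          then show ?case using S by (auto simp: P)
        qed
        with infsupp[OF S(3)] show False by simp
      qed
    qed
    show "q = smult (1 / 4 ^ n) (bspoly n S)" using qc c by (simp add: q'_def)
    show "(LINT t|\<sigma>. (\<Prod>s\<in>S. (t - s)) * t ^ k * zero_weight n S t) = 0"
      if k: "k < n" for k
    proof -
      have "(LINT t|\<sigma>. (\<Prod>s\<in>S. (t - s)) * t ^ k * w t) = (LINT t|\<sigma>. R t * t ^ k / K)"
      proof (rule integral_cong_AE)
        show "AE t in \<sigma>. (\<Prod>s\<in>S. (t - s)) * t ^ k * w t = R t * t ^ k / K" using ab(3)
        proof eventually_elim
          case (elim t)
          then have "1 < t" using ab by simp
          then show ?case using Rw[of t] K0 by (simp add: field_simps)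
        qed
      qed (unfold w_def, measurable)
      also have "... = 0" using orthR[OF k] by (simp add: R_def)
      finally show ?thesis by (simp add: w_def zero_weight_def)
    qed
  qed (use S in auto)
qed

subsection \<open>Heine formula\<close>

text \<open>The product runs over ordered pairs, so this is the squared Vandermonde determinant. A
  general index set allows single indices to be split off.\<close>

definition vdm2 :: "'i set \<Rightarrow> ('i \<Rightarrow> real) \<Rightarrow> real" where
  "vdm2 I x = (\<Prod>i\<in>I. \<Prod>j\<in>I - {i}. \<bar>x i - x j\<bar>)"

lemma vdm2_nonneg: "0 \<le> vdm2 I x"
  unfolding vdm2_def by (intro prod_nonneg) auto

lemma vdm2_insert:
  assumes "finite I" "i \<notin> I"
  shows "vdm2 (insert i I) x = (\<Prod>j\<in>I. (x i - x j)\<^sup>2) * vdm2 I x"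
proof -
  have "(\<Prod>j\<in>insert i I - {k}. \<bar>x k - x j\<bar>) = \<bar>x k - x i\<bar> * (\<Prod>j\<in>I - {k}. \<bar>x k - x j\<bar>)" if "k \<in> I" for k
  proof -
    have "insert i I - {k} = insert i (I - {k})" using assms that by auto
    then show ?thesis using assms by simp
  qed
  then have "(\<Prod>k\<in>I. \<Prod>j\<in>insert i I - {k}. \<bar>x k - x j\<bar>) = (\<Prod>k\<in>I. \<bar>x k - x i\<bar>) * vdm2 I x" by (simp add: vdm2_def prod.distrib)
  moreover have "insert i I - {i} = I" using assms by auto
  ultimately have "vdm2 (insert i I) x = (\<Prod>j\<in>I. \<bar>x i - x j\<bar>) * ((\<Prod>k\<in>I. \<bar>x k - x i\<bar>) * vdm2 I x)"
    using assms by (simp add: vdm2_def)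
  also have "... = (\<Prod>j\<in>I. \<bar>x i - x j\<bar> * \<bar>x j - x i\<bar>) * vdm2 I x" by (simp add: prod.distrib mult.assoc)
  also have "(\<Prod>j\<in>I. \<bar>x i - x j\<bar> * \<bar>x j - x i\<bar>) = (\<Prod>j\<in>I. (x i - x j)\<^sup>2)"
    by (intro prod.cong refl) (auto simp: abs_if power2_eq_square algebra_simps)
  finally show ?thesis .
qed

lemma vdm2_cong: "(\<And>i. i \<in> I \<Longrightarrow> x i = y i) \<Longrightarrow> vdm2 I x = vdm2 I y"
  unfolding vdm2_def by (intro prod.cong) auto

lemma vdm2_eq_0: "finite I \<Longrightarrow> i \<in> I \<Longrightarrow> j \<in> I \<Longrightarrow> i \<noteq> j \<Longrightarrow> x i = x j \<Longrightarrow> vdm2 I x = 0"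
  unfolding vdm2_def by (rule prod_zero, simp, rule bexI[of _ i], rule prod_zero) auto

text \<open>Lagrange interpolation of \<open>Q\<close> at the nodes \<open>x i\<close>, multiplied by the squared Vandermonde
  determinant so that coinciding nodes are harmless.\<close>

lemma lagrange_vdm2:
  fixes Q :: "real poly"
  assumes I: "finite I" and Q: "degree Q = card I" "lead_coeff Q = 1"
  shows "poly Q z * vdm2 I x = (\<Prod>i\<in>I. (z - x i)) * vdm2 I x
    + (\<Sum>i\<in>I. poly Q (x i) * (\<Prod>j\<in>I - {i}. (z - x j) * (x i - x j)) * vdm2 (I - {i}) x)"
proof (cases "inj_on x I")
  case False
  then obtain a b where ab: "a \<in> I" "b \<in> I" "a \<noteq> b" "x a = x b" by (auto simp: inj_on_def)
  have "(\<Prod>j\<in>I - {i}. (z - x j) * (x i - x j)) * vdm2 (I - {i}) x = 0" if "i \<in> I" for i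
  proof (cases "i = a \<or> i = b")
    case True
    then have "(\<Prod>j\<in>I - {i}. (z - x j) * (x i - x j)) = 0"
    proof
      assume "i = a"
      then show ?thesis using ab I by (intro prod_zero bexI[of _ b]) auto
    next
      assume "i = b"
      then show ?thesis using ab I by (intro prod_zero bexI[of _ a]) auto
    qed
    then show ?thesis by simp
  next
    case False
    then have "vdm2 (I - {i}) x = 0" using ab I by (intro vdm2_eq_0[of _ a b]) auto
    then show ?thesis by simp
  qed
  then have "(\<Sum>i\<in>I. poly Q (x i) * (\<Prod>j\<in>I - {i}. (z - x j) * (x i - x j)) * vdm2 (I - {i}) x) = 0"
    by (intro sum.neutral) (auto simp: mult.assoc)
  moreover have "vdm2 I x = 0" using vdm2_eq_0[OF I ab(1,2,3,4)] .
  ultimately show ?thesis by simp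
next
  case True
  define n where "n = card I"
  define p where "p i = (\<Prod>j\<in>I - {i}. x i - x j)" for i
  define l where "l i = (\<Prod>j\<in>I - {i}. [:- x j, 1:])" for i
  define W where "W = (\<Prod>i\<in>I. [:- x i, 1:])"
  define L where "L = (\<Sum>i\<in>I. smult (poly Q (x i) / p i) (l i))"
  define D where "D = Q - W - L"
  have p0: "p i \<noteq> 0" if "i \<in> I" for i using True that I by (auto simp: p_def inj_on_def)
  have l: "poly (l i) y = (\<Prod>j\<in>I - {i}. y - x j)" for i y by (simp add: l_def poly_prod)
  have W: "poly W y = (\<Prod>j\<in>I. y - x j)" for y by (simp add: W_def poly_prod)
  have lx: "poly (l i) (x k) = (if i = k then p i else 0)" if "i \<in> I" "k \<in> I" for i k
  proof (cases "i = k")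
    case False
    then show ?thesis unfolding l using that I by (auto intro!: prod_zero bexI[of _ k])
  qed (simp add: l p_def)
  have Dx: "poly D (x k) = 0" if k: "k \<in> I" for k
  proof -
    have "poly L (x k) = (\<Sum>i\<in>I. if i = k then poly Q (x k) else 0)"
      unfolding L_def poly_sum using k p0 by (intro sum.cong) (auto simp: lx)
    also have "... = poly Q (x k)" using I k by simp
    moreover have "poly W (x k) = 0" unfolding W using I k by (intro prod_zero) auto
    ultimately show ?thesis by (simp add: D_def)
  qed
  have dl: "degree (l i) < n" if "i \<in> I" for i
  proof -
    have "degree (l i) \<le> card (I - {i})" unfolding l_def by (rule degree_prod_linear_le)
    also have "... < n" unfolding n_def using I that by (intro card_Diff1_less)
    finally show ?thesis .
  qed
  have dL: "coeff L k = 0" if "n \<le> k" for k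
  proof -
    have "coeff (l i) k = 0" if "i \<in> I" for i using dl[OF that] \<open>n \<le> k\<close> by (intro coeff_eq_0) simp
    then show ?thesis unfolding L_def coeff_sum by (intro sum.neutral) auto
  qed
  have Wm: "degree W = n" "lead_coeff W = 1"
    unfolding W_def n_def lead_coeff_prod by (simp_all add: degree_prod_eq_sum_degree)
  have "coeff D k = 0" if "n \<le> k" for k
  proof (cases "k = n")
    case True
    have "coeff W n = 1" "coeff Q n = 1" using Wm Q by (simp_all add: n_def)
    then show ?thesis using True dL[of n] by (simp add: D_def)
  next
    case False
    then have "coeff W k = 0" "coeff Q k = 0" using Wm Q that by (auto simp: n_def intro!: coeff_eq_0)
    then show ?thesis using dL[of k] that by (simp add: D_def)
  qed
  from this[of "degree D"] have dD: "D = 0 \<or> degree D < n" by (cases "n \<le> degree D") auto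
  have "D = 0"
  proof (rule ccontr)
    assume "D \<noteq> 0"
    then have "finite {y. poly D y = 0}" "card {y. poly D y = 0} \<le> degree D"
      by (auto intro: poly_roots_finite card_poly_roots_bound)
    moreover have "x ` I \<subseteq> {y. poly D y = 0}" using Dx by auto
    ultimately have "card (x ` I) \<le> degree D" by (meson card_mono le_trans)
    then show False using dD \<open>D \<noteq> 0\<close> card_image[OF True] by (simp add: n_def)
  qed
  then have "Q = W + L" by (simp add: D_def algebra_simps)
  then have "poly Q z = poly W z + poly L z" by simp
  also have "poly L z = (\<Sum>i\<in>I. poly Q (x i) / p i * (\<Prod>j\<in>I - {i}. z - x j))" unfolding L_def by (simp add: poly_sum l)
  finally have "poly Q z * vdm2 I x = (\<Prod>i\<in>I. (z - x i)) * vdm2 I x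
      + (\<Sum>i\<in>I. poly Q (x i) / p i * (\<Prod>j\<in>I - {i}. z - x j) * vdm2 I x)" by (simp add: W distrib_right sum_distrib_right)
  also have "(\<Sum>i\<in>I. poly Q (x i) / p i * (\<Prod>j\<in>I - {i}. z - x j) * vdm2 I x)
    = (\<Sum>i\<in>I. poly Q (x i) * (\<Prod>j\<in>I - {i}. (z - x j) * (x i - x j)) * vdm2 (I - {i}) x)"
  proof (intro sum.cong refl)
    fix i assume i: "i \<in> I"
    have "vdm2 I x = vdm2 (insert i (I - {i})) x" using i by (simp add: insert_absorb)
    also have "... = p i * p i * vdm2 (I - {i}) x"
      using I by (subst vdm2_insert) (auto simp: p_def power2_eq_square prod.distrib)
    finally show "poly Q (x i) / p i * (\<Prod>j\<in>I - {i}. z - x j) * vdm2 I x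
      = poly Q (x i) * (\<Prod>j\<in>I - {i}. (z - x j) * (x i - x j)) * vdm2 (I - {i}) x"
      using p0[OF i] by (simp add: prod.distrib flip: p_def)
  qed
  finally show ?thesis .
qed

lemma vdm2_measurable:
  assumes "finite J" "J \<subseteq> I"
  shows "vdm2 J \<in> borel_measurable (Pi\<^sub>M I (\<lambda>_. borel))"
proof -
  have c: "(\<lambda>x. x i) \<in> borel_measurable (Pi\<^sub>M I (\<lambda>_. borel :: real measure))" if "i \<in> J" for i
    using assms that by (intro measurable_component_singleton) auto
  show ?thesis unfolding vdm2_def[abs_def] by (intro borel_measurable_prod borel_measurable_abs borel_measurable_diff c) auto
qed

lemma poly_component_measurable:
  "i \<in> I \<Longrightarrow> (\<lambda>x. poly Q (x i)) \<in> borel_measurable (Pi\<^sub>M I (\<lambda>_. borel))" for Q :: "real poly" by measurable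

lemma vdm2_field_measurable:
  fixes M :: "real measure" and h :: "real \<Rightarrow> real"
  assumes "finite I" "sets M = sets borel" and h: "h \<in> borel_measurable borel"
  shows "(\<lambda>x. vdm2 I x * (\<Prod>i\<in>I. h (x i))) \<in> borel_measurable (Pi\<^sub>M I (\<lambda>_. M))"
proof -
  have s: "sets (Pi\<^sub>M I (\<lambda>_. M)) = sets (Pi\<^sub>M I (\<lambda>_. borel :: real measure))" by (intro sets_PiM_cong) (auto simp: assms)
  have c: "(\<lambda>x. h (x i)) \<in> borel_measurable (Pi\<^sub>M I (\<lambda>_. borel))" if "i \<in> I" for i
    using measurable_compose[OF measurable_component_singleton[OF that] h] .
  show ?thesis unfolding measurable_cong_sets[OF s refl]
    by (intro borel_measurable_times vdm2_measurable borel_measurable_prod c assms) auto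
qed

text \<open>Boundedness on the cube only: polynomials in the coordinates are unbounded on the whole
  product space, and the weights below vanish off [a, b].\<close>

definition bdd_cube :: "'i set \<Rightarrow> real \<Rightarrow> real \<Rightarrow> (('i \<Rightarrow> real) \<Rightarrow> real) \<Rightarrow> bool" where
  "bdd_cube I a b f \<longleftrightarrow> (\<exists>B. \<forall>x. (\<forall>i\<in>I. x i \<in> {a..b}) \<longrightarrow> \<bar>f x\<bar> \<le> B)"

lemma bdd_cubeI: "(\<And>x. (\<And>i. i \<in> I \<Longrightarrow> x i \<in> {a..b}) \<Longrightarrow> \<bar>f x\<bar> \<le> B) \<Longrightarrow> bdd_cube I a b f"
  unfolding bdd_cube_def by blast

lemma bdd_cube_const: "bdd_cube I a b (\<lambda>_. c)"
  by (rule bdd_cubeI[of _ _ _ _ "\<bar>c\<bar>"]) auto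

lemma bdd_cube_mult:
  assumes "bdd_cube I a b f" "bdd_cube I a b g"
  shows "bdd_cube I a b (\<lambda>x. f x * g x)"
proof -
  obtain B where B: "\<forall>x. (\<forall>i\<in>I. x i \<in> {a..b}) \<longrightarrow> \<bar>f x\<bar> \<le> B" using assms(1) unfolding bdd_cube_def by (elim exE)
  obtain C where C: "\<forall>x. (\<forall>i\<in>I. x i \<in> {a..b}) \<longrightarrow> \<bar>g x\<bar> \<le> C" using assms(2) unfolding bdd_cube_def by (elim exE)
  show ?thesis
  proof (rule bdd_cubeI)
    fix x assume "\<And>i. i \<in> I \<Longrightarrow> x i \<in> {a..b}"
    then have x: "\<forall>i\<in>I. x i \<in> {a..b}" by (rule ballI)
    have "\<bar>f x\<bar> \<le> B" "\<bar>g x\<bar> \<le> C" using x B C by simp_all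
    then show "\<bar>f x * g x\<bar> \<le> B * C" unfolding abs_mult by (intro mult_mono) linarith+
  qed
qed

lemma bdd_cube_prod:
  assumes "\<And>k. k \<in> K \<Longrightarrow> bdd_cube I a b (f k)"
  shows "bdd_cube I a b (\<lambda>x. \<Prod>k\<in>K. f k x)"
  using assms by (induction K rule: infinite_finite_induct) (simp_all add: bdd_cube_const bdd_cube_mult)

lemma bdd_cube_diff:
  assumes "i \<in> I" "j \<in> I" shows "bdd_cube I a b (\<lambda>x. x i - x j)"
proof (rule bdd_cubeI)
  fix x assume "\<And>k. k \<in> I \<Longrightarrow> x k \<in> {a..b}"
  from this[of i] this[of j] show "\<bar>x i - x j\<bar> \<le> b - a" using assms by auto
qed

lemma bdd_cube_diff':
  assumes "i \<in> I" shows "bdd_cube I a b (\<lambda>x. c - x i)"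
proof (rule bdd_cubeI)
  fix x assume "\<And>k. k \<in> I \<Longrightarrow> x k \<in> {a..b}"
  from this[of i] show "\<bar>c - x i\<bar> \<le> \<bar>c\<bar> + \<bar>a\<bar> + \<bar>b\<bar>" using assms by auto
qed

lemma bdd_cube_abs: "bdd_cube I a b f \<Longrightarrow> bdd_cube I a b (\<lambda>x. \<bar>f x\<bar>)"
  by (simp add: bdd_cube_def)

lemma bdd_cube_vdm2: "J \<subseteq> I \<Longrightarrow> bdd_cube I a b (vdm2 J)"
  unfolding vdm2_def[abs_def] by (intro bdd_cube_prod bdd_cube_abs bdd_cube_diff) auto

lemma bdd_cube_poly:
  assumes "i \<in> I" shows "bdd_cube I a b (\<lambda>x. poly Q (x i))"
proof -
  have "compact (poly Q ` {a..b})" by (intro compact_continuous_image continuous_intros) auto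
  then obtain D where "\<And>y. y \<in> poly Q ` {a..b} \<Longrightarrow> norm y \<le> D" using compact_imp_bounded bounded_iff by metis
  then show ?thesis using assms by (intro bdd_cubeI[of _ _ _ _ D]) auto
qed

lemma integrable_PiM_weight:
  fixes M :: "real measure"
  assumes M: "prob_space M" "sets M = sets borel" and I: "finite I"
    and [measurable]: "w \<in> borel_measurable borel"
    and w: "\<And>x. \<bar>w x\<bar> \<le> W" "\<And>x. x \<notin> {a..b} \<Longrightarrow> w x = 0"
    and [measurable]: "f \<in> borel_measurable (Pi\<^sub>M I (\<lambda>_. borel))" and f: "bdd_cube I a b f"
  shows "integrable (Pi\<^sub>M I (\<lambda>_. M)) (\<lambda>x. f x * (\<Prod>i\<in>I. w (x i)))"
proof -
  interpret M: prob_space M by fact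
  interpret P: product_prob_space "\<lambda>_. M" I ..
  have s [measurable_cong]: "sets (Pi\<^sub>M I (\<lambda>_. M)) = sets (Pi\<^sub>M I (\<lambda>_. borel))" by (intro sets_PiM_cong) (auto simp: M)
  obtain B where B: "\<And>x. (\<And>i. i \<in> I \<Longrightarrow> x i \<in> {a..b}) \<Longrightarrow> \<bar>f x\<bar> \<le> B" using f unfolding bdd_cube_def by blast
  have W0: "0 \<le> W" using w(1)[of 0] by linarith
  show ?thesis
  proof (rule P.integrable_const_bound[of _ "\<bar>B\<bar> * W ^ card I"])
    show "AE x in Pi\<^sub>M I (\<lambda>_. M). norm (f x * (\<Prod>i\<in>I. w (x i))) \<le> \<bar>B\<bar> * W ^ card I"
    proof (intro AE_I2)
      fix x
      show "norm (f x * (\<Prod>i\<in>I. w (x i))) \<le> \<bar>B\<bar> * W ^ card I"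
      proof (cases "\<forall>i\<in>I. x i \<in> {a..b}")
        case True
        have "\<bar>f x\<bar> * (\<Prod>i\<in>I. \<bar>w (x i)\<bar>) \<le> \<bar>B\<bar> * (\<Prod>i\<in>I. W)"
          using B[of x] True w(1) by (intro mult_mono prod_mono prod_nonneg) auto
        then show ?thesis by (simp add: abs_mult abs_prod)
      next
        case False
        then have "(\<Prod>i\<in>I. w (x i)) = 0" using w(2) I by (auto intro!: prod_zero)
        then show ?thesis using W0 by simp
      qed
    qed
  qed (use I in measurable)
qed

text \<open>Multiplied by the weights, the Lagrange identity carries one error term per node. As a
  function of its own node x i, this term is Q(x i) w(x i) times a polynomial of degree < card I.
  Integrating over x i first, it vanishes by orthogonality.\<close>

lemma heine_formula:
  fixes M :: "real measure" and Q :: "real poly"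
  assumes M: "prob_space M" "sets M = sets borel" and I: "finite I"
    and [measurable]: "w \<in> borel_measurable borel"
    and w: "\<And>x. \<bar>w x\<bar> \<le> W" "\<And>x. x \<notin> {a..b} \<Longrightarrow> w x = 0"
    and Q: "degree Q = card I" "lead_coeff Q = 1"
    and orth: "\<And>k. k < card I \<Longrightarrow> (LINT t|M. poly Q t * t ^ k * w t) = 0"
  shows "poly Q z * (LINT x|(Pi\<^sub>M I (\<lambda>_. M)). vdm2 I x * (\<Prod>i\<in>I. w (x i)))
    = (LINT x|(Pi\<^sub>M I (\<lambda>_. M)). (\<Prod>i\<in>I. (z - x i)) * vdm2 I x * (\<Prod>i\<in>I. w (x i)))"
proof -
  let ?P = "Pi\<^sub>M I (\<lambda>_. M)"
  interpret M: prob_space M by fact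
  interpret P: product_prob_space "\<lambda>_. M" I ..
  have s [measurable_cong]: "sets ?P = sets (Pi\<^sub>M I (\<lambda>_. borel))" by (intro sets_PiM_cong) (auto simp: M)
  have [measurable_cong]: "sets M = sets borel" by fact
  define T where "T i x = poly Q (x i) * (\<Prod>j\<in>I - {i}. (z - x j) * (x i - x j)) * vdm2 (I - {i}) x" for i x
  have Tm: "T i \<in> borel_measurable (Pi\<^sub>M I (\<lambda>_. borel))" if "i \<in> I" for i unfolding T_def using that I
    by (intro borel_measurable_times borel_measurable_prod borel_measurable_diff measurable_component_singleton
        poly_component_measurable vdm2_measurable) auto
  have Tb: "bdd_cube I a b (T i)" if "i \<in> I" for i
    unfolding T_def using that by (intro bdd_cube_mult bdd_cube_prod bdd_cube_poly bdd_cube_diff bdd_cube_diff' bdd_cube_vdm2) auto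
  have Ti: "integrable ?P (\<lambda>x. T i x * (\<Prod>i\<in>I. w (x i)))" if "i \<in> I" for i
    using Tm Tb that by (intro integrable_PiM_weight[OF M I _ w]) auto
  have T0: "(LINT x|?P. T i x * (\<Prod>i\<in>I. w (x i))) = 0" if i: "i \<in> I" for i
  proof -
    define J where "J = I - {i}"
    have J: "finite J" "i \<notin> J" "I = insert i J" using I i by (auto simp: J_def)
    have inner: "(LINT y|M. T i (x(i := y)) * (\<Prod>k\<in>insert i J. w ((x(i := y)) k))) = 0" for x :: "'a \<Rightarrow> real"
    proof -
      define p where "p = (\<Prod>j\<in>J. [:- x j, 1:])"
      have "degree p \<le> card J" unfolding p_def by (rule degree_prod_linear_le)
      then have dp: "degree p < card I" using J by simp
      define c where "c = (\<Prod>j\<in>J. z - x j) * vdm2 J x * (\<Prod>k\<in>J. w (x k))"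
      have eq: "T i (x(i := y)) * (\<Prod>k\<in>insert i J. w ((x(i := y)) k)) = c * (poly Q y * poly p y * w y)" for y
      proof -
        have "vdm2 J (x(i := y)) = vdm2 J x" by (rule vdm2_cong) (use J in auto)
        moreover have "(\<Prod>k\<in>J. w ((x(i := y)) k)) = (\<Prod>k\<in>J. w (x k))" using J by (intro prod.cong) auto
        moreover have "(\<Prod>j\<in>J. (z - (x(i := y)) j) * ((x(i := y)) i - (x(i := y)) j)) = (\<Prod>j\<in>J. (z - x j) * (y - x j))"
          using J by (intro prod.cong) auto
        ultimately show ?thesis using J(1,2) by (simp add: T_def J_def[symmetric] c_def p_def poly_prod prod.distrib)
      qed
      \<comment> \<open>Integrability in one variable is the product statement for the one-element
        index set \<open>{()}\<close>, transported along the coordinate map.\<close>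
      have iQ: "integrable M (\<lambda>y. poly Q y * y ^ k * w y)" for k
      proof -
        have "integrable (Pi\<^sub>M {()} (\<lambda>_. M)) (\<lambda>x. (poly (Q * monom 1 k) (x ())) * (\<Prod>i\<in>{()}. w (x i)))"
          by (intro integrable_PiM_weight[OF M _ _ w] bdd_cube_poly poly_component_measurable) auto
        then have "integrable (Pi\<^sub>M {()} (\<lambda>_. M)) (\<lambda>x. poly Q (x ()) * (x ()) ^ k * w (x ()))" by (simp add: poly_monom)
        moreover have "distr (Pi\<^sub>M {()} (\<lambda>_. M)) M (\<lambda>x. x ()) = M"
        proof -
          interpret product_prob_space "\<lambda>_::unit. M" "{()}" ..
          show ?thesis using PiM_component[of "()"] by simp
        qed
        ultimately show ?thesis
          by (subst (asm) integrable_distr_eq[symmetric, of "\<lambda>x. x ()" _ M "\<lambda>y. poly Q y * y ^ k * w y"])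
             (auto simp: M measurable_cong_sets[OF s M(2)])
      qed
      have "(LINT y|M. poly Q y * poly p y * w y) = (LINT y|M. (\<Sum>k\<le>degree p. coeff p k * (poly Q y * y ^ k * w y)))"
        by (intro Bochner_Integration.integral_cong refl) (simp add: poly_altdef[of p] sum_distrib_left sum_distrib_right mult_ac)
      also have "... = (\<Sum>k\<le>degree p. coeff p k * (LINT y|M. poly Q y * y ^ k * w y))"
        using iQ by (subst Bochner_Integration.integral_sum) auto
      also have "... = 0" using orth dp by (intro sum.neutral) auto
      finally show ?thesis unfolding eq by simp
    qed
    have "(LINT x|?P. T i x * (\<Prod>i\<in>I. w (x i)))
      = (LINT x|(Pi\<^sub>M J (\<lambda>_. M)). (LINT y|M. T i (x(i := y)) * (\<Prod>k\<in>insert i J. w ((x(i := y)) k))))"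
      using Ti[OF i] unfolding J(3) by (subst P.product_integral_insert[OF J(1,2)]) auto
    then show ?thesis unfolding inner by simp
  qed
  have iV: "integrable ?P (\<lambda>x. (\<Prod>i\<in>I. (z - x i)) * vdm2 I x * (\<Prod>i\<in>I. w (x i)))"
    using I by (intro integrable_PiM_weight[OF M I _ w] bdd_cube_mult bdd_cube_prod bdd_cube_diff' bdd_cube_vdm2
      borel_measurable_times borel_measurable_prod borel_measurable_diff measurable_component_singleton vdm2_measurable) auto
  have "poly Q z * (LINT x|?P. vdm2 I x * (\<Prod>i\<in>I. w (x i)))
     = (LINT x|?P. poly Q z * vdm2 I x * (\<Prod>i\<in>I. w (x i)))" by (simp add: mult.assoc)
  also have "... = (LINT x|?P. (\<Prod>i\<in>I. (z - x i)) * vdm2 I x * (\<Prod>i\<in>I. w (x i)) + (\<Sum>k\<in>I. T k x * (\<Prod>i\<in>I. w (x i))))"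
    unfolding lagrange_vdm2[OF I Q] T_def by (simp add: distrib_right sum_distrib_right)
  also have "... = (LINT x|?P. (\<Prod>i\<in>I. (z - x i)) * vdm2 I x * (\<Prod>i\<in>I. w (x i)))"
    using iV Ti T0 by (subst Bochner_Integration.integral_add) (auto simp: Bochner_Integration.integral_sum)
  finally show ?thesis .
qed

text \<open>The tangent line of exp at the mean. The right-hand side is a nonnegative integral
  because integrability of exp (g x) is not known beforehand.\<close>

lemma (in prob_space) jensen_exp:
  assumes "integrable M g"
  shows "ennreal (exp (LINT x|M. g x)) \<le> (\<integral>\<^sup>+x. ennreal (exp (g x)) \<partial>M)"
proof (cases "(\<integral>\<^sup>+x. ennreal (exp (g x)) \<partial>M) = \<infinity>")
  case False
  have [measurable]: "g \<in> borel_measurable M" using assms by auto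
  have i: "integrable M (\<lambda>x. exp (g x))" using False by (intro integrableI_nonneg) (auto simp: top.not_eq_extremum)
  define m where "m = (LINT x|M. g x)"
  have "exp m = (LINT x|M. exp m * (1 + (g x - m)))" using assms by (simp add: m_def prob_space)
  also have "... \<le> (LINT x|M. exp (g x))"
  proof (rule integral_mono)
    fix x
    have "exp m * (1 + (g x - m)) \<le> exp m * exp (g x - m)" by (intro mult_left_mono exp_ge_add_one_self) auto
    then show "exp m * (1 + (g x - m)) \<le> exp (g x)" by (simp flip: exp_add)
  qed (use assms i in auto)
  finally have "ennreal (exp m) \<le> ennreal (LINT x|M. exp (g x))" by (rule ennreal_leI)
  also have "... = (\<integral>\<^sup>+x. ennreal (exp (g x)) \<partial>M)" using i by (intro nn_integral_eq_integral[symmetric]) auto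
  finally show ?thesis by (simp add: m_def)
qed simp

text \<open>Integrating out one variable at a time, Jensen's inequality turns the factor containing the
  new variable into \<open>exp\<close> of the potential of \<open>M\<close>, which is absorbed into the external field \<open>h\<close>.\<close>

lemma vdm2_jensen_lower_bound:
  fixes M :: "real measure"
  assumes M: "prob_space M" "sets M = sets borel"
    and at: "\<And>x. emeasure M {x} = 0"
    and U: "\<And>x. integrable M (\<lambda>t. ln \<bar>t - x\<bar>)" "integrable M (\<lambda>x. LINT t|M. ln \<bar>t - x\<bar>)"
    and h: "integrable M h"
  shows "ennreal (exp (real n * (real n - 1) * (LINT x|M. LINT t|M. ln \<bar>t - x\<bar>) + real n * (LINT x|M. h x)))
    \<le> (\<integral>\<^sup>+x. ennreal (vdm2 {..<n} x * (\<Prod>i<n. exp (h (x i)))) \<partial>Pi\<^sub>M {..<n} (\<lambda>_. M))" using h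
proof (induction n arbitrary: h)
  case 0
  interpret M: prob_space M by fact
  interpret product_prob_space "\<lambda>_::nat. M" "{}" ..
  show ?case by (simp add: vdm2_def PiM_empty)
next
  case (Suc n)
  interpret M: prob_space M by fact
  interpret PS: product_sigma_finite "\<lambda>_::nat. M" ..
  have [measurable_cong]: "sets M = sets borel" by fact
  define u where "u x = (LINT t|M. ln \<bar>t - x\<bar>)" for x
  define E where "E = (LINT x|M. u x)"
  have [measurable]: "h \<in> borel_measurable borel" using Suc.prems M(2) by (auto cong: measurable_cong_sets)
  have s [measurable_cong]: "sets (Pi\<^sub>M I (\<lambda>_. M)) = sets (Pi\<^sub>M I (\<lambda>_. borel))" for I :: "nat set"
    by (intro sets_PiM_cong) (auto simp: M)
  have inner: "ennreal (exp ((\<Sum>j<n. 2 * u (x j)) + (LINT y|M. h y)))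
     \<le> (\<integral>\<^sup>+y. ennreal ((\<Prod>j<n. (y - x j)\<^sup>2) * exp (h y)) \<partial>M)" for x
  proof -
    define g where "g y = (\<Sum>j<n. 2 * ln \<bar>y - x j\<bar>) + h y" for y
    have ig: "integrable M g" unfolding g_def using U(1) Suc.prems by auto
    have "(LINT y|M. g y) = (\<Sum>j<n. 2 * u (x j)) + (LINT y|M. h y)"
      unfolding g_def u_def using U(1) Suc.prems by (simp add: Bochner_Integration.integral_sum)
    then have "ennreal (exp ((\<Sum>j<n. 2 * u (x j)) + (LINT y|M. h y))) \<le> (\<integral>\<^sup>+y. ennreal (exp (g y)) \<partial>M)"
      using M.jensen_exp[OF ig] by simp
    also have "... \<le> (\<integral>\<^sup>+y. ennreal ((\<Prod>j<n. (y - x j)\<^sup>2) * exp (h y)) \<partial>M)"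
    proof (rule nn_integral_mono_AE)
      have "AE y in M. y \<notin> (\<Union>j<n. {x j})"
      proof (rule AE_not_in)
        show "(\<Union>j<n. {x j}) \<in> null_sets M" using at M by (intro null_sets_UN') auto
      qed
      then show "AE y in M. ennreal (exp (g y)) \<le> ennreal ((\<Prod>j<n. (y - x j)\<^sup>2) * exp (h y))"
      proof eventually_elim
        case (elim y)
        have "exp (2 * ln \<bar>y - x j\<bar>) = (y - x j)\<^sup>2" if "j < n" for j
        proof -
          have "0 < \<bar>y - x j\<bar>" using elim that by auto
          then have "exp (2 * ln \<bar>y - x j\<bar>) = \<bar>y - x j\<bar> * \<bar>y - x j\<bar>" by (simp add: exp_double power2_eq_square)
          then show ?thesis by (simp add: power2_eq_square abs_mult[symmetric])
        qed
        then show ?case by (simp add: g_def exp_add exp_sum)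
      qed
    qed
    finally show ?thesis .
  qed
  define h' where "h' x = h x + 2 * u x" for x
  have um [measurable]: "u \<in> borel_measurable borel" using U(2) M(2) unfolding u_def by (auto cong: measurable_cong_sets)
  have ih': "integrable M h'" unfolding h'_def using Suc.prems U(2) by (auto simp: u_def)
  have inth': "(LINT x|M. h' x) = (LINT x|M. h x) + 2 * E"
    unfolding h'_def E_def using Suc.prems U(2) by (simp add: u_def[symmetric])
  have meas: "(\<lambda>x. ennreal (vdm2 {..<Suc n} x * (\<Prod>i<Suc n. exp (h (x i))))) \<in> borel_measurable (Pi\<^sub>M (insert n {..<n}) (\<lambda>_. M))"
    unfolding lessThan_Suc[symmetric] by (intro measurable_compose[OF vdm2_field_measurable measurable_ennreal] M) auto
  have "ennreal (exp (real (Suc n) * (real (Suc n) - 1) * E + real (Suc n) * (LINT x|M. h x)))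
    = ennreal (exp (real n * (real n - 1) * E + real n * (LINT x|M. h' x))) * ennreal (exp (LINT x|M. h x))"
    by (simp add: inth' ennreal_mult[symmetric] exp_add[symmetric] algebra_simps)
  also have "... \<le> (\<integral>\<^sup>+x. ennreal (vdm2 {..<n} x * (\<Prod>i<n. exp (h' (x i)))) \<partial>Pi\<^sub>M {..<n} (\<lambda>_. M)) * ennreal (exp (LINT x|M. h x))"
    using Suc.IH[OF ih'] unfolding u_def[symmetric] E_def[symmetric] by (intro mult_right_mono) auto
  also have "... = (\<integral>\<^sup>+x. ennreal (vdm2 {..<n} x * (\<Prod>i<n. exp (h' (x i)))) * ennreal (exp (LINT x|M. h x)) \<partial>Pi\<^sub>M {..<n} (\<lambda>_. M))"
    by (intro nn_integral_multc[symmetric] measurable_compose[OF vdm2_field_measurable measurable_ennreal] M)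
       (auto simp: h'_def)
  also have "... \<le> (\<integral>\<^sup>+x. (\<integral>\<^sup>+y. ennreal (vdm2 {..<Suc n} (x(n := y)) * (\<Prod>i<Suc n. exp (h ((x(n := y)) i)))) \<partial>M) \<partial>Pi\<^sub>M {..<n} (\<lambda>_. M))"
  proof (rule nn_integral_mono)
    fix x :: "nat \<Rightarrow> real"
    define c where "c = vdm2 {..<n} x * (\<Prod>i<n. exp (h (x i)))"
    have c0: "0 \<le> c" unfolding c_def by (intro mult_nonneg_nonneg vdm2_nonneg prod_nonneg) auto
    have eq: "vdm2 {..<Suc n} (x(n := y)) * (\<Prod>i<Suc n. exp (h ((x(n := y)) i))) = c * ((\<Prod>j<n. (y - x j)\<^sup>2) * exp (h y))" for y
    proof -
      have "vdm2 {..<n} (x(n := y)) = vdm2 {..<n} x" by (rule vdm2_cong) auto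
      moreover have "(\<Prod>j<n. (y - (x(n := y)) j)\<^sup>2) = (\<Prod>j<n. (y - x j)\<^sup>2)" by (intro prod.cong) auto
      moreover have "(\<Prod>i<n. exp (h ((x(n := y)) i))) = (\<Prod>i<n. exp (h (x i)))" by (intro prod.cong) auto
      ultimately show ?thesis by (simp add: lessThan_Suc vdm2_insert c_def)
    qed
    have "ennreal (vdm2 {..<n} x * (\<Prod>i<n. exp (h' (x i)))) * ennreal (exp (LINT x|M. h x))
      = ennreal c * ennreal (exp ((\<Sum>j<n. 2 * u (x j)) + (LINT y|M. h y)))"
      using c0 by (simp add: c_def h'_def exp_add exp_sum prod.distrib vdm2_nonneg prod_nonneg ennreal_mult[symmetric] mult_ac)
    also have "... \<le> ennreal c * (\<integral>\<^sup>+y. ennreal ((\<Prod>j<n. (y - x j)\<^sup>2) * exp (h y)) \<partial>M)"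
      using inner[of x] by (intro mult_left_mono) auto
    also have "... = (\<integral>\<^sup>+y. ennreal c * ennreal ((\<Prod>j<n. (y - x j)\<^sup>2) * exp (h y)) \<partial>M)"
      by (intro nn_integral_cmult[symmetric]) measurable
    also have "... = (\<integral>\<^sup>+y. ennreal (vdm2 {..<Suc n} (x(n := y)) * (\<Prod>i<Suc n. exp (h ((x(n := y)) i)))) \<partial>M)"
      unfolding eq using c0 by (intro nn_integral_cong) (simp add: ennreal_mult prod_nonneg)
    finally show "ennreal (vdm2 {..<n} x * (\<Prod>i<n. exp (h' (x i)))) * ennreal (exp (LINT x|M. h x))
      \<le> (\<integral>\<^sup>+y. ennreal (vdm2 {..<Suc n} (x(n := y)) * (\<Prod>i<Suc n. exp (h ((x(n := y)) i)))) \<partial>M)" .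
  qed
  also have "... = (\<integral>\<^sup>+x. ennreal (vdm2 {..<Suc n} x * (\<Prod>i<Suc n. exp (h (x i)))) \<partial>Pi\<^sub>M {..<Suc n} (\<lambda>_. M))"
    using PS.product_nn_integral_insert[OF _ _ meas] by (simp add: lessThan_Suc)
  finally show ?case unfolding E_def u_def .
qed

text \<open>Serves to pass from a dominated measure to \<sigma>: the price \<open>C ^ n\<close> is
  invisible at the scale exp (n^2) of the energies.\<close>

lemma nn_integral_PiM_mono_measure:
  fixes M N :: "real measure"
  assumes M: "prob_space M" "sets M = sets borel" and N: "prob_space N" "sets N = sets borel"
    and le: "\<And>A. A \<in> sets borel \<Longrightarrow> emeasure N A \<le> C * emeasure M A"
  shows "f \<in> borel_measurable (Pi\<^sub>M {..<n} (\<lambda>_. borel)) \<Longrightarrow>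
    (\<integral>\<^sup>+x. f x \<partial>Pi\<^sub>M {..<n::nat} (\<lambda>_. N)) \<le> C ^ n * (\<integral>\<^sup>+x. f x \<partial>Pi\<^sub>M {..<n} (\<lambda>_. M))"
proof (induction n arbitrary: f)
  case 0
  show ?case by (simp add: PiM_empty)
next
  case (Suc n)
  interpret M: prob_space M by fact
  interpret N: prob_space N by fact
  interpret PM: product_sigma_finite "\<lambda>_::nat. M" ..
  interpret PN: product_sigma_finite "\<lambda>_::nat. N" ..
  have [measurable_cong]: "sets M = sets borel" "sets N = sets borel" by fact+
  have s [measurable_cong]: "sets (Pi\<^sub>M I (\<lambda>_. M)) = sets (Pi\<^sub>M I (\<lambda>_. borel))"
    "sets (Pi\<^sub>M I (\<lambda>_. N)) = sets (Pi\<^sub>M I (\<lambda>_. borel))" for I :: "nat set" by (intro sets_PiM_cong; simp add: M N)+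
  have [measurable]: "f \<in> borel_measurable (Pi\<^sub>M (insert n {..<n}) (\<lambda>_. borel))" using Suc.prems by (simp add: lessThan_Suc)
  have fm: "f \<in> borel_measurable (Pi\<^sub>M (insert n {..<n}) (\<lambda>_. M))" "f \<in> borel_measurable (Pi\<^sub>M (insert n {..<n}) (\<lambda>_. N))"
    by measurable
  have upd: "(\<lambda>(x, y). f (x(n := y))) \<in> borel_measurable (Pi\<^sub>M {..<n} (\<lambda>_. borel) \<Otimes>\<^sub>M M)" by measurable
  have "N \<le> scale_measure C M" using le M(2) N(2) by (subst le_measure) auto
  then have single: "(\<integral>\<^sup>+y. g y \<partial>N) \<le> C * (\<integral>\<^sup>+y. g y \<partial>M)" if "g \<in> borel_measurable borel" for g
    using nn_integral_mono_measure[of N "scale_measure C M" g] nn_integral_scale_measure[of g M C] that M(2) N(2)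
    by (simp cong: measurable_cong_sets)
  have "(\<integral>\<^sup>+x. f x \<partial>Pi\<^sub>M {..<Suc n} (\<lambda>_. N)) = (\<integral>\<^sup>+x. (\<integral>\<^sup>+y. f (x(n := y)) \<partial>N) \<partial>Pi\<^sub>M {..<n} (\<lambda>_. N))"
    using PN.product_nn_integral_insert[OF _ _ fm(2)] by (simp add: lessThan_Suc)
  also have "... \<le> (\<integral>\<^sup>+x. C * (\<integral>\<^sup>+y. f (x(n := y)) \<partial>M) \<partial>Pi\<^sub>M {..<n} (\<lambda>_. N))"
  proof (rule nn_integral_mono, rule single)
    fix x assume "x \<in> space (Pi\<^sub>M {..<n} (\<lambda>_. N))"
    then have "x \<in> space (Pi\<^sub>M {..<n} (\<lambda>_. borel :: real measure))" by (simp add: space_PiM sets_eq_imp_space_eq[OF N(2)])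
    then show "(\<lambda>y. f (x(n := y))) \<in> borel_measurable borel" by measurable
  qed
  also have "... \<le> C ^ n * (\<integral>\<^sup>+x. C * (\<integral>\<^sup>+y. f (x(n := y)) \<partial>M) \<partial>Pi\<^sub>M {..<n} (\<lambda>_. M))" by (intro Suc.IH) measurable
  also have "(\<integral>\<^sup>+x. C * (\<integral>\<^sup>+y. f (x(n := y)) \<partial>M) \<partial>Pi\<^sub>M {..<n} (\<lambda>_. M)) = C * (\<integral>\<^sup>+x. (\<integral>\<^sup>+y. f (x(n := y)) \<partial>M) \<partial>Pi\<^sub>M {..<n} (\<lambda>_. M))"
    by (intro nn_integral_cmult) measurable
  also have "(\<integral>\<^sup>+x. (\<integral>\<^sup>+y. f (x(n := y)) \<partial>M) \<partial>Pi\<^sub>M {..<n} (\<lambda>_. M)) = (\<integral>\<^sup>+x. f x \<partial>Pi\<^sub>M {..<Suc n} (\<lambda>_. M))"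
    using PM.product_nn_integral_insert[OF _ _ fm(1)] by (simp add: lessThan_Suc)
  finally show ?case by (simp add: mult_ac)
qed

subsection \<open>Logarithmic energy\<close>

definition psupp :: "real set \<Rightarrow> real measure \<Rightarrow> bool" where
  "psupp S \<mu> \<longleftrightarrow> prob_space \<mu> \<and> sets \<mu> = sets borel \<and> (AE x in \<mu>. x \<in> S)"

lemma psuppD:
  assumes "psupp S \<mu>"
  shows "prob_space \<mu>" "sets \<mu> = sets borel" "space \<mu> = UNIV" "finite_measure \<mu>" "sigma_finite_measure \<mu>"
    "AE x in \<mu>. x \<in> S" "real_distribution \<mu>"
proof -
  show p: "prob_space \<mu>" and s: "sets \<mu> = sets borel" and "AE x in \<mu>. x \<in> S" using assms by (auto simp: psupp_def)
  then interpret prob_space \<mu> by simp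
  show sp: "space \<mu> = UNIV" using sets_eq_imp_space_eq[OF s] by simp
  show "finite_measure \<mu>" "sigma_finite_measure \<mu>" by unfold_locales
  show "real_distribution \<mu>" using s sp by unfold_locales auto
qed

lemma psupp_mono: "psupp S \<mu> \<Longrightarrow> S \<subseteq> T \<Longrightarrow> psupp T \<mu>"
  unfolding psupp_def by (auto elim: eventually_mono)

text \<open>A positive definite model of the logarithmic kernel: the energy is an \<open>L\<^sup>2\<close> norm of the masses of
  intervals, those of length \<open>L\<close> being weighted with \<open>1 / L\<^sup>2\<close>. At distances up to \<open>R\<close> the resulting
  kernel is \<open>ln (R / dist) + 1 / 2\<close>; the parameter \<open>h\<close> cuts off the singularity.\<close>

definition ewt :: "real \<Rightarrow> real \<Rightarrow> real \<Rightarrow> real" where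
  "ewt h R L = (if h < L \<and> 0 < L \<and> L < 2 * R then (if L < R then 1 / L\<^sup>2 else 1 / R\<^sup>2) else 0)"

lemma ewt_measurable [measurable]: "ewt h R \<in> borel_measurable borel"
  unfolding ewt_def by measurable

lemma ewt_nonneg: "0 \<le> ewt h R L"
  by (simp add: ewt_def)

text \<open>A point (L, y) stands for the interval [y, y + L). The density depends on L alone, which
  makes the measure invariant under translations of y.\<close>

definition emeas :: "real \<Rightarrow> real \<Rightarrow> (real \<times> real) measure" where
  "emeas h R = density lborel (\<lambda>p. ennreal (ewt h R (fst p)))"

lemma sets_emeas [simp, measurable_cong]: "sets (emeas h R) = sets borel"
  by (simp add: emeas_def)

lemma space_emeas [simp]: "space (emeas h R) = UNIV"
  by (simp add: emeas_def)

lemma fst_snd_borel [measurable]: "fst \<in> borel_measurable (borel :: (real \<times> real) measure)"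
    "snd \<in> borel_measurable (borel :: (real \<times> real) measure)"
  by (auto intro!: borel_measurable_continuous_onI continuous_intros)

lemma nn_integral_emeas:
  assumes [measurable]: "f \<in> borel_measurable borel"
  shows "(\<integral>\<^sup>+p. f p \<partial>emeas h R) = (\<integral>\<^sup>+L. \<integral>\<^sup>+y. ennreal (ewt h R L) * f (L, y) \<partial>lborel \<partial>lborel)"
proof -
  have "(\<integral>\<^sup>+p. f p \<partial>emeas h R) = (\<integral>\<^sup>+p. ennreal (ewt h R (fst p)) * f p \<partial>lborel)"
    unfolding emeas_def by (intro nn_integral_density) measurable
  also have "... = (\<integral>\<^sup>+p. ennreal (ewt h R (fst p)) * f p \<partial>(lborel \<Otimes>\<^sub>M lborel))" by (simp add: lborel_prod)
  also have "... = (\<integral>\<^sup>+L. \<integral>\<^sup>+y. ennreal (ewt h R L) * f (L, y) \<partial>lborel \<partial>lborel)"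
  proof -
    have "(\<lambda>p. ennreal (ewt h R (fst p)) * f p) \<in> borel_measurable borel" by measurable
    then have "(\<lambda>p. ennreal (ewt h R (fst p)) * f p) \<in> borel_measurable (lborel \<Otimes>\<^sub>M lborel)" by (simp add: lborel_prod)
    from lborel.nn_integral_fst[OF this] show ?thesis by simp
  qed
  finally show ?thesis .
qed

definition inseg :: "real \<times> real \<Rightarrow> real \<Rightarrow> bool" where
  "inseg p x \<longleftrightarrow> snd p \<le> x \<and> x < snd p + fst p"

definition seg :: "real measure \<Rightarrow> real \<times> real \<Rightarrow> real" where
  "seg \<mu> p = measure \<mu> {snd p..<snd p + fst p}"

definition kern :: "real \<Rightarrow> real \<Rightarrow> real \<Rightarrow> real \<Rightarrow> ennreal" where
  "kern h R x t = (\<integral>\<^sup>+p. of_bool (inseg p x \<and> inseg p t) \<partial>emeas h R)"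

text \<open>Defined by masses of intervals rather than by the kernel, so that
  \<open>een h R \<mu> \<mu>\<close> is visibly a squared norm; values in \<open>ennreal\<close>
  admit measures of infinite energy.\<close>

definition een :: "real \<Rightarrow> real \<Rightarrow> real measure \<Rightarrow> real measure \<Rightarrow> ennreal" where
  "een h R \<mu> \<nu> = (\<integral>\<^sup>+p. ennreal (seg \<mu> p * seg \<nu> p) \<partial>emeas h R)"

lemma inseg_measurable [measurable]:
  assumes [measurable]: "f \<in> M \<rightarrow>\<^sub>M borel" "g \<in> M \<rightarrow>\<^sub>M (borel :: real measure)"
  shows "Measurable.pred M (\<lambda>x. inseg (f x) (g x))"
proof -
  have "(\<lambda>x. fst (f x)) \<in> M \<rightarrow>\<^sub>M borel" "(\<lambda>x. snd (f x)) \<in> M \<rightarrow>\<^sub>M borel"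
    using measurable_compose[OF assms(1) fst_snd_borel(1)] measurable_compose[OF assms(1) fst_snd_borel(2)] .
  note [measurable] = this
  show ?thesis unfolding inseg_def by measurable
qed

lemma seg_nonneg: "0 \<le> seg \<mu> p"
  by (simp add: seg_def)

lemma seg_le_1: "prob_space \<mu> \<Longrightarrow> seg \<mu> p \<le> 1"
  by (simp add: seg_def prob_space.prob_le_1)

lemma nn_integral_inseg:
  assumes "finite_measure \<mu>" "sets \<mu> = sets borel"
  shows "(\<integral>\<^sup>+x. of_bool (inseg p x) \<partial>\<mu>) = ennreal (seg \<mu> p)"
proof -
  interpret finite_measure \<mu> by fact
  have "(\<integral>\<^sup>+x. of_bool (inseg p x) \<partial>\<mu>) = (\<integral>\<^sup>+x. indicator {snd p..<snd p + fst p} x \<partial>\<mu>)"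
    by (intro nn_integral_cong) (auto simp: inseg_def indicator_def)
  also have "... = emeasure \<mu> {snd p..<snd p + fst p}" using assms by (intro nn_integral_indicator) auto
  finally show ?thesis by (simp add: seg_def emeasure_eq_measure)
qed

lemma seg_measurable [measurable]:
  assumes "finite_measure \<mu>" "sets \<mu> = sets borel"
  shows "seg \<mu> \<in> borel_measurable borel"
proof -
  interpret finite_measure \<mu> by fact
  note [measurable_cong] = assms(2)
  have "(\<lambda>p. enn2real (\<integral>\<^sup>+x. of_bool (inseg p x) \<partial>\<mu>)) \<in> borel_measurable (borel :: (real \<times> real) measure)" by measurable
  then show ?thesis unfolding nn_integral_inseg[OF assms] by (simp add: seg_nonneg)
qed

lemma kern_measurable [measurable]:
  "(\<lambda>z. kern h R (fst z) (snd z)) \<in> borel_measurable (borel \<Otimes>\<^sub>M borel)"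
proof -
  interpret sigma_finite_measure "lborel :: (real \<times> real) measure" by (rule lborel.sigma_finite_measure_axioms)
  have "kern h R x t = (\<integral>\<^sup>+p. ennreal (ewt h R (fst p)) * of_bool (inseg p x \<and> inseg p t) \<partial>lborel)" for x t
    unfolding kern_def emeas_def by (intro nn_integral_density) measurable
  then show ?thesis by simp
qed

text \<open>Tonelli: the product of two masses of an interval is the double integral of the
  indicator that the interval contains both points.\<close>

lemma een_kern:
  assumes \<mu>: "finite_measure \<mu>" "sets \<mu> = sets borel" and \<nu>: "finite_measure \<nu>" "sets \<nu> = sets borel"
  shows "een h R \<mu> \<nu> = (\<integral>\<^sup>+x. \<integral>\<^sup>+t. kern h R x t \<partial>\<nu> \<partial>\<mu>)"
proof -
  interpret m: finite_measure \<mu> by fact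
  interpret n: finite_measure \<nu> by fact
  note [measurable_cong] = \<mu>(2) \<nu>(2)
  note [measurable] = seg_measurable[OF \<mu>] seg_measurable[OF \<nu>]
  interpret P1: pair_sigma_finite \<mu> "lborel :: (real \<times> real) measure" ..
  interpret P2: pair_sigma_finite \<nu> "lborel :: (real \<times> real) measure" ..
  let ?w = "\<lambda>p::real\<times>real. ennreal (ewt h R (fst p))"
  have "een h R \<mu> \<nu> = (\<integral>\<^sup>+p. ?w p * ennreal (seg \<mu> p * seg \<nu> p) \<partial>lborel)"
    unfolding een_def emeas_def by (intro nn_integral_density) measurable
  also have "... = (\<integral>\<^sup>+p. (\<integral>\<^sup>+x. (\<integral>\<^sup>+t. ?w p * of_bool (inseg p x \<and> inseg p t) \<partial>\<nu>) \<partial>\<mu>) \<partial>lborel)"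
  proof (intro nn_integral_cong)
    fix p :: "real \<times> real"
    have "(\<integral>\<^sup>+x. (\<integral>\<^sup>+t. ?w p * of_bool (inseg p x \<and> inseg p t) \<partial>\<nu>) \<partial>\<mu>)
      = (\<integral>\<^sup>+x. (\<integral>\<^sup>+t. (?w p * of_bool (inseg p x)) * of_bool (inseg p t) \<partial>\<nu>) \<partial>\<mu>)" by (intro nn_integral_cong) auto
    also have "... = (\<integral>\<^sup>+x. (?w p * of_bool (inseg p x)) * ennreal (seg \<nu> p) \<partial>\<mu>)"
      by (subst nn_integral_cmult) (auto simp: nn_integral_inseg[OF \<nu>])
    also have "... = (\<integral>\<^sup>+x. (?w p * ennreal (seg \<nu> p)) * of_bool (inseg p x) \<partial>\<mu>)"
      by (intro nn_integral_cong) (simp add: mult_ac)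
    also have "... = ?w p * ennreal (seg \<nu> p) * ennreal (seg \<mu> p)"
      by (subst nn_integral_cmult) (auto simp: nn_integral_inseg[OF \<mu>])
    finally show "?w p * ennreal (seg \<mu> p * seg \<nu> p) = (\<integral>\<^sup>+x. (\<integral>\<^sup>+t. ?w p * of_bool (inseg p x \<and> inseg p t) \<partial>\<nu>) \<partial>\<mu>)"
      by (simp add: ennreal_mult seg_nonneg mult_ac)
  qed
  also have "... = (\<integral>\<^sup>+x. (\<integral>\<^sup>+p. (\<integral>\<^sup>+t. ?w p * of_bool (inseg p x \<and> inseg p t) \<partial>\<nu>) \<partial>lborel) \<partial>\<mu>)"
    by (rule P1.Fubini') measurable
  also have "... = (\<integral>\<^sup>+x. (\<integral>\<^sup>+t. (\<integral>\<^sup>+p. ?w p * of_bool (inseg p x \<and> inseg p t) \<partial>lborel) \<partial>\<nu>) \<partial>\<mu>)"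
    by (intro nn_integral_cong P2.Fubini') measurable
  also have "... = (\<integral>\<^sup>+x. \<integral>\<^sup>+t. kern h R x t \<partial>\<nu> \<partial>\<mu>)"
    unfolding kern_def emeas_def by (intro nn_integral_cong nn_integral_density[symmetric]) measurable
  finally show ?thesis .
qed

text \<open>The interval [y, y + L) contains both points iff y lies in (max x t - L, min x t], a set
  of length L - |x - t|.\<close>

lemma kern_eq: "kern h R x t = (\<integral>\<^sup>+L. ennreal (ewt h R L * max 0 (L - \<bar>x - t\<bar>)) \<partial>lborel)"
proof -
  have "kern h R x t = (\<integral>\<^sup>+L. \<integral>\<^sup>+y. ennreal (ewt h R L) * of_bool (inseg (L, y) x \<and> inseg (L, y) t) \<partial>lborel \<partial>lborel)"
    unfolding kern_def by (intro nn_integral_emeas) measurable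
  also have "... = (\<integral>\<^sup>+L. ennreal (ewt h R L * max 0 (L - \<bar>x - t\<bar>)) \<partial>lborel)"
  proof (intro nn_integral_cong)
    fix L :: real
    have "(\<integral>\<^sup>+y. ennreal (ewt h R L) * of_bool (inseg (L, y) x \<and> inseg (L, y) t) \<partial>lborel)
      = (\<integral>\<^sup>+y. ennreal (ewt h R L) * indicator {max x t - L<..min x t} y \<partial>lborel)"
      by (intro nn_integral_cong) (auto simp: inseg_def indicator_def)
    also have "... = ennreal (ewt h R L) * emeasure lborel {max x t - L<..min x t}"
      by (rule nn_integral_cmult_indicator) simp
    also have "emeasure lborel {max x t - L<..min x t} = ennreal (max 0 (L - \<bar>x - t\<bar>))"
    proof (cases "\<bar>x - t\<bar> \<le> L")
      case True
      then have "max x t - L \<le> min x t" "min x t - (max x t - L) = max 0 (L - \<bar>x - t\<bar>)" by (auto simp: max_def min_def)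
      then show ?thesis by (simp only: emeasure_lborel_Ioc)
    next
      case False
      then have "{max x t - L<..min x t} = {}" "max 0 (L - \<bar>x - t\<bar>) = 0" by (auto simp: max_def min_def)
      then show ?thesis by (simp only: emeasure_empty ennreal_0)
    qed
    finally show "(\<integral>\<^sup>+y. ennreal (ewt h R L) * of_bool (inseg (L, y) x \<and> inseg (L, y) t) \<partial>lborel)
      = ennreal (ewt h R L * max 0 (L - \<bar>x - t\<bar>))" by (simp add: ennreal_mult ewt_nonneg)
  qed
  finally show ?thesis .
qed

lemma kern_commute: "kern h R x t = kern h R t x"
  unfolding kern_eq by (simp add: abs_minus_commute)

lemma kern_mono_dist: "\<bar>x - t\<bar> \<le> \<bar>y - s\<bar> \<Longrightarrow> kern h R y s \<le> kern h R x t"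
  unfolding kern_eq by (intro nn_integral_mono ennreal_leI mult_left_mono) (auto simp: ewt_nonneg)

lemma kern_mono_trunc: "0 \<le> h \<Longrightarrow> kern h R x t \<le> kern 0 R x t"
  unfolding kern_eq by (intro nn_integral_mono ennreal_leI mult_right_mono) (auto simp: ewt_def)

text \<open>The weight is at most 1 / h^2 + 1 / R^2, the second factor of the integrand at most 2 R,
  and L runs through an interval of length at most 2 R.\<close>

lemma kern_trunc_bounded:
  assumes "0 < h" "0 < R"
  shows "kern h R x t \<le> ennreal (4 * R\<^sup>2 * (1 / h\<^sup>2 + 1 / R\<^sup>2))"
proof -
  have "kern h R x t \<le> (\<integral>\<^sup>+L. ennreal ((1 / h\<^sup>2 + 1 / R\<^sup>2) * (2 * R)) * indicator {0..2 * R} L \<partial>lborel)" unfolding kern_eq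
  proof (intro nn_integral_mono)
    fix L :: real
    show "ennreal (ewt h R L * max 0 (L - \<bar>x - t\<bar>)) \<le> ennreal ((1 / h\<^sup>2 + 1 / R\<^sup>2) * (2 * R)) * indicator {0..2 * R} L"
    proof (cases "h < L \<and> L < 2 * R")
      case True
      have "h\<^sup>2 \<le> L\<^sup>2" using True assms by (intro power_mono) auto
      then have "1 / L\<^sup>2 \<le> 1 / h\<^sup>2" by (intro divide_left_mono) (use True assms in auto)
      then have "ewt h R L \<le> 1 / h\<^sup>2 + 1 / R\<^sup>2" using True assms by (auto simp: ewt_def add_increasing2 add_increasing)
      moreover have "max 0 (L - \<bar>x - t\<bar>) \<le> 2 * R" using True assms by auto
      ultimately have "ewt h R L * max 0 (L - \<bar>x - t\<bar>) \<le> (1 / h\<^sup>2 + 1 / R\<^sup>2) * (2 * R)" by (intro mult_mono) auto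
      then show ?thesis using True assms by (simp add: ennreal_leI)
    qed (auto simp: ewt_def)
  qed
  also have "... = ennreal ((1 / h\<^sup>2 + 1 / R\<^sup>2) * (2 * R)) * ennreal (2 * R)"
    using assms by (subst nn_integral_cmult_indicator) auto
  also have "... = ennreal (4 * R\<^sup>2 * (1 / h\<^sup>2 + 1 / R\<^sup>2))"
    using assms by (subst ennreal_mult[symmetric]) (auto simp: power2_eq_square mult_ac)
  finally show ?thesis .
qed

text \<open>With r = |x - t|, the lengths in [r, R] contribute ln (R / r) + r / R - 1 and the
  lengths in [R, 2 R] contribute 3 / 2 - r / R. The constant weight 1 / R^2 on the second range is
  chosen so that r / R cancels; the sum leaves the constant 1 / 2.\<close>

lemma kern_log:
  assumes "0 < \<bar>x - t\<bar>" "\<bar>x - t\<bar> \<le> R"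
  shows "kern 0 R x t = ennreal (ln (R / \<bar>x - t\<bar>) + 1 / 2)"
proof -
  define r where "r = \<bar>x - t\<bar>"
  have r: "0 < r" "r \<le> R" using assms by (auto simp: r_def)
  have "kern 0 R x t = (\<integral>\<^sup>+L. ennreal ((L - r) / L\<^sup>2) * indicator {r..R} L + ennreal ((L - r) / R\<^sup>2) * indicator {R..2 * R} L \<partial>lborel)"
    unfolding kern_eq r_def[symmetric]
  proof (intro nn_integral_cong_AE)
    have "AE L in lborel. L \<noteq> R \<and> L \<noteq> 2 * R" using AE_lborel_singleton[of R] AE_lborel_singleton[of "2 * R"] by eventually_elim simp
    then show "AE L in lborel. ennreal (ewt 0 R L * max 0 (L - r)) =
        ennreal ((L - r) / L\<^sup>2) * indicator {r..R} L + ennreal ((L - r) / R\<^sup>2) * indicator {R..2 * R} L"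
      by eventually_elim (use r in \<open>auto simp: ewt_def indicator_def max_def\<close>)
  qed
  also have "... = (\<integral>\<^sup>+L. ennreal ((L - r) / L\<^sup>2) * indicator {r..R} L \<partial>lborel) + (\<integral>\<^sup>+L. ennreal ((L - r) / R\<^sup>2) * indicator {R..2 * R} L \<partial>lborel)"
    by (intro nn_integral_add) measurable
  also have "(\<integral>\<^sup>+L. ennreal ((L - r) / L\<^sup>2) * indicator {r..R} L \<partial>lborel) = ennreal ((ln R + r / R) - (ln r + r / r))"
  proof (rule nn_integral_FTC_Icc)
    fix L assume L: "L \<in> {r..R}"
    then have "0 < L" using r by auto
    then show "((\<lambda>L. ln L + r / L) has_real_derivative (L - r) / L\<^sup>2) (at L)"
      by (auto intro!: derivative_eq_intros simp: field_simps power2_eq_square)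
    show "0 \<le> (L - r) / L\<^sup>2" using L by auto
  qed (use r in auto)
  also have "(\<integral>\<^sup>+L. ennreal ((L - r) / R\<^sup>2) * indicator {R..2 * R} L \<partial>lborel)
     = ennreal (((2 * R)\<^sup>2 / 2 - r * (2 * R)) / R\<^sup>2 - (R\<^sup>2 / 2 - r * R) / R\<^sup>2)"
  proof (rule nn_integral_FTC_Icc)
    fix L assume L: "L \<in> {R..2 * R}"
    show "((\<lambda>L. (L\<^sup>2 / 2 - r * L) / R\<^sup>2) has_real_derivative (L - r) / R\<^sup>2) (at L)"
      by (rule DERIV_cdivide) (auto intro!: derivative_eq_intros)
    show "0 \<le> (L - r) / R\<^sup>2" using L r by auto
  qed (use r in auto)
  also have "((2 * R)\<^sup>2 / 2 - r * (2 * R)) / R\<^sup>2 - (R\<^sup>2 / 2 - r * R) / R\<^sup>2 = 3 / 2 - r / R"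
    using r by (simp add: field_simps power2_eq_square)
  also have "ennreal ((ln R + r / R) - (ln r + r / r)) + ennreal (3 / 2 - r / R) = ennreal ((ln R + r / R) - (ln r + r / r) + (3 / 2 - r / R))"
  proof (rule ennreal_plus[symmetric])
    have "ln (r / R) \<le> r / R - 1" using r by (intro ln_le_minus_one) auto
    then show "0 \<le> (ln R + r / R) - (ln r + r / r)" using r by (simp add: ln_div)
    have "r / R \<le> 1" using r by simp
    then show "0 \<le> 3 / 2 - r / R" by linarith
  qed
  also have "(ln R + r / R) - (ln r + r / r) + (3 / 2 - r / R) = ln (R / r) + 1 / 2" using r by (simp add: ln_div)
  finally show ?thesis by (simp add: r_def)
qed

text \<open>The kernel decreases with the distance, so its diagonal value dominates ln (R / r) for
  every small r.\<close>

lemma kern_diag: "0 < R \<Longrightarrow> kern 0 R x x = \<infinity>"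
proof (rule ccontr)
  assume R: "0 < R" and "kern 0 R x x \<noteq> \<infinity>"
  then obtain c where c: "kern 0 R x x = ennreal c" "0 \<le> c" by (cases "kern 0 R x x") auto
  define r where "r = R / exp (c + 1)"
  have r: "0 < r" "r \<le> R" using R c by (auto simp: r_def divide_le_eq)
  have "kern 0 R x (x + r) \<le> kern 0 R x x" by (rule kern_mono_dist) auto
  also have "kern 0 R x (x + r) = ennreal (ln (R / r) + 1 / 2)" using r by (subst kern_log) auto
  also have "ln (R / r) = c + 1" using R by (simp add: r_def)
  finally show False using c by (simp add: ennreal_le_iff)
qed

abbreviation fin_en :: "real \<Rightarrow> real measure \<Rightarrow> bool" where
  "fin_en R \<mu> \<equiv> een 0 R \<mu> \<mu> < \<infinity>"

abbreviation ip :: "real \<Rightarrow> real measure \<Rightarrow> real measure \<Rightarrow> real" where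
  "ip R \<mu> \<nu> \<equiv> (LINT p|(emeas 0 R). seg \<mu> p * seg \<nu> p)"

lemma integrable_seg_prod:
  assumes \<mu>: "psupp S \<mu>" "fin_en R \<mu>" and \<nu>: "psupp T \<nu>" "fin_en R \<nu>"
  shows "integrable (emeas 0 R) (\<lambda>p. seg \<mu> p * seg \<nu> p)"
proof -
  note [measurable] = seg_measurable[OF psuppD(4,2)[OF \<mu>(1)]] seg_measurable[OF psuppD(4,2)[OF \<nu>(1)]]
  have i: "integrable (emeas 0 R) (\<lambda>p. seg \<mu> p * seg \<mu> p)" "integrable (emeas 0 R) (\<lambda>p. seg \<nu> p * seg \<nu> p)"
    using \<mu>(2) \<nu>(2) unfolding een_def by (auto intro!: integrableI_nonneg simp: seg_nonneg)
  show ?thesis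
  proof (rule Bochner_Integration.integrable_bound[OF Bochner_Integration.integrable_add[OF i]])
    show "AE p in emeas 0 R. norm (seg \<mu> p * seg \<nu> p) \<le> norm (seg \<mu> p * seg \<mu> p + seg \<nu> p * seg \<nu> p)"
    proof (intro AE_I2)
      fix p
      have "0 \<le> (seg \<mu> p - seg \<nu> p)\<^sup>2" by simp
      then have "2 * (seg \<mu> p * seg \<nu> p) \<le> seg \<mu> p * seg \<mu> p + seg \<nu> p * seg \<nu> p"
        by (simp add: power2_eq_square algebra_simps)
      moreover have "0 \<le> seg \<mu> p * seg \<nu> p" by (simp add: seg_nonneg)
      ultimately show "norm (seg \<mu> p * seg \<nu> p) \<le> norm (seg \<mu> p * seg \<mu> p + seg \<nu> p * seg \<nu> p)" by simp
    qed
  qed measurable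
qed

lemma een_eq_ip:
  assumes \<mu>: "psupp S \<mu>" "fin_en R \<mu>" and \<nu>: "psupp T \<nu>" "fin_en R \<nu>"
  shows "een 0 R \<mu> \<nu> = ennreal (ip R \<mu> \<nu>)" unfolding een_def using integrable_seg_prod[OF assms]
  by (intro nn_integral_eq_integral) (auto simp: seg_nonneg)

lemma ip_diff:
  assumes \<mu>: "psupp S \<mu>" "fin_en R \<mu>" and \<nu>: "psupp T \<nu>" "fin_en R \<nu>"
  shows "integrable (emeas 0 R) (\<lambda>p. (seg \<mu> p - seg \<nu> p)\<^sup>2)"
    "(LINT p|(emeas 0 R). (seg \<mu> p - seg \<nu> p)\<^sup>2) = ip R \<mu> \<mu> + ip R \<nu> \<nu> - 2 * ip R \<mu> \<nu>"
proof -
  have eq: "(\<lambda>p. (seg \<mu> p - seg \<nu> p)\<^sup>2) = (\<lambda>p. (seg \<mu> p * seg \<mu> p + seg \<nu> p * seg \<nu> p) - 2 * (seg \<mu> p * seg \<nu> p))"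
    by (auto simp: power2_eq_square algebra_simps)
  note i = integrable_seg_prod[OF \<mu> \<mu>] integrable_seg_prod[OF \<nu> \<nu>] integrable_seg_prod[OF \<mu> \<nu>]
  show "integrable (emeas 0 R) (\<lambda>p. (seg \<mu> p - seg \<nu> p)\<^sup>2)" unfolding eq using i by auto
  show "(LINT p|(emeas 0 R). (seg \<mu> p - seg \<nu> p)\<^sup>2) = ip R \<mu> \<mu> + ip R \<nu> \<nu> - 2 * ip R \<mu> \<nu>" unfolding eq using i by simp
qed

lemma AE_pair_psupp:
  assumes \<mu>: "psupp S \<mu>" and \<nu>: "psupp T \<nu>" and [measurable]: "S \<in> sets borel" "T \<in> sets borel"
  shows "AE z in \<mu> \<Otimes>\<^sub>M \<nu>. fst z \<in> S \<and> snd z \<in> T"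
proof -
  interpret m: prob_space \<mu> using psuppD[OF \<mu>] by simp
  interpret n: prob_space \<nu> using psuppD[OF \<nu>] by simp
  interpret pair_sigma_finite \<mu> \<nu> ..
  note [measurable_cong] = psuppD(2)[OF \<mu>] psuppD(2)[OF \<nu>]
  show ?thesis
  proof (rule AE_pair_measure)
    show "AE x in \<mu>. AE y in \<nu>. fst (x, y) \<in> S \<and> snd (x, y) \<in> T" using psuppD(6)[OF \<mu>]
    proof eventually_elim
      case (elim x)
      show ?case using psuppD(6)[OF \<nu>] by eventually_elim (use elim in simp)
    qed
  qed measurable
qed

text \<open>The kernel is infinite on the diagonal, so finite energy makes the diagonal a null set
  of the product measure. Off it the points have distance at most R, and the kernel is the logarithm
  up to sign and constant.\<close>

lemma log_energy:
  assumes \<mu>: "psupp {a..b} \<mu>" "fin_en R \<mu>" and \<nu>: "psupp {a..b} \<nu>" "fin_en R \<nu>"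
    and R: "0 < R" "b - a \<le> R"
  shows "AE z in \<mu> \<Otimes>\<^sub>M \<nu>. fst z \<noteq> snd z"
    "integrable (\<mu> \<Otimes>\<^sub>M \<nu>) (\<lambda>z. ln \<bar>fst z - snd z\<bar>)"
    "(LINT z|(\<mu> \<Otimes>\<^sub>M \<nu>). ln \<bar>fst z - snd z\<bar>) = ln R + 1 / 2 - ip R \<mu> \<nu>"
proof -
  let ?P = "\<mu> \<Otimes>\<^sub>M \<nu>"
  interpret m: prob_space \<mu> using psuppD[OF \<mu>(1)] by simp
  interpret n: prob_space \<nu> using psuppD[OF \<nu>(1)] by simp
  interpret pair_prob_space \<mu> \<nu> ..
  note [measurable_cong] = psuppD(2)[OF \<mu>(1)] psuppD(2)[OF \<nu>(1)]
  have nn: "(\<integral>\<^sup>+z. kern 0 R (fst z) (snd z) \<partial>?P) = ennreal (ip R \<mu> \<nu>)"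
    using een_eq_ip[OF assms(1-4)] een_kern[OF psuppD(4,2)[OF \<mu>(1)] psuppD(4,2)[OF \<nu>(1)], of 0 R]
    by (subst n.nn_integral_fst[symmetric]) simp_all
  have "AE z in ?P. kern 0 R (fst z) (snd z) \<noteq> \<infinity>" by (rule nn_integral_PInf_AE) (simp_all add: nn)
  then show ne: "AE z in ?P. fst z \<noteq> snd z" by eventually_elim (use kern_diag[OF R(1)] in auto)
  define f where "f z = ln (R / \<bar>fst z - snd z\<bar>) + 1 / 2" for z :: "real \<times> real"
  have ab: "AE z in ?P. fst z \<in> {a..b} \<and> snd z \<in> {a..b}" by (rule AE_pair_psupp[OF \<mu>(1) \<nu>(1)]) auto
  have fm [measurable]: "f \<in> borel_measurable ?P" unfolding f_def by measurable
  have AEf: "AE z in ?P. kern 0 R (fst z) (snd z) = ennreal (f z) \<and> 0 \<le> f z \<and> ln \<bar>fst z - snd z\<bar> = ln R + 1 / 2 - f z"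
    using ne ab
  proof eventually_elim
    case (elim z)
    then have z: "0 < \<bar>fst z - snd z\<bar>" "\<bar>fst z - snd z\<bar> \<le> R" using R by auto
    have "0 \<le> ln (R / \<bar>fst z - snd z\<bar>)" using z by (intro ln_ge_zero) auto
    then show ?case using kern_log[OF z] z by (simp add: f_def ln_div)
  qed
  have "(\<integral>\<^sup>+z. ennreal (f z) \<partial>?P) = ennreal (ip R \<mu> \<nu>)" unfolding nn[symmetric] using AEf by (intro nn_integral_cong_AE) auto
  then have fi: "integrable ?P f" "(LINT z|?P. f z) = ip R \<mu> \<nu>"
    using AEf by (auto intro!: integrableI_nn_integral_finite[where x = "ip R \<mu> \<nu>"] integral_eq_nn_integral[THEN trans]
        simp: seg_nonneg elim!: eventually_mono)
  have eq: "AE z in ?P. ln \<bar>fst z - snd z\<bar> = ln R + 1 / 2 - f z" using AEf by eventually_elim simp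
  have "integrable ?P (\<lambda>z. ln R + 1 / 2 - f z)" using fi by auto
  then show "integrable ?P (\<lambda>z. ln \<bar>fst z - snd z\<bar>)"
    by (rule integrable_cong_AE_imp) (use eq in \<open>auto elim!: eventually_mono\<close>)
  have "(LINT z|?P. ln \<bar>fst z - snd z\<bar>) = (LINT z|?P. ln R + 1 / 2 - f z)" using eq by (intro integral_cong_AE) auto
  also have "... = ln R + 1 / 2 - ip R \<mu> \<nu>" using fi by (simp add: P.prob_space)
  finally show "(LINT z|?P. ln \<bar>fst z - snd z\<bar>) = ln R + 1 / 2 - ip R \<mu> \<nu>" .
qed

text \<open>Atoms have to be excluded explicitly: \<open>ln 0 = 0\<close> hides the diagonal from
  the integrability of the logarithm.\<close>

lemma finite_een_of_integrable_log:
  assumes \<mu>: "psupp {a..b} \<mu>" and at: "\<And>x. emeasure \<mu> {x} = 0"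
    and int: "integrable (\<mu> \<Otimes>\<^sub>M \<mu>) (\<lambda>z. ln \<bar>fst z - snd z\<bar>)" and R: "0 < R" "b - a \<le> R"
  shows "fin_en R \<mu>"
proof -
  let ?P = "\<mu> \<Otimes>\<^sub>M \<mu>"
  interpret m: prob_space \<mu> using psuppD[OF \<mu>(1)] by simp
  interpret pair_prob_space \<mu> \<mu> ..
  note [measurable_cong] = psuppD(2)[OF \<mu>(1)]
  have ne: "AE z in ?P. fst z \<noteq> snd z"
  proof (rule AE_pair_measure)
    show "AE x in \<mu>. AE y in \<mu>. fst (x, y) \<noteq> snd (x, y)"
    proof (rule AE_I2)
      fix x
      have "{x} \<in> null_sets \<mu>" using at psuppD(2)[OF \<mu>] by auto
      then show "AE y in \<mu>. fst (x, y) \<noteq> snd (x, y)" by (rule AE_I') auto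
    qed
  qed measurable
  have ab: "AE z in ?P. fst z \<in> {a..b} \<and> snd z \<in> {a..b}" by (rule AE_pair_psupp[OF \<mu>(1) \<mu>(1)]) auto
  have "een 0 R \<mu> \<mu> = (\<integral>\<^sup>+z. kern 0 R (fst z) (snd z) \<partial>?P)"
    by (subst een_kern[OF psuppD(4,2)[OF \<mu>(1)] psuppD(4,2)[OF \<mu>(1)]], subst m.nn_integral_fst[symmetric]) simp_all
  also have "... = (\<integral>\<^sup>+z. ennreal (ln R + 1 / 2 - ln \<bar>fst z - snd z\<bar>) \<partial>?P)"
  proof (intro nn_integral_cong_AE)
    show "AE z in ?P. kern 0 R (fst z) (snd z) = ennreal (ln R + 1 / 2 - ln \<bar>fst z - snd z\<bar>)" using ne ab
    proof eventually_elim
      case (elim z)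
      then have z: "0 < \<bar>fst z - snd z\<bar>" "\<bar>fst z - snd z\<bar> \<le> R" using R by auto
      then have "ln (R / \<bar>fst z - snd z\<bar>) + 1 / 2 = ln R + 1 / 2 - ln \<bar>fst z - snd z\<bar>" using R by (simp add: ln_div)
      then show ?case unfolding kern_log[OF z] by (simp only:)
    qed
  qed
  also have "... < \<infinity>"
  proof -
    have "integrable ?P (\<lambda>z. ln R + 1 / 2 - ln \<bar>fst z - snd z\<bar>)" using int by auto
    then have "(\<integral>\<^sup>+z. ennreal (norm (ln R + 1 / 2 - ln \<bar>fst z - snd z\<bar>)) \<partial>?P) < \<infinity>" by (simp add: integrable_iff_bounded)
    then show ?thesis by (rule le_less_trans[rotated]) (auto intro!: nn_integral_mono ennreal_leI)
  qed
  finally show ?thesis .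
qed

lemma AE_lborel_open_ex:
  fixes U :: "(real \<times> real) set"
  assumes "AE p in lborel. P p" "open U" "U \<noteq> {}"
  obtains p where "p \<in> U" "P p"
proof -
  obtain N where N: "N \<in> null_sets lborel" "{p. \<not> P p} \<subseteq> N" using assms(1) unfolding eventually_ae_filter by auto
  have "\<not> U \<subseteq> N"
  proof
    assume "U \<subseteq> N"
    moreover have "negligible N" using N(1) by (simp add: negligible_iff_null_sets null_sets_completionI)
    ultimately have "negligible U" by (rule negligible_subset[rotated])
    with open_not_negligible[OF assms(2,3)] show False by simp
  qed
  then show thesis using N that by auto
qed

text \<open>Strict positive definiteness. The masses agree only for almost every interval of
  positive weight. An interval starting to the left of a sees the distribution function at its right
  end, and lengths between R and 2 R reach every point of (a, b). Right continuity removes the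
  exceptional null set.\<close>

lemma psupp_eq_of_seg_eq:
  assumes \<mu>: "psupp {a..b} \<mu>" "fin_en R \<mu>" and \<nu>: "psupp {a..b} \<nu>" "fin_en R \<nu>"
    and R: "0 < R" "b - a \<le> R" and le: "ip R \<mu> \<mu> + ip R \<nu> \<nu> - 2 * ip R \<mu> \<nu> \<le> 0"
  shows "\<mu> = \<nu>"
proof -
  interpret m: real_distribution \<mu> using psuppD[OF \<mu>(1)] by simp
  interpret n: real_distribution \<nu> using psuppD[OF \<nu>(1)] by simp
  note [measurable] = seg_measurable[OF psuppD(4,2)[OF \<mu>(1)]] seg_measurable[OF psuppD(4,2)[OF \<nu>(1)]]
  have "(LINT p|(emeas 0 R). (seg \<mu> p - seg \<nu> p)\<^sup>2) = 0"
  proof (rule antisym)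
    show "(LINT p|(emeas 0 R). (seg \<mu> p - seg \<nu> p)\<^sup>2) \<le> 0" unfolding ip_diff(2)[OF assms(1-4)] by (rule le)
  qed simp
  then have "AE p in emeas 0 R. (seg \<mu> p - seg \<nu> p)\<^sup>2 = 0"
    using integral_nonneg_eq_0_iff_AE[OF ip_diff(1)[OF assms(1-4)]] by simp
  then have AE: "AE p in lborel. 0 < ewt 0 R (fst p) \<longrightarrow> seg \<mu> p = seg \<nu> p"
    unfolding emeas_def by (subst (asm) AE_density) auto
  have left: "seg \<kappa> p = measure \<kappa> {..<snd p + fst p}" if "snd p < a" "psupp {a..b} \<kappa>" for \<kappa> p
  proof -
    interpret k: prob_space \<kappa> using psuppD[OF that(2)] by simp
    have AEk: "AE x in \<kappa>. a \<le> x" using psuppD(6)[OF that(2)] by eventually_elim simp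
    show ?thesis unfolding seg_def
      by (rule k.finite_measure_eq_AE) (use that AEk psuppD(2)[OF that(2)] in \<open>auto elim!: eventually_mono\<close>)
  qed
  have "cdf \<mu> x0 = cdf \<nu> x0" for x0
  proof -
    consider "x0 < a" | "b \<le> x0" | "a \<le> x0" "x0 < b" by linarith
    then show ?thesis
    proof cases
      case 1
      have "cdf \<kappa> x0 = 0" if "psupp {a..b} \<kappa>" for \<kappa>
      proof -
        interpret k: prob_space \<kappa> using psuppD[OF that] by simp
        have "AE x in \<kappa>. x \<notin> {..x0}" using psuppD(6)[OF that] by eventually_elim (use 1 in auto)
        then show ?thesis unfolding cdf_def using psuppD(2)[OF that] by (simp add: k.prob_eq_0)
      qed
      then show ?thesis using \<mu> \<nu> by simp
    next
      case 2
      have "cdf \<kappa> x0 = 1" if "psupp {a..b} \<kappa>" for \<kappa>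
      proof -
        interpret k: prob_space \<kappa> using psuppD[OF that] by simp
        have "AE x in \<kappa>. x \<in> {..x0}" using psuppD(6)[OF that] by eventually_elim (use 2 in auto)
        then show ?thesis unfolding cdf_def using psuppD(2)[OF that] by (simp add: k.prob_eq_1)
      qed
      then show ?thesis using \<mu> \<nu> by simp
    next
      case 3
      have "\<exists>v. x0 < v \<and> v < x0 + 1 / Suc k \<and> measure \<mu> {..<v} = measure \<nu> {..<v}" for k :: nat
      proof -
        define x where "x = min ((x0 + b) / 2) (x0 + 1 / (2 * Suc k))"
        have "x0 < x" "x < b" "x \<le> x0 + 1 / (2 * Suc k)" using 3 by (auto simp: x_def min_def)
        moreover have "1 / (2 * real (Suc k)) < 1 / Suc k" by (intro divide_strict_left_mono) auto
        ultimately have x: "x0 < x" "x < b" "x < x0 + 1 / Suc k" by linarith+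
        define U where "U = {p :: real \<times> real. snd p < a \<and> x0 < snd p + fst p \<and> snd p + fst p < x0 + 1 / Suc k \<and> R < fst p \<and> fst p < 2 * R}"
        have "open U" unfolding U_def by (intro open_Collect_conj open_Collect_less continuous_intros)
        \<comment> \<open>The interval from a - R + (x - a) / 2 to x: it is longer than R, and it
          starts to the left of a because x - a < b - a <= R.\<close>
        moreover have "(R + (x - a) / 2, a - R + (x - a) / 2) \<in> U" using x 3 R by (auto simp: U_def field_simps)
        ultimately obtain p where p: "p \<in> U" "0 < ewt 0 R (fst p) \<longrightarrow> seg \<mu> p = seg \<nu> p"
          using AE_lborel_open_ex[OF AE, of U] by blast
        have "0 < ewt 0 R (fst p)" using p(1) R by (auto simp: U_def ewt_def)
        then have "measure \<mu> {..<snd p + fst p} = measure \<nu> {..<snd p + fst p}"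
          using p left[OF _ \<mu>(1), of p] left[OF _ \<nu>(1), of p] by (auto simp: U_def)
        then show ?thesis using p(1) by (intro exI[of _ "snd p + fst p"]) (auto simp: U_def)
      qed
      then obtain v where v: "\<And>k. x0 < v k" "\<And>k. v k < x0 + 1 / Suc k" "\<And>k. measure \<mu> {..<v k} = measure \<nu> {..<v k}" by metis
      have lim: "(\<lambda>k. measure \<kappa> {..<v k}) \<longlonglongrightarrow> cdf \<kappa> x0" if "psupp {a..b} \<kappa>" for \<kappa>
      proof -
        interpret k: real_distribution \<kappa> using psuppD[OF that] by simp
        have "v \<longlonglongrightarrow> x0"
        proof (rule tendsto_sandwich[OF _ _ tendsto_const])
          show "(\<lambda>k. x0 + 1 / Suc k) \<longlonglongrightarrow> x0"
            using tendsto_add[OF tendsto_const LIMSEQ_Suc[OF lim_1_over_n[where 'a = real]], of x0] by simp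
        qed (use v in \<open>auto intro!: always_eventually less_imp_le\<close>)
        then have "filterlim v (at_right x0) sequentially" using v(1) by (intro tendsto_imp_filterlim_at_right) auto
        moreover have "(cdf \<kappa> \<longlongrightarrow> cdf \<kappa> x0) (at_right x0)" using k.cdf_is_right_cont[of x0] by (simp add: continuous_within)
        ultimately have l: "(\<lambda>k. cdf \<kappa> (v k)) \<longlonglongrightarrow> cdf \<kappa> x0" by (rule filterlim_compose[rotated])
        show ?thesis
        proof (rule tendsto_sandwich[OF _ _ tendsto_const l])
          show "\<forall>\<^sub>F k in sequentially. cdf \<kappa> x0 \<le> measure \<kappa> {..<v k}" unfolding cdf_def using v(1)
            by (intro always_eventually allI k.finite_measure_mono) (auto intro: le_less_trans)
          show "\<forall>\<^sub>F k in sequentially. measure \<kappa> {..<v k} \<le> cdf \<kappa> (v k)"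
            unfolding cdf_def by (intro always_eventually allI k.finite_measure_mono) auto
        qed
      qed
      show ?thesis using lim[OF \<mu>(1)] lim[OF \<nu>(1)] unfolding v(3) by (rule LIMSEQ_unique)
    qed
  qed
  then show ?thesis by (intro cdf_unique m.real_distribution_axioms n.real_distribution_axioms) auto
qed

text \<open>Fatou's lemma: intervals whose end points carry no mass of the limit are continuity sets.\<close>

lemma een_weak_conv_liminf:
  assumes \<mu>: "\<And>n::nat. real_distribution (\<mu> n)" and M: "real_distribution M" and wc: "weak_conv_m \<mu> M"
  shows "een h R M M \<le> liminf (\<lambda>n. een h R (\<mu> n) (\<mu> n))"
proof -
  interpret M: real_distribution M by fact
  have fm: "finite_measure (\<mu> n)" "sets (\<mu> n) = sets borel" for n
    using \<mu>[of n] by (auto simp: real_distribution_def prob_space_def real_distribution_axioms_def)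
  have fM: "finite_measure M" "sets M = sets borel" using M by (auto simp: real_distribution_def prob_space_def)
  note [measurable] = seg_measurable[OF fm] seg_measurable[OF fM]
  define C where "C = {x. measure M {x} \<noteq> 0}"
  have cC: "countable C" unfolding C_def by (rule M.countable_support)
  have "AE p in lborel \<Otimes>\<^sub>M lborel. snd p \<notin> C \<and> snd p + fst p \<notin> C"
  proof -
    have Cm [measurable]: "C \<in> sets borel" using null_setsD2[OF countable_imp_null_set_lborel[OF cC]] by simp
    show ?thesis
    proof (rule lborel_pair.AE_pair_measure)
      show "AE L in lborel. AE y in lborel. snd (L, y) \<notin> C \<and> snd (L, y) + fst (L, y) \<notin> C"
      proof (rule AE_I2)
        fix L :: real
        have "countable (C \<union> (\<lambda>c. c - L) ` C)" using cC by auto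
        then have "(C \<union> (\<lambda>c. c - L) ` C) \<in> null_sets lborel" by (rule countable_imp_null_set_lborel)
        then show "AE y in lborel. snd (L, y) \<notin> C \<and> snd (L, y) + fst (L, y) \<notin> C"
          by (rule AE_I') (auto simp: image_iff, metis add_diff_cancel_right')
      qed
    qed measurable
  qed
  then have AE: "AE p in lborel. snd p \<notin> C \<and> snd p + fst p \<notin> C" unfolding lborel_prod .
  have conv: "AE p in lborel. (\<lambda>n. seg (\<mu> n) p) \<longlonglongrightarrow> seg M p" using AE
  proof eventually_elim
    case (elim p)
    show ?case unfolding seg_def
    proof (rule weak_conv_imp_continuity_set_conv[OF \<mu> M wc])
      have "frontier {snd p..<snd p + fst p} \<subseteq> {snd p, snd p + fst p}"
        by (cases "0 < fst p") (auto simp: frontier_def closure_atLeastLessThan interior_atLeastLessThan)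
      then have "emeasure M (frontier {snd p..<snd p + fst p}) \<le> emeasure M {snd p, snd p + fst p}"
        by (intro emeasure_mono) auto
      also have "... \<le> emeasure M {snd p} + emeasure M {snd p + fst p}"
        using emeasure_subadditive[of "{snd p}" M "{snd p + fst p}"] by (simp add: insert_commute)
      also have "... = 0" using elim by (simp add: C_def M.emeasure_eq_measure)
      finally show "emeasure M (frontier {snd p..<snd p + fst p}) = 0" by simp
    qed auto
  qed
  have "een h R M M = (\<integral>\<^sup>+p. liminf (\<lambda>n. ennreal (seg (\<mu> n) p * seg (\<mu> n) p)) \<partial>emeas h R)" unfolding een_def
  proof (rule nn_integral_cong_AE)
    have "AE p in lborel. 0 < ennreal (ewt h R (fst p)) \<longrightarrow> ennreal (seg M p * seg M p) = liminf (\<lambda>n. ennreal (seg (\<mu> n) p * seg (\<mu> n) p))"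
      using conv
    proof eventually_elim
      case (elim p)
      have "(\<lambda>n. ennreal (seg (\<mu> n) p * seg (\<mu> n) p)) \<longlonglongrightarrow> ennreal (seg M p * seg M p)"
        by (intro tendsto_ennrealI tendsto_mult elim)
      then show ?case using lim_imp_Liminf[OF sequentially_bot] by metis
    qed
    then show "AE p in emeas h R. ennreal (seg M p * seg M p) = liminf (\<lambda>n. ennreal (seg (\<mu> n) p * seg (\<mu> n) p))"
      unfolding emeas_def by (subst AE_density) measurable
  qed
  also have "... \<le> liminf (\<lambda>n. een h R (\<mu> n) (\<mu> n))" unfolding een_def by (rule nn_integral_liminf) measurable
  finally show ?thesis .
qed

subsection \<open>Approximation by dominated measures\<close>

text \<open>Vitali covering. Outer regularity puts A into an open set of tiny \<sigma>-mass; small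
  disjoint intervals inside it cover A up to a Lebesgue null set, and positive density bounds their
  lengths by their \<sigma>-masses.\<close>

lemma lebesgue_null_of_pos_density:
  fixes \<sigma> :: "real measure"
  assumes \<sigma>: "finite_measure \<sigma>" "sets \<sigma> = sets borel"
    and dens: "AE t in lborel. t \<in> A \<longrightarrow> pos_density_at \<sigma> t"
    and A: "A \<in> sets borel" "emeasure \<sigma> A = 0"
  shows "A \<in> null_sets lborel"
proof -
  interpret s: finite_measure \<sigma> by fact
  have sp: "space \<sigma> = UNIV" using sets_eq_imp_space_eq[OF \<sigma>(2)] by simp
  obtain N where N: "N \<in> null_sets lborel" "{t. \<not> (t \<in> A \<longrightarrow> pos_density_at \<sigma> t)} \<subseteq> N"
    using dens unfolding eventually_ae_filter by auto
  \<comment> \<open>Countably many levels: around points of \<open>S k\<close>, every small interval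
    has \<sigma>-mass at least a fixed fraction of its length.\<close>
  define S where "S k = {t\<in>A. \<forall>e. 0 < e \<longrightarrow> e < 1 / Suc k \<longrightarrow> e / Suc k \<le> measure \<sigma> {t - e..t + e}}" for k :: nat
  have "A \<subseteq> N \<union> (\<Union>k. S k)"
  proof
    fix t assume t: "t \<in> A"
    show "t \<in> N \<union> (\<Union>k. S k)"
    proof (cases "t \<in> N")
      case False
      then have "pos_density_at \<sigma> t" using N(2) t by auto
      then obtain D where D: "D > 0" "((\<lambda>e. measure \<sigma> {t - e..t + e} / (2 * e)) \<longlongrightarrow> D) (at_right 0)"
        unfolding pos_density_at_def by auto
      have "\<forall>\<^sub>F e in at_right 0. D / 2 < measure \<sigma> {t - e..t + e} / (2 * e)" using D by (intro order_tendstoD) auto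
      then obtain b where b: "b > 0" "\<And>e. 0 < e \<Longrightarrow> e < b \<Longrightarrow> D / 2 < measure \<sigma> {t - e..t + e} / (2 * e)"
        unfolding eventually_at_right_field by auto
      obtain k :: nat where k: "1 / Suc k < min b D" using D(1) b(1) by (metis nat_approx_posE min_less_iff_conj)
      have "e / Suc k \<le> measure \<sigma> {t - e..t + e}" if e: "0 < e" "e < 1 / Suc k" for e
      proof -
        have "e < b" using e k by linarith
        from b(2)[OF e(1) this] have "D * e < measure \<sigma> {t - e..t + e}" using e(1) by (simp add: field_simps)
        moreover have "e * (1 / Suc k) \<le> e * D" using k e by (intro mult_left_mono) auto
        ultimately show ?thesis by (simp add: mult.commute)
      qed
      then have "t \<in> S k" using t by (simp add: S_def)
      then show ?thesis by blast
    qed simp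
  qed
  moreover have "negligible (S k)" for k unfolding negligible_outer_le
  proof (intro allI impI)
    fix \<epsilon> :: real assume \<epsilon>: "\<epsilon> > 0"
    \<comment> \<open>An interval of radius e centred in \<open>S k\<close> has length 2 e, at most
      c times its \<sigma>-mass. The disjoint intervals of the covering thus have total length at
      most c \<sigma>(U) <= \<epsilon>.\<close>
    define c where "c = 2 * real (Suc k)"
    have c: "c > 0" by (simp add: c_def)
    have "emeasure \<sigma> A < ennreal (\<epsilon> / c)" using \<epsilon> c A(2) by simp
    moreover have "emeasure \<sigma> A = (INF U \<in> {U. A \<subseteq> U \<and> open U}. emeasure \<sigma> U)" using A(1) \<sigma> by (intro outer_regular) auto
    ultimately obtain U where U: "A \<subseteq> U" "open U" "emeasure \<sigma> U < ennreal (\<epsilon> / c)" by (auto simp: INF_less_iff)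
    define K where "K = {p :: real \<times> real. 0 < snd p \<and> snd p < 1 / Suc k \<and> fst p \<in> S k \<and> cball (fst p) (snd p) \<subseteq> U}"
    obtain C where C: "countable C" "C \<subseteq> K" "pairwise (\<lambda>i j. disjnt (cball (fst i) (snd i)) (cball (fst j) (snd j))) C"
      "negligible (S k - (\<Union>i\<in>C. cball (fst i) (snd i)))"
    proof (rule Vitali_covering_theorem_cballs[of K snd "S k" fst])
      show "0 < snd i" if "i \<in> K" for i using that by (simp add: K_def)
      show "\<exists>i. i \<in> K \<and> x \<in> cball (fst i) (snd i) \<and> snd i < d" if x: "x \<in> S k" "0 < d" for x d
      proof -
        have "x \<in> U" using x U(1) by (auto simp: S_def)
        then obtain e where e: "e > 0" "cball x e \<subseteq> U" using U(2) open_contains_cball by blast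
        define r where "r = min (e / 2) (min (d / 2) (1 / (2 * Suc k)))"
        have r: "0 < r" "r \<le> e / 2" "r \<le> d / 2" "r \<le> 1 / (2 * Suc k)" using e x by (auto simp: r_def)
        have "1 / real (2 * Suc k) < 1 / Suc k" by (intro divide_strict_left_mono) auto
        with r(4) have r4: "r < 1 / Suc k" by (rule le_less_trans)
        have "cball x r \<subseteq> cball x e" using r by auto
        then have "cball x r \<subseteq> U" using e by blast
        then have "(x, r) \<in> K" using r r4 x by (simp add: K_def)
        then show ?thesis using r x by (intro exI[of _ "(x, r)"]) auto
      qed
    qed blast
    define B where "B = (\<Union>i\<in>C. cball (fst i) (snd i))"
    have disj: "disjoint_family_on (\<lambda>i. cball (fst i) (snd i)) C"
      using C(3) by (auto simp: disjoint_family_on_def pairwise_def disjnt_def)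
    have bm: "cball (fst i) (snd i) \<in> sets borel" for i :: "real \<times> real" by simp
    have Bm: "B \<in> sets borel" unfolding B_def using C(1) by (intro sets.countable_UN'') auto
    have "emeasure lborel B = (\<integral>\<^sup>+i. emeasure lborel (cball (fst i) (snd i)) \<partial>count_space C)"
      unfolding B_def using C(1) disj by (intro emeasure_UN_countable) auto
    also have "... \<le> (\<integral>\<^sup>+i. ennreal c * emeasure \<sigma> (cball (fst i) (snd i)) \<partial>count_space C)"
    proof (intro nn_integral_mono)
      fix i assume "i \<in> space (count_space C)"
      then have i: "0 < snd i" "snd i < 1 / Suc k" "fst i \<in> S k" using C(2) by (auto simp: K_def)
      have "snd i / Suc k \<le> measure \<sigma> {fst i - snd i..fst i + snd i}" using i by (auto simp: S_def)
      then have "2 * snd i \<le> c * measure \<sigma> (cball (fst i) (snd i))" by (simp add: cball_eq_atLeastAtMost c_def field_simps)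
      then have "ennreal (2 * snd i) \<le> ennreal c * emeasure \<sigma> (cball (fst i) (snd i))"
        using c by (simp add: s.emeasure_eq_measure ennreal_mult[symmetric] ennreal_leI)
      then show "emeasure lborel (cball (fst i) (snd i)) \<le> ennreal c * emeasure \<sigma> (cball (fst i) (snd i))"
        using i(1) by (simp add: cball_eq_atLeastAtMost)
    qed
    also have "... = ennreal c * (\<integral>\<^sup>+i. emeasure \<sigma> (cball (fst i) (snd i)) \<partial>count_space C)" by (intro nn_integral_cmult) auto
    also have "(\<integral>\<^sup>+i. emeasure \<sigma> (cball (fst i) (snd i)) \<partial>count_space C) = emeasure \<sigma> B"
      unfolding B_def using C(1) disj \<sigma>(2) by (intro emeasure_UN_countable[symmetric]) auto
    also have "ennreal c * emeasure \<sigma> B \<le> ennreal c * emeasure \<sigma> U"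
      using C(2) U(2) \<sigma>(2) by (intro mult_left_mono emeasure_mono) (auto simp: B_def K_def)
    also have "ennreal c * emeasure \<sigma> U \<le> ennreal c * ennreal (\<epsilon> / c)" using U(3) by (intro mult_left_mono) auto
    also have "... = ennreal \<epsilon>" using c \<epsilon> by (simp add: ennreal_mult[symmetric])
    finally have B\<epsilon>: "emeasure lborel B \<le> ennreal \<epsilon>" by simp
    have eL: "emeasure lebesgue B = emeasure lborel B" using Bm by simp
    have B1: "B \<in> lmeasurable" using B\<epsilon> Bm eL by (intro fmeasurableI) (auto simp: top.not_eq_extremum intro: le_less_trans)
    have B2: "measure lebesgue B \<le> \<epsilon>" unfolding measure_def eL using B\<epsilon> \<epsilon> by (simp add: enn2real_leI)
    let ?N = "S k - B"
    have N: "negligible ?N" using C(4) by (simp add: B_def)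
    show "\<exists>T. S k \<subseteq> T \<and> T \<in> lmeasurable \<and> measure lebesgue T \<le> \<epsilon>"
    proof (intro exI conjI)
      show "S k \<subseteq> B \<union> ?N" by auto
      show "B \<union> ?N \<in> lmeasurable" using B1 N negligible_imp_measurable by (intro fmeasurable.Un) auto
      have "measure lebesgue (B \<union> ?N) = measure lebesgue B"
        by (rule measure_negligible_symdiff[OF B1]) (use N in \<open>auto intro: negligible_subset\<close>)
      then show "measure lebesgue (B \<union> ?N) \<le> \<epsilon>" using B2 by simp
    qed
  qed
  moreover have "negligible N" using N(1) by (simp add: negligible_iff_null_sets null_sets_completionI)
  ultimately have "negligible A" by (meson negligible_Un negligible_Union_nat negligible_countable_Union negligible_subset)
  then show ?thesis using A(1) by (auto simp: negligible_iff_null_sets null_sets_def)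
qed

text \<open>By the preceding lemma, Lebesgue measure on F is absolutely continuous with respect to
  \<sigma>. Its density f is finite almost everywhere, so removing the set where f exceeds a large k
  costs little length and leaves a set on which f is bounded.\<close>

lemma lebesgue_dominated:
  fixes \<sigma> :: "real measure"
  assumes \<sigma>: "finite_measure \<sigma>" "sets \<sigma> = sets borel" and F: "F \<in> sets borel" "emeasure lborel F < \<infinity>"
    and dens: "AE t in lborel. t \<in> F \<longrightarrow> pos_density_at \<sigma> t" and \<epsilon>: "\<epsilon> > 0"
  obtains B K where "B \<in> sets borel" "B \<subseteq> F" "K > (0::real)" "measure lborel (F - B) < \<epsilon>"
    "\<And>A. A \<in> sets borel \<Longrightarrow> emeasure lborel (A \<inter> B) \<le> ennreal K * emeasure \<sigma> A"
proof -
  interpret s: finite_measure \<sigma> by fact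
  note [measurable_cong] = \<sigma>(2)
  define N where "N = density lborel (indicator F)"
  have sN: "sets N = sets borel" by (simp add: N_def)
  have eN: "emeasure N A = emeasure lborel (F \<inter> A)" if "A \<in> sets borel" for A
    unfolding N_def using that F(1) by (subst emeasure_density) (auto simp: indicator_inter_arith[symmetric])
  have ac: "absolutely_continuous \<sigma> N" unfolding absolutely_continuous_def
  proof
    fix A assume A: "A \<in> null_sets \<sigma>"
    then have Ab: "A \<in> sets borel" using \<sigma>(2) by auto
    have "emeasure \<sigma> (F \<inter> A) \<le> emeasure \<sigma> A" using A by (intro emeasure_mono) auto
    then have "emeasure \<sigma> (F \<inter> A) = 0" using A by auto
    moreover have "AE t in lborel. t \<in> F \<inter> A \<longrightarrow> pos_density_at \<sigma> t" using dens by eventually_elim simp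
    ultimately have "F \<inter> A \<in> null_sets lborel" using F(1) Ab by (intro lebesgue_null_of_pos_density[OF \<sigma>]) auto
    then have "emeasure N A = 0" using eN[OF Ab] null_setsD1 by metis
    then show "A \<in> null_sets N" using Ab sN by (intro null_setsI) auto
  qed
  obtain f where f: "f \<in> borel_measurable \<sigma>" "density \<sigma> f = N" using s.Radon_Nikodym[OF ac] sN \<sigma>(2) by auto
  have fb [measurable]: "f \<in> borel_measurable borel" using f(1) \<sigma>(2) by (simp cong: measurable_cong_sets)
  have fN: "emeasure N A = (\<integral>\<^sup>+x. f x * indicator A x \<partial>\<sigma>)" if "A \<in> sets borel" for A
    unfolding f(2)[symmetric] using that f(1) \<sigma>(2) by (intro emeasure_density) auto
  define D where "D k = {x\<in>F. ennreal (real k) < f x}" for k :: nat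
  have Dm: "D k \<in> sets borel" for k unfolding D_def using F(1) by measurable
  have "(\<Inter>k. D k) = {x\<in>F. f x = \<infinity>}"
  proof (intro set_eqI iffI)
    fix x assume x: "x \<in> (\<Inter>k. D k)"
    have "f x = \<infinity>"
    proof (rule ccontr)
      assume "f x \<noteq> \<infinity>"
      then obtain r where r: "f x = ennreal r" "0 \<le> r" by (cases "f x") auto
      obtain k :: nat where "r \<le> real k" using real_arch_simple by blast
      then have "f x \<le> ennreal (real k)" using r by (simp add: ennreal_leI)
      moreover have "ennreal (real k) < f x" using x by (auto simp: D_def)
      ultimately show False by (simp add: leD)
    qed
    then show "x \<in> {x\<in>F. f x = \<infinity>}" using x by (auto simp: D_def)
  qed (auto simp: D_def)
  moreover have "emeasure lborel {x\<in>F. f x = \<infinity>} = 0"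
  proof -
    have m: "{x\<in>F. f x = \<infinity>} \<in> sets borel" using F(1) by measurable
    have "(\<integral>\<^sup>+x. f x \<partial>\<sigma>) = emeasure N UNIV" using fN[of UNIV] by simp
    also have "... < \<infinity>" using eN[of UNIV] F(2) by simp
    finally have "AE x in \<sigma>. f x \<noteq> \<infinity>" by (intro nn_integral_PInf_AE f(1)) auto
    then have "emeasure N {x\<in>F. f x = \<infinity>} = 0"
    proof -
      assume AE: "AE x in \<sigma>. f x \<noteq> \<infinity>"
      note [measurable] = m f(1)
      have "(\<lambda>x. f x * indicator {x\<in>F. f x = \<infinity>} x) \<in> borel_measurable \<sigma>" by measurable
      moreover have "AE x in \<sigma>. f x * indicator {x\<in>F. f x = \<infinity>} x = 0" using AE by eventually_elim (simp add: indicator_def)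
      ultimately show ?thesis unfolding fN[OF m] by (simp add: nn_integral_0_iff_AE)
    qed
    then show ?thesis unfolding eN[OF m] by (simp add: Int_def conj_ac cong: conj_cong)
  qed
  ultimately have "(\<lambda>k. emeasure lborel (D k)) \<longlonglongrightarrow> 0"
  proof -
    assume *: "(\<Inter>k. D k) = {x\<in>F. f x = \<infinity>}" "emeasure lborel {x\<in>F. f x = \<infinity>} = 0"
    have "(\<lambda>k. emeasure lborel (D k)) \<longlonglongrightarrow> emeasure lborel (\<Inter>k. D k)"
    proof (rule Lim_emeasure_decseq)
      show "range D \<subseteq> sets lborel" using Dm by auto
      show "decseq D" unfolding decseq_def D_def by (auto intro: le_less_trans[rotated] ennreal_leI)
      show "emeasure lborel (D k) \<noteq> \<infinity>" for k
      proof -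
        have "emeasure lborel (D k) \<le> emeasure lborel F" using F(1) by (intro emeasure_mono) (auto simp: D_def)
        then show ?thesis using F(2) by auto
      qed
    qed
    then show ?thesis using * by simp
  qed
  then have "\<forall>\<^sub>F k in sequentially. emeasure lborel (D k) < ennreal \<epsilon>" using \<epsilon> by (intro order_tendstoD) auto
  then obtain k where k: "emeasure lborel (D k) < ennreal \<epsilon>" by (auto simp: eventually_sequentially)
  show thesis
  \<comment> \<open>Adding 1 keeps the constant positive when k = 0.\<close>
  proof (rule that[of "F - D k" "real k + 1"])
    show "F - D k \<in> sets borel" using F(1) Dm by auto
    have "F - (F - D k) = D k" by (auto simp: D_def)
    then show "measure lborel (F - (F - D k)) < \<epsilon>"
    proof -
      have "emeasure lborel (D k) = ennreal (measure lborel (D k))" using k by (intro emeasure_eq_ennreal_measure) auto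
      then show ?thesis using k \<open>F - (F - D k) = D k\<close> by (simp add: ennreal_less_iff)
    qed
    fix A :: "real set" assume A: "A \<in> sets borel"
    have m: "A \<inter> (F - D k) \<in> sets borel" using A F(1) Dm by auto
    have "emeasure lborel (A \<inter> (F - D k)) = emeasure N (A \<inter> (F - D k))"
      unfolding eN[OF m] by (rule arg_cong[of _ _ "emeasure lborel"]) auto
    also have "... = (\<integral>\<^sup>+x. f x * indicator (A \<inter> (F - D k)) x \<partial>\<sigma>)" by (rule fN[OF m])
    also have "... \<le> (\<integral>\<^sup>+x. ennreal (real k + 1) * indicator A x \<partial>\<sigma>)"
    proof (intro nn_integral_mono)
      fix x
      have "f x \<le> ennreal (real k + 1)" if "x \<in> F - D k"
        using that by (auto simp: D_def not_less intro: order_trans ennreal_leI)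
      then show "f x * indicator (A \<inter> (F - D k)) x \<le> ennreal (real k + 1) * indicator A x" by (auto simp: indicator_def)
    qed
    also have "... = ennreal (real k + 1) * emeasure \<sigma> A" using A \<sigma>(2) by (intro nn_integral_cmult_indicator) auto
    finally show "emeasure lborel (A \<inter> (F - D k)) \<le> ennreal (real k + 1) * emeasure \<sigma> A" .
  qed auto
qed

lemma (in prob_space) expectation_square_le:
  fixes f :: "'a \<Rightarrow> real"
  assumes [measurable]: "f \<in> borel_measurable M" and b: "\<And>x. 0 \<le> f x" "\<And>x. f x \<le> 1"
  shows "(LINT x|M. f x)\<^sup>2 \<le> (LINT x|M. (f x)\<^sup>2)"
proof -
  have i: "integrable M f" by (rule integrable_const_bound[of _ 1]) (use b in auto)
  have i2: "integrable M (\<lambda>x. (f x)\<^sup>2)" by (rule integrable_const_bound[of _ 1]) (use b in \<open>auto simp: power_le_one\<close>)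
  have "0 \<le> variance f" by (rule variance_positive)
  also have "variance f = (LINT x|M. (f x)\<^sup>2) - (LINT x|M. f x)\<^sup>2" by (rule variance_eq[OF i i2])
  finally show ?thesis by simp
qed

text \<open>Translation invariance of Lebesgue measure in the left end point of the
  intervals.\<close>

lemma een_shift:
  assumes "finite_measure \<mu>" "sets \<mu> = sets borel"
  shows "(\<integral>\<^sup>+p. ennreal ((seg \<mu> (fst p, snd p - s))\<^sup>2) \<partial>emeas h R) = een h R \<mu> \<mu>"
proof -
  note [measurable] = seg_measurable[OF assms]
  have pm: "(\<lambda>p::real\<times>real. (fst p, snd p - s)) \<in> borel_measurable borel"
    by (intro borel_measurable_continuous_onI continuous_intros)
  have "(\<lambda>p. seg \<mu> (fst p, snd p - s)) \<in> borel_measurable borel" using measurable_compose[OF pm seg_measurable[OF assms]] .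
  note [measurable] = this
  have "(\<integral>\<^sup>+p. ennreal ((seg \<mu> (fst p, snd p - s))\<^sup>2) \<partial>emeas h R)
    = (\<integral>\<^sup>+L. \<integral>\<^sup>+y. ennreal (ewt h R L) * ennreal ((seg \<mu> (L, y - s))\<^sup>2) \<partial>lborel \<partial>lborel)" by (subst nn_integral_emeas) auto
  also have "... = (\<integral>\<^sup>+L. \<integral>\<^sup>+y. ennreal (ewt h R L) * ennreal ((seg \<mu> (L, y))\<^sup>2) \<partial>lborel \<partial>lborel)"
  proof (rule nn_integral_cong)
    fix L :: real
    have "(\<lambda>y::real. (L, y)) \<in> borel_measurable borel" by (intro borel_measurable_continuous_onI continuous_intros)
    from measurable_compose[OF this seg_measurable[OF assms]]
    have [measurable]: "(\<lambda>y. seg \<mu> (L, y)) \<in> borel_measurable borel" .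
    have "(\<integral>\<^sup>+y. ennreal (ewt h R L) * ennreal ((seg \<mu> (L, y))\<^sup>2) \<partial>lborel)
      = ennreal \<bar>1\<bar> * (\<integral>\<^sup>+y. ennreal (ewt h R L) * ennreal ((seg \<mu> (L, - s + 1 * y))\<^sup>2) \<partial>lborel)"
      by (intro nn_integral_real_affine) auto
    then show "(\<integral>\<^sup>+y. ennreal (ewt h R L) * ennreal ((seg \<mu> (L, y - s))\<^sup>2) \<partial>lborel)
      = (\<integral>\<^sup>+y. ennreal (ewt h R L) * ennreal ((seg \<mu> (L, y))\<^sup>2) \<partial>lborel)" by simp
  qed
  also have "... = een h R \<mu> \<mu>" unfolding een_def by (subst nn_integral_emeas) (auto simp: power2_eq_square)
  finally show ?thesis .
qed

text \<open>The complement is a union of translates of an open set, so the set itself is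
  closed.\<close>

lemma inner_parallel_set_measurable:
  fixes F :: "real set"
  assumes "closed F"
  shows "{x. {x - h..x + h} \<subseteq> F} \<in> sets borel"
proof -
  have "- {x. {x - h..x + h} \<subseteq> F} = (\<Union>s\<in>{-h..h}. {x. x + s \<in> - F})"
  proof (intro set_eqI iffI)
    fix x assume "x \<in> - {x. {x - h..x + h} \<subseteq> F}"
    then have "\<exists>y\<in>{x - h..x + h}. y \<notin> F" by (simp add: subset_eq)
    then obtain y where "y \<in> {x - h..x + h}" "y \<notin> F" by blast
    then show "x \<in> (\<Union>s\<in>{-h..h}. {x. x + s \<in> - F})" by (intro UN_I[of "y - x"]) auto
  next
    fix x assume "x \<in> (\<Union>s\<in>{-h..h}. {x. x + s \<in> - F})"
    then obtain s where "s \<in> {-h..h}" "x + s \<notin> F" by auto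
    then have "x + s \<in> {x - h..x + h}" "x + s \<notin> F" by auto
    then show "x \<in> - {x. {x - h..x + h} \<subseteq> F}" by blast
  qed
  moreover have "open {x. x + s \<in> - F}" for s
  proof -
    have "open ((\<lambda>x. x + s) -` (- F))" using assms by (intro open_vimage continuous_intros) auto
    then show ?thesis by (simp add: vimage_def)
  qed
  ultimately have "open (- {x. {x - h..x + h} \<subseteq> F})" by auto
  then have "closed {x. {x - h..x + h} \<subseteq> F}" by (simp add: closed_def)
  then show ?thesis by simp
qed

text \<open>The smoothed measure is the law of \<open>z + s\<close> with \<open>z\<close> distributed according to \<open>\<mu>\<close> and \<open>s\<close>
  uniform on \<open>[-h, h]\<close>, conditioned on \<open>z + s\<close> lying in a set where Lebesgue measure is dominated
  by \<open>\<sigma>\<close>. Averaging over translations does not increase the energy, which is a convex functional.\<close>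

lemma smooth_approximation:
  fixes \<sigma> \<mu> :: "real measure" and f :: "real \<Rightarrow> real"
  assumes \<sigma>: "finite_measure \<sigma>" "sets \<sigma> = sets borel" and F: "compact F" "finite (F - interior F)"
    and dens: "AE t in lborel. t \<in> F \<longrightarrow> pos_density_at \<sigma> t"
    and \<mu>: "psupp F \<mu>" "fin_en R \<mu>" and at: "\<And>x. emeasure \<mu> {x} = 0"
    and f: "continuous_on UNIV f" "\<And>x. \<bar>f x\<bar> \<le> Bf" and \<epsilon>: "\<epsilon> > 0"
  obtains \<beta> M M' where "psupp F \<beta>" "fin_en R \<beta>" "ip R \<beta> \<beta> \<le> ip R \<mu> \<mu> + \<epsilon>"
    "(LINT x|\<beta>. f x) \<le> (LINT x|\<mu>. f x) + \<epsilon>" "M > (0::real)" "M' > (0::real)"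
    "\<And>A. A \<in> sets borel \<Longrightarrow> emeasure \<beta> A \<le> ennreal M * emeasure \<sigma> A"
    "\<And>A. A \<in> sets borel \<Longrightarrow> emeasure \<beta> A \<le> ennreal M' * emeasure lborel A"
proof -
  interpret m: prob_space \<mu> using psuppD[OF \<mu>(1)] by simp
  note [measurable_cong] = psuppD(2)[OF \<mu>(1)]
  have [measurable]: "F \<in> sets borel" "f \<in> borel_measurable borel"
    using F(1) f(1) by (auto intro: borel_compact borel_measurable_continuous_onI)
  define I where "I = ip R \<mu> \<mu>"
  have I0: "0 \<le> I" unfolding I_def by (intro integral_nonneg_AE AE_I2) (simp add: seg_nonneg)
  have B0: "0 \<le> Bf" using f(2)[of 0] by linarith
  \<comment> \<open>\<open>c\<close> below is the probability of the conditioning event, at least 1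
    - \<delta>. The energy grows by a factor at most 1 / c^2 <= 1 + 8 \<delta>, an excess of at most
    8 \<delta> I <= \<epsilon>. An integrand bounded by 2 Bf grows by 1 / c <= 1 + 2 \<delta>, an
    excess of at most \<epsilon> / 2.\<close>
  define \<delta> where "\<delta> = min (1/2) (min (\<epsilon> / (8 * (I + 1))) (\<epsilon> / (8 * (Bf + 1))))"
  have "0 < \<epsilon> / (8 * (I + 1))" "0 < \<epsilon> / (8 * (Bf + 1))" using \<epsilon> I0 B0 by simp_all
  then have \<delta>: "0 < \<delta>" "\<delta> \<le> 1/2" "\<delta> \<le> \<epsilon> / (8 * (I + 1))" "\<delta> \<le> \<epsilon> / (8 * (Bf + 1))" unfolding \<delta>_def by linarith+
  \<comment> \<open>The points whose shifts by at most h stay in F. They exhaust the interior as h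
    decreases, and the finite boundary is null because \<mu> has no atoms.\<close>
  define Fh where "Fh h = {x. {x - h..x + h} \<subseteq> F}" for h
  have Fhm [measurable]: "Fh h \<in> sets borel" for h
    unfolding Fh_def using F(1) by (intro inner_parallel_set_measurable compact_imp_closed)
  have "(\<lambda>k. measure \<mu> (Fh (1 / Suc k))) \<longlonglongrightarrow> measure \<mu> (\<Union>k. Fh (1 / Suc k))"
  proof (rule m.finite_Lim_measure_incseq)
    show "range (\<lambda>k. Fh (1 / Suc k)) \<subseteq> sets \<mu>" using Fhm by (auto simp: psuppD(2)[OF \<mu>(1)])
    show "incseq (\<lambda>k. Fh (1 / Suc k))"
    proof (rule incseq_SucI)
      fix k :: nat
      have le: "1 / real (Suc (Suc k)) \<le> 1 / Suc k" by (intro divide_left_mono) auto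
      show "Fh (1 / Suc k) \<le> Fh (1 / Suc (Suc k))"
      proof
        fix x assume "x \<in> Fh (1 / Suc k)"
        then have "{x - 1 / Suc k..x + 1 / Suc k} \<subseteq> F" by (simp add: Fh_def)
        moreover have "{x - 1 / Suc (Suc k)..x + 1 / Suc (Suc k)} \<subseteq> {x - 1 / Suc k..x + 1 / Suc k}"
          using le by (intro atLeastatMost_subset_iff[THEN iffD2] disjI2) linarith
        ultimately show "x \<in> Fh (1 / Suc (Suc k))" unfolding Fh_def mem_Collect_eq by (rule subset_trans[rotated])
      qed
    qed
  qed
  moreover have "measure \<mu> (\<Union>k. Fh (1 / Suc k)) = 1"
  proof -
    have int: "interior F \<subseteq> (\<Union>k. Fh (1 / Suc k))"
    proof
      fix x assume "x \<in> interior F"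
      then obtain e where e: "e > 0" "cball x e \<subseteq> F" using mem_interior_cball by blast
      obtain k :: nat where k: "1 / Suc k < e" using nat_approx_posE[OF e(1)] by blast
      then have "{x - 1 / Suc k..x + 1 / Suc k} \<subseteq> cball x e"
        unfolding cball_eq_atLeastAtMost by (intro atLeastatMost_subset_iff[THEN iffD2] disjI2) linarith
      then have "x \<in> Fh (1 / Suc k)" using e unfolding Fh_def by blast
      then show "x \<in> (\<Union>k. Fh (1 / Suc k))" by blast
    qed
    have "AE x in \<mu>. x \<notin> F - interior F"
    proof (rule AE_not_in)
      have "(\<Union>x\<in>F - interior F. {x}) \<in> null_sets \<mu>"
        using at F(2) psuppD(2)[OF \<mu>(1)] by (intro null_sets_UN') (auto intro: countable_finite)
      then show "F - interior F \<in> null_sets \<mu>" by simp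
    qed
    then have "AE x in \<mu>. x \<in> (\<Union>k. Fh (1 / Suc k))" using psuppD(6)[OF \<mu>(1)] by eventually_elim (use int in auto)
    then show ?thesis using psuppD(2)[OF \<mu>(1)] by (subst m.prob_eq_1) auto
  qed
  ultimately have lim1: "(\<lambda>k. measure \<mu> (Fh (1 / Suc k))) \<longlonglongrightarrow> 1" by simp
  have ev1: "\<forall>\<^sub>F k in sequentially. 1 - \<delta> / 2 < measure \<mu> (Fh (1 / Suc k))"
    using \<delta>(1) by (intro order_tendstoD(1)[OF lim1]) simp
  define W where "W = {x + s |x s. x \<in> F \<and> s \<in> {-1..1::real}}"
  have "compact W" unfolding W_def using F(1) by (intro compact_sums) auto
  then have "uniformly_continuous_on W f"
    using f(1) by (intro compact_uniformly_continuous continuous_on_subset[OF f(1)]) auto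
  moreover have "0 < \<epsilon> / 8" using \<epsilon> by simp
  ultimately obtain d where d: "d > 0" "\<forall>x\<in>W. \<forall>y\<in>W. dist y x < d \<longrightarrow> dist (f y) (f x) < \<epsilon> / 8"
    unfolding uniformly_continuous_on_def by meson
  obtain k0 :: nat where k0: "1 / Suc k0 < d" using nat_approx_posE[OF d(1)] by blast
  obtain k1 where k1: "\<And>k. k \<ge> k1 \<Longrightarrow> 1 - \<delta> / 2 < measure \<mu> (Fh (1 / Suc k))" using ev1 by (auto simp: eventually_sequentially)
  define h where "h = 1 / real (Suc (max k0 k1))"
  have "h \<le> 1 / Suc k0" unfolding h_def by (intro divide_left_mono) auto
  then have h: "0 < h" "h < d" "h \<le> 1" "1 - \<delta> / 2 < measure \<mu> (Fh h)" using k0 k1[of "max k0 k1"] by (auto simp: h_def)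
  have osc: "\<bar>f (x + s) - f x\<bar> \<le> \<epsilon> / 8" if x: "x \<in> F" "s \<in> {-h..h}" for x s
  proof -
    have s: "s \<in> {-1..1}" using x h by auto
    have "x + s \<in> W" unfolding W_def using x(1) s by blast
    moreover have "x \<in> W" unfolding W_def mem_Collect_eq using x(1) by - (rule exI[of _ x], rule exI[of _ 0], simp)
    moreover have "dist (x + s) x < d" using x h by (auto simp: dist_real_def)
    ultimately have "dist (f (x + s)) (f x) < \<epsilon> / 8" using d(2) by blast
    then show ?thesis by (simp add: dist_real_def)
  qed
  have "emeasure lborel F < \<infinity>" using emeasure_bounded_finite[OF compact_imp_bounded[OF F(1)]] by simp
  moreover have "0 < \<delta> * h" using \<delta>(1) h(1) by simp
  \<comment> \<open>The tolerance is \<delta> h because the uniform law on [-h, h] has density 1 /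
    (2 h): landing in F but outside B then has probability at most \<delta> / 2.\<close>
  ultimately obtain B K where B: "B \<in> sets borel" "B \<subseteq> F" "K > 0" "measure lborel (F - B) < \<delta> * h"
    "\<And>A. A \<in> sets borel \<Longrightarrow> emeasure lborel (A \<inter> B) \<le> ennreal K * emeasure \<sigma> A"
    by (rule lebesgue_dominated[OF \<sigma> \<open>F \<in> sets borel\<close> _ dens]) blast
  note [measurable] = B(1)
  define U where "U = uniform_measure lborel {-h..h}"
  have eh: "emeasure lborel {-h..h} = ennreal (2 * h)" using h(1) by simp
  have prU: "prob_space U" unfolding U_def using h(1) by (intro prob_space_uniform_measure) auto
  then interpret U: prob_space U .
  have sU [measurable_cong]: "sets U = sets borel" by (simp add: U_def)
  have AEU: "AE s in U. s \<in> {-h..h}" unfolding U_def by (intro AE_uniform_measureI) auto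
  have psU: "psupp {-h..h} U" unfolding psupp_def using prU sU AEU by (intro conjI)
  have eU: "emeasure U A \<le> ennreal (1 / (2 * h)) * emeasure lborel A" if "A \<in> sets borel" for A
  proof -
    have "emeasure U A = emeasure lborel ({-h..h} \<inter> A) / ennreal (2 * h)"
      unfolding U_def using that eh by (simp add: emeasure_uniform_measure)
    also have "... \<le> emeasure lborel A / ennreal (2 * h)" using that by (intro divide_right_mono_ennreal emeasure_mono) auto
    also have "... = ennreal (1 / (2 * h)) * emeasure lborel A"
      using h(1) by (simp add: divide_ennreal_def inverse_ennreal mult.commute inverse_eq_divide)
    finally show ?thesis .
  qed
  have eUt: "emeasure U {s. z + s \<in> A} \<le> ennreal (1 / (2 * h)) * emeasure lborel A" if A: "A \<in> sets borel" for A z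
  proof -
    have m: "{s. z + s \<in> A} \<in> sets borel" using A by measurable
    have "emeasure lborel A = emeasure (distr lborel borel ((+) z)) A" by (simp add: lborel_distr_plus)
    also have "... = emeasure lborel {s. z + s \<in> A}" using A by (subst emeasure_distr) (auto simp: vimage_def)
    finally show ?thesis using eU[OF m] by simp
  qed
  let ?P = "\<mu> \<Otimes>\<^sub>M U"
  interpret P: pair_prob_space \<mu> U ..
  define E where "E = {p\<in>space ?P. fst p \<in> Fh h \<and> fst p + snd p \<in> B}"
  have Em [measurable]: "E \<in> sets ?P" unfolding E_def by measurable
  define c where "c = measure ?P E"
  \<comment> \<open>Two losses of at most \<delta> / 2 each: z outside the inner parallel set, and z
    + s in F but outside B.\<close>
  have c1: "1 - \<delta> \<le> c"
  proof -
    define E1 where "E1 = {p\<in>space ?P. fst p \<in> Fh h}"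
    define E2 where "E2 = {p\<in>space ?P. fst p + snd p \<in> F - B}"
    have [measurable]: "E1 \<in> sets ?P" "E2 \<in> sets ?P" unfolding E1_def E2_def by measurable
    have "E1 = Fh h \<times> space U" using psuppD(3)[OF \<mu>(1)] by (auto simp: E1_def space_pair_measure)
    then have "emeasure ?P E1 = emeasure \<mu> (Fh h) * emeasure U (space U)"
      using psuppD(2)[OF \<mu>(1)] by (simp only:, intro U.emeasure_pair_measure_Times) auto
    then have e1: "measure ?P E1 = measure \<mu> (Fh h)" by (simp add: measure_def U.emeasure_space_1)
    have "emeasure ?P E2 = (\<integral>\<^sup>+z. emeasure U (Pair z -` E2) \<partial>\<mu>)" by (rule U.emeasure_pair_measure_alt) measurable
    also have "... \<le> (\<integral>\<^sup>+z. ennreal (\<delta> / 2) \<partial>\<mu>)"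
    proof (intro nn_integral_mono)
      fix z
      have "Pair z -` E2 = {s. z + s \<in> F - B}" using psuppD(3)[OF \<mu>(1)] sets_eq_imp_space_eq[OF sU] by (auto simp: E2_def space_pair_measure)
      then have "emeasure U (Pair z -` E2) \<le> ennreal (1 / (2 * h)) * emeasure lborel (F - B)" using eUt[of "F - B" z] by simp
      also have "emeasure lborel (F - B) = ennreal (measure lborel (F - B))"
      proof (rule emeasure_eq_ennreal_measure)
        have "emeasure lborel (F - B) \<le> emeasure lborel F" by (intro emeasure_mono) auto
        then show "emeasure lborel (F - B) \<noteq> \<top>" using \<open>emeasure lborel F < \<infinity>\<close> by auto
      qed
      also have "ennreal (1 / (2 * h)) * ... = ennreal (measure lborel (F - B) / (2 * h))"
        using h(1) by (simp add: ennreal_mult[symmetric])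
      also have "... \<le> ennreal (\<delta> / 2)" using B(4) h(1) by (intro ennreal_leI) (simp add: field_simps)
      finally show "emeasure U (Pair z -` E2) \<le> ennreal (\<delta> / 2)" .
    qed
    also have "... = ennreal (\<delta> / 2)" by (simp add: m.emeasure_space_1)
    finally have e2: "measure ?P E2 \<le> \<delta> / 2" unfolding measure_def using \<delta>(1) by (intro enn2real_leI) auto
    have "AE p in ?P. snd p \<in> {-h..h}" using AEU by (intro P.AE_pair_measure) auto
    then have "measure ?P E1 \<le> measure ?P (E \<union> E2)"
    proof (intro P.P.finite_measure_mono_AE)
      assume "AE p in ?P. snd p \<in> {-h..h}"
      then show "AE p in ?P. p \<in> E1 \<longrightarrow> p \<in> E \<union> E2"
      proof eventually_elim
        case (elim p)
        have "fst p + snd p \<in> F" if "fst p \<in> Fh h"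
        proof -
          have "fst p + snd p \<in> {fst p - h..fst p + h}" using elim by auto
          then show ?thesis using that by (auto simp: Fh_def)
        qed
        then show ?case by (auto simp: E1_def E2_def E_def)
      qed
    qed measurable
    also have "... \<le> c + measure ?P E2" unfolding c_def by (rule measure_Un_le) measurable
    finally show ?thesis using e1 e2 h(4) by linarith
  qed
  have c: "1/2 \<le> c" "c \<le> 1" using c1 \<delta>(2) by (auto simp: c_def)
  define \<beta> where "\<beta> = distr (uniform_measure ?P E) borel (\<lambda>p. fst p + snd p)"
  have eE: "emeasure ?P E = ennreal c" by (simp add: c_def P.P.emeasure_eq_measure)
  have nnint: "(\<integral>\<^sup>+x. g x \<partial>\<beta>) = (\<integral>\<^sup>+p. g (fst p + snd p) * indicator E p \<partial>?P) / ennreal c"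
    if [measurable]: "g \<in> borel_measurable borel" for g unfolding \<beta>_def eE[symmetric]
    by (subst nn_integral_distr) (measurable, subst nn_integral_uniform_measure, measurable)
  have sb: "sets \<beta> = sets borel" by (simp add: \<beta>_def)
  have em\<beta>: "emeasure \<beta> A = emeasure ?P {p\<in>E. fst p + snd p \<in> A} / ennreal c" if A: "A \<in> sets borel" for A
  proof -
    have [measurable]: "A \<in> sets borel" by fact
    have "emeasure \<beta> A = (\<integral>\<^sup>+x. indicator A x \<partial>\<beta>)" using A sb by simp
    also have "... = (\<integral>\<^sup>+p. indicator A (fst p + snd p) * indicator E p \<partial>?P) / ennreal c" by (rule nnint) measurable
    also have "(\<lambda>p. indicator A (fst p + snd p) * indicator E p :: ennreal) = indicator {p\<in>E. fst p + snd p \<in> A}"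
      by (rule ext) (auto simp: indicator_def)
    also have "(\<integral>\<^sup>+p. indicator {p\<in>E. fst p + snd p \<in> A} p \<partial>?P) = emeasure ?P {p\<in>E. fst p + snd p \<in> A}"
      unfolding E_def by (intro nn_integral_indicator) measurable
    finally show ?thesis .
  qed
  have pr\<beta>: "prob_space \<beta>" unfolding \<beta>_def using eE c
    by (intro prob_space.prob_space_distr prob_space_uniform_measure) (auto simp: ennreal_zero_less_top)
  have AE\<beta>: "AE x in \<beta>. x \<in> B"
  proof -
    have "emeasure \<beta> (- B) = 0" by (subst em\<beta>) (auto simp: E_def)
    then show ?thesis using sb by (intro AE_I'[of "- B"]) auto
  qed
  have ps\<beta>: "psupp F \<beta>" unfolding psupp_def using pr\<beta> sb AE\<beta> B(2) by (auto elim: eventually_mono)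
  have leb: "emeasure ?P {p\<in>E. fst p + snd p \<in> A} \<le> ennreal (1 / (2 * h)) * emeasure lborel (A \<inter> B)" if A: "A \<in> sets borel" for A
  proof -
    have [measurable]: "A \<in> sets borel" by fact
    have m: "{p\<in>E. fst p + snd p \<in> A} \<in> sets ?P" unfolding E_def by measurable
    have "emeasure ?P {p\<in>E. fst p + snd p \<in> A} = (\<integral>\<^sup>+z. emeasure U (Pair z -` {p\<in>E. fst p + snd p \<in> A}) \<partial>\<mu>)"
      by (rule U.emeasure_pair_measure_alt[OF m])
    also have "... \<le> (\<integral>\<^sup>+z. ennreal (1 / (2 * h)) * emeasure lborel (A \<inter> B) \<partial>\<mu>)"
    proof (intro nn_integral_mono)
      fix z
      have "emeasure U (Pair z -` {p\<in>E. fst p + snd p \<in> A}) \<le> emeasure U {s. z + s \<in> A \<inter> B}"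
        by (intro emeasure_mono) (auto simp: E_def)
      also have "... \<le> ennreal (1 / (2 * h)) * emeasure lborel (A \<inter> B)" by (rule eUt) measurable
      finally show "emeasure U (Pair z -` {p\<in>E. fst p + snd p \<in> A}) \<le> ennreal (1 / (2 * h)) * emeasure lborel (A \<inter> B)" .
    qed
    also have "... = ennreal (1 / (2 * h)) * emeasure lborel (A \<inter> B)" by (simp add: m.emeasure_space_1)
    finally show ?thesis .
  qed
  have div2: "x / ennreal c \<le> 2 * x" for x :: ennreal
  proof -
    have "x / ennreal c = x * ennreal (1 / c)" using c by (simp add: divide_ennreal_def inverse_ennreal inverse_eq_divide)
    also have "... \<le> x * ennreal 2" using c by (intro mult_left_mono ennreal_leI) (auto simp: divide_le_eq)
    finally show ?thesis by (simp add: mult.commute)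
  qed
  have dom1: "emeasure \<beta> A \<le> ennreal (1 / h) * emeasure lborel (A \<inter> B)" if A: "A \<in> sets borel" for A
  proof -
    have "emeasure \<beta> A \<le> 2 * emeasure ?P {p\<in>E. fst p + snd p \<in> A}" unfolding em\<beta>[OF A] by (rule div2)
    also have "... \<le> 2 * (ennreal (1 / (2 * h)) * emeasure lborel (A \<inter> B))" by (intro mult_left_mono leb[OF A]) simp
    also have "... = (ennreal 2 * ennreal (1 / (2 * h))) * emeasure lborel (A \<inter> B)" by (simp add: mult.assoc)
    also have "ennreal 2 * ennreal (1 / (2 * h)) = ennreal (1 / h)" using h(1) by (subst ennreal_mult[symmetric]) auto
    finally show ?thesis .
  qed
  note smU = seg_measurable[OF psuppD(4,2)[OF \<mu>(1)]]
  have shm: "(\<lambda>s. seg \<mu> (fst p, snd p - s)) \<in> borel_measurable U" for p :: "real \<times> real"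
  proof -
    have "(\<lambda>s. (fst p, snd p - s)) \<in> borel_measurable borel" by (intro borel_measurable_continuous_onI continuous_intros)
    from measurable_compose[OF this smU] show ?thesis by (simp cong: measurable_cong_sets[OF sU])
  qed
  \<comment> \<open>Dropping the conditioning event bounds the mass of an interval by the average of
    the masses of its translates, at the price 1 / c.\<close>
  have seg\<beta>: "seg \<beta> p \<le> (LINT s|U. seg \<mu> (fst p, snd p - s)) / c" for p
  proof -
    let ?A = "{snd p..<snd p + fst p}"
    have m: "{q\<in>E. fst q + snd q \<in> ?A} \<in> sets ?P" unfolding E_def by measurable
    have "emeasure ?P {q\<in>E. fst q + snd q \<in> ?A} \<le> emeasure ?P {q\<in>space ?P. fst q + snd q \<in> ?A}"
      by (intro emeasure_mono) (auto simp: E_def)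
    also have "... = (\<integral>\<^sup>+s. emeasure \<mu> ((\<lambda>z. (z, s)) -` {q\<in>space ?P. fst q + snd q \<in> ?A}) \<partial>U)"
      by (rule P.emeasure_pair_measure_alt2) measurable
    also have "... = (\<integral>\<^sup>+s. ennreal (seg \<mu> (fst p, snd p - s)) \<partial>U)"
    proof (intro nn_integral_cong)
      fix s
      have "(\<lambda>z. (z, s)) -` {q\<in>space ?P. fst q + snd q \<in> ?A} = {snd p - s..<snd p - s + fst p}"
        using psuppD(3)[OF \<mu>(1)] sets_eq_imp_space_eq[OF sU] by (auto simp: space_pair_measure)
      then show "emeasure \<mu> ((\<lambda>z. (z, s)) -` {q\<in>space ?P. fst q + snd q \<in> ?A}) = ennreal (seg \<mu> (fst p, snd p - s))"
        by (simp add: seg_def m.emeasure_eq_measure)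
    qed
    also have "... = ennreal (LINT s|U. seg \<mu> (fst p, snd p - s))" using shm seg_le_1[OF psuppD(1)[OF \<mu>(1)]]
      by (intro nn_integral_eq_integral U.integrable_const_bound[of _ 1]) (auto simp: seg_nonneg)
    finally have "emeasure \<beta> ?A \<le> ennreal (LINT s|U. seg \<mu> (fst p, snd p - s)) / ennreal c"
      by (subst em\<beta>) (auto intro: divide_right_mono_ennreal)
    also have "... = ennreal ((LINT s|U. seg \<mu> (fst p, snd p - s)) / c)"
      using c by (intro divide_ennreal integral_nonneg) (auto simp: seg_nonneg)
    finally show ?thesis
      unfolding seg_def[of \<beta>] measure_def using c by (intro enn2real_leI) (auto simp: seg_nonneg intro!: divide_nonneg_nonneg integral_nonneg)
  qed
  have een\<beta>: "een 0 R \<beta> \<beta> \<le> ennreal (1 / c\<^sup>2) * een 0 R \<mu> \<mu>"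
  proof -
    interpret PL: pair_sigma_finite "lborel :: (real \<times> real) measure" U ..
    have jm: "(\<lambda>q. seg \<mu> (fst (fst q), snd (fst q) - snd q)) \<in> borel_measurable (lborel \<Otimes>\<^sub>M U)"
    proof -
      have "(\<lambda>q::(real\<times>real)\<times>real. (fst (fst q), snd (fst q) - snd q)) \<in> borel_measurable borel"
        by (intro borel_measurable_continuous_onI continuous_intros)
      then have "(\<lambda>q. seg \<mu> (fst (fst q), snd (fst q) - snd q)) \<in> borel_measurable (borel :: ((real\<times>real)\<times>real) measure)"
        by (rule measurable_compose[OF _ smU])
      moreover have "sets (lborel \<Otimes>\<^sub>M U) = sets ((borel :: (real\<times>real) measure) \<Otimes>\<^sub>M (borel :: real measure))"
        by (intro sets_pair_measure_cong) (simp_all add: sU)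
      then have "sets (lborel \<Otimes>\<^sub>M U) = sets (borel :: ((real\<times>real)\<times>real) measure)" by (simp only: borel_prod)
      ultimately show ?thesis by (simp cong: measurable_cong_sets)
    qed
    have jm2: "(\<lambda>p. \<integral>\<^sup>+s. ennreal ((seg \<mu> (fst p, snd p - s))\<^sup>2) \<partial>U) \<in> borel_measurable lborel"
    proof -
      have "(\<lambda>q. ennreal ((seg \<mu> (fst (fst q), snd (fst q) - snd q))\<^sup>2)) \<in> borel_measurable (lborel \<Otimes>\<^sub>M U)"
        using jm by measurable
      from U.borel_measurable_nn_integral_fst[OF this] show ?thesis by simp
    qed
    have "een 0 R \<beta> \<beta> \<le> (\<integral>\<^sup>+p. ennreal (1 / c\<^sup>2) * (\<integral>\<^sup>+s. ennreal ((seg \<mu> (fst p, snd p - s))\<^sup>2) \<partial>U) \<partial>emeas 0 R)"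
      unfolding een_def
    proof (intro nn_integral_mono)
      fix p :: "real \<times> real"
      let ?a = "LINT s|U. seg \<mu> (fst p, snd p - s)"
      have "seg \<beta> p * seg \<beta> p \<le> (?a / c) * (?a / c)"
        using seg\<beta>[of p] c by (intro mult_mono) (auto simp: seg_nonneg intro!: divide_nonneg_nonneg integral_nonneg)
      also have "... = 1 / c\<^sup>2 * ?a\<^sup>2" by (simp add: power2_eq_square)
      also have "... \<le> 1 / c\<^sup>2 * (LINT s|U. (seg \<mu> (fst p, snd p - s))\<^sup>2)" using shm seg_le_1[OF psuppD(1)[OF \<mu>(1)]]
        by (intro mult_left_mono U.expectation_square_le) (auto simp: seg_nonneg)
      finally have "ennreal (seg \<beta> p * seg \<beta> p) \<le> ennreal (1 / c\<^sup>2 * (LINT s|U. (seg \<mu> (fst p, snd p - s))\<^sup>2))" by (rule ennreal_leI)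
      also have "... = ennreal (1 / c\<^sup>2) * ennreal (LINT s|U. (seg \<mu> (fst p, snd p - s))\<^sup>2)" by (intro ennreal_mult) auto
      also have "ennreal (LINT s|U. (seg \<mu> (fst p, snd p - s))\<^sup>2) = (\<integral>\<^sup>+s. ennreal ((seg \<mu> (fst p, snd p - s))\<^sup>2) \<partial>U)"
        using shm[of p] seg_le_1[OF psuppD(1)[OF \<mu>(1)]]
        by (intro nn_integral_eq_integral[symmetric] U.integrable_const_bound[of _ 1]) (auto simp: seg_nonneg power_le_one)
      finally show "ennreal (seg \<beta> p * seg \<beta> p) \<le> ennreal (1 / c\<^sup>2) * (\<integral>\<^sup>+s. ennreal ((seg \<mu> (fst p, snd p - s))\<^sup>2) \<partial>U)" .
    qed
    also have "... = ennreal (1 / c\<^sup>2) * (\<integral>\<^sup>+p. (\<integral>\<^sup>+s. ennreal ((seg \<mu> (fst p, snd p - s))\<^sup>2) \<partial>U) \<partial>emeas 0 R)"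
      using jm2 by (intro nn_integral_cmult) (simp add: emeas_def)
    also have "(\<integral>\<^sup>+p. (\<integral>\<^sup>+s. ennreal ((seg \<mu> (fst p, snd p - s))\<^sup>2) \<partial>U) \<partial>emeas 0 R)
      = (\<integral>\<^sup>+p. (\<integral>\<^sup>+s. ennreal (ewt 0 R (fst p)) * ennreal ((seg \<mu> (fst p, snd p - s))\<^sup>2) \<partial>U) \<partial>lborel)"
      unfolding emeas_def using jm2 shm by (subst nn_integral_density) (auto simp: nn_integral_cmult)
    also have "... = (\<integral>\<^sup>+s. (\<integral>\<^sup>+p. ennreal (ewt 0 R (fst p)) * ennreal ((seg \<mu> (fst p, snd p - s))\<^sup>2) \<partial>lborel) \<partial>U)"
    proof (rule PL.Fubini'[symmetric])
      have "(\<lambda>q. ennreal (ewt 0 R (fst (fst q))) * ennreal ((seg \<mu> (fst (fst q), snd (fst q) - snd q))\<^sup>2)) \<in> borel_measurable (lborel \<Otimes>\<^sub>M U)"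
        using jm by measurable
      then show "(\<lambda>(p, s). ennreal (ewt 0 R (fst p)) * ennreal ((seg \<mu> (fst p, snd p - s))\<^sup>2)) \<in> borel_measurable (lborel \<Otimes>\<^sub>M U)"
        by (simp add: case_prod_beta)
    qed
    also have "... = (\<integral>\<^sup>+s. een 0 R \<mu> \<mu> \<partial>U)"
    proof (intro nn_integral_cong)
      fix s :: real
      have pm: "(\<lambda>p::real\<times>real. (fst p, snd p - s)) \<in> borel_measurable borel"
        by (intro borel_measurable_continuous_onI continuous_intros)
      have "(\<lambda>p. seg \<mu> (fst p, snd p - s)) \<in> borel_measurable borel" using measurable_compose[OF pm smU] .
      then have [measurable]: "(\<lambda>p. ennreal ((seg \<mu> (fst p, snd p - s))\<^sup>2)) \<in> borel_measurable borel" by measurable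
      have "(\<integral>\<^sup>+p. ennreal (ewt 0 R (fst p)) * ennreal ((seg \<mu> (fst p, snd p - s))\<^sup>2) \<partial>lborel)
        = (\<integral>\<^sup>+p. ennreal ((seg \<mu> (fst p, snd p - s))\<^sup>2) \<partial>emeas 0 R)"
        unfolding emeas_def by (intro nn_integral_density[symmetric]) measurable
      also have "... = een 0 R \<mu> \<mu>" by (rule een_shift[OF psuppD(4,2)[OF \<mu>(1)]])
      finally show "(\<integral>\<^sup>+p. ennreal (ewt 0 R (fst p)) * ennreal ((seg \<mu> (fst p, snd p - s))\<^sup>2) \<partial>lborel) = een 0 R \<mu> \<mu>" .
    qed
    also have "... = een 0 R \<mu> \<mu>" by (simp add: U.emeasure_space_1)
    finally show ?thesis .
  qed
  have I: "een 0 R \<mu> \<mu> = ennreal I" unfolding I_def by (rule een_eq_ip[OF \<mu> \<mu>])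
  have fin\<beta>: "fin_en R \<beta>" using een\<beta> unfolding I by (rule le_less_trans) (simp add: ennreal_mult_less_top)
  have ipb: "ip R \<beta> \<beta> \<le> I + \<epsilon>"
  proof -
    have "ennreal (ip R \<beta> \<beta>) \<le> ennreal (1 / c\<^sup>2) * ennreal I" using een\<beta> unfolding een_eq_ip[OF ps\<beta> fin\<beta> ps\<beta> fin\<beta>] I .
    also have "... = ennreal (1 / c\<^sup>2 * I)" using I0 by (intro ennreal_mult[symmetric]) auto
    finally have "ennreal (ip R \<beta> \<beta>) \<le> ennreal (1 / c\<^sup>2 * I)" .
    then have ipc: "ip R \<beta> \<beta> \<le> 1 / c\<^sup>2 * I" using I0 by (subst (asm) ennreal_le_iff) auto
    \<comment> \<open>From c >= 1 - \<delta>: (1 + 8 \<delta>) (1 - \<delta>)^2 - 1 = \<delta> (6 -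
      15 \<delta> + 8 \<delta>^2), and the last factor is positive for \<delta> <= 1/2.\<close>
    have "1 / c\<^sup>2 \<le> 1 + 8 * \<delta>"
    proof -
      have "1 \<le> (1 + 8 * \<delta>) * (1 - \<delta>)\<^sup>2"
      proof -
        have "(1 + 8 * \<delta>) * (1 - \<delta>)\<^sup>2 - 1 = \<delta> * (6 - 15 * \<delta> + 8 * \<delta>\<^sup>2)" by (simp add: power2_eq_square algebra_simps)
        moreover have "0 \<le> 6 - 15 * \<delta> + 8 * \<delta>\<^sup>2"
        proof -
          have "6 - 15 * \<delta> + 8 * \<delta>\<^sup>2 = 8 * (1/2 - \<delta>)\<^sup>2 + 7 * (1/2 - \<delta>) + 1/2" by (simp add: power2_eq_square algebra_simps)
          moreover have "0 \<le> 8 * (1/2 - \<delta>)\<^sup>2 + 7 * (1/2 - \<delta>) + 1/2" using \<delta>(2) by (intro add_nonneg_nonneg) auto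
          ultimately show ?thesis by (simp only:)
        qed
        ultimately show ?thesis using \<delta>(1) by (metis diff_ge_0_iff_ge less_imp_le mult_nonneg_nonneg)
      qed
      also have "... \<le> (1 + 8 * \<delta>) * c\<^sup>2" using c1 \<delta> by (intro mult_left_mono power_mono) auto
      finally show ?thesis using c by (simp add: divide_le_eq)
    qed
    then have "1 / c\<^sup>2 * I \<le> (1 + 8 * \<delta>) * I" using I0 by (intro mult_right_mono) auto
    moreover have "8 * \<delta> * I \<le> 8 * (\<epsilon> / (8 * (I + 1))) * I" using \<delta>(3) I0 by (intro mult_right_mono mult_left_mono) auto
    moreover have "8 * (\<epsilon> / (8 * (I + 1))) * I \<le> \<epsilon>" using I0 \<epsilon> by (simp add: divide_le_eq)
    moreover have "(1 + 8 * \<delta>) * I = I + 8 * \<delta> * I" by (simp add: algebra_simps)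
    ultimately show ?thesis using ipc by linarith
  qed
  have intf: "(LINT x|\<beta>. f x) \<le> (LINT x|\<mu>. f x) + \<epsilon>"
  proof -
    interpret b: prob_space \<beta> by fact
    \<comment> \<open>Shifted to be nonnegative, so that dropping the conditioning event only
      increases the integral.\<close>
    define g where "g x = f x + Bf" for x
    have g: "0 \<le> g x" "g x \<le> 2 * Bf" for x using f(2)[of x] by (auto simp: g_def)
    have [measurable]: "g \<in> borel_measurable borel" unfolding g_def by measurable
    have gi: "integrable \<mu> g" "integrable \<beta> g"
      using g sb by (auto intro!: m.integrable_const_bound[of _ "2 * Bf"] b.integrable_const_bound[of _ "2 * Bf"] cong: measurable_cong_sets)
    have fi: "integrable \<mu> f" "integrable \<beta> f"
      using f(2) sb by (auto intro!: m.integrable_const_bound[of _ Bf] b.integrable_const_bound[of _ Bf] cong: measurable_cong_sets)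
    have "ennreal (LINT x|\<beta>. g x) = (\<integral>\<^sup>+x. ennreal (g x) \<partial>\<beta>)" using gi g by (intro nn_integral_eq_integral[symmetric]) auto
    also have "... = (\<integral>\<^sup>+p. ennreal (g (fst p + snd p)) * indicator E p \<partial>?P) / ennreal c" by (rule nnint) measurable
    also have "... \<le> (\<integral>\<^sup>+p. ennreal (g (fst p) + \<epsilon> / 8) \<partial>?P) / ennreal c"
    proof (intro divide_right_mono_ennreal nn_integral_mono_AE)
      have "AE p in ?P. fst p \<in> F \<and> snd p \<in> {-h..h}" by (rule AE_pair_psupp[OF \<mu>(1) psU]) measurable
      then show "AE p in ?P. ennreal (g (fst p + snd p)) * indicator E p \<le> ennreal (g (fst p) + \<epsilon> / 8)"
      proof eventually_elim
        case (elim p)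
        have "g (fst p + snd p) \<le> g (fst p) + \<epsilon> / 8" using osc[of "fst p" "snd p"] elim unfolding g_def by linarith
        then have "ennreal (g (fst p + snd p)) \<le> ennreal (g (fst p) + \<epsilon> / 8)" by (rule ennreal_leI)
        then show ?case by (auto simp: indicator_def simp del: ennreal_plus)
      qed
    qed
    also have "(\<integral>\<^sup>+p. ennreal (g (fst p) + \<epsilon> / 8) \<partial>?P) = (\<integral>\<^sup>+z. \<integral>\<^sup>+s. ennreal (g z + \<epsilon> / 8) \<partial>U \<partial>\<mu>)"
      by (subst U.nn_integral_fst[symmetric]) auto
    also have "... = (\<integral>\<^sup>+z. ennreal (g z + \<epsilon> / 8) \<partial>\<mu>)" by (simp add: U.emeasure_space_1)
    also have "... = ennreal (LINT z|\<mu>. g z + \<epsilon> / 8)"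
      using gi g \<epsilon> by (intro nn_integral_eq_integral) (auto intro!: AE_I2 add_nonneg_nonneg)
    also have "(LINT z|\<mu>. g z + \<epsilon> / 8) = (LINT z|\<mu>. g z) + \<epsilon> / 8" using gi by (simp add: m.prob_space)
    also have "ennreal ((LINT z|\<mu>. g z) + \<epsilon> / 8) / ennreal c = ennreal (((LINT z|\<mu>. g z) + \<epsilon> / 8) / c)"
      using c \<epsilon> g by (intro divide_ennreal add_nonneg_nonneg integral_nonneg) auto
    finally have "(LINT x|\<beta>. g x) \<le> ((LINT z|\<mu>. g z) + \<epsilon> / 8) / c"
      using c \<epsilon> g by (subst (asm) ennreal_le_iff) (auto intro!: divide_nonneg_nonneg add_nonneg_nonneg integral_nonneg)
    also have "... \<le> ((LINT z|\<mu>. g z) + \<epsilon> / 8) * (1 + 2 * \<delta>)"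
    proof -
      have "1 \<le> (1 + 2 * \<delta>) * (1 - \<delta>)"
      proof -
        have "(1 + 2 * \<delta>) * (1 - \<delta>) - 1 = \<delta> * (1 - 2 * \<delta>)" by (simp add: algebra_simps)
        moreover have "0 \<le> \<delta> * (1 - 2 * \<delta>)" using \<delta> by (intro mult_nonneg_nonneg) auto
        ultimately show ?thesis by linarith
      qed
      also have "... \<le> (1 + 2 * \<delta>) * c" using c1 \<delta> by (intro mult_left_mono) auto
      finally have "1 / c \<le> 1 + 2 * \<delta>" using c by (simp add: divide_le_eq)
      then have "((LINT z|\<mu>. g z) + \<epsilon> / 8) * (1 / c) \<le> ((LINT z|\<mu>. g z) + \<epsilon> / 8) * (1 + 2 * \<delta>)"
        using g \<epsilon> by (intro mult_left_mono add_nonneg_nonneg integral_nonneg) auto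
      then show ?thesis by simp
    qed
    also have "... \<le> (LINT z|\<mu>. g z) + \<epsilon>"
    proof -
      have "(LINT z|\<mu>. g z) \<le> (LINT z|\<mu>. 2 * Bf)" using gi g by (intro integral_mono) auto
      then have gb: "(LINT z|\<mu>. g z) \<le> 2 * Bf" using m.prob_space by simp
      have "2 * \<delta> * (LINT z|\<mu>. g z) \<le> 2 * \<delta> * (2 * Bf)" using gb \<delta> by (intro mult_left_mono) auto
      also have "... \<le> 2 * (\<epsilon> / (8 * (Bf + 1))) * (2 * Bf)" using \<delta>(4) B0 by (intro mult_right_mono mult_left_mono) auto
      also have "... = \<epsilon> / 2 * (Bf / (Bf + 1))" using B0 by (simp add: field_simps)
      also have "... \<le> \<epsilon> / 2 * 1" using B0 \<epsilon> by (intro mult_left_mono) auto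
      finally have t1: "2 * \<delta> * (LINT z|\<mu>. g z) \<le> \<epsilon> / 2" by simp
      have "\<delta> * \<epsilon> \<le> 1 / 2 * \<epsilon>" using \<delta> \<epsilon> by (intro mult_right_mono) auto
      then have t2: "\<epsilon> / 8 * (1 + 2 * \<delta>) \<le> \<epsilon> / 4" by (simp add: algebra_simps)
      have "((LINT z|\<mu>. g z) + \<epsilon> / 8) * (1 + 2 * \<delta>) = (LINT z|\<mu>. g z) + 2 * \<delta> * (LINT z|\<mu>. g z) + \<epsilon> / 8 * (1 + 2 * \<delta>)"
        by (simp add: algebra_simps)
      then show ?thesis using t1 t2 \<epsilon> by linarith
    qed
    finally have "(LINT x|\<beta>. g x) \<le> (LINT z|\<mu>. g z) + \<epsilon>" .
    then show ?thesis unfolding g_def using fi m.prob_space b.prob_space by simp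
  qed
  show thesis
  proof (rule that[of \<beta> "K / h" "1 / h"])
    fix A :: "real set" assume A: "A \<in> sets borel"
    have "emeasure \<beta> A \<le> ennreal (1 / h) * emeasure lborel (A \<inter> B)" by (rule dom1[OF A])
    also have "... \<le> ennreal (1 / h) * (ennreal K * emeasure \<sigma> A)" by (intro mult_left_mono B(5)[OF A]) simp
    also have "... = ennreal (K / h) * emeasure \<sigma> A"
      using h(1) B(3) by (simp add: mult.assoc[symmetric] ennreal_mult[symmetric] mult.commute)
    finally show "emeasure \<beta> A \<le> ennreal (K / h) * emeasure \<sigma> A" .
    have "emeasure lborel (A \<inter> B) \<le> emeasure lborel A" using A by (intro emeasure_mono) auto
    then show "emeasure \<beta> A \<le> ennreal (1 / h) * emeasure lborel A"
      using dom1[OF A] by (meson mult_left_mono order_trans zero_le)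
  qed (use ps\<beta> fin\<beta> ipb intf h(1) B(3) in \<open>auto simp: I_def\<close>)
qed

text \<open>For each length L the inner integral is at most 2 L^2 times the weight, which is 2 for L
  < R and at most 8 for L < 2 R; integrating over L in [0, 2 R] gives 16 R.\<close>

lemma nn_integral_kern_lborel:
  assumes R: "0 < R"
  shows "(\<integral>\<^sup>+t. kern 0 R x t \<partial>lborel) \<le> ennreal (16 * R)"
proof -
  have "(\<integral>\<^sup>+t. kern 0 R x t \<partial>lborel) = (\<integral>\<^sup>+t. \<integral>\<^sup>+L. ennreal (ewt 0 R L * max 0 (L - \<bar>x - t\<bar>)) \<partial>lborel \<partial>lborel)"
    unfolding kern_eq ..
  also have "... = (\<integral>\<^sup>+L. \<integral>\<^sup>+t. ennreal (ewt 0 R L * max 0 (L - \<bar>x - t\<bar>)) \<partial>lborel \<partial>lborel)"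
    by (rule lborel_pair.Fubini') measurable
  also have "... \<le> (\<integral>\<^sup>+L. ennreal 8 * indicator {0..2 * R} L \<partial>lborel)"
  proof (intro nn_integral_mono)
    fix L :: real
    show "(\<integral>\<^sup>+t. ennreal (ewt 0 R L * max 0 (L - \<bar>x - t\<bar>)) \<partial>lborel) \<le> ennreal 8 * indicator {0..2 * R} L"
    proof (cases "0 < L \<and> L < 2 * R")
      case True
      have "(\<integral>\<^sup>+t. ennreal (ewt 0 R L * max 0 (L - \<bar>x - t\<bar>)) \<partial>lborel)
        \<le> (\<integral>\<^sup>+t. ennreal (ewt 0 R L * L) * indicator {x - L..x + L} t \<partial>lborel)"
        using True by (intro nn_integral_mono) (auto simp: indicator_def ewt_nonneg intro!: ennreal_leI mult_left_mono)
      also have "... = ennreal (ewt 0 R L * L) * ennreal (2 * L)" using True by (subst nn_integral_cmult_indicator) auto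
      also have "... = ennreal (ewt 0 R L * L * (2 * L))" using True by (simp add: ennreal_mult ewt_nonneg)
      also have "ewt 0 R L * L * (2 * L) \<le> 8"
      proof (cases "L < R")
        case False
        have "L\<^sup>2 \<le> (2 * R)\<^sup>2" using True by (intro power_mono) auto
        then show ?thesis using True False R by (simp add: ewt_def power2_eq_square divide_le_eq mult_ac)
      qed (use True in \<open>simp add: ewt_def power2_eq_square\<close>)
      then have "ennreal (ewt 0 R L * L * (2 * L)) \<le> ennreal 8" by (rule ennreal_leI)
      finally show ?thesis using True by simp
    qed (auto simp: ewt_def)
  qed
  also have "... = ennreal 8 * ennreal (2 * R)" using R by (subst nn_integral_cmult_indicator) auto
  also have "... = ennreal (16 * R)" using R by (subst ennreal_mult[symmetric]) auto
  finally show ?thesis .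
qed

text \<open>A density bounded by M gives the kernel potential the uniform bound 16 R M, hence a
  finite logarithmic potential at every point and not just almost everywhere.\<close>

lemma bounded_density_log_integrable:
  assumes \<beta>: "psupp {a..b} \<beta>" and dom: "\<And>A. A \<in> sets borel \<Longrightarrow> emeasure \<beta> A \<le> ennreal M * emeasure lborel A"
    and M: "0 < M"
  shows "integrable \<beta> (\<lambda>t. ln \<bar>t - x\<bar>)" and "emeasure \<beta> {x} = 0"
proof -
  interpret b: prob_space \<beta> using psuppD[OF \<beta>] by simp
  have sb [measurable_cong]: "sets \<beta> = sets borel" using psuppD[OF \<beta>] by simp
  show at: "emeasure \<beta> {x} = 0" for x using dom[of "{x}"] by simp
  define R where "R = \<bar>x\<bar> + \<bar>a\<bar> + \<bar>b\<bar> + 1"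
  have R: "0 < R" by (simp add: R_def)
  have km: "(\<lambda>t. kern 0 R x t) \<in> borel_measurable borel"
    using measurable_compose[OF measurable_Pair1'[of x borel borel] kern_measurable[of 0 R]] by simp
  have "\<beta> \<le> scale_measure (ennreal M) lborel" using dom sb by (subst le_measure) auto
  then have "(\<integral>\<^sup>+t. kern 0 R x t \<partial>\<beta>) \<le> (\<integral>\<^sup>+t. kern 0 R x t \<partial>scale_measure (ennreal M) lborel)"
    using sb by (intro nn_integral_mono_measure) auto
  also have "... = ennreal M * (\<integral>\<^sup>+t. kern 0 R x t \<partial>lborel)" using km by (intro nn_integral_scale_measure) auto
  also have "... \<le> ennreal M * ennreal (16 * R)" by (intro mult_left_mono nn_integral_kern_lborel R) simp
  also have "... < \<infinity>" by (simp add: ennreal_mult_less_top)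
  finally have fin: "(\<integral>\<^sup>+t. kern 0 R x t \<partial>\<beta>) < \<infinity>" .
  have "{x} \<in> null_sets \<beta>" using at sb by auto
  then have ne: "AE t in \<beta>. t \<noteq> x" by (rule AE_I') auto
  have "(\<integral>\<^sup>+t. ennreal (ln R + 1 / 2 - ln \<bar>t - x\<bar>) \<partial>\<beta>) = (\<integral>\<^sup>+t. kern 0 R x t \<partial>\<beta>)"
  proof (rule nn_integral_cong_AE)
    show "AE t in \<beta>. ennreal (ln R + 1 / 2 - ln \<bar>t - x\<bar>) = kern 0 R x t" using ne psuppD(6)[OF \<beta>]
    proof eventually_elim
      case (elim t)
      then have z: "0 < \<bar>x - t\<bar>" "\<bar>x - t\<bar> \<le> R" by (auto simp: R_def)
      then have "ln (R / \<bar>x - t\<bar>) + 1 / 2 = ln R + 1 / 2 - ln \<bar>t - x\<bar>" using R by (simp add: ln_div abs_minus_commute)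
      then show ?case unfolding kern_log[OF z] by (simp only:)
    qed
  qed
  moreover have "AE t in \<beta>. 0 \<le> ln R + 1 / 2 - ln \<bar>t - x\<bar>" using ne psuppD(6)[OF \<beta>]
  proof eventually_elim
    case (elim t)
    then have "ln \<bar>t - x\<bar> \<le> ln R" by (subst ln_le_cancel_iff) (auto simp: R_def)
    then show ?case by simp
  qed
  ultimately have "integrable \<beta> (\<lambda>t. ln R + 1 / 2 - ln \<bar>t - x\<bar>)" using fin by (intro integrableI_nonneg) auto
  then have "integrable \<beta> (\<lambda>t. ln R + 1 / 2 - (ln R + 1 / 2 - ln \<bar>t - x\<bar>))"
    by (rule Bochner_Integration.integrable_diff[OF b.integrable_const])
  moreover have "(\<lambda>t. ln R + 1 / 2 - (ln R + 1 / 2 - ln \<bar>t - x\<bar>)) = (\<lambda>t. ln \<bar>t - x\<bar>)" by (rule ext) simp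
  ultimately show "integrable \<beta> (\<lambda>t. ln \<bar>t - x\<bar>)" by (simp only:)
qed

subsection \<open>Energy minimization in an external field\<close>

text \<open>The convex combination (1 - s) \<mu> + s \<nu>, realized as a two-step random experiment
  so that the formula for integrals over \<open>bind\<close> applies.\<close>

definition mixm :: "real \<Rightarrow> real measure \<Rightarrow> real measure \<Rightarrow> real measure" where
  "mixm s \<mu> \<nu> = measure_pmf (bernoulli_pmf s) \<bind> (\<lambda>b. if b then \<nu> else \<mu>)"

context
  fixes s :: real and \<mu> \<nu> :: "real measure" and S :: "real set"
  assumes s: "0 \<le> s" "s \<le> 1" and \<mu>: "psupp S \<mu>" and \<nu>: "psupp S \<nu>"
begin

lemma mixm_kernel:
  "(\<lambda>b. if b then \<nu> else \<mu>) \<in> measurable (measure_pmf (bernoulli_pmf s)) (subprob_algebra borel)"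
  using psuppD(1,2)[OF \<mu>] psuppD(1,2)[OF \<nu>] by (auto simp: space_subprob_algebra prob_space_imp_subprob_space)

lemma sets_mixm: "sets (mixm s \<mu> \<nu>) = sets borel"
  unfolding mixm_def by (subst sets_bind[OF sets_kernel[OF mixm_kernel]]) auto

lemma nn_integral_mixm:
  assumes "f \<in> borel_measurable borel"
  shows "(\<integral>\<^sup>+x. f x \<partial>mixm s \<mu> \<nu>) = ennreal (1 - s) * (\<integral>\<^sup>+x. f x \<partial>\<mu>) + ennreal s * (\<integral>\<^sup>+x. f x \<partial>\<nu>)"
  unfolding mixm_def nn_integral_bind[OF assms mixm_kernel]
  using s by (subst nn_integral_bernoulli_pmf) (auto simp: mult.commute add.commute)

lemma emeasure_mixm:
  "A \<in> sets borel \<Longrightarrow> emeasure (mixm s \<mu> \<nu>) A = ennreal (1 - s) * emeasure \<mu> A + ennreal s * emeasure \<nu> A"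
  using nn_integral_mixm[of "indicator A"] sets_mixm psuppD(2)[OF \<mu>] psuppD(2)[OF \<nu>] by simp

lemma psupp_mixm: "psupp S (mixm s \<mu> \<nu>)"
proof -
  interpret m: prob_space \<mu> using psuppD[OF \<mu>] by simp
  interpret n: prob_space \<nu> using psuppD[OF \<nu>] by simp
  have sp: "space (mixm s \<mu> \<nu>) = UNIV" using sets_eq_imp_space_eq[OF sets_mixm] by simp
  have "emeasure (mixm s \<mu> \<nu>) UNIV = ennreal (1 - s) + ennreal s"
    using emeasure_mixm[of UNIV] m.emeasure_space_1 n.emeasure_space_1 psuppD(3)[OF \<mu>] psuppD(3)[OF \<nu>] by simp
  also have "... = 1" using s by (simp flip: ennreal_plus)
  finally have "prob_space (mixm s \<mu> \<nu>)" using sp by (intro prob_spaceI) simp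
  moreover have "AE x in mixm s \<mu> \<nu>. x \<in> S"
  proof -
    obtain N1 where N1: "{x \<in> space \<mu>. x \<notin> S} \<subseteq> N1" "emeasure \<mu> N1 = 0" "N1 \<in> sets \<mu>" using AE_E[OF psuppD(6)[OF \<mu>]] by auto
    obtain N2 where N2: "{x \<in> space \<nu>. x \<notin> S} \<subseteq> N2" "emeasure \<nu> N2 = 0" "N2 \<in> sets \<nu>" using AE_E[OF psuppD(6)[OF \<nu>]] by auto
    have b: "N1 \<in> sets borel" "N2 \<in> sets borel" using N1 N2 psuppD(2)[OF \<mu>] psuppD(2)[OF \<nu>] by auto
    have "emeasure \<mu> (N1 \<inter> N2) \<le> emeasure \<mu> N1" "emeasure \<nu> (N1 \<inter> N2) \<le> emeasure \<nu> N2"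
      using N1(3) N2(3) by (auto intro!: emeasure_mono)
    then have "emeasure (mixm s \<mu> \<nu>) (N1 \<inter> N2) = 0" using emeasure_mixm[of "N1 \<inter> N2"] b N1 N2 by simp
    then show ?thesis using b N1(1) N2(1) sets_mixm psuppD(3)[OF \<mu>] psuppD(3)[OF \<nu>] sp by (intro AE_I[of _ _ "N1 \<inter> N2"]) auto
  qed
  ultimately show ?thesis unfolding psupp_def using sets_mixm by simp
qed

lemma integral_mixm:
  fixes f :: "real \<Rightarrow> real"
  assumes f: "f \<in> borel_measurable borel" and b: "\<And>x. \<bar>f x\<bar> \<le> B"
  shows "(LINT x|mixm s \<mu> \<nu>. f x) = (1 - s) * (LINT x|\<mu>. f x) + s * (LINT x|\<nu>. f x)"
proof -
  have int: "integrable \<kappa> f \<and> (\<integral>\<^sup>+x. ennreal (f x + B) \<partial>\<kappa>) = ennreal ((LINT x|\<kappa>. f x) + B) \<and> 0 \<le> (LINT x|\<kappa>. f x) + B"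
    if "psupp S \<kappa>" for \<kappa>
  proof -
    interpret k: prob_space \<kappa> using psuppD[OF that] by simp
    have fk: "f \<in> borel_measurable \<kappa>" using f psuppD(2)[OF that] by (simp cong: measurable_cong_sets)
    have i: "integrable \<kappa> f" by (rule k.integrable_const_bound[of _ B]) (use b fk in auto)
    have nn: "0 \<le> f x + B" for x using b[of x] by linarith
    have "(\<integral>\<^sup>+x. ennreal (f x + B) \<partial>\<kappa>) = ennreal (LINT x|\<kappa>. f x + B)" using i nn by (intro nn_integral_eq_integral) auto
    moreover have "(LINT x|\<kappa>. f x + B) = (LINT x|\<kappa>. f x) + B" using i by (simp add: k.prob_space)
    moreover have "0 \<le> (LINT x|\<kappa>. f x + B)" using nn by (intro integral_nonneg_AE) auto
    ultimately show ?thesis using i by (simp only: simp_thms)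
  qed
  note m = int[OF \<mu>] and n = int[OF \<nu>] and x = int[OF psupp_mixm]
  have "(\<lambda>x. ennreal (f x + B)) \<in> borel_measurable borel" using f by measurable
  from nn_integral_mixm[OF this]
  have "ennreal ((LINT x|mixm s \<mu> \<nu>. f x) + B) = ennreal (1 - s) * ennreal ((LINT x|\<mu>. f x) + B) + ennreal s * ennreal ((LINT x|\<nu>. f x) + B)"
    using m n x by simp
  also have "... = ennreal ((1 - s) * ((LINT x|\<mu>. f x) + B) + s * ((LINT x|\<nu>. f x) + B))"
    using m n s by (simp add: ennreal_mult ennreal_plus)
  finally have "(LINT x|mixm s \<mu> \<nu>. f x) + B = (1 - s) * ((LINT x|\<mu>. f x) + B) + s * ((LINT x|\<nu>. f x) + B)"
    using m n x s by (subst (asm) ennreal_inj) auto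
  then show ?thesis by (simp add: algebra_simps)
qed

lemma seg_mixm: "seg (mixm s \<mu> \<nu>) p = (1 - s) * seg \<mu> p + s * seg \<nu> p"
proof -
  interpret m: prob_space \<mu> using psuppD[OF \<mu>] by simp
  interpret n: prob_space \<nu> using psuppD[OF \<nu>] by simp
  have "emeasure (mixm s \<mu> \<nu>) {snd p..<snd p + fst p} = ennreal ((1 - s) * seg \<mu> p + s * seg \<nu> p)"
    using s by (simp add: emeasure_mixm m.emeasure_eq_measure n.emeasure_eq_measure seg_def ennreal_mult ennreal_plus)
  then show ?thesis using s by (simp add: seg_def[of "mixm s \<mu> \<nu>"] measure_def seg_nonneg del: ennreal_plus)
qed

lemma een_mixm:
  assumes fe: "fin_en R \<mu>" "fin_en R \<nu>"
  shows "fin_en R (mixm s \<mu> \<nu>)"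
    "ip R (mixm s \<mu> \<nu>) (mixm s \<mu> \<nu>) = ip R \<mu> \<mu> + 2 * s * (ip R \<mu> \<nu> - ip R \<mu> \<mu>)
       + s\<^sup>2 * (ip R \<mu> \<mu> + ip R \<nu> \<nu> - 2 * ip R \<mu> \<nu>)"
proof -
  note i = integrable_seg_prod[OF \<mu> fe(1) \<mu> fe(1)] integrable_seg_prod[OF \<nu> fe(2) \<nu> fe(2)] integrable_seg_prod[OF \<mu> fe(1) \<nu> fe(2)]
  have eq: "(\<lambda>p. seg (mixm s \<mu> \<nu>) p * seg (mixm s \<mu> \<nu>) p) =
     (\<lambda>p. (1 - s)\<^sup>2 * (seg \<mu> p * seg \<mu> p) + 2 * (s * (1 - s)) * (seg \<mu> p * seg \<nu> p) + s\<^sup>2 * (seg \<nu> p * seg \<nu> p))"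
    unfolding seg_mixm by (rule ext) (simp add: power2_eq_square algebra_simps)
  have ii: "integrable (emeas 0 R) (\<lambda>p. seg (mixm s \<mu> \<nu>) p * seg (mixm s \<mu> \<nu>) p)"
    unfolding eq using i by (intro Bochner_Integration.integrable_add integrable_mult_right) auto
  have "een 0 R (mixm s \<mu> \<nu>) (mixm s \<mu> \<nu>) = ennreal (ip R (mixm s \<mu> \<nu>) (mixm s \<mu> \<nu>))"
    unfolding een_def using ii by (intro nn_integral_eq_integral) (auto simp: seg_nonneg)
  then show "fin_en R (mixm s \<mu> \<nu>)" by simp
  have "ip R (mixm s \<mu> \<nu>) (mixm s \<mu> \<nu>) = (1 - s)\<^sup>2 * ip R \<mu> \<mu> + 2 * (s * (1 - s)) * ip R \<mu> \<nu> + s\<^sup>2 * ip R \<nu> \<nu>"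
    unfolding eq using i by simp
  then show "ip R (mixm s \<mu> \<nu>) (mixm s \<mu> \<nu>) = ip R \<mu> \<mu> + 2 * s * (ip R \<mu> \<nu> - ip R \<mu> \<mu>)
       + s\<^sup>2 * (ip R \<mu> \<mu> + ip R \<nu> \<nu> - 2 * ip R \<mu> \<nu>)" by (simp add: power2_eq_square algebra_simps)
qed

end

text \<open>Division by s and s tending to 0; if A were negative, the explicit s would keep s B
  below - A / 2.\<close>

lemma nonneg_of_quadratic:
  fixes A B :: real
  assumes "\<And>s. 0 < s \<Longrightarrow> s \<le> 1 \<Longrightarrow> 0 \<le> s * A + s\<^sup>2 * B"
  shows "0 \<le> A"
proof (rule ccontr)
  assume A: "\<not> 0 \<le> A"
  define s where "s = min 1 (- A / (2 * (\<bar>B\<bar> + 1)))"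
  have s: "0 < s" "s \<le> 1" "s \<le> - A / (2 * (\<bar>B\<bar> + 1))" using A by (auto simp: s_def divide_less_0_iff)
  have "0 \<le> s * (A + s * B)" using assms[OF s(1,2)] by (simp add: power2_eq_square algebra_simps)
  then have "0 \<le> A + s * B" using s(1) by (simp add: zero_le_mult_iff)
  also have "s * B \<le> s * (\<bar>B\<bar> + 1)" using s by (intro mult_left_mono) auto
  also have "... \<le> - A / (2 * (\<bar>B\<bar> + 1)) * (\<bar>B\<bar> + 1)" using s(3) by (intro mult_right_mono) auto
  also have "... = - A / 2" by (simp add: field_simps)
  finally show False using A by simp
qed

lemma energy_first_order:
  assumes G: "G \<in> borel_measurable borel" "\<And>x. \<bar>G x\<bar> \<le> B"
    and \<mu>: "psupp F \<mu>" "fin_en R \<mu>" and \<nu>: "psupp F \<nu>" "fin_en R \<nu>"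
    and min: "\<And>\<kappa>. psupp F \<kappa> \<Longrightarrow> fin_en R \<kappa> \<Longrightarrow> ip R \<mu> \<mu> + (LINT x|\<mu>. G x) \<le> ip R \<kappa> \<kappa> + (LINT x|\<kappa>. G x)"
  shows "0 \<le> 2 * (ip R \<mu> \<nu> - ip R \<mu> \<mu>) + ((LINT x|\<nu>. G x) - (LINT x|\<mu>. G x))"
proof (rule nonneg_of_quadratic)
  fix s :: real assume "0 < s" "s \<le> 1"
  then have s: "0 \<le> s" "s \<le> 1" by auto
  have "ip R \<mu> \<mu> + (LINT x|\<mu>. G x) \<le> ip R (mixm s \<mu> \<nu>) (mixm s \<mu> \<nu>) + (LINT x|mixm s \<mu> \<nu>. G x)"
    by (intro min psupp_mixm[OF s \<mu>(1) \<nu>(1)] een_mixm(1)[OF s \<mu>(1) \<nu>(1) \<mu>(2) \<nu>(2)])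
  then show "0 \<le> s * (2 * (ip R \<mu> \<nu> - ip R \<mu> \<mu>) + ((LINT x|\<nu>. G x) - (LINT x|\<mu>. G x)))
     + s\<^sup>2 * (ip R \<mu> \<mu> + ip R \<nu> \<nu> - 2 * ip R \<mu> \<nu>)"
    unfolding een_mixm(2)[OF s \<mu>(1) \<nu>(1) \<mu>(2) \<nu>(2)] integral_mixm[OF s \<mu>(1) \<nu>(1) G] by (simp add: algebra_simps)
qed

text \<open>Inserting \<open>le\<close> into the first-order condition in the direction of \<nu>
  makes the squared distance of \<mu> and \<nu> nonpositive.\<close>

lemma energy_minimizer_unique:
  assumes F: "F \<subseteq> {a..b}" and R: "0 < R" "b - a \<le> R" and G: "G \<in> borel_measurable borel" "\<And>x. \<bar>G x\<bar> \<le> B"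
    and \<mu>: "psupp F \<mu>" "fin_en R \<mu>" and \<nu>: "psupp F \<nu>" "fin_en R \<nu>"
    and min: "\<And>\<kappa>. psupp F \<kappa> \<Longrightarrow> fin_en R \<kappa> \<Longrightarrow> ip R \<mu> \<mu> + (LINT x|\<mu>. G x) \<le> ip R \<kappa> \<kappa> + (LINT x|\<kappa>. G x)"
    and le: "ip R \<nu> \<nu> + (LINT x|\<nu>. G x) \<le> ip R \<mu> \<mu> + (LINT x|\<mu>. G x)"
  shows "\<mu> = \<nu>"
proof (rule psupp_eq_of_seg_eq[OF psupp_mono[OF \<mu>(1) F] \<mu>(2) psupp_mono[OF \<nu>(1) F] \<nu>(2) R])
  show "ip R \<mu> \<mu> + ip R \<nu> \<nu> - 2 * ip R \<mu> \<nu> \<le> 0" using energy_first_order[OF G \<mu> \<nu> min] le by simp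
qed

section \<open>Compactness for measures of bounded truncated energy\<close>

lemma een_trunc_mono: "0 \<le> h \<Longrightarrow> h \<le> h' \<Longrightarrow> een h' R \<mu> \<mu> \<le> een h R \<mu> \<mu>"
proof -
  assume h: "0 \<le> h" "h \<le> h'"
  have "een h' R \<mu> \<mu> = (\<integral>\<^sup>+p. ennreal (seg \<mu> p * seg \<mu> p) \<partial>density lborel (\<lambda>p. ennreal (ewt h' R (fst p))))"
    by (simp add: een_def emeas_def)
  have le: "emeas h' R \<le> emeas h R"
  proof (subst le_measure)
    show "\<forall>A\<in>sets (emeas h' R). emeasure (emeas h' R) A \<le> emeasure (emeas h R) A" unfolding emeas_def
      using h by (auto simp: emeasure_density ewt_def intro!: nn_integral_mono mult_right_mono ennreal_leI)
  qed simp
  show ?thesis unfolding een_def by (rule nn_integral_mono_measure[OF _ le]) simp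
qed

lemma een_trunc_finite:
  assumes "psupp S \<mu>" "0 < h" "0 < R"
  shows "een h R \<mu> \<mu> < \<infinity>"
proof -
  interpret prob_space \<mu> using psuppD[OF assms(1)] by simp
  have "een h R \<mu> \<mu> = (\<integral>\<^sup>+x. \<integral>\<^sup>+t. kern h R x t \<partial>\<mu> \<partial>\<mu>)" by (intro een_kern psuppD[OF assms(1)])
  also have "... \<le> (\<integral>\<^sup>+x. \<integral>\<^sup>+t. ennreal (4 * R\<^sup>2 * (1 / h\<^sup>2 + 1 / R\<^sup>2)) \<partial>\<mu> \<partial>\<mu>)"
    by (intro nn_integral_mono kern_trunc_bounded assms)
  also have "... < \<infinity>" by (simp add: emeasure_space_1)
  finally show ?thesis .
qed

text \<open>Monotone convergence as the cut-off decreases to 0.\<close>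

lemma een_sup_trunc:
  assumes \<mu>: "psupp S \<mu>" and le: "\<And>k::nat. een (1 / Suc k) R \<mu> \<mu> \<le> C"
  shows "een 0 R \<mu> \<mu> \<le> C"
proof -
  note [measurable] = seg_measurable[OF psuppD(4,2)[OF \<mu>]]
  define f where "f h p = ennreal (ewt h R (fst p)) * ennreal (seg \<mu> p * seg \<mu> p)" for h and p :: "real \<times> real"
  have een: "een h R \<mu> \<mu> = (\<integral>\<^sup>+p. f h p \<partial>lborel)" for h
    unfolding een_def emeas_def f_def by (intro nn_integral_density) measurable
  have fm: "f h \<in> borel_measurable lborel" for h unfolding f_def by measurable
  have "(\<integral>\<^sup>+p. (SUP k. f (1 / real (Suc k)) p) \<partial>lborel) = (SUP k. (\<integral>\<^sup>+p. f (1 / real (Suc k)) p \<partial>lborel))"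
  proof (rule nn_integral_monotone_convergence_SUP)
    show "incseq (\<lambda>k p. f (1 / real (Suc k)) p)"
    proof (intro incseq_SucI le_funI)
      fix k :: nat and p :: "real \<times> real"
      have "1 / real (Suc (Suc k)) \<le> 1 / Suc k" by (intro divide_left_mono) auto
      then have "ewt (1 / Suc k) R (fst p) \<le> ewt (1 / Suc (Suc k)) R (fst p)" by (simp add: ewt_def)
      then show "f (1 / real (Suc k)) p \<le> f (1 / real (Suc (Suc k))) p"
        unfolding f_def by (intro mult_right_mono ennreal_leI) auto
    qed
  qed (rule fm)
  also have "... \<le> C" using le unfolding een by (intro SUP_least) blast
  finally have 1: "(\<integral>\<^sup>+p. (SUP k. f (1 / real (Suc k)) p) \<partial>lborel) \<le> C" .
  have "f 0 p \<le> (SUP k. f (1 / real (Suc k)) p)" for p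
  proof (cases "0 < fst p")
    case True
    then obtain k :: nat where "1 / Suc k < fst p" using nat_approx_posE by blast
    then have "f 0 p = f (1 / real (Suc k)) p" using True by (simp add: f_def ewt_def)
    then show ?thesis by (metis SUP_upper UNIV_I)
  qed (simp add: f_def ewt_def)
  then have "een 0 R \<mu> \<mu> \<le> (\<integral>\<^sup>+p. (SUP k. f (1 / real (Suc k)) p) \<partial>lborel)" unfolding een by (intro nn_integral_mono) blast
  with 1 show ?thesis by (rule order_trans[rotated])
qed

text \<open>The bounded continuous function min 1 (distance to F) has integral 0 along the sequence,
  hence in the limit, and it vanishes only on the closed set F.\<close>

lemma psupp_weak_limit:
  assumes F: "closed F" and \<mu>: "\<And>n::nat. psupp F (\<mu> n)" and M: "real_distribution M" and wc: "weak_conv_m \<mu> M"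
  shows "psupp F M"
proof -
  interpret M: real_distribution M by fact
  interpret m0: prob_space "\<mu> 0" using psuppD[OF \<mu>] by simp
  have ne: "F \<noteq> {}" using psuppD(6)[OF \<mu>[of 0]] by auto
  define d where "d x = min 1 (infdist x F)" for x
  have dc: "isCont d x" for x unfolding d_def by (intro continuous_intros)
  have db: "norm (d x) \<le> 1" for x by (simp add: d_def infdist_nonneg)
  have dm [measurable]: "d \<in> borel_measurable borel"
    using dc by (intro borel_measurable_continuous_onI continuous_at_imp_continuous_on) auto
  have "(\<lambda>n. LINT x|(\<mu> n). d x) \<longlonglongrightarrow> (LINT x|M. d x)"
    by (rule weak_conv_imp_integral_bdd_continuous_conv[OF psuppD(7)[OF \<mu>] M wc dc db])
  moreover have "(LINT x|(\<mu> n). d x) = 0" for n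
  proof -
    have "AE x in \<mu> n. d x = 0" using psuppD(6)[OF \<mu>[of n]] by eventually_elim (simp add: d_def)
    then have "(LINT x|(\<mu> n). d x) = (LINT x|(\<mu> n). 0)"
      using psuppD(2)[OF \<mu>[of n]] by (intro integral_cong_AE) (auto cong: measurable_cong_sets)
    then show ?thesis by simp
  qed
  ultimately have "(LINT x|M. d x) = 0" by (simp add: LIMSEQ_const_iff)
  moreover have "integrable M d" by (rule M.integrable_const_bound[of _ 1]) (use db in auto)
  ultimately have "AE x in M. d x = 0" by (subst (asm) integral_nonneg_eq_0_iff_AE) (auto simp: d_def infdist_nonneg)
  then have "AE x in M. x \<in> F"
    by eventually_elim (use F ne in \<open>auto simp: d_def min_def in_closed_iff_infdist_zero split: if_splits\<close>)
  then show ?thesis unfolding psupp_def using M.prob_space_axioms by simp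
qed

lemma tight_psupp:
  assumes "\<And>n::nat. psupp {a..b} (\<mu> n)"
  shows "tight \<mu>" unfolding tight_def
proof (intro conjI allI impI)
  show "real_distribution (\<mu> n)" for n using psuppD(7)[OF assms] .
  fix \<epsilon> :: real assume \<epsilon>: "0 < \<epsilon>"
  have ab: "a \<le> b"
  proof -
    interpret prob_space "\<mu> 0" using psuppD[OF assms] by simp
    show ?thesis
    proof (rule ccontr)
      assume "\<not> a \<le> b"
      then have "{a..b} = {}" by simp
      then have "AE x in \<mu> 0. False" using psuppD(6)[OF assms[of 0]] by simp
      then show False by simp
    qed
  qed
  have "measure (\<mu> n) {a - 1<..b} = 1" for n
  proof -
    interpret prob_space "\<mu> n" using psuppD[OF assms] by simp
    have "AE x in \<mu> n. x \<in> {a - 1<..b}" using psuppD(6)[OF assms[of n]] by eventually_elim simp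
    then show ?thesis using psuppD(2)[OF assms[of n]] by (subst prob_eq_1) auto
  qed
  then show "\<exists>a b. a < b \<and> (\<forall>n. 1 - \<epsilon> < measure (\<mu> n) {a<..b})"
    using \<epsilon> ab by - (rule exI[of _ "a - 1"], rule exI[of _ b], simp)
qed

text \<open>The energies are truncated because the lemma is meant for empirical measures, whose full
  energy is infinite. Cut-off and tolerance shrink together, so that the limit measure has its full
  energy under control.\<close>

lemma energy_compactness:
  assumes F: "closed F" "F \<subseteq> {a..b}" and R: "0 < R" and G: "continuous_on UNIV G" "\<And>x. \<bar>G x\<bar> \<le> B"
    and \<mu>: "\<And>m::nat. psupp F (\<mu> m)"
    and le: "\<And>m. enn2real (een (1 / Suc m) R (\<mu> m) (\<mu> m)) + (LINT x|(\<mu> m). G x) \<le> e + 1 / Suc m"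
  obtains r M where "strict_mono r" "psupp F M" "weak_conv_m (\<mu> \<circ> r) M" "fin_en R M"
    "ip R M M + (LINT x|M. G x) \<le> e"
proof -
  have "tight \<mu>" by (rule tight_psupp[OF psupp_mono[OF \<mu> F(2)]])
  from tight_imp_convergent_subsubsequence[OF this strict_mono_id]
  obtain r M where r: "strict_mono r" and M: "real_distribution M" and wc: "weak_conv_m (\<mu> \<circ> r) M" by (auto simp: comp_def)
  have \<mu>r: "psupp F ((\<mu> \<circ> r) n)" for n using \<mu> by simp
  have pM: "psupp F M" by (rule psupp_weak_limit[OF F(1) \<mu>r M wc])
  have Gc: "isCont G x" for x using G(1) by (simp add: continuous_on_eq_continuous_at)
  have Glim: "(\<lambda>n. LINT x|(\<mu> \<circ> r) n. G x) \<longlonglongrightarrow> (LINT x|M. G x)"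
    by (rule weak_conv_imp_integral_bdd_continuous_conv[OF psuppD(7)[OF \<mu>r] M wc Gc, of B]) (use G(2) in simp)
  define c where "c n = e + 1 / Suc (r n) - (LINT x|(\<mu> \<circ> r) n. G x)" for n
  have "(\<lambda>n. 1 / real (Suc (r n))) \<longlonglongrightarrow> 0"
    using LIMSEQ_subseq_LIMSEQ[OF LIMSEQ_Suc[OF lim_1_over_n[where 'a = real]] r] by (simp add: comp_def)
  then have clim: "c \<longlonglongrightarrow> e + 0 - (LINT x|M. G x)" unfolding c_def by (intro tendsto_intros Glim)
  have c0: "0 \<le> c n" for n
  proof -
    have "0 \<le> enn2real (een (1 / Suc (r n)) R (\<mu> (r n)) (\<mu> (r n)))" by simp
    also have "... \<le> c n" using le[of "r n"] by (simp add: c_def)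
    finally show ?thesis .
  qed
  have cl0: "0 \<le> e - (LINT x|M. G x)" using LIMSEQ_le_const[OF clim, of 0] c0 by auto
  \<comment> \<open>The cut-off 1 / Suc k stays fixed while n runs: eventually the cut-off of the
    n-th measure is finer, its energy dominates the one with the fixed cut-off, and lower
    semicontinuity applies to the latter.\<close>
  have "een (1 / Suc k) R M M \<le> ennreal (e - (LINT x|M. G x))" for k :: nat
  proof -
    have "een (1 / Suc k) R M M \<le> liminf (\<lambda>n. een (1 / Suc k) R ((\<mu> \<circ> r) n) ((\<mu> \<circ> r) n))"
      by (rule een_weak_conv_liminf[OF psuppD(7)[OF \<mu>r] M wc])
    also have "... \<le> liminf (\<lambda>n. ennreal (c n))"
    proof (rule Liminf_mono)
      have "\<forall>\<^sub>F n in sequentially. k \<le> n" by (rule eventually_ge_at_top)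
      then show "\<forall>\<^sub>F n in sequentially. een (1 / Suc k) R ((\<mu> \<circ> r) n) ((\<mu> \<circ> r) n) \<le> ennreal (c n)"
      proof eventually_elim
        case (elim n)
        have "k \<le> r n" using elim seq_suble[OF r, of n] by linarith
        then have le1: "1 / real (Suc (r n)) \<le> 1 / Suc k" by (intro divide_left_mono) auto
        have "een (1 / Suc k) R (\<mu> (r n)) (\<mu> (r n)) \<le> een (1 / Suc (r n)) R (\<mu> (r n)) (\<mu> (r n))"
          by (rule een_trunc_mono[OF _ le1]) simp
        also have "... = ennreal (enn2real (een (1 / Suc (r n)) R (\<mu> (r n)) (\<mu> (r n))))"
          using een_trunc_finite[OF \<mu>[of "r n"], of "1 / Suc (r n)" R] R by simp
        also have "... \<le> ennreal (c n)" using le[of "r n"] by (intro ennreal_leI) (simp add: c_def)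
        finally show ?case by simp
      qed
    qed
    also have "... = ennreal (e + 0 - (LINT x|M. G x))" by (intro lim_imp_Liminf tendsto_ennrealI clim) simp
    finally show ?thesis by simp
  qed
  then have een: "een 0 R M M \<le> ennreal (e - (LINT x|M. G x))" by (rule een_sup_trunc[OF pM])
  then have fe: "fin_en R M" by (rule le_less_trans) simp
  have "ip R M M \<le> e - (LINT x|M. G x)" using een cl0 unfolding een_eq_ip[OF pM fe pM fe] by simp
  then show thesis using that[OF r pM wc fe] by simp
qed

lemma integral_weak_conv_psupp:
  assumes "\<And>n::nat. psupp S (\<mu> n)" "psupp S M" "weak_conv_m \<mu> M" and f: "continuous_on UNIV f" "\<And>x. \<bar>f x\<bar> \<le> B"
  shows "(\<lambda>n. LINT x|(\<mu> n). f x) \<longlonglongrightarrow> (LINT x|M. (f x :: real))"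
  by (rule weak_conv_imp_integral_bdd_continuous_conv[OF psuppD(7)[OF assms(1)] psuppD(7)[OF assms(2)] assms(3)])
     (use f in \<open>auto simp: continuous_on_eq_continuous_at\<close>)

text \<open>The direct method; the infimum is finite because the field is bounded and the energy is
  nonnegative.\<close>

lemma energy_minimizer_exists:
  assumes F: "closed F" "F \<subseteq> {a..b}" and R: "0 < R" and G: "continuous_on UNIV G" "\<And>x. \<bar>G x\<bar> \<le> B"
    and ne: "psupp F \<kappa>0" "een 0 R \<kappa>0 \<kappa>0 < \<infinity>"
  obtains \<omega> where "psupp F \<omega>" "fin_en R \<omega>"
    "\<And>\<kappa>. psupp F \<kappa> \<Longrightarrow> fin_en R \<kappa> \<Longrightarrow> ip R \<omega> \<omega> + (LINT x|\<omega>. G x) \<le> ip R \<kappa> \<kappa> + (LINT x|\<kappa>. G x)"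
proof -
  define T where "T = {ip R \<kappa> \<kappa> + (LINT x|\<kappa>. G x) |\<kappa>. psupp F \<kappa> \<and> fin_en R \<kappa>}"
  define e where "e = Inf T"
  have T: "T \<noteq> {}" using ne by (auto simp: T_def)
  have lower: "- B \<le> ip R \<kappa> \<kappa> + (LINT x|\<kappa>. G x)" if "psupp F \<kappa>" for \<kappa>
  proof -
    interpret prob_space \<kappa> using psuppD[OF that] by simp
    have "G \<in> borel_measurable borel" using G(1) by (rule borel_measurable_continuous_onI)
    then have Gm: "G \<in> borel_measurable \<kappa>" using psuppD(2)[OF that] by (simp cong: measurable_cong_sets)
    have "integrable \<kappa> G" by (rule integrable_const_bound[of _ B]) (use G Gm in auto)
    then have "(LINT x|\<kappa>. - B) \<le> (LINT x|\<kappa>. G x)" using G(2) by (intro integral_mono) (auto simp: abs_le_iff minus_le_iff)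
    moreover have "0 \<le> ip R \<kappa> \<kappa>" by (intro integral_nonneg_AE AE_I2) (simp add: seg_nonneg)
    moreover have "(LINT x|\<kappa>. - B) = - B" by (simp add: prob_space)
    ultimately show ?thesis by linarith
  qed
  have bdd: "bdd_below T" using lower by (intro bdd_belowI[of _ "- B"]) (auto simp: T_def)
  have eT: "e \<le> ip R \<kappa> \<kappa> + (LINT x|\<kappa>. G x)" if "psupp F \<kappa>" "fin_en R \<kappa>" for \<kappa>
    unfolding e_def using that by (intro cInf_lower bdd) (auto simp: T_def)
  have "\<exists>\<kappa>. psupp F \<kappa> \<and> fin_en R \<kappa> \<and> ip R \<kappa> \<kappa> + (LINT x|\<kappa>. G x) < e + 1 / Suc m" for m :: nat
  proof -
    have "\<exists>y\<in>T. y < e + 1 / Suc m" unfolding e_def by (rule cInf_lessD[OF T]) simp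
    then show ?thesis by (auto simp: T_def)
  qed
  then obtain \<mu> where \<mu>: "\<And>m. psupp F (\<mu> m)" "\<And>m. een 0 R (\<mu> m) (\<mu> m) < \<infinity>"
    "\<And>m. ip R (\<mu> m) (\<mu> m) + (LINT x|(\<mu> m). G x) < e + 1 / Suc m" by metis
  have "enn2real (een (1 / Suc m) R (\<mu> m) (\<mu> m)) + (LINT x|(\<mu> m). G x) \<le> e + 1 / Suc m" for m
  proof -
    have "een (1 / Suc m) R (\<mu> m) (\<mu> m) \<le> een 0 R (\<mu> m) (\<mu> m)" by (rule een_trunc_mono) auto
    also have "... = ennreal (ip R (\<mu> m) (\<mu> m))" by (rule een_eq_ip[OF \<mu>(1,2) \<mu>(1,2)])
    finally have "enn2real (een (1 / Suc m) R (\<mu> m) (\<mu> m)) \<le> ip R (\<mu> m) (\<mu> m)"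
      by (intro enn2real_leI) (auto intro!: integral_nonneg_AE simp: seg_nonneg)
    then show ?thesis using \<mu>(3)[of m] by linarith
  qed
  from energy_compactness[OF F R G \<mu>(1) this]
  obtain M where M: "psupp F M" "fin_en R M" "ip R M M + (LINT x|M. G x) \<le> e" by metis
  show thesis by (rule that[OF M(1,2)]) (use M(3) eT in \<open>auto intro: order_trans\<close>)
qed

text \<open>Compactness and uniqueness, by contradiction. The gain is uniformity: one m, serving as
  cut-off and tolerance at once, works for all measures and in particular for empirical measures
  with any number of points.\<close>

lemma energy_concentration:
  fixes f G :: "real \<Rightarrow> real"
  assumes F: "closed F" "F \<subseteq> {a..b}" and R: "0 < R" "b - a \<le> R" and G: "continuous_on UNIV G" "\<And>x. \<bar>G x\<bar> \<le> B"
    and \<omega>: "psupp F \<omega>" "fin_en R \<omega>"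
    and min: "\<And>\<kappa>. psupp F \<kappa> \<Longrightarrow> fin_en R \<kappa> \<Longrightarrow> ip R \<omega> \<omega> + (LINT x|\<omega>. G x) \<le> ip R \<kappa> \<kappa> + (LINT x|\<kappa>. G x)"
    and f: "continuous_on UNIV f" "\<And>x. \<bar>f x\<bar> \<le> C" and \<delta>: "0 < \<delta>"
  obtains m :: nat where "\<And>\<mu>. psupp F \<mu> \<Longrightarrow>
    enn2real (een (1 / Suc m) R \<mu> \<mu>) + (LINT x|\<mu>. G x) \<le> ip R \<omega> \<omega> + (LINT x|\<omega>. G x) + 1 / Suc m \<Longrightarrow>
    \<bar>(LINT x|\<mu>. f x) - (LINT x|\<omega>. f x)\<bar> < \<delta>"
proof (rule ccontr)
  assume no: "\<not> thesis"
  define e where "e = ip R \<omega> \<omega> + (LINT x|\<omega>. G x)"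
  have "\<exists>\<mu>. psupp F \<mu> \<and> enn2real (een (1 / Suc m) R \<mu> \<mu>) + (LINT x|\<mu>. G x) \<le> e + 1 / Suc m \<and>
      \<not> \<bar>(LINT x|\<mu>. f x) - (LINT x|\<omega>. f x)\<bar> < \<delta>" for m :: nat using no that[of m] unfolding e_def by blast
  then obtain \<mu> where \<mu>: "\<And>m. psupp F (\<mu> m)"
    "\<And>m. enn2real (een (1 / Suc m) R (\<mu> m) (\<mu> m)) + (LINT x|(\<mu> m). G x) \<le> e + 1 / Suc m"
    "\<And>m. \<not> \<bar>(LINT x|(\<mu> m). f x) - (LINT x|\<omega>. f x)\<bar> < \<delta>" by metis
  from energy_compactness[OF F R(1) G \<mu>(1,2)]
  obtain r M where M: "strict_mono r" "psupp F M" "weak_conv_m (\<mu> \<circ> r) M" "fin_en R M" "ip R M M + (LINT x|M. G x) \<le> e"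
    by metis
  have Gm: "G \<in> borel_measurable borel" using G(1) by (rule borel_measurable_continuous_onI)
  have "\<omega> = M" by (rule energy_minimizer_unique[OF F(2) R Gm G(2) \<omega> M(2,4) min]) (use M(5) in \<open>simp_all add: e_def\<close>)
  have "(\<lambda>n. LINT x|(\<mu> \<circ> r) n. f x) \<longlonglongrightarrow> (LINT x|M. f x)" by (rule integral_weak_conv_psupp[OF _ M(2,3) f]) (use \<mu>(1) in simp)
  then have "\<forall>\<^sub>F n in sequentially. dist (LINT x|(\<mu> \<circ> r) n. f x) (LINT x|M. f x) < \<delta>" using \<delta> by (rule tendstoD)
  then obtain n where "dist (LINT x|(\<mu> \<circ> r) n. f x) (LINT x|M. f x) < \<delta>" by (auto simp: eventually_sequentially)
  then show False using \<mu>(3)[of "r n"] \<open>\<omega> = M\<close> by (simp add: dist_real_def)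
qed

subsection \<open>Orthogonality with varying weights\<close>

text \<open>The image of the uniform law on the indices, so that coinciding points count with
  multiplicity. For n = 0 the index set is empty and no law is available, whence the conditions n >=
  1.\<close>

definition emp :: "nat \<Rightarrow> (nat \<Rightarrow> real) \<Rightarrow> real measure" where
  "emp n x = distr (measure_pmf (pmf_of_set {..<n})) borel x"

lemma integral_emp:
  fixes f :: "real \<Rightarrow> real"
  assumes "n \<ge> 1" "f \<in> borel_measurable borel"
  shows "(LINT y|emp n x. f y) = (\<Sum>i<n. f (x i)) / n" unfolding emp_def using assms
  by (subst integral_distr) (auto simp: integral_pmf_of_set lessThan_empty_iff)

lemma nn_integral_emp:
  assumes "n \<ge> 1" "f \<in> borel_measurable borel"
  shows "(\<integral>\<^sup>+y. f y \<partial>emp n x) = (\<Sum>i<n. f (x i)) / ennreal n" unfolding emp_def using assms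
  by (subst nn_integral_distr) (auto simp: nn_integral_pmf_of_set lessThan_empty_iff ennreal_of_nat_eq_real_of_nat)

lemma emp_psupp:
  assumes n: "n \<ge> 1" and x: "\<And>i. i < n \<Longrightarrow> x i \<in> S" and S: "S \<in> sets borel"
  shows "psupp S (emp n x)"
proof -
  interpret p: prob_space "emp n x" unfolding emp_def by (intro measure_pmf.prob_space_distr) simp
  have "emeasure (emp n x) (- S) = (\<integral>\<^sup>+y. indicator (- S) y \<partial>emp n x)"
    using S by (intro nn_integral_indicator[symmetric]) (simp add: emp_def)
  also have "... = 0" using x S by (subst nn_integral_emp[OF n]) auto
  finally have "AE y in emp n x. y \<in> S" using S by (intro AE_I'[of "- S"]) (auto simp: emp_def)
  then show ?thesis unfolding psupp_def using p.prob_space_axioms by (simp add: emp_def)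
qed

text \<open>The truncated kernel is finite on the diagonal, which costs only a term linear in \<open>n\<close>.\<close>

lemma vdm2_le_energy:
  assumes n: "n \<ge> 1" and x: "\<And>i. i < n \<Longrightarrow> x i \<in> {a..b}" and R: "0 < R" "b - a \<le> R" and h: "0 < h"
  shows "vdm2 {..<n} x \<le> exp (real n * (real n - 1) * (ln R + 1 / 2)
     - (real n)\<^sup>2 * enn2real (een h R (emp n x) (emp n x)) + real n * (4 * R\<^sup>2 * (1 / h\<^sup>2 + 1 / R\<^sup>2)))"
proof (cases "inj_on x {..<n}")
  case False
  then obtain i j where "i < n" "j < n" "i \<noteq> j" "x i = x j" by (auto simp: inj_on_def)
  then have "vdm2 {..<n} x = 0" by (intro vdm2_eq_0[of _ i j]) auto
  then show ?thesis by simp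
next
  case True
  define C where "C = 4 * R\<^sup>2 * (1 / h\<^sup>2 + 1 / R\<^sup>2)"
  define c0 where "c0 = ln R + 1 / 2"
  define k where "k i j = enn2real (kern h R (x i) (x j))" for i j
  have C0: "0 \<le> C" by (simp add: C_def)
  have kf: "kern h R (x i) (x j) = ennreal (k i j)" for i j
    unfolding k_def using kern_trunc_bounded[OF h R(1), of "x i" "x j"]
    by (intro ennreal_enn2real[symmetric]) (auto intro: le_less_trans)
  have k0: "0 \<le> k i j" for i j by (simp add: k_def)
  have kd: "k i i \<le> C" for i
    unfolding k_def C_def using kern_trunc_bounded[OF h R(1)] C0 by (intro enn2real_leI) (auto simp: C_def)
  have ko: "k i j \<le> c0 - ln \<bar>x i - x j\<bar>" if "i < n" "j < n" "i \<noteq> j" for i j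
  proof -
    have z: "0 < \<bar>x i - x j\<bar>" "\<bar>x i - x j\<bar> \<le> R" using True that x[of i] x[of j] R by (auto simp: inj_on_def)
    have "ennreal (k i j) \<le> ennreal (ln (R / \<bar>x i - x j\<bar>) + 1 / 2)"
      unfolding kf[symmetric] kern_log[OF z, symmetric] using h by (intro kern_mono_trunc) simp
    moreover have "0 \<le> ln (R / \<bar>x i - x j\<bar>)" using z by (intro ln_ge_zero) auto
    ultimately have "k i j \<le> ln (R / \<bar>x i - x j\<bar>) + 1 / 2" by (subst (asm) ennreal_le_iff) auto
    then show ?thesis using z R by (simp add: ln_div c0_def)
  qed
  have kmb: "(\<lambda>t. kern h R y t) \<in> borel_measurable borel" for y
    using measurable_compose[OF measurable_Pair1'[of y borel borel] kern_measurable[of h R]] by simp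
  have psu: "psupp {a..b} (emp n x)" using n x by (intro emp_psupp) auto
  have "een h R (emp n x) (emp n x) = (\<integral>\<^sup>+y. \<integral>\<^sup>+t. kern h R y t \<partial>emp n x \<partial>emp n x)" by (intro een_kern psuppD[OF psu])
  also have "... = (\<integral>\<^sup>+y. (\<Sum>j<n. kern h R y (x j)) / ennreal n \<partial>emp n x)"
    by (intro nn_integral_cong nn_integral_emp[OF n] kmb)
  also have "... = (\<Sum>i<n. (\<Sum>j<n. kern h R (x i) (x j)) / ennreal n) / ennreal n"
  proof (rule nn_integral_emp[OF n])
    have "(\<lambda>y. kern h R y (x j)) \<in> borel_measurable borel" for j using kmb[of "x j"] by (subst kern_commute) simp
    then show "(\<lambda>y. (\<Sum>j<n. kern h R y (x j)) / ennreal n) \<in> borel_measurable borel" by measurable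
  qed
  also have "... = ennreal ((\<Sum>i<n. \<Sum>j<n. k i j) / (real n)\<^sup>2)" unfolding kf using n k0
    by (simp add: sum_nonneg divide_ennreal sum_divide_distrib[symmetric] power2_eq_square)
  finally have "enn2real (een h R (emp n x) (emp n x)) = (\<Sum>i<n. \<Sum>j<n. k i j) / (real n)\<^sup>2" using k0 by (simp add: sum_nonneg)
  then have E: "(real n)\<^sup>2 * enn2real (een h R (emp n x) (emp n x)) = (\<Sum>i<n. \<Sum>j<n. k i j)" using n by simp
  define L where "L = (\<Sum>i<n. \<Sum>j\<in>{..<n} - {i}. ln \<bar>x i - x j\<bar>)"
  have "(\<Sum>i<n. \<Sum>j<n. k i j) = (\<Sum>i<n. k i i + (\<Sum>j\<in>{..<n} - {i}. k i j))" by (intro sum.cong refl) (subst sum.remove, auto)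
  also have "... \<le> (\<Sum>i<n. C + (\<Sum>j\<in>{..<n} - {i}. c0 - ln \<bar>x i - x j\<bar>))" using kd ko by (intro sum_mono add_mono) auto
  also have "... = real n * C + real n * (real n - 1) * c0 - L"
    using n by (simp add: L_def sum.distrib sum_subtractf card_Diff_singleton of_nat_diff)
  finally have le: "L \<le> real n * (real n - 1) * c0 - (real n)\<^sup>2 * enn2real (een h R (emp n x) (emp n x)) + real n * C"
    unfolding E by linarith
  have "vdm2 {..<n} x = exp L" unfolding vdm2_def L_def exp_sum[OF finite_lessThan]
  proof (intro prod.cong refl)
    fix i assume i: "i \<in> {..<n}"
    have "exp (\<Sum>j\<in>{..<n} - {i}. ln \<bar>x i - x j\<bar>) = (\<Prod>j\<in>{..<n} - {i}. exp (ln \<bar>x i - x j\<bar>))" by (rule exp_sum) simp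
    also have "... = (\<Prod>j\<in>{..<n} - {i}. \<bar>x i - x j\<bar>)" using True i by (intro prod.cong refl) (auto simp: inj_on_def)
    finally show "(\<Prod>j\<in>{..<n} - {i}. \<bar>x i - x j\<bar>) = exp (\<Sum>j\<in>{..<n} - {i}. ln \<bar>x i - x j\<bar>)" by simp
  qed
  then show ?thesis using le unfolding C_def c0_def by simp
qed

lemma potential_integral:
  assumes \<beta>: "psupp {a..b} \<beta>" and dom: "\<And>A. A \<in> sets borel \<Longrightarrow> emeasure \<beta> A \<le> ennreal M * emeasure lborel A"
    and M: "0 < M" and fe: "fin_en R \<beta>" and R: "0 < R" "b - a \<le> R"
  shows "integrable \<beta> (\<lambda>x. LINT t|\<beta>. ln \<bar>t - x\<bar>)"
    "(LINT x|\<beta>. LINT t|\<beta>. ln \<bar>t - x\<bar>) = ln R + 1 / 2 - ip R \<beta> \<beta>"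
proof -
  interpret b: prob_space \<beta> using psuppD[OF \<beta>] by simp
  interpret pair_prob_space \<beta> \<beta> ..
  note le = log_energy[OF \<beta> fe \<beta> fe R]
  have eq: "(\<lambda>z :: real \<times> real. ln \<bar>fst z - snd z\<bar>) = (\<lambda>(x, t). ln \<bar>t - x\<bar>)"
  proof (rule ext)
    fix z :: "real \<times> real"
    have "\<bar>fst z - snd z\<bar> = \<bar>snd z - fst z\<bar>" by (rule abs_minus_commute)
    then show "ln \<bar>fst z - snd z\<bar> = (case z of (x, t) \<Rightarrow> ln \<bar>t - x\<bar>)" by (simp only: case_prod_beta)
  qed
  have i: "integrable (\<beta> \<Otimes>\<^sub>M \<beta>) (\<lambda>(x, t). ln \<bar>t - x\<bar>)" using le(2) unfolding eq .
  show "integrable \<beta> (\<lambda>x. LINT t|\<beta>. ln \<bar>t - x\<bar>)" by (rule integrable_fst[OF i])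
  show "(LINT x|\<beta>. LINT t|\<beta>. ln \<bar>t - x\<bar>) = ln R + 1 / 2 - ip R \<beta> \<beta>" unfolding integral_fst[OF i] using le(3) unfolding eq .
qed

lemma AE_PiM_all:
  assumes "psupp S \<sigma>" "finite I"
  shows "AE x in Pi\<^sub>M I (\<lambda>_. \<sigma>). \<forall>i\<in>I. x i \<in> S"
proof (intro eventually_ball_finite ballI assms(2))
  fix i assume "i \<in> I"
  then show "AE x in Pi\<^sub>M I (\<lambda>_. \<sigma>). x i \<in> S"
    using psuppD(1)[OF assms(1)] psuppD(6)[OF assms(1)] by (intro AE_PiM_component) auto
qed

text \<open>Jensen's inequality for the product of copies of \<beta>, followed by a change to
  \<sigma>. Domination by Lebesgue measure makes the potential of \<beta> finite at every point, as
  Jensen requires; domination by \<sigma> permits the change, at the cost M^n.\<close>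

lemma partition_function_lower:
  assumes \<sigma>: "psupp S \<sigma>" and \<beta>: "psupp {a..b} \<beta>" "fin_en R \<beta>" and R: "0 < R" "b - a \<le> R"
    and M: "0 < M" "0 < M'"
    and dom: "\<And>A. A \<in> sets borel \<Longrightarrow> emeasure \<beta> A \<le> ennreal M * emeasure \<sigma> A"
      "\<And>A. A \<in> sets borel \<Longrightarrow> emeasure \<beta> A \<le> ennreal M' * emeasure lborel A"
    and g: "g \<in> borel_measurable borel" "\<And>x. \<bar>g x\<bar> \<le> B"
  shows "ennreal (exp (real n * (real n - 1) * (ln R + 1 / 2 - ip R \<beta> \<beta>) + real n * (LINT x|\<beta>. g x)))
    \<le> ennreal (M ^ n) * (\<integral>\<^sup>+x. ennreal (vdm2 {..<n} x * (\<Prod>i<n. exp (g (x i)))) \<partial>Pi\<^sub>M {..<n} (\<lambda>_. \<sigma>))"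
proof -
  interpret b: prob_space \<beta> using psuppD[OF \<beta>(1)] by simp
  have pot: "integrable \<beta> (\<lambda>x. LINT t|\<beta>. ln \<bar>t - x\<bar>)"
    "(LINT x|\<beta>. LINT t|\<beta>. ln \<bar>t - x\<bar>) = ln R + 1 / 2 - ip R \<beta> \<beta>"
    by (rule potential_integral[OF \<beta>(1) _ M(2) \<beta>(2) R]; rule dom(2); assumption)+
  have bd: "integrable \<beta> (\<lambda>t. ln \<bar>t - x\<bar>)" "emeasure \<beta> {x} = 0" for x
    by (rule bounded_density_log_integrable[OF \<beta>(1) _ M(2)]; rule dom(2); assumption)+
  have gi: "integrable \<beta> g"
    using g psuppD(2)[OF \<beta>(1)] by (intro b.integrable_const_bound[of _ B]) (auto cong: measurable_cong_sets)
  have "ennreal (exp (real n * (real n - 1) * (ln R + 1 / 2 - ip R \<beta> \<beta>) + real n * (LINT x|\<beta>. g x)))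
    \<le> (\<integral>\<^sup>+x. ennreal (vdm2 {..<n} x * (\<Prod>i<n. exp (g (x i)))) \<partial>Pi\<^sub>M {..<n} (\<lambda>_. \<beta>))"
    using vdm2_jensen_lower_bound[OF psuppD(1,2)[OF \<beta>(1)] bd(2) bd(1) pot(1) gi, of n] unfolding pot(2) .
  also have "... \<le> ennreal M ^ n * (\<integral>\<^sup>+x. ennreal (vdm2 {..<n} x * (\<Prod>i<n. exp (g (x i)))) \<partial>Pi\<^sub>M {..<n} (\<lambda>_. \<sigma>))"
    using g(1) by (intro nn_integral_PiM_mono_measure psuppD(1,2)[OF \<sigma>] psuppD(1,2)[OF \<beta>(1)] dom(1)
      measurable_compose[OF vdm2_field_measurable measurable_ennreal]) auto
  also have "ennreal M ^ n = ennreal (M ^ n)" using M by (simp add: ennreal_power)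
  finally show ?thesis .
qed

text \<open>The diagonal is a null set of the product measure and contains the square of every
  atom.\<close>

lemma no_atoms_of_finite_energy:
  assumes \<mu>: "psupp {a..b} \<mu>" "fin_en R \<mu>" and R: "0 < R" "b - a \<le> R"
  shows "emeasure \<mu> {x} = 0"
proof -
  interpret m: prob_space \<mu> using psuppD[OF \<mu>(1)] by simp
  interpret pair_prob_space \<mu> \<mu> ..
  have s [measurable_cong]: "sets \<mu> = sets borel" using psuppD[OF \<mu>(1)] by simp
  have "AE z in \<mu> \<Otimes>\<^sub>M \<mu>. z \<notin> {x} \<times> {x}" using log_energy(1)[OF \<mu> \<mu> R] by eventually_elim auto
  then have "emeasure (\<mu> \<Otimes>\<^sub>M \<mu>) ({x} \<times> {x}) = 0" using s by (subst (asm) AE_iff_measurable[of "{x} \<times> {x}"])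
      (auto simp: space_pair_measure psuppD(3)[OF \<mu>(1)] simp del: insert_Times_insert Sigma_empty1 Sigma_empty2 intro!: pair_measureI)
  then have "emeasure \<mu> {x} * emeasure \<mu> {x} = 0" using s by (subst (asm) m.emeasure_pair_measure_Times) auto
  then show ?thesis by simp
qed

text \<open>Clamping the arguments turns the logarithms below into bounded continuous functions on the
  whole line without changing integrals of measures on \<open>[a, b]\<close>.\<close>

definition cl :: "real \<Rightarrow> real \<Rightarrow> real \<Rightarrow> real" where
  "cl a b t = max a (min b t)"

lemma cl_in: "a \<le> b \<Longrightarrow> cl a b t \<in> {a..b}"
  by (simp add: cl_def)

lemma cl_id: "t \<in> {a..b} \<Longrightarrow> cl a b t = t"
  by (simp add: cl_def)

lemma continuous_on_cl [continuous_intros]: "continuous_on A f \<Longrightarrow> continuous_on A (\<lambda>x. cl a b (f x))"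
  unfolding cl_def by (intro continuous_intros)

lemma cl_measurable [measurable]: "cl a b \<in> borel_measurable borel"
  unfolding cl_def by measurable

text \<open>The configurations in Heine's formula are split by the truncated energy of their
  empirical measure. Near the minimum, concentration forces prod (z - x i) between exp (n (l -
  \<delta>)) and exp (n (l + \<delta>)). The others have an integrand that is exp (- n^2 \<epsilon>
  / 2 + O(n)) relative to the partition integral.\<close>

lemma heine_two_sided:
  fixes \<sigma> \<beta> :: "real measure" and Q :: "real poly" and G g k :: "real \<Rightarrow> real" and n :: nat
  assumes F: "F \<in> sets borel" "F \<subseteq> {a..b}" "a < b" and \<sigma>: "psupp F \<sigma>" and R: "0 < R" "b - a \<le> R"
    and g: "g \<in> borel_measurable borel" "\<And>x. \<bar>g x\<bar> \<le> B" and k: "k \<in> borel_measurable borel" "\<And>x. \<bar>k x\<bar> \<le> Bk"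
    and G: "G \<in> borel_measurable borel" "\<And>x. \<bar>G x\<bar> \<le> B" and gG: "\<And>x. \<bar>g x - G x\<bar> \<le> \<epsilon> / 8"
    and \<beta>: "psupp {a..b} \<beta>" "fin_en R \<beta>" and M: "0 < M" "0 < M'"
    and dom: "\<And>A. A \<in> sets borel \<Longrightarrow> emeasure \<beta> A \<le> ennreal M * emeasure \<sigma> A"
      "\<And>A. A \<in> sets borel \<Longrightarrow> emeasure \<beta> A \<le> ennreal M' * emeasure lborel A"
    and E: "ip R \<beta> \<beta> + (LINT x|\<beta>. G x) \<le> e + \<epsilon> / 4"
    and n: "n \<ge> 1" and Q: "degree Q = n" "lead_coeff Q = 1"
    and orth: "\<And>j. j < n \<Longrightarrow> (LINT t|\<sigma>. poly Q t * t ^ j * (exp (- (real n * g t) - k t) * indicator {a..b} t)) = 0"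
    and h: "0 < h" and z: "b < z" and \<epsilon>: "0 < \<epsilon>"
    and conc: "\<And>\<mu>. psupp F \<mu> \<Longrightarrow> enn2real (een h R \<mu> \<mu>) + (LINT x|\<mu>. G x) \<le> e + \<epsilon> \<Longrightarrow>
        \<bar>(LINT t|\<mu>. ln (z - cl a b t)) - l\<bar> < \<delta>"
    and C: "C = 4 * R\<^sup>2 * (1 / h\<^sup>2 + 1 / R\<^sup>2) + 2 * Bk + ln M"
  shows "poly Q z \<le> exp (real n * (l + \<delta>)) + (z - a) ^ n * exp (- (real n)\<^sup>2 * \<epsilon> / 2 + real n * C)"
    and "exp (real n * (l - \<delta>)) * (1 - exp (- (real n)\<^sup>2 * \<epsilon> / 2 + real n * C)) \<le> poly Q z"
proof -
  let ?P = "Pi\<^sub>M {..<n} (\<lambda>_. \<sigma>)"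
  interpret s: prob_space \<sigma> using psuppD[OF \<sigma>] by simp
  interpret b: prob_space \<beta> using psuppD[OF \<beta>(1)] by simp
  interpret P: prob_space "?P" by (intro prob_space_PiM psuppD(1)[OF \<sigma>])
  note [measurable] = g(1) k(1) G(1)
  define c0 where "c0 = ln R + 1 / 2"
  define Ch where "Ch = 4 * R\<^sup>2 * (1 / h\<^sup>2 + 1 / R\<^sup>2)"
  define gg where "gg t = - (real n * g t) - k t" for t
  define w where "w t = exp (gg t) * indicator {a..b} t" for t
  define V where "V x = vdm2 {..<n} x * (\<Prod>i<n. w (x i))" for x
  define Pz where "Pz x = (\<Prod>i<n. (z - x i))" for x
  define Z where "Z = (LINT x|?P. V x)"
  \<comment> \<open>Bounds the integrand on configurations of excess energy: e + \<epsilon> is the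
    threshold, \<epsilon> / 8 the error of replacing g by G, \<open>Ch\<close> the diagonal of the
    truncated kernel, \<open>Bk\<close> the bounded part of the weight.\<close>
  define Bb where "Bb = exp (real n * (real n - 1) * c0 - (real n)\<^sup>2 * (e + \<epsilon>) + (real n)\<^sup>2 * (\<epsilon> / 8) + n * Ch + n * Bk)"
  have B0: "0 \<le> B" "0 \<le> Bk" using G(2)[of 0] k(2)[of 0] by linarith+
  have [measurable]: "gg \<in> borel_measurable borel" "w \<in> borel_measurable borel" unfolding gg_def w_def by measurable
  have ggb: "\<bar>gg x\<bar> \<le> n * B + Bk" for x
  proof -
    have "\<bar>real n * g x\<bar> \<le> n * B" unfolding abs_mult using g(2)[of x] by (simp add: mult_left_mono)
    then show ?thesis using k(2)[of x] unfolding gg_def by linarith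
  qed
  have wb: "\<bar>w x\<bar> \<le> exp (n * B + Bk)" for x using ggb[of x] by (simp add: w_def indicator_def abs_le_iff)
  have w0: "w x = 0" if "x \<notin> {a..b}" for x using that by (simp add: w_def)
  have wn: "0 \<le> w x" for x by (simp add: w_def)
  have Vn: "0 \<le> V x" for x unfolding V_def by (intro mult_nonneg_nonneg vdm2_nonneg prod_nonneg) (simp add: wn)
  have iV: "integrable ?P V" unfolding V_def
    by (rule integrable_PiM_weight[where W = "exp (n * B + Bk)" and a = a and b = b])
      (use psuppD(1,2)[OF \<sigma>] wb w0 in \<open>auto intro!: vdm2_measurable bdd_cube_vdm2\<close>)
  have iPV: "integrable ?P (\<lambda>x. Pz x * V x)"
  proof -
    have "integrable ?P (\<lambda>x. (Pz x * vdm2 {..<n} x) * (\<Prod>i<n. w (x i)))" unfolding Pz_def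
      by (rule integrable_PiM_weight[where W = "exp (n * B + Bk)" and a = a and b = b])
        (use psuppD(1,2)[OF \<sigma>] wb w0 in \<open>auto intro!: vdm2_measurable bdd_cube_vdm2 bdd_cube_mult bdd_cube_prod
        bdd_cube_diff' borel_measurable_times borel_measurable_prod borel_measurable_diff measurable_component_singleton\<close>)
    then show ?thesis by (simp add: V_def mult.assoc)
  qed
  have heine: "poly Q z * Z = (LINT x|?P. Pz x * V x)" unfolding Z_def V_def Pz_def mult.assoc[symmetric]
  proof (rule heine_formula[where W = "exp (n * B + Bk)" and a = a and b = b])
    show "(LINT t|\<sigma>. poly Q t * t ^ j * w t) = 0" if "j < card {..<n}" for j
      using orth[of j] that by (simp add: w_def gg_def)
  qed (use psuppD(1,2)[OF \<sigma>] Q wb w0 in auto)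
  have AEF: "AE x in ?P. \<forall>i<n. x i \<in> F" using AE_PiM_all[OF \<sigma>, of "{..<n}"] by (simp add: Ball_def)
  have z0: "0 < z - b" "0 < z - a" using z F(3) by auto
  have ln_bound: "(\<Prod>i<n. w (x i)) = exp (\<Sum>i<n. gg (x i))" if "\<forall>i<n. x i \<in> F" for x
    using that F(2) by (simp add: w_def exp_sum subset_eq)
  have bad: "V x \<le> Bb" if x: "\<forall>i<n. x i \<in> F" and nb: "\<not> enn2real (een h R (emp n x) (emp n x)) + (LINT t|emp n x. G t) \<le> e + \<epsilon>" for x
  proof -
    define En where "En = enn2real (een h R (emp n x) (emp n x))"
    have GE: "(LINT t|emp n x. G t) = (\<Sum>i<n. G (x i)) / n" by (rule integral_emp[OF n]) measurable
    have "(\<Sum>i<n. gg (x i)) \<le> (\<Sum>i<n. - (real n * G (x i)) + real n * (\<epsilon> / 8) + Bk)"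
    proof (rule sum_mono)
      fix i
      have "real n * (G (x i) - g (x i)) \<le> real n * (\<epsilon> / 8)" using gG[of "x i"] by (intro mult_left_mono) linarith+
      then show "gg (x i) \<le> - (real n * G (x i)) + real n * (\<epsilon> / 8) + Bk"
        using k(2)[of "x i"] by (simp add: gg_def algebra_simps)
    qed
    also have "... = - (real n * (\<Sum>i<n. G (x i))) + (real n)\<^sup>2 * (\<epsilon> / 8) + n * Bk"
      by (simp only: sum.distrib sum_negf sum_distrib_left[symmetric] sum_constant card_lessThan power2_eq_square mult.assoc)
    also have "real n * (\<Sum>i<n. G (x i)) = (real n)\<^sup>2 * (LINT t|emp n x. G t)" using n by (simp add: GE power2_eq_square)
    finally have s: "(\<Sum>i<n. gg (x i)) \<le> - ((real n)\<^sup>2 * (LINT t|emp n x. G t)) + (real n)\<^sup>2 * (\<epsilon> / 8) + n * Bk" .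
    have "V x \<le> exp (real n * (real n - 1) * c0 - (real n)\<^sup>2 * En + n * Ch) * exp (\<Sum>i<n. gg (x i))"
      unfolding V_def ln_bound[OF x] En_def c0_def Ch_def
      using x F(2) by (intro mult_right_mono vdm2_le_energy[OF n _ R h]) auto
    also have "... = exp (real n * (real n - 1) * c0 - (real n)\<^sup>2 * En + n * Ch + (\<Sum>i<n. gg (x i)))" by (simp add: exp_add)
    also have "... \<le> Bb"
    proof -
      have "(real n)\<^sup>2 * (e + \<epsilon>) \<le> (real n)\<^sup>2 * (En + (LINT t|emp n x. G t))"
        using nb by (intro mult_left_mono) (auto simp: En_def)
      then have "(real n)\<^sup>2 * (e + \<epsilon>) \<le> (real n)\<^sup>2 * En + (real n)\<^sup>2 * (LINT t|emp n x. G t)" by (simp only: distrib_left)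
      then have "real n * (real n - 1) * c0 - (real n)\<^sup>2 * En + real n * Ch + (\<Sum>i<n. gg (x i))
        \<le> real n * (real n - 1) * c0 - (real n)\<^sup>2 * (e + \<epsilon>) + (real n)\<^sup>2 * (\<epsilon> / 8) + n * Ch + n * Bk" using s by linarith
      then show ?thesis unfolding Bb_def exp_le_cancel_iff .
    qed
    finally show ?thesis .
  qed
  have good: "exp (n * (l - \<delta>)) \<le> Pz x \<and> Pz x \<le> exp (n * (l + \<delta>))"
    if x: "\<forall>i<n. x i \<in> F" and nb: "enn2real (een h R (emp n x) (emp n x)) + (LINT t|emp n x. G t) \<le> e + \<epsilon>" for x
  proof -
    have ps: "psupp F (emp n x)" using x F(1) by (intro emp_psupp[OF n]) auto
    have "(LINT t|emp n x. ln (z - cl a b t)) = (\<Sum>i<n. ln (z - cl a b (x i))) / n" by (rule integral_emp[OF n]) measurable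
    also have "(\<Sum>i<n. ln (z - cl a b (x i))) = (\<Sum>i<n. ln (z - x i))"
      using x F(2) by (intro sum.cong refl) (auto simp: cl_id subset_eq)
    finally have eq: "(\<Sum>i<n. ln (z - x i)) = n * (LINT t|emp n x. ln (z - cl a b t))" using n by simp
    have "Pz x = exp (\<Sum>i<n. ln (z - x i))"
      unfolding Pz_def exp_sum[OF finite_lessThan] using x F(2) z by (intro prod.cong refl) (force simp: subset_eq)
    also have "... = exp (n * (LINT t|emp n x. ln (z - cl a b t)))" unfolding eq ..
    finally have P: "Pz x = exp (n * (LINT t|emp n x. ln (z - cl a b t)))" .
    show ?thesis unfolding P using conc[OF ps nb] by (auto intro!: mult_left_mono)
  qed
  have Pn: "0 \<le> Pz x \<and> Pz x \<le> (z - a) ^ n" if x: "\<forall>i<n. x i \<in> F" for x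
  proof -
    have "(\<Prod>i<n. (z - x i)) \<le> (\<Prod>i<n. (z - a))" using x F(2) z by (intro prod_mono) (force simp: subset_eq)
    moreover have "0 \<le> (\<Prod>i<n. (z - x i))" using x F(2) z by (intro prod_nonneg) (force simp: subset_eq)
    ultimately show ?thesis by (simp add: Pz_def)
  qed
  have Bb0: "0 \<le> Bb" by (simp add: Bb_def)
  \<comment> \<open>On configurations of excess energy V x - Bb is nonpositive, which makes the
    lower estimate trivial there. Both kinds of configurations thus satisfy one inequality that can
    be integrated.\<close>
  have two_sided: "exp (n * (l - \<delta>)) * (V x - Bb) \<le> Pz x * V x \<and> Pz x * V x \<le> exp (n * (l + \<delta>)) * V x + (z - a) ^ n * Bb"
    if x: "\<forall>i<n. x i \<in> F" for x
  proof (cases "enn2real (een h R (emp n x) (emp n x)) + (LINT t|emp n x. G t) \<le> e + \<epsilon>")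
    case True
    have "exp (n * (l - \<delta>)) * (V x - Bb) \<le> exp (n * (l - \<delta>)) * V x" using Bb0 by (intro mult_left_mono) auto
    moreover have "exp (n * (l - \<delta>)) * V x \<le> Pz x * V x" "Pz x * V x \<le> exp (n * (l + \<delta>)) * V x"
      using good[OF x True] Vn by (auto intro!: mult_right_mono)
    moreover have "0 \<le> (z - a) ^ n * Bb" using z0 Bb0 by simp
    ultimately show ?thesis by linarith
  next
    case False
    have "exp (n * (l - \<delta>)) * (V x - Bb) \<le> 0" using bad[OF x False] by (intro mult_nonneg_nonpos) auto
    moreover have "0 \<le> Pz x * V x" "0 \<le> exp (n * (l + \<delta>)) * V x" using Pn[OF x] Vn by (auto intro: mult_nonneg_nonneg)
    moreover have "Pz x * V x \<le> (z - a) ^ n * Bb" using Pn[OF x] bad[OF x False] Vn z0 by (intro mult_mono) auto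
    ultimately show ?thesis by linarith
  qed
  have "(LINT x|?P. Pz x * V x) \<le> (LINT x|?P. exp (n * (l + \<delta>)) * V x + (z - a) ^ n * Bb)"
    by (rule integral_mono_AE[OF iPV]) (use iV AEF two_sided in \<open>auto elim!: eventually_mono\<close>)
  then have up: "poly Q z * Z \<le> exp (n * (l + \<delta>)) * Z + (z - a) ^ n * Bb" using heine iV by (simp add: Z_def P.prob_space)
  have "(LINT x|?P. exp (n * (l - \<delta>)) * (V x - Bb)) \<le> (LINT x|?P. Pz x * V x)"
    by (rule integral_mono_AE[OF _ iPV]) (use iV AEF two_sided in \<open>auto elim!: eventually_mono\<close>)
  then have low: "exp (n * (l - \<delta>)) * (Z - Bb) \<le> poly Q z * Z" using heine iV by (simp add: Z_def P.prob_space)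
  define r where "r = exp (- (real n)\<^sup>2 * \<epsilon> / 2 + n * C)"
  \<comment> \<open>The balance of the coefficients of n^2: excess energy gives - (e + \<epsilon>) +
    \<epsilon> / 8, the competitor \<beta> gives at least - (e + \<epsilon> / 4 + \<epsilon> / 8),
    and the difference is - \<epsilon> / 2. The linear terms \<open>Ch\<close>, twice
    \<open>Bk\<close> and \<open>ln M\<close> make up C.\<close>
  have ratio: "Bb \<le> r * Z"
  proof -
    have gi: "integrable \<beta> g" "integrable \<beta> k" "integrable \<beta> G" using g k G psuppD(2)[OF \<beta>(1)]
      by (auto intro!: b.integrable_const_bound[of g B] b.integrable_const_bound[of k Bk] b.integrable_const_bound[of G B] cong: measurable_cong_sets)
    have intgg: "(LINT x|\<beta>. gg x) = - (n * (LINT x|\<beta>. g x)) - (LINT x|\<beta>. k x)" unfolding gg_def using gi by simp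
    have ikb: "(LINT x|\<beta>. k x) \<le> Bk"
    proof -
      have "(LINT x|\<beta>. k x) \<le> (LINT x|\<beta>. Bk)" using gi k(2) by (intro integral_mono) (auto simp: abs_le_iff)
      then show ?thesis using b.prob_space by simp
    qed
    have igb: "(LINT x|\<beta>. g x) \<le> (LINT x|\<beta>. G x) + \<epsilon> / 8"
    proof -
      have "(LINT x|\<beta>. g x) \<le> (LINT x|\<beta>. G x + \<epsilon> / 8)"
      proof (rule integral_mono)
        show "g x \<le> G x + \<epsilon> / 8" for x using gG[of x] by linarith
      qed (use gi in auto)
      also have "... = (LINT x|\<beta>. G x) + \<epsilon> / 8" using gi b.prob_space by simp
      finally show ?thesis .
    qed
    have ipn: "0 \<le> ip R \<beta> \<beta>" by (intro integral_nonneg_AE AE_I2) (simp add: seg_nonneg)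
    have nnZ: "(\<integral>\<^sup>+x. ennreal (vdm2 {..<n} x * (\<Prod>i<n. exp (gg (x i)))) \<partial>?P) = ennreal Z"
    proof -
      have "(\<integral>\<^sup>+x. ennreal (vdm2 {..<n} x * (\<Prod>i<n. exp (gg (x i)))) \<partial>?P) = (\<integral>\<^sup>+x. ennreal (V x) \<partial>?P)" using AEF
      proof (intro nn_integral_cong_AE, eventually_elim)
        case (elim x)
        have "(\<Prod>i<n. w (x i)) = (\<Prod>i<n. exp (gg (x i)))"
          using elim F(2) by (intro prod.cong refl) (auto simp: w_def subset_eq)
        then show ?case by (simp add: V_def)
      qed
      also have "... = ennreal Z" unfolding Z_def by (rule nn_integral_eq_integral[OF iV]) (rule AE_I2, rule Vn)
      finally show ?thesis .
    qed
    have Zn: "0 \<le> Z" unfolding Z_def by (rule integral_nonneg_AE) (rule AE_I2, rule Vn)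
    have gm: "gg \<in> borel_measurable borel" by measurable
    have "ennreal (exp (real n * (real n - 1) * (ln R + 1 / 2 - ip R \<beta> \<beta>) + real n * (LINT x|\<beta>. gg x))) \<le> ennreal (M ^ n) * ennreal Z"
      unfolding nnZ[symmetric] by (rule partition_function_lower[OF \<sigma> \<beta> R M _ _ gm ggb]; rule dom; assumption)
    also have "... = ennreal (M ^ n * Z)" using M Zn by (intro ennreal_mult[symmetric]) auto
    finally have "exp (real n * (real n - 1) * (c0 - ip R \<beta> \<beta>) + real n * (LINT x|\<beta>. gg x)) \<le> M ^ n * Z"
      using M Zn unfolding c0_def by (subst (asm) ennreal_le_iff) auto
    moreover have "exp (real n * (real n - 1) * c0 - (real n)\<^sup>2 * (e + \<epsilon> / 4 + \<epsilon> / 8) - n * Bk)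
       \<le> exp (real n * (real n - 1) * (c0 - ip R \<beta> \<beta>) + real n * (LINT x|\<beta>. gg x))"
    proof -
      \<comment> \<open>Passing from n (n - 1) to n^2 only lowers the bound, since the energy is
        nonnegative.\<close>
      have "real n * (real n - 1) * ip R \<beta> \<beta> \<le> (real n)\<^sup>2 * ip R \<beta> \<beta>"
        using ipn by (intro mult_right_mono) (auto simp: power2_eq_square intro!: mult_left_mono)
      moreover have "real n * (real n * (LINT x|\<beta>. g x)) \<le> (real n)\<^sup>2 * ((LINT x|\<beta>. G x) + \<epsilon> / 8)"
        unfolding power2_eq_square mult.assoc using igb by (intro mult_left_mono) auto
      moreover have "real n * (LINT x|\<beta>. k x) \<le> n * Bk" using ikb by (intro mult_left_mono) auto
      moreover have "(real n)\<^sup>2 * (ip R \<beta> \<beta> + (LINT x|\<beta>. G x)) \<le> (real n)\<^sup>2 * (e + \<epsilon> / 4)" using E by (intro mult_left_mono) auto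
      ultimately show ?thesis unfolding intgg by (simp add: algebra_simps)
    qed
    ultimately have "exp (real n * (real n - 1) * c0 - (real n)\<^sup>2 * (e + \<epsilon> / 4 + \<epsilon> / 8) - n * Bk) \<le> M ^ n * Z" by linarith
    moreover have "Bb = exp (- (real n)\<^sup>2 * \<epsilon> / 2 + n * (Ch + 2 * Bk)) * exp (real n * (real n - 1) * c0 - (real n)\<^sup>2 * (e + \<epsilon> / 4 + \<epsilon> / 8) - n * Bk)"
      unfolding Bb_def exp_add[symmetric] by (simp add: algebra_simps)
    ultimately have "Bb \<le> exp (- (real n)\<^sup>2 * \<epsilon> / 2 + n * (Ch + 2 * Bk)) * (M ^ n * Z)" by (metis exp_ge_zero mult_left_mono)
    also have "M ^ n = exp (n * ln M)" using M by (simp add: exp_of_nat_mult)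
    also have "exp (- (real n)\<^sup>2 * \<epsilon> / 2 + n * (Ch + 2 * Bk)) * (exp (n * ln M) * Z) = r * Z"
      unfolding r_def C Ch_def mult.assoc[symmetric] exp_add[symmetric] by (simp add: algebra_simps)
    finally show ?thesis .
  qed
  \<comment> \<open>Positivity of the partition integral follows from \<open>ratio\<close>, since Bb
    > 0.\<close>
  have Zpos: "0 < Z"
  proof -
    have "0 < Bb" by (simp add: Bb_def)
    also have "... \<le> r * Z" by (rule ratio)
    finally show ?thesis by (simp add: r_def zero_less_mult_iff)
  qed
  have "poly Q z * Z \<le> (exp (n * (l + \<delta>)) + (z - a) ^ n * r) * Z"
  proof -
    have "(z - a) ^ n * Bb \<le> (z - a) ^ n * (r * Z)" using ratio z0 by (intro mult_left_mono) auto
    then show ?thesis using up by (simp add: algebra_simps)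
  qed
  then show "poly Q z \<le> exp (n * (l + \<delta>)) + (z - a) ^ n * exp (- (real n)\<^sup>2 * \<epsilon> / 2 + n * C)" using Zpos by (simp add: r_def)
  have "exp (n * (l - \<delta>)) * (1 - r) * Z \<le> poly Q z * Z"
  proof -
    have "exp (n * (l - \<delta>)) * (Z - r * Z) \<le> exp (n * (l - \<delta>)) * (Z - Bb)" using ratio by (intro mult_left_mono) auto
    then have "exp (n * (l - \<delta>)) * (Z - r * Z) \<le> poly Q z * Z" using low by (rule order_trans)
    then show ?thesis by (simp add: left_diff_distrib mult.assoc)
  qed
  then show "exp (n * (l - \<delta>)) * (1 - exp (- (real n)\<^sup>2 * \<epsilon> / 2 + n * C)) \<le> poly Q z" using Zpos by (simp add: r_def)
qed

text \<open>For a fixed tolerance, the error terms of the two-sided estimate are exp (- n^2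
  \<epsilon> / 2 + O(n)) while the main terms are exponential in n, so they disappear in the n-th
  root. The fields vary with the index; uniform closeness to G absorbs this into \<epsilon> /
  8.\<close>

lemma heine_limit:
  fixes \<sigma> \<omega> :: "real measure" and Q :: "nat \<Rightarrow> real poly" and G k :: "real \<Rightarrow> real" and g :: "nat \<Rightarrow> real \<Rightarrow> real"
  assumes F: "compact F" "F \<subseteq> {a..b}" "a < b" "finite (F - interior F)" and \<sigma>: "psupp F \<sigma>"
    and dens: "AE t in lborel. t \<in> F \<longrightarrow> pos_density_at \<sigma> t" and R: "0 < R" "b - a \<le> R"
    and g: "\<And>m. g m \<in> borel_measurable borel" "\<And>m x. \<bar>g m x\<bar> \<le> B" and k: "k \<in> borel_measurable borel" "\<And>x. \<bar>k x\<bar> \<le> Bk"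
    and G: "continuous_on UNIV G" "\<And>x. \<bar>G x\<bar> \<le> B" and gG: "uniform_limit UNIV g G sequentially"
    and \<omega>: "psupp F \<omega>" "fin_en R \<omega>"
    and min: "\<And>\<kappa>. psupp F \<kappa> \<Longrightarrow> fin_en R \<kappa> \<Longrightarrow> ip R \<omega> \<omega> + (LINT x|\<omega>. G x) \<le> ip R \<kappa> \<kappa> + (LINT x|\<kappa>. G x)"
    and N: "filterlim N at_top sequentially" "\<And>m. N m \<ge> 1"
    and Q: "\<And>m. degree (Q m) = N m" "\<And>m. lead_coeff (Q m) = 1"
    and orth: "\<And>m j. j < N m \<Longrightarrow> (LINT t|\<sigma>. poly (Q m) t * t ^ j * (exp (- (real (N m) * g m t) - k t) * indicator {a..b} t)) = 0"
    and z: "b < z"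
  shows "(\<lambda>m. ln (poly (Q m) z) / N m) \<longlonglongrightarrow> (LINT t|\<omega>. ln (z - cl a b t))"
proof -
  define l where "l = (LINT t|\<omega>. ln (z - cl a b t))"
  have Fb: "F \<in> sets borel" "closed F" using F(1) by (auto intro: borel_compact compact_imp_closed)
  have Gm: "G \<in> borel_measurable borel" using G(1) by (rule borel_measurable_continuous_onI)
  have \<omega>ab: "psupp {a..b} \<omega>" by (rule psupp_mono[OF \<omega>(1) F(2)])
  have at: "emeasure \<omega> {x} = 0" for x by (rule no_atoms_of_finite_energy[OF \<omega>ab \<omega>(2) R])
  have "(\<lambda>m. ln (poly (Q m) z) / N m) \<longlonglongrightarrow> l"
  proof (rule tendstoI)
    fix \<delta>0 :: real assume \<delta>0: "0 < \<delta>0"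
    define \<delta> where "\<delta> = \<delta>0 / 2"
    have \<delta>: "0 < \<delta>" using \<delta>0 by (simp add: \<delta>_def)
    define f where "f t = ln (z - cl a b t)" for t
    have clr: "z - b \<le> z - cl a b t \<and> z - cl a b t \<le> z - a" for t using cl_in[of a b t] F(3) by auto
    have fc: "continuous_on UNIV f" unfolding f_def using clr z by (intro continuous_intros) (smt (verit, best))
    have fb: "\<bar>f t\<bar> \<le> \<bar>ln (z - b)\<bar> + \<bar>ln (z - a)\<bar>" for t
    proof -
      have "ln (z - b) \<le> f t" "f t \<le> ln (z - a)" unfolding f_def using clr[of t] z F(3) by (auto intro!: ln_mono)
      then show ?thesis by linarith
    qed
    obtain m0 :: nat where conc: "\<And>\<mu>. psupp F \<mu> \<Longrightarrow>
      enn2real (een (1 / Suc m0) R \<mu> \<mu>) + (LINT x|\<mu>. G x) \<le> ip R \<omega> \<omega> + (LINT x|\<omega>. G x) + 1 / Suc m0 \<Longrightarrow>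
      \<bar>(LINT x|\<mu>. f x) - (LINT x|\<omega>. f x)\<bar> < \<delta>"
      by (rule energy_concentration[OF Fb(2) F(2) R G \<omega> min fc fb \<delta>]; (assumption | (rule that, assumption)))
    \<comment> \<open>The number that is the cut-off of the kernel in \<open>conc\<close> also
      serves as the tolerance for the energy.\<close>
    define \<epsilon> where "\<epsilon> = 1 / real (Suc m0)"
    have \<epsilon>: "0 < \<epsilon>" by (simp add: \<epsilon>_def)
    have \<epsilon>8: "0 < \<epsilon> / 8" using \<epsilon> by simp
    define e where "e = ip R \<omega> \<omega> + (LINT x|\<omega>. G x)"
    obtain \<beta> M M' where \<beta>: "psupp F \<beta>" "fin_en R \<beta>" "ip R \<beta> \<beta> \<le> ip R \<omega> \<omega> + \<epsilon> / 8"
      "(LINT x|\<beta>. G x) \<le> (LINT x|\<omega>. G x) + \<epsilon> / 8" and M: "M > (0::real)" "M' > (0::real)"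
      and dom: "\<And>A. A \<in> sets borel \<Longrightarrow> emeasure \<beta> A \<le> ennreal M * emeasure \<sigma> A"
      "\<And>A. A \<in> sets borel \<Longrightarrow> emeasure \<beta> A \<le> ennreal M' * emeasure lborel A"
      by (rule smooth_approximation[OF psuppD(4,2)[OF \<sigma>] F(1,4) dens \<omega> at G \<epsilon>8]; (assumption | (rule that; assumption)))
    have E: "ip R \<beta> \<beta> + (LINT x|\<beta>. G x) \<le> e + \<epsilon> / 4" using \<beta>(3,4) unfolding e_def by linarith
    define C where "C = 4 * R\<^sup>2 * (1 / (1 / real (Suc m0))\<^sup>2 + 1 / R\<^sup>2) + 2 * Bk + ln M"
    \<comment> \<open>Exceeds the coefficients of n in the exponents below, with a reserve of 2; n
      >= 2 c1 / \<epsilon> makes n^2 \<epsilon> / 2 at least n c1.\<close>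
    define c1 where "c1 = \<bar>C\<bar> + \<bar>ln (z - a)\<bar> + \<bar>l + \<delta>\<bar> + 2"
    have c1: "0 < c1" by (simp add: c1_def)
    have evg: "\<forall>\<^sub>F m in sequentially. \<forall>x\<in>UNIV. dist (g m x) (G x) < \<epsilon> / 8" using gG \<epsilon>8 unfolding uniform_limit_iff by blast
    \<comment> \<open>The summand 2 / \<delta> ensures n \<delta> > 1 > ln 2, which absorbs the
      factors 2 in \<open>q_up\<close> and \<open>q_low\<close>.\<close>
    have evN: "\<forall>\<^sub>F m in sequentially. 2 * c1 / \<epsilon> + 2 / \<delta> + 1 \<le> real (N m)"
    proof -
      have "filterlim (\<lambda>m. real (N m)) at_top sequentially"
        using N(1) by (rule filterlim_compose[OF filterlim_real_sequentially])
      then show ?thesis unfolding filterlim_at_top by blast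
    qed
    show "\<forall>\<^sub>F m in sequentially. dist (ln (poly (Q m) z) / N m) l < \<delta>0" using evg evN
    proof eventually_elim
      case (elim m)
      define n where "n = N m"
      have n1: "1 \<le> n" using N(2) by (simp add: n_def)
      have nr: "2 * c1 / \<epsilon> \<le> n" "2 / \<delta> < n" "1 \<le> real n"
      proof -
        have "0 \<le> 2 * c1 / \<epsilon>" "0 \<le> 2 / \<delta>" using c1 \<epsilon> \<delta> by simp_all
        then show "2 * c1 / \<epsilon> \<le> n" "2 / \<delta> < n" "1 \<le> real n" using elim(2) unfolding n_def by linarith+
      qed
      define r where "r = exp (- (real n)\<^sup>2 * \<epsilon> / 2 + n * C)"
      have gGm: "\<bar>g m x - G x\<bar> \<le> \<epsilon> / 8" for x using elim(1) by (auto simp: dist_real_def intro: less_imp_le)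
      have conc': "\<bar>(LINT t|\<mu>. ln (z - cl a b t)) - l\<bar> < \<delta>"
        if "psupp F \<mu>" "enn2real (een (1 / real (Suc m0)) R \<mu> \<mu>) + (LINT x|\<mu>. G x) \<le> e + \<epsilon>" for \<mu>
        using conc[OF that(1)] that(2) unfolding e_def \<epsilon>_def f_def l_def by simp
      have hpos: "0 < 1 / real (Suc m0)" by simp
      have dg: "degree (Q m) = n" "lead_coeff (Q m) = 1" using Q by (simp_all add: n_def)
      have orth': "(LINT t|\<sigma>. poly (Q m) t * t ^ j * (exp (- (real n * g m t) - k t) * indicator {a..b} t)) = 0" if "j < n" for j
        using orth[of j m] that by (simp add: n_def)
      note ts = heine_two_sided[OF Fb(1) F(2,3) \<sigma> R g k Gm G(2) gGm psupp_mono[OF \<beta>(1) F(2)] \<beta>(2) M dom E n1 dg orth' hpos z \<epsilon> conc' C_def]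
      have up: "poly (Q m) z \<le> exp (n * (l + \<delta>)) + (z - a) ^ n * r" unfolding r_def by (rule ts(1); assumption)
      have low: "exp (n * (l - \<delta>)) * (1 - r) \<le> poly (Q m) z" unfolding r_def by (rule ts(2); assumption)
      have key: "- (real n)\<^sup>2 * \<epsilon> / 2 \<le> - (real n * c1)"
      proof -
        have "c1 \<le> real n * \<epsilon> / 2" using nr(1) \<epsilon> by (simp add: field_simps)
        then have "real n * c1 \<le> real n * (real n * \<epsilon> / 2)" by (intro mult_left_mono) auto
        then show ?thesis by (simp add: power2_eq_square algebra_simps)
      qed
      have nC: "real n * C \<le> real n * \<bar>C\<bar>" by (intro mult_left_mono) auto
      have r1: "r \<le> 1 / 2"
      proof -
        have "real n * 1 \<le> real n * (c1 - \<bar>C\<bar>)" unfolding c1_def by (intro mult_left_mono) auto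
        then have "real n + real n * \<bar>C\<bar> \<le> real n * c1" by (simp add: right_diff_distrib)
        then have "- (real n)\<^sup>2 * \<epsilon> / 2 + n * C \<le> - 1" using key nC nr(3) by linarith
        then have "r \<le> exp (- 1)" unfolding r_def by simp
        also have "... \<le> 1 / 2" using exp_ge_add_one_self[of "1::real"] by (simp add: exp_minus field_simps)
        finally show ?thesis .
      qed
      have r2: "(z - a) ^ n * r \<le> exp (n * (l + \<delta>))"
      proof -
        have za: "0 < z - a" using z F(3) by simp
        have "(z - a) ^ n = exp (n * ln (z - a))" using za by (simp add: exp_of_nat_mult)
        then have "(z - a) ^ n * r = exp (n * ln (z - a) + (- (real n)\<^sup>2 * \<epsilon> / 2 + n * C))" by (simp add: r_def exp_add)
        also have "n * ln (z - a) + (- (real n)\<^sup>2 * \<epsilon> / 2 + n * C) \<le> n * (l + \<delta>)"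
        proof -
          have "real n * (ln (z - a) + \<bar>C\<bar> - c1) \<le> real n * (l + \<delta>)" unfolding c1_def by (intro mult_left_mono) auto
          then show ?thesis using key nC by (simp add: algebra_simps)
        qed
        finally show ?thesis by simp
      qed
      have q_up: "poly (Q m) z \<le> 2 * exp (n * (l + \<delta>))" using up r2 by linarith
      have q_low: "exp (n * (l - \<delta>)) / 2 \<le> poly (Q m) z"
      proof -
        have "exp (n * (l - \<delta>)) * (1 / 2) \<le> exp (n * (l - \<delta>)) * (1 - r)" using r1 by (intro mult_left_mono) auto
        then have "exp (n * (l - \<delta>)) * (1 / 2) \<le> poly (Q m) z" using low by (rule order_trans)
        then show ?thesis by simp
      qed
      have qpos: "0 < poly (Q m) z" using q_low by (rule less_le_trans[rotated]) simp
      have ln2: "ln 2 < (1::real)" using ln_2_less_1 .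
      have "ln (poly (Q m) z) \<le> ln (2 * exp (n * (l + \<delta>)))" using q_up qpos by (intro ln_mono) auto
      also have "... = ln 2 + n * (l + \<delta>)" by (simp add: ln_mult)
      finally have u: "ln (poly (Q m) z) < n * (l + \<delta>) + 1" using ln2 by linarith
      have "ln (exp (n * (l - \<delta>)) / 2) \<le> ln (poly (Q m) z)" using q_low qpos by (intro ln_mono) auto
      moreover have "ln (exp (n * (l - \<delta>)) / 2) = n * (l - \<delta>) - ln 2" by (simp add: ln_div)
      ultimately have d: "n * (l - \<delta>) - 1 < ln (poly (Q m) z)" using ln2 by linarith
      have nd: "1 < n * \<delta>" using nr(2) \<delta> by (simp add: field_simps)
      have "n * (l - \<delta>0) < ln (poly (Q m) z)" "ln (poly (Q m) z) < n * (l + \<delta>0)"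
        using u d nd unfolding \<delta>_def by (simp_all add: algebra_simps)
      then have "l - \<delta>0 < ln (poly (Q m) z) / n" "ln (poly (Q m) z) / n < l + \<delta>0" using n1 by (simp_all add: field_simps)
      then show ?case by (simp add: dist_real_def n_def abs_less_iff)
    qed
  qed
  then show ?thesis by (simp add: l_def)
qed

subsection \<open>The equilibrium problem\<close>

lemma integrable_psupp_bounded:
  fixes f :: "real \<Rightarrow> real"
  assumes "psupp S \<mu>" "f \<in> borel_measurable borel" "\<And>x. \<bar>f x\<bar> \<le> B"
  shows "integrable \<mu> f"
proof -
  interpret prob_space \<mu> using psuppD[OF assms(1)] by simp
  have "f \<in> borel_measurable \<mu>" using assms(2) psuppD(2)[OF assms(1)] by (simp cong: measurable_cong_sets)
  then show ?thesis using assms(3) by (intro integrable_const_bound[of _ B]) auto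
qed

lemma integral_psupp_abs_le:
  fixes f :: "real \<Rightarrow> real"
  assumes "psupp S \<mu>" "f \<in> borel_measurable borel" "\<And>x. \<bar>f x\<bar> \<le> B"
  shows "\<bar>LINT x|\<mu>. f x\<bar> \<le> B"
proof -
  interpret prob_space \<mu> using psuppD[OF assms(1)] by simp
  have "norm (LINT x|\<mu>. f x) \<le> (LINT x|\<mu>. B)"
    by (rule Bochner_Integration.integral_norm_bound_integral[OF integrable_psupp_bounded[OF assms]]) (use assms(3) in auto)
  then show ?thesis by (simp add: prob_space)
qed

lemma kern_measurable_comp [measurable]:
  assumes [measurable]: "f \<in> M \<rightarrow>\<^sub>M borel" "g \<in> M \<rightarrow>\<^sub>M borel"
  shows "(\<lambda>z. kern h R (f z) (g z)) \<in> borel_measurable M"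
proof -
  have "(\<lambda>z. (f z, g z)) \<in> M \<rightarrow>\<^sub>M borel \<Otimes>\<^sub>M borel" by measurable
  from measurable_compose[OF this kern_measurable] show ?thesis by simp
qed

lemma csqrt_measurable [measurable]: "csqrt \<in> borel_measurable borel"
proof -
  have "csqrt = (\<lambda>z. of_real (sqrt ((cmod z + Re z) / 2)) + \<i> * of_real ((if Im z < 0 then - 1 else 1) * sqrt ((cmod z - Re z) / 2)))"
    by (rule ext) (auto simp: complex_eq_iff)
  also have "... \<in> borel_measurable borel" by measurable
  finally show ?thesis .
qed

lemma phi_measurable [measurable]: "phi \<in> borel_measurable borel"
  unfolding phi_def[abs_def] sqz_def by measurable

text \<open>Its mean over the n points of S is ln |H(v)| / n, with H = \<open>Hpoly S\<close>. The
  asymptotics of q needs it at v = 1 / phi z.\<close>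

definition lk :: "real \<Rightarrow> real \<Rightarrow> complex \<Rightarrow> real \<Rightarrow> real" where
  "lk a b v s = ln (cmod (1 - v / of_real (tau (cl a b s))))"

text \<open>The logarithm of one factor of the product in \<open>zero_weight\<close>: the
  interaction of a point with a zero.\<close>

definition lgk :: "real \<Rightarrow> real \<Rightarrow> real \<Rightarrow> real \<Rightarrow> real" where
  "lgk a b x t = ln (1 - 1 / (tau (cl a b x) * tau (cl a b t)))"

text \<open>Stems from the power of 1 / tau t in \<open>zero_weight\<close>; on [a, b] it is also
  the logarithm of |phi| that occurs in \<open>Jen\<close>.\<close>

definition hl :: "real \<Rightarrow> real \<Rightarrow> real \<Rightarrow> real" where
  "hl a b x = ln (tau (cl a b x))"

text \<open>The length of the image of [a, b] under tau. As tau expands distances, it also dominates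
  b - a, so one parameter R serves both a measure and its image.\<close>

abbreviation tlen :: "real \<Rightarrow> real \<Rightarrow> real" where
  "tlen a b \<equiv> tau b - tau a"

definition ptau :: "real measure \<Rightarrow> real measure" where
  "ptau \<mu> = distr \<mu> borel tau"

context
  fixes a b :: real
  assumes ab: "1 < a" "a < b"
begin

lemma tau_cl: "tau a \<le> tau (cl a b s)" "tau (cl a b s) \<le> tau b" "1 < tau (cl a b s)"
proof -
  have "a \<le> cl a b s" "cl a b s \<le> b" using cl_in[of a b s] ab by auto
  then show 1: "tau a \<le> tau (cl a b s)" and "tau (cl a b s) \<le> tau b" using ab by (auto intro!: tau_mono)
  show "1 < tau (cl a b s)" using tau_gt1[OF ab(1)] 1 by linarith
qed

lemma inverse_tau_less_1: "0 < 1 - 1 / tau a"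
  using tau_gt1[OF ab(1)] by simp

lemma lk_arg:
  assumes "cmod v \<le> 1"
  shows "1 - 1 / tau a \<le> cmod (1 - v / of_real (tau (cl a b s)))"
    "cmod (1 - v / of_real (tau (cl a b s))) \<le> 2"
proof -
  have t: "1 < tau a" by (rule tau_gt1[OF ab(1)])
  have "cmod (v / of_real (tau (cl a b s))) = cmod v / tau (cl a b s)" using tau_cl(3)[of s] by (simp add: norm_divide)
  also have "... \<le> 1 / tau a" using assms tau_cl(1)[of s] t by (intro frac_le) auto
  finally have 1: "cmod (v / of_real (tau (cl a b s))) \<le> 1 / tau a" .
  have 2: "1 / tau a < 1" using t by simp
  show "1 - 1 / tau a \<le> cmod (1 - v / of_real (tau (cl a b s)))"
    using norm_triangle_ineq2[of 1 "v / complex_of_real (tau (cl a b s))"] 1 unfolding norm_one by linarith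
  show "cmod (1 - v / of_real (tau (cl a b s))) \<le> 2"
    using norm_triangle_ineq4[of 1 "v / complex_of_real (tau (cl a b s))"] 1 2 unfolding norm_one by linarith
qed

text \<open>ln (A / B) <= A / B - 1, and both moduli are bounded below by 1 - 1 / tau a. The
  Lipschitz constant does not depend on s, so it survives integration against any probability
  measure.\<close>

lemma lk_diff_le:
  assumes "cmod v \<le> 1" "cmod w \<le> 1"
  shows "lk a b v s - lk a b w s \<le> cmod (v - w) / (1 - 1 / tau a)"
proof -
  define T where "T = complex_of_real (tau (cl a b s))"
  define A B where "A = cmod (1 - v / T)" and "B = cmod (1 - w / T)"
  note v = lk_arg[OF assms(1), of s] and w = lk_arg[OF assms(2), of s]
  have AB: "0 < A" "0 < B" "1 - 1 / tau a \<le> B" using v w inverse_tau_less_1 unfolding A_def B_def T_def by linarith+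
  have "lk a b v s = ln A" "lk a b w s = ln B" by (simp_all add: lk_def A_def B_def T_def)
  then have "lk a b v s - lk a b w s = ln (A / B)" using AB by (simp add: ln_div)
  also have "... \<le> A / B - 1" using AB by (intro ln_le_minus_one) simp
  also have "... = (A - B) / B" using AB by (simp add: field_simps)
  also have "... \<le> cmod (v - w) / B"
  proof (rule divide_right_mono)
    have "A - B \<le> cmod ((1 - v / T) - (1 - w / T))" unfolding A_def B_def by (rule norm_triangle_ineq2)
    also have "(1 - v / T) - (1 - w / T) = - ((v - w) / T)" by (simp add: diff_divide_distrib)
    also have "cmod (- ((v - w) / T)) = cmod (v - w) / tau (cl a b s)"
      using tau_cl(3)[of s] by (simp only: norm_minus_cancel norm_divide) (simp add: T_def)
    also have "... \<le> cmod (v - w) / 1" using tau_cl(3)[of s] by (intro divide_left_mono) auto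
    finally show "A - B \<le> cmod (v - w)" by simp
  qed (use AB in simp)
  also have "... \<le> cmod (v - w) / (1 - 1 / tau a)" using AB inverse_tau_less_1 by (intro divide_left_mono mult_pos_pos) auto
  finally show ?thesis .
qed

lemma lk_bounded:
  assumes "cmod v \<le> 1"
  shows "\<bar>lk a b v s\<bar> \<le> \<bar>ln (1 - 1 / tau a)\<bar> + ln 2"
proof -
  note v = lk_arg[OF assms, of s]
  have 1: "ln (1 - 1 / tau a) \<le> lk a b v s" unfolding lk_def using v inverse_tau_less_1 by (intro ln_mono) linarith+
  have 2: "lk a b v s \<le> ln 2" unfolding lk_def using v inverse_tau_less_1 by (intro ln_mono) linarith+
  have "0 \<le> ln (2 :: real)" by simp
  with 1 2 show ?thesis by linarith
qed

lemma continuous_on_lk: "cmod v \<le> 1 \<Longrightarrow> continuous_on UNIV (lk a b v)"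
proof -
  assume v: "cmod v \<le> 1"
  have "complex_of_real (tau (cl a b s)) \<noteq> 0" for s using tau_cl(3)[of s] by simp
  moreover have "1 - v / complex_of_real (tau (cl a b s)) \<noteq> 0" for s using lk_arg(1)[OF v, of s] inverse_tau_less_1 by auto
  ultimately show ?thesis unfolding lk_def[abs_def] by (intro continuous_intros) auto
qed

lemma lk_measurable: "cmod v \<le> 1 \<Longrightarrow> lk a b v \<in> borel_measurable borel"
  by (rule borel_measurable_continuous_onI) (rule continuous_on_lk)

lemma integral_lk_lipschitz:
  assumes \<kappa>: "psupp S \<kappa>" and vw: "cmod v \<le> 1" "cmod w \<le> 1"
  shows "\<bar>(LINT s|\<kappa>. lk a b v s) - (LINT s|\<kappa>. lk a b w s)\<bar> \<le> cmod (v - w) / (1 - 1 / tau a)"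
proof -
  interpret k: prob_space \<kappa> using psuppD[OF \<kappa>] by simp
  have i: "integrable \<kappa> (lk a b u)" if "cmod u \<le> 1" for u
    by (rule integrable_psupp_bounded[OF \<kappa> lk_measurable[OF that] lk_bounded[OF that]])
  have "(LINT s|\<kappa>. lk a b u s) - (LINT s|\<kappa>. lk a b u' s) \<le> cmod (u - u') / (1 - 1 / tau a)"
    if u: "cmod u \<le> 1" "cmod u' \<le> 1" for u u'
  proof -
    have "(LINT s|\<kappa>. lk a b u s) - (LINT s|\<kappa>. lk a b u' s) = (LINT s|\<kappa>. lk a b u s - lk a b u' s)"
      using i[OF u(1)] i[OF u(2)] by simp
    also have "... \<le> cmod (u - u') / (1 - 1 / tau a)"
      using i[OF u(1)] i[OF u(2)] by (intro k.integral_le_const AE_I2 lk_diff_le u) auto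
    finally show ?thesis .
  qed
  from this[OF vw] this[OF vw(2,1)] show ?thesis by (simp add: norm_minus_commute abs_le_iff)
qed

text \<open>Weak convergence gives convergence for each v; the common Lipschitz constant and a
  finite net of the closed disc make it uniform. Both the external fields and the final asymptotics
  rest on this.\<close>

lemma lk_uniform_limit:
  assumes \<mu>: "\<And>n::nat. psupp {a..b} (\<mu> n)" and M: "psupp {a..b} M" and wc: "weak_conv_m \<mu> M"
  shows "uniform_limit (cball 0 1) (\<lambda>n v. LINT s|(\<mu> n). lk a b v s) (\<lambda>v. LINT s|M. lk a b v s) sequentially"
proof (rule uniform_limitI)
  fix e :: real assume e: "0 < e"
  define c where "c = 1 - 1 / tau a"
  have c: "0 < c" using inverse_tau_less_1 by (simp add: c_def)
  \<comment> \<open>Moving v to the nearest net point then costs at most e / 4 in each of the two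
    integrals.\<close>
  define \<delta> where "\<delta> = e * c / 4"
  have \<delta>: "0 < \<delta>" using e c by (simp add: \<delta>_def)
  obtain k :: "complex set" where k: "k \<subseteq> cball 0 1" "finite k" "cball 0 1 \<subseteq> (\<Union>v\<in>k. ball v \<delta>)"
  proof (rule compactE_image[of "cball (0::complex) 1" "cball 0 1" "\<lambda>v. ball v \<delta>"])
    show "cball (0::complex) 1 \<subseteq> (\<Union>v\<in>cball 0 1. ball v \<delta>)" using \<delta> by force
  qed (auto intro: that)
  have "\<forall>\<^sub>F n in sequentially. \<bar>(LINT s|(\<mu> n). lk a b v s) - (LINT s|M. lk a b v s)\<bar> < e / 4" if "v \<in> k" for v
  proof -
    have v: "cmod v \<le> 1" using k(1) that by auto
    have "0 < e / 4" using e by simp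
    from tendstoD[OF integral_weak_conv_psupp[OF \<mu> M wc continuous_on_lk[OF v] lk_bounded[OF v]] this]
    show ?thesis by (simp add: dist_real_def)
  qed
  then have "\<forall>\<^sub>F n in sequentially. \<forall>v\<in>k. \<bar>(LINT s|(\<mu> n). lk a b v s) - (LINT s|M. lk a b v s)\<bar> < e / 4"
    using k(2) by (intro eventually_ball_finite) auto
  then show "\<forall>\<^sub>F n in sequentially. \<forall>v\<in>cball 0 1. dist (LINT s|(\<mu> n). lk a b v s) (LINT s|M. lk a b v s) < e"
  proof eventually_elim
    case (elim n)
    show ?case
    proof
      fix v :: complex assume "v \<in> cball 0 1"
      then obtain w where w: "w \<in> k" "dist w v < \<delta>" and v: "cmod v \<le> 1" using k(3) by auto
      have w1: "cmod w \<le> 1" using w(1) k(1) by auto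
      have "cmod (v - w) / c \<le> \<delta> / c" using w(2) c by (intro divide_right_mono) (auto simp: dist_norm norm_minus_commute)
      also have "\<delta> / c = e / 4" using c by (simp add: \<delta>_def)
      finally have d: "cmod (v - w) / c \<le> e / 4" .
      have "\<bar>(LINT s|(\<mu> n). lk a b v s) - (LINT s|(\<mu> n). lk a b w s)\<bar> \<le> e / 4"
        "\<bar>(LINT s|M. lk a b v s) - (LINT s|M. lk a b w s)\<bar> \<le> e / 4"
        using integral_lk_lipschitz[OF \<mu> v w1, of n] integral_lk_lipschitz[OF M v w1] d unfolding c_def by linarith+
      moreover have "\<bar>(LINT s|(\<mu> n). lk a b w s) - (LINT s|M. lk a b w s)\<bar> < e / 4" using elim w(1) by blast
      ultimately show "dist (LINT s|(\<mu> n). lk a b v s) (LINT s|M. lk a b v s) < e"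
        unfolding dist_real_def using e by linarith
    qed
  qed
qed

text \<open>Hence the field generated by a measure is its \<open>lk\<close> transform sampled at v =
  1 / tau x, and it inherits the bounds and the uniform convergence.\<close>

lemma lgk_eq_lk: "lgk a b x t = lk a b (complex_of_real (1 / tau (cl a b x))) t"
proof -
  note x = tau_cl(3)[of x] and t = tau_cl(3)[of t]
  have xt: "1 < tau (cl a b x) * tau (cl a b t)" using x t by (simp add: less_1_mult)
  have "1 - complex_of_real (1 / tau (cl a b x)) / complex_of_real (tau (cl a b t))
    = complex_of_real (1 - 1 / (tau (cl a b x) * tau (cl a b t)))" by simp
  moreover have "0 < 1 - 1 / (tau (cl a b x) * tau (cl a b t))" using xt by simp
  ultimately show ?thesis unfolding lgk_def lk_def by (simp only: norm_of_real abs_of_pos)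
qed

lemma inverse_tau_cl_le_1: "cmod (of_real (1 / tau (cl a b x))) \<le> 1"
proof -
  have "\<bar>1 / tau (cl a b x)\<bar> \<le> 1" using tau_cl(3)[of x] by simp
  then show ?thesis by (simp only: norm_of_real)
qed

lemma lgk_bounded: "\<bar>lgk a b x t\<bar> \<le> \<bar>ln (1 - 1 / tau a)\<bar> + ln 2"
  unfolding lgk_eq_lk by (rule lk_bounded[OF inverse_tau_cl_le_1])

lemma lgk_measurable [measurable]:
  assumes [measurable]: "f \<in> borel_measurable M" "g \<in> borel_measurable M"
  shows "(\<lambda>z. lgk a b (f z) (g z)) \<in> borel_measurable M" unfolding lgk_def by measurable

lemma continuous_on_hl: "continuous_on UNIV (hl a b)"
proof -
  have "tau (cl a b x) \<noteq> 0" "0 < tau (cl a b x)" for x using tau_cl(3)[of x] by auto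
  then show ?thesis unfolding hl_def[abs_def] by (intro continuous_intros) auto
qed

lemma hl_measurable [measurable]: "hl a b \<in> borel_measurable borel"
  by (rule borel_measurable_continuous_onI) (rule continuous_on_hl)

lemma hl_bounds: "0 \<le> hl a b x" "hl a b x \<le> ln (tau b)" "\<bar>hl a b x\<bar> \<le> ln (tau b)"
proof -
  show 1: "0 \<le> hl a b x" "hl a b x \<le> ln (tau b)" unfolding hl_def using tau_cl[of x] by (auto intro!: ln_mono)
  then show "\<bar>hl a b x\<bar> \<le> ln (tau b)" by linarith
qed

lemma psupp_ptau: "psupp {a..b} \<mu> \<Longrightarrow> psupp {tau a..tau b} (ptau \<mu>)"
proof -
  assume \<mu>: "psupp {a..b} \<mu>"
  interpret m: prob_space \<mu> using psuppD[OF \<mu>] by simp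
  note [measurable_cong] = psuppD(2)[OF \<mu>]
  have t: "tau \<in> measurable \<mu> borel" by measurable
  have "AE x in \<mu>. tau x \<in> {tau a..tau b}" using psuppD(6)[OF \<mu>] by eventually_elim (use ab in \<open>auto intro!: tau_mono\<close>)
  then have "AE x in ptau \<mu>. x \<in> {tau a..tau b}" unfolding ptau_def by (subst AE_distr_iff[OF t]) auto
  then show ?thesis unfolding psupp_def using m.prob_space_distr[OF t] by (simp add: ptau_def)
qed

text \<open>tau expands distances and the kernel decreases with the distance.\<close>

lemma een_ptau:
  assumes \<mu>: "psupp {a..b} \<mu>"
  shows "een 0 R (ptau \<mu>) (ptau \<mu>) \<le> een 0 R \<mu> \<mu>"
proof -
  interpret m: prob_space \<mu> using psuppD[OF \<mu>] by simp
  note p = psupp_ptau[OF \<mu>]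
  interpret p: prob_space "ptau \<mu>" using psuppD[OF p] by simp
  note [measurable_cong] = psuppD(2)[OF \<mu>] psuppD(2)[OF p]
  have t: "tau \<in> measurable \<mu> borel" by measurable
  have d: "(\<integral>\<^sup>+y. f y \<partial>ptau \<mu>) = (\<integral>\<^sup>+x. f (tau x) \<partial>\<mu>)" if "f \<in> borel_measurable borel" for f :: "real \<Rightarrow> ennreal"
    unfolding ptau_def by (rule nn_integral_distr[OF t]) (use that in simp)
  have km: "(\<lambda>t. kern 0 R y t) \<in> borel_measurable borel" for y by measurable
  have km2: "(\<lambda>y. \<integral>\<^sup>+t. kern 0 R y (tau t) \<partial>\<mu>) \<in> borel_measurable borel" by measurable
  have "een 0 R (ptau \<mu>) (ptau \<mu>) = (\<integral>\<^sup>+y. \<integral>\<^sup>+t. kern 0 R y t \<partial>ptau \<mu> \<partial>ptau \<mu>)" by (rule een_kern) (use psuppD[OF p] in auto)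
  also have "... = (\<integral>\<^sup>+x. \<integral>\<^sup>+t. kern 0 R (tau x) (tau t) \<partial>\<mu> \<partial>\<mu>)" unfolding d[OF km] by (rule d[OF km2])
  also have "... \<le> (\<integral>\<^sup>+x. \<integral>\<^sup>+t. kern 0 R x t \<partial>\<mu> \<partial>\<mu>)"
  proof (rule nn_integral_mono_AE)
    show "AE x in \<mu>. (\<integral>\<^sup>+t. kern 0 R (tau x) (tau t) \<partial>\<mu>) \<le> (\<integral>\<^sup>+t. kern 0 R x t \<partial>\<mu>)" using psuppD(6)[OF \<mu>]
    proof eventually_elim
      case (elim x)
      show ?case
      proof (rule nn_integral_mono_AE)
        show "AE t in \<mu>. kern 0 R (tau x) (tau t) \<le> kern 0 R x t" using psuppD(6)[OF \<mu>]
        proof eventually_elim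
          case (elim t)
          have "\<bar>x - t\<bar> \<le> \<bar>tau x - tau t\<bar>"
            using tau_expand[of x t] tau_expand[of t x] elim \<open>x \<in> {a..b}\<close> ab by (cases "x \<le> t") auto
          then show ?case by (rule kern_mono_dist)
        qed
      qed
    qed
  qed
  also have "... = een 0 R \<mu> \<mu>" by (rule een_kern[symmetric]) (use psuppD[OF \<mu>] in auto)
  finally show ?thesis .
qed

lemma length_le_tau: "0 < tau b - tau a" "b - a \<le> tau b - tau a"
  using tau_expand[of a b] ab by auto

lemma tau_log_energy:
  assumes \<mu>: "psupp {a..b} \<mu>" "fin_en (tlen a b) \<mu>" and \<nu>: "psupp {a..b} \<nu>" "fin_en (tlen a b) \<nu>"
  shows "integrable (\<mu> \<Otimes>\<^sub>M \<nu>) (\<lambda>z. ln \<bar>tau (fst z) - tau (snd z)\<bar>)"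
    "(LINT z|(\<mu> \<Otimes>\<^sub>M \<nu>). ln \<bar>tau (fst z) - tau (snd z)\<bar>) = ln (tlen a b) + 1 / 2 - ip (tlen a b) (ptau \<mu>) (ptau \<nu>)"
proof -
  let ?P = "\<mu> \<Otimes>\<^sub>M \<nu>"
  note p\<mu> = psupp_ptau[OF \<mu>(1)] and p\<nu> = psupp_ptau[OF \<nu>(1)]
  have e: "fin_en (tlen a b) (ptau \<mu>)" "fin_en (tlen a b) (ptau \<nu>)"
    using een_ptau[OF \<mu>(1), of "tlen a b"] een_ptau[OF \<nu>(1), of "tlen a b"] \<mu>(2) \<nu>(2) by (auto intro: le_less_trans)
  note [measurable_cong] = psuppD(2)[OF \<mu>(1)] psuppD(2)[OF \<nu>(1)]
  have t: "tau \<in> measurable \<mu> borel" "tau \<in> measurable \<nu> borel" by measurable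
  have pair: "ptau \<mu> \<Otimes>\<^sub>M ptau \<nu> = distr ?P (borel \<Otimes>\<^sub>M borel) (\<lambda>(x, y). (tau x, tau y))"
    unfolding ptau_def by (rule pair_measure_distr[OF t]) (use psuppD(5)[OF p\<nu>] in \<open>simp add: ptau_def\<close>)
  have m: "(\<lambda>(x, y). (tau x, tau y)) \<in> ?P \<rightarrow>\<^sub>M borel \<Otimes>\<^sub>M borel" by measurable
  have f: "(\<lambda>z. ln \<bar>fst z - snd z\<bar>) \<in> borel_measurable (borel \<Otimes>\<^sub>M (borel :: real measure))" by measurable
  note le = log_energy[OF p\<mu> e(1) p\<nu> e(2) length_le_tau(1) order_refl]
  show "integrable ?P (\<lambda>z. ln \<bar>tau (fst z) - tau (snd z)\<bar>)"
    using le(2) unfolding pair integrable_distr_eq[OF m f] by (simp add: case_prod_beta)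
  show "(LINT z|?P. ln \<bar>tau (fst z) - tau (snd z)\<bar>) = ln (tlen a b) + 1 / 2 - ip (tlen a b) (ptau \<mu>) (ptau \<nu>)"
    using le(3) unfolding pair integral_distr[OF m f] by (simp add: case_prod_beta)
qed

lemma lgk_log:
  assumes "x \<in> {a..b}" "t \<in> {a..b}" "x \<noteq> t"
  shows "lgk a b x t = ln \<bar>x - t\<bar> - ln \<bar>tau x - tau t\<bar> + ln 2"
proof -
  have xt: "1 < tau x" "1 < tau t" using assms ab by (auto intro!: tau_gt1)
  have p: "1 < tau x * tau t" using xt by (simp add: less_1_mult)
  have pos: "0 < 1 - 1 / (tau x * tau t)" using p by simp
  have e: "x - t = (tau x - tau t) * (1 - 1 / (tau x * tau t)) / 2" using assms ab by (intro tau_diff) auto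
  have ne: "0 < \<bar>tau x - tau t\<bar>" using e assms(3) by auto
  define y d where "y = 1 - 1 / (tau x * tau t)" and "d = \<bar>tau x - tau t\<bar>"
  have dy: "\<bar>x - t\<bar> = d * y / 2" unfolding e abs_divide abs_mult y_def d_def using pos by simp
  have "0 < y" "0 < d" using pos ne by (simp_all only: y_def d_def)
  then have "ln \<bar>x - t\<bar> = ln \<bar>tau x - tau t\<bar> + ln (1 - 1 / (tau x * tau t)) - ln 2"
    unfolding y_def[symmetric] d_def[symmetric] dy by (simp add: ln_div ln_mult_pos)
  then show ?thesis unfolding lgk_def using assms by (simp add: cl_id)
qed

lemma integrable_pair_bounded:
  fixes f :: "real \<times> real \<Rightarrow> real"
  assumes "psupp S \<mu>" "psupp T \<nu>" "f \<in> borel_measurable (borel \<Otimes>\<^sub>M borel)" "\<And>z. \<bar>f z\<bar> \<le> B"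
  shows "integrable (\<mu> \<Otimes>\<^sub>M \<nu>) f"
proof -
  interpret m: prob_space \<mu> using psuppD[OF assms(1)] by simp
  interpret n: prob_space \<nu> using psuppD[OF assms(2)] by simp
  interpret pair_prob_space \<mu> \<nu> ..
  note [measurable_cong] = psuppD(2)[OF assms(1)] psuppD(2)[OF assms(2)]
  have "f \<in> borel_measurable (\<mu> \<Otimes>\<^sub>M \<nu>)" using assms(3) by measurable
  then show ?thesis using assms(4) by (intro integrable_const_bound[of _ B]) auto
qed

lemma integrable_lgk:
  assumes "psupp S \<mu>" "psupp T \<nu>"
  shows "integrable (\<mu> \<Otimes>\<^sub>M \<nu>) (\<lambda>z. lgk a b (fst z) (snd z))"
  by (rule integrable_pair_bounded[OF assms _ lgk_bounded]) measurable

text \<open>\<open>lgk_log\<close> integrated: the interaction in the weight is the mutual energy of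
  the images under tau minus that of the measures themselves. Both are singular, their difference is
  not.\<close>

lemma lgk_energy:
  assumes \<mu>: "psupp {a..b} \<mu>" "fin_en (tlen a b) \<mu>" and \<nu>: "psupp {a..b} \<nu>" "fin_en (tlen a b) \<nu>"
  shows "(LINT z|(\<mu> \<Otimes>\<^sub>M \<nu>). lgk a b (fst z) (snd z)) = ip (tlen a b) (ptau \<mu>) (ptau \<nu>) - ip (tlen a b) \<mu> \<nu> + ln 2"
proof -
  let ?P = "\<mu> \<Otimes>\<^sub>M \<nu>"
  interpret m: prob_space \<mu> using psuppD[OF \<mu>(1)] by simp
  interpret n: prob_space \<nu> using psuppD[OF \<nu>(1)] by simp
  interpret pair_prob_space \<mu> \<nu> ..
  note le = log_energy[OF \<mu> \<nu> length_le_tau] and tle = tau_log_energy[OF \<mu> \<nu>]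
  note [measurable_cong] = psuppD(2)[OF \<mu>(1)] psuppD(2)[OF \<nu>(1)]
  have AE: "AE z in ?P. fst z \<in> {a..b} \<and> snd z \<in> {a..b}" by (rule AE_pair_psupp[OF \<mu>(1) \<nu>(1)]) auto
  have "(LINT z|?P. lgk a b (fst z) (snd z))
    = (LINT z|?P. ln \<bar>fst z - snd z\<bar> - ln \<bar>tau (fst z) - tau (snd z)\<bar> + ln 2)"
  proof (rule integral_cong_AE)
    show "AE z in ?P. lgk a b (fst z) (snd z) = ln \<bar>fst z - snd z\<bar> - ln \<bar>tau (fst z) - tau (snd z)\<bar> + ln 2"
      using AE le(1) by eventually_elim (intro lgk_log; simp)
  qed measurable
  also have "... = ip (tlen a b) (ptau \<mu>) (ptau \<nu>) - ip (tlen a b) \<mu> \<nu> + ln 2" using le(2,3) tle P.prob_space by simp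
  finally show ?thesis .
qed

lemma integral_pair_fst_snd:
  fixes f :: "real \<Rightarrow> real"
  assumes \<mu>: "psupp S \<mu>" and \<nu>: "psupp T \<nu>" and f: "f \<in> borel_measurable borel" "\<And>x. \<bar>f x\<bar> \<le> B"
  shows "integrable (\<mu> \<Otimes>\<^sub>M \<nu>) (\<lambda>z. f (fst z))" "integrable (\<mu> \<Otimes>\<^sub>M \<nu>) (\<lambda>z. f (snd z))"
    "(LINT z|(\<mu> \<Otimes>\<^sub>M \<nu>). f (fst z)) = (LINT x|\<mu>. f x)" "(LINT z|(\<mu> \<Otimes>\<^sub>M \<nu>). f (snd z)) = (LINT x|\<nu>. f x)"
proof -
  let ?P = "\<mu> \<Otimes>\<^sub>M \<nu>"
  interpret m: prob_space \<mu> using psuppD[OF \<mu>] by simp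
  interpret n: prob_space \<nu> using psuppD[OF \<nu>] by simp
  interpret pair_prob_space \<mu> \<nu> ..
  note [measurable] = f(1)
  show i: "integrable ?P (\<lambda>z. f (fst z))" "integrable ?P (\<lambda>z. f (snd z))"
    by (rule integrable_pair_bounded[OF \<mu> \<nu> _ f(2)]; measurable)+
  show "(LINT z|?P. f (fst z)) = (LINT x|\<mu>. f x)" using integral_fst'[OF i(1)] n.prob_space by simp
  show "(LINT z|?P. f (snd z)) = (LINT x|\<nu>. f x)" using integral_fst'[OF i(2)] m.prob_space by simp
qed

text \<open>|1 - phi x phi t| = tau x tau t (1 - 1 / (tau x tau t)). By \<open>lgk_energy\<close>,
  one of the two copies of - ln |x - t| is traded for the same kernel on the images under tau. So
  \<open>Jen\<close> is a sum of two squared norms, a linear term and a constant.\<close>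

lemma Jen_eq:
  assumes \<mu>: "psupp {a..b} \<mu>" "fin_en (tlen a b) \<mu>"
  shows "Jen \<mu> = ip (tlen a b) \<mu> \<mu> + ip (tlen a b) (ptau \<mu>) (ptau \<mu>) + 4 * (LINT x|\<mu>. hl a b x) + (ln 2 - 2 * ln (tlen a b) - 1)"
proof -
  let ?P = "\<mu> \<Otimes>\<^sub>M \<mu>"
  interpret m: prob_space \<mu> using psuppD[OF \<mu>(1)] by simp
  interpret pair_prob_space \<mu> \<mu> ..
  note le = log_energy[OF \<mu> \<mu> length_le_tau]
  note [measurable_cong] = psuppD(2)[OF \<mu>(1)]
  have AE: "AE z in ?P. fst z \<in> {a..b} \<and> snd z \<in> {a..b}" by (rule AE_pair_psupp[OF \<mu>(1) \<mu>(1)]) auto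
  note h = integral_pair_fst_snd[OF \<mu>(1) \<mu>(1) hl_measurable hl_bounds(3)]
  have 1: "(LINT xt|?P. ln (cmod (1 - phi (of_real (fst xt)) * phi (of_real (snd xt))) / \<bar>fst xt - snd xt\<bar>\<^sup>2))
    = (LINT z|?P. hl a b (fst z) + hl a b (snd z) + lgk a b (fst z) (snd z) - 2 * ln \<bar>fst z - snd z\<bar>)"
  proof (rule integral_cong_AE)
    show "AE z in ?P. ln (cmod (1 - phi (of_real (fst z)) * phi (of_real (snd z))) / \<bar>fst z - snd z\<bar>\<^sup>2)
      = hl a b (fst z) + hl a b (snd z) + lgk a b (fst z) (snd z) - 2 * ln \<bar>fst z - snd z\<bar>" using AE le(1)
    proof eventually_elim
      case (elim z)
      define x t where "x = fst z" and "t = snd z"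
      have xt: "x \<in> {a..b}" "t \<in> {a..b}" "x \<noteq> t" using elim by (auto simp: x_def t_def)
      have tt: "1 < tau x" "1 < tau t" using xt ab by (auto intro!: tau_gt1)
      have p: "1 < tau x * tau t" using tt by (simp add: less_1_mult)
      have "1 - phi (of_real x) * phi (of_real t) = of_real (1 - tau x * tau t)" using xt ab by (simp add: phi_real)
      then have "cmod (1 - phi (of_real x) * phi (of_real t)) = tau x * tau t - 1" using p by (simp only: norm_of_real)
      also have "... = tau x * tau t * (1 - 1 / (tau x * tau t))" using tt by (simp add: field_simps)
      finally have c: "cmod (1 - phi (of_real x) * phi (of_real t)) = tau x * tau t * (1 - 1 / (tau x * tau t))" .
      have pos: "0 < 1 - 1 / (tau x * tau t)" "0 < tau x * tau t" "0 < \<bar>x - t\<bar>\<^sup>2" using p xt by simp_all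
      have "ln (cmod (1 - phi (of_real x) * phi (of_real t)) / \<bar>x - t\<bar>\<^sup>2)
        = ln (tau x * tau t) + ln (1 - 1 / (tau x * tau t)) - ln (\<bar>x - t\<bar>\<^sup>2)"
      proof -
        define y z where "y = 1 - 1 / (tau x * tau t)" and "z = tau x * tau t"
        have "0 < y" "0 < z" using pos by (simp_all only: y_def z_def)
        then have "ln (z * y / \<bar>x - t\<bar>\<^sup>2) = ln z + ln y - ln (\<bar>x - t\<bar>\<^sup>2)" using pos(3) by (simp only: ln_divide_pos mult_pos_pos ln_mult_pos)
        then show ?thesis unfolding c y_def z_def .
      qed
      also have "ln (tau x * tau t) = ln (tau x) + ln (tau t)" using tt by (simp add: ln_mult_pos)
      also have "ln (\<bar>x - t\<bar>\<^sup>2) = 2 * ln \<bar>x - t\<bar>" using xt by (subst ln_realpow) auto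
      finally show ?case using xt unfolding x_def[symmetric] t_def[symmetric] hl_def lgk_def by (simp add: cl_id)
    qed
  qed measurable
  have 2: "(LINT x|\<mu>. ln (cmod (phi (of_real x)))) = (LINT x|\<mu>. hl a b x)"
  proof (rule integral_cong_AE)
    show "AE x in \<mu>. ln (cmod (phi (of_real x))) = hl a b x" using psuppD(6)[OF \<mu>(1)]
    proof eventually_elim
      case (elim x)
      then have "1 < tau x" using ab by (auto intro!: tau_gt1)
      then show ?case using elim ab by (simp add: hl_def cl_id phi_real)
    qed
  qed measurable
  note l = integrable_lgk[OF \<mu>(1) \<mu>(1)]
  have "(LINT z|?P. hl a b (fst z) + hl a b (snd z) + lgk a b (fst z) (snd z) - 2 * ln \<bar>fst z - snd z\<bar>)
    = 2 * (LINT x|\<mu>. hl a b x) + (ip (tlen a b) (ptau \<mu>) (ptau \<mu>) - ip (tlen a b) \<mu> \<mu> + ln 2) - 2 * (ln (tlen a b) + 1 / 2 - ip (tlen a b) \<mu> \<mu>)"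
    using h l le(2,3) lgk_energy[OF \<mu> \<mu>] by simp
  then show ?thesis unfolding Jen_def 1 2 by simp
qed

lemma ptau_mixm:
  assumes s: "0 \<le> s" "s \<le> 1" and \<mu>: "psupp {a..b} \<mu>" and \<nu>: "psupp {a..b} \<nu>"
  shows "ptau (mixm s \<mu> \<nu>) = mixm s (ptau \<mu>) (ptau \<nu>)"
proof (rule measure_eqI)
  note p\<mu> = psupp_ptau[OF \<mu>] and p\<nu> = psupp_ptau[OF \<nu>]
  note pm = psupp_mixm[OF s \<mu> \<nu>]
  note sp = psuppD(3)[OF \<mu>] psuppD(3)[OF \<nu>] psuppD(3)[OF pm]
  note [measurable_cong] = psuppD(2)[OF \<mu>] psuppD(2)[OF \<nu>] psuppD(2)[OF pm]
  show "sets (ptau (mixm s \<mu> \<nu>)) = sets (mixm s (ptau \<mu>) (ptau \<nu>))" unfolding sets_mixm[OF s p\<mu> p\<nu>] by (simp add: ptau_def)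
  fix A assume "A \<in> sets (ptau (mixm s \<mu> \<nu>))"
  then have A: "A \<in> sets borel" by (simp add: ptau_def)
  have tA: "tau -` A \<in> sets borel" using measurable_sets[OF tau_measurable A] by simp
  have d: "emeasure (ptau \<kappa>) A = emeasure \<kappa> (tau -` A)" if "psupp {a..b} \<kappa>" for \<kappa>
    unfolding ptau_def using A psuppD(2,3)[OF that] by (subst emeasure_distr) (auto cong: measurable_cong_sets)
  show "emeasure (ptau (mixm s \<mu> \<nu>)) A = emeasure (mixm s (ptau \<mu>) (ptau \<nu>)) A"
    unfolding emeasure_mixm[OF s p\<mu> p\<nu> A] d[OF \<mu>] d[OF \<nu>] d[OF pm] emeasure_mixm[OF s \<mu> \<nu> tA] ..
qed

text \<open>Half of the directional derivative of \<open>Jen\<close> towards \<mu>. The image under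
  tau of a convex combination is the convex combination of the images, so both norms are quadratic
  in s.\<close>

lemma equilibrium_first_order:
  assumes F: "F \<subseteq> {a..b}" and \<eta>: "psupp F \<eta>" "fin_en (tlen a b) \<eta>" and \<mu>: "psupp F \<mu>" "fin_en (tlen a b) \<mu>"
    and min: "\<And>\<kappa>. psupp F \<kappa> \<Longrightarrow> fin_en (tlen a b) \<kappa> \<Longrightarrow> Jen \<eta> \<le> Jen \<kappa>"
  shows "0 \<le> (ip (tlen a b) \<eta> \<mu> - ip (tlen a b) \<eta> \<eta>) + (ip (tlen a b) (ptau \<eta>) (ptau \<mu>) - ip (tlen a b) (ptau \<eta>) (ptau \<eta>))
    + 2 * ((LINT x|\<mu>. hl a b x) - (LINT x|\<eta>. hl a b x))"
proof -
  note l = psupp_mono[OF \<eta>(1) F] and m = psupp_mono[OF \<mu>(1) F]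
  note pl = psupp_ptau[OF l] and pm = psupp_ptau[OF m]
  have e: "fin_en (tlen a b) (ptau \<eta>)" "fin_en (tlen a b) (ptau \<mu>)"
    using een_ptau[OF l, of "tlen a b"] een_ptau[OF m, of "tlen a b"] \<eta>(2) \<mu>(2) by (auto intro: le_less_trans)
  define B1 where "B1 = ip (tlen a b) \<eta> \<eta> + ip (tlen a b) \<mu> \<mu> - 2 * ip (tlen a b) \<eta> \<mu>"
  define B2 where "B2 = ip (tlen a b) (ptau \<eta>) (ptau \<eta>) + ip (tlen a b) (ptau \<mu>) (ptau \<mu>) - 2 * ip (tlen a b) (ptau \<eta>) (ptau \<mu>)"
  have "0 \<le> 2 * (ip (tlen a b) \<eta> \<mu> - ip (tlen a b) \<eta> \<eta>) + 2 * (ip (tlen a b) (ptau \<eta>) (ptau \<mu>) - ip (tlen a b) (ptau \<eta>) (ptau \<eta>))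
    + 4 * ((LINT x|\<mu>. hl a b x) - (LINT x|\<eta>. hl a b x))"
  proof (rule nonneg_of_quadratic)
    fix s :: real assume "0 < s" "s \<le> 1"
    then have s: "0 \<le> s" "s \<le> 1" by auto
    note mx = een_mixm[OF s \<eta>(1) \<mu>(1) \<eta>(2) \<mu>(2)]
    note mxt = een_mixm[OF s pl pm e]
    have "Jen \<eta> \<le> Jen (mixm s \<eta> \<mu>)" by (rule min[OF psupp_mixm[OF s \<eta>(1) \<mu>(1)] mx(1)])
    then show "0 \<le> s * (2 * (ip (tlen a b) \<eta> \<mu> - ip (tlen a b) \<eta> \<eta>) + 2 * (ip (tlen a b) (ptau \<eta>) (ptau \<mu>) - ip (tlen a b) (ptau \<eta>) (ptau \<eta>))
      + 4 * ((LINT x|\<mu>. hl a b x) - (LINT x|\<eta>. hl a b x))) + s\<^sup>2 * (B1 + B2)"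
      unfolding Jen_eq[OF l \<eta>(2)] Jen_eq[OF psupp_mixm[OF s l m] mx(1)] ptau_mixm[OF s l m] mx(2) mxt(2)
        integral_mixm[OF s \<eta>(1) \<mu>(1) hl_measurable hl_bounds(3)] B1_def B2_def by (simp add: algebra_simps)
  qed
  moreover have "0 \<le> p + q + 2 * r" if "0 \<le> 2 * p + 2 * q + 4 * r" for p q r :: real using that by linarith
  ultimately show ?thesis by blast
qed

text \<open>The self-consistent extremal problem satisfied by the limit of the zero distributions and the
  minimization of \<^const>\<open>Jen\<close> have the same first-order conditions.\<close>

lemma self_consistent_eq_equilibrium:
  assumes F: "F \<subseteq> {a..b}" and \<eta>: "psupp F \<eta>" "fin_en (tlen a b) \<eta>" and \<nu>: "psupp F \<nu>" "fin_en (tlen a b) \<nu>"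
    and min: "\<And>\<kappa>. psupp F \<kappa> \<Longrightarrow> fin_en (tlen a b) \<kappa> \<Longrightarrow> Jen \<eta> \<le> Jen \<kappa>"
    and G: "G = (\<lambda>x. 2 * hl a b x + (LINT t|\<nu>. lgk a b x t))"
    and min': "\<And>\<kappa>. psupp F \<kappa> \<Longrightarrow> fin_en (tlen a b) \<kappa> \<Longrightarrow> ip (tlen a b) \<nu> \<nu> + (LINT x|\<nu>. G x) \<le> ip (tlen a b) \<kappa> \<kappa> + (LINT x|\<kappa>. G x)"
  shows "\<nu> = \<eta>"
proof -
  note l = psupp_mono[OF \<eta>(1) F] and n = psupp_mono[OF \<nu>(1) F]
  note pl = psupp_ptau[OF l] and pn = psupp_ptau[OF n]
  interpret n: prob_space \<nu> using psuppD[OF \<nu>(1)] by simp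
  note [measurable_cong] = psuppD(2)[OF \<nu>(1)]
  have e: "fin_en (tlen a b) (ptau \<eta>)" "fin_en (tlen a b) (ptau \<nu>)"
    using een_ptau[OF l, of "tlen a b"] een_ptau[OF n, of "tlen a b"] \<eta>(2) \<nu>(2) by (auto intro: le_less_trans)
  define Bl where "Bl = \<bar>ln (1 - 1 / tau a)\<bar> + ln 2"
  have lb: "\<bar>LINT t|\<nu>. lgk a b x t\<bar> \<le> Bl" for x
    unfolding Bl_def by (rule integral_psupp_abs_le[OF \<nu>(1) _ lgk_bounded]) measurable
  have lm [measurable]: "(\<lambda>x. LINT t|\<nu>. lgk a b x t) \<in> borel_measurable borel" by measurable
  have Gm: "G \<in> borel_measurable borel" unfolding G by measurable
  have Gb: "\<bar>G x\<bar> \<le> 2 * ln (tau b) + Bl" for x unfolding G using lb[of x] hl_bounds(3)[of x] by linarith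
  \<comment> \<open>By \<open>lgk_energy\<close>, the field generated by \<nu> acts on \<kappa> as a
    difference of two mutual energies.\<close>
  have IG: "(LINT x|\<kappa>. G x) = 2 * (LINT x|\<kappa>. hl a b x) + (ip (tlen a b) (ptau \<kappa>) (ptau \<nu>) - ip (tlen a b) \<kappa> \<nu> + ln 2)"
    if \<kappa>: "psupp F \<kappa>" "fin_en (tlen a b) \<kappa>" for \<kappa>
  proof -
    note k = psupp_mono[OF \<kappa>(1) F]
    interpret k: prob_space \<kappa> using psuppD[OF k] by simp
    interpret pair_prob_space \<kappa> \<nu> ..
    have "integrable \<kappa> (hl a b)" by (rule integrable_psupp_bounded[OF \<kappa>(1) hl_measurable hl_bounds(3)])
    moreover have "integrable \<kappa> (\<lambda>x. LINT t|\<nu>. lgk a b x t)" by (rule integrable_psupp_bounded[OF \<kappa>(1) lm lb])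
    moreover have "(LINT x|\<kappa>. LINT t|\<nu>. lgk a b x t) = ip (tlen a b) (ptau \<kappa>) (ptau \<nu>) - ip (tlen a b) \<kappa> \<nu> + ln 2"
      using integral_fst'[OF integrable_lgk[OF \<kappa>(1) \<nu>(1)]] lgk_energy[OF k \<kappa>(2) n \<nu>(2)] by simp
    ultimately show ?thesis unfolding G by simp
  qed
  have c: "ip (tlen a b) \<eta> \<nu> = ip (tlen a b) \<nu> \<eta>" "ip (tlen a b) (ptau \<eta>) (ptau \<nu>) = ip (tlen a b) (ptau \<nu>) (ptau \<eta>)" by (simp_all only: mult.commute)
  have 1: "0 \<le> 2 * (ip (tlen a b) \<nu> \<eta> - ip (tlen a b) \<nu> \<nu>) + ((LINT x|\<eta>. G x) - (LINT x|\<nu>. G x))"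
    by (rule energy_first_order[OF Gm Gb \<nu> \<eta> min'])
  have 2: "0 \<le> (ip (tlen a b) \<eta> \<nu> - ip (tlen a b) \<eta> \<eta>) + (ip (tlen a b) (ptau \<eta>) (ptau \<nu>) - ip (tlen a b) (ptau \<eta>) (ptau \<eta>))
    + 2 * ((LINT x|\<nu>. hl a b x) - (LINT x|\<eta>. hl a b x))" by (rule equilibrium_first_order[OF F \<eta> \<nu> min])
  have 3: "0 \<le> ip (tlen a b) (ptau \<nu>) (ptau \<nu>) + ip (tlen a b) (ptau \<eta>) (ptau \<eta>) - 2 * ip (tlen a b) (ptau \<nu>) (ptau \<eta>)"
    unfolding ip_diff(2)[OF pn e(2) pl e(1), symmetric] by (rule integral_nonneg_AE) simp
  \<comment> \<open>In the sum of the two first-order conditions the linear terms cancel; what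
    remains is that the squared distances of \<nu> and \<eta> and of their images under tau add up
    to at most 0. The second one is nonnegative, so the first is nonpositive.\<close>
  have "ip (tlen a b) \<nu> \<nu> + ip (tlen a b) \<eta> \<eta> - 2 * ip (tlen a b) \<nu> \<eta> \<le> 0"
  proof -
    have "nn + ll - 2 * nl \<le> 0"
      if "0 \<le> 2 * (nl - nn) + ((2 * hl + (pnl - nl + l2)) - (2 * hn + (pnn - nn + l2)))"
        "0 \<le> (nl - ll) + (pnl - pll) + 2 * (hn - hl)" "0 \<le> pnn + pll - 2 * pnl"
      for nn ll nl pnn pll pnl hn hl l2 :: real using that by (smt (verit))
    from this[OF 1[unfolded IG[OF \<eta>] IG[OF \<nu>] c] 2[unfolded c] 3] show ?thesis .
  qed
  then show ?thesis by (rule psupp_eq_of_seg_eq[OF n \<nu>(2) l \<eta>(2) length_le_tau])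
qed

end

section \<open>Finiteness of the potential of the equilibrium measure\<close>

lemma integrable_log_of_kern:
  assumes \<mu>: "psupp {a..b} \<mu>" "emeasure \<mu> {x} = 0" and x: "x \<in> {a..b}" and R: "0 < R" "b - a \<le> R"
    and fin: "(\<integral>\<^sup>+t. kern 0 R x t \<partial>\<mu>) < \<infinity>"
  shows "integrable \<mu> (\<lambda>t. ln \<bar>x - t\<bar>)"
proof -
  interpret m: prob_space \<mu> using psuppD[OF \<mu>(1)] by simp
  note [measurable_cong] = psuppD(2)[OF \<mu>(1)]
  define f where "f t = ln R + 1 / 2 - ln \<bar>x - t\<bar>" for t
  have fm [measurable]: "f \<in> borel_measurable \<mu>" unfolding f_def by measurable
  have "AE t in \<mu>. t \<noteq> x" using \<mu>(2) psuppD(2,3)[OF \<mu>(1)] by (intro AE_I[of _ _ "{x}"]) auto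
  with psuppD(6)[OF \<mu>(1)] have ae: "AE t in \<mu>. kern 0 R x t = ennreal (f t) \<and> 0 \<le> f t"
  proof eventually_elim
    case (elim t)
    then have xt: "0 < \<bar>x - t\<bar>" "\<bar>x - t\<bar> \<le> R" using x R by auto
    have "ln \<bar>x - t\<bar> \<le> ln R" using xt by (intro ln_mono) auto
    then have nn: "0 \<le> f t" by (simp add: f_def)
    have e: "ln (R / \<bar>x - t\<bar>) + 1 / 2 = f t" using ln_divide_pos[OF R(1) xt(1)] by (simp add: f_def)
    show ?case using kern_log[OF xt, unfolded e] nn by blast
  qed
  have "(\<integral>\<^sup>+t. ennreal (f t) \<partial>\<mu>) = (\<integral>\<^sup>+t. kern 0 R x t \<partial>\<mu>)"
    by (rule nn_integral_cong_AE) (use ae in \<open>auto elim: eventually_mono\<close>)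
  then have "integrable \<mu> f" using fin ae by (intro integrableI_nonneg) (auto elim: eventually_mono)
  then have "integrable \<mu> (\<lambda>t. ln R + 1 / 2 - f t)" by simp
  then show ?thesis by (simp add: f_def)
qed

text \<open>Fatou's lemma in the length L; the integrand is continuous in the position.\<close>

lemma kern_lsc:
  assumes "y \<longlonglongrightarrow> x"
  shows "kern h R x t \<le> liminf (\<lambda>k. kern h R (y k) t)"
proof -
  have lim: "(\<lambda>k. ennreal (ewt h R L * max 0 (L - \<bar>y k - t\<bar>))) \<longlonglongrightarrow> ennreal (ewt h R L * max 0 (L - \<bar>x - t\<bar>))" for L
    by (intro tendsto_intros assms)
  have "kern h R x t = (\<integral>\<^sup>+L. liminf (\<lambda>k. ennreal (ewt h R L * max 0 (L - \<bar>y k - t\<bar>))) \<partial>lborel)"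
    unfolding kern_eq by (intro nn_integral_cong) (use lim_imp_Liminf[OF trivial_limit_sequentially lim] in simp)
  also have "... \<le> liminf (\<lambda>k. kern h R (y k) t)" unfolding kern_eq by (intro nn_integral_liminf) measurable
  finally show ?thesis .
qed

lemma kern_potential_lsc:
  assumes "y \<longlonglongrightarrow> x" and \<mu>: "psupp S \<mu>"
  shows "(\<integral>\<^sup>+t. kern h R x t \<partial>\<mu>) \<le> liminf (\<lambda>k. \<integral>\<^sup>+t. kern h R (y k) t \<partial>\<mu>)"
proof -
  note [measurable_cong] = psuppD(2)[OF \<mu>]
  have "(\<integral>\<^sup>+t. kern h R x t \<partial>\<mu>) \<le> (\<integral>\<^sup>+t. liminf (\<lambda>k. kern h R (y k) t) \<partial>\<mu>)" by (intro nn_integral_mono kern_lsc assms)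
  also have "... \<le> liminf (\<lambda>k. \<integral>\<^sup>+t. kern h R (y k) t \<partial>\<mu>)" by (intro nn_integral_liminf) measurable
  finally show ?thesis .
qed

text \<open>Conditioning on A raises the mass of an interval at most by the factor 1 / \<mu>(A),
  hence the energy at most by its square.\<close>

lemma een_uniform_measure:
  assumes \<mu>: "psupp S \<mu>" "een h R \<mu> \<mu> < \<infinity>" and A: "A \<in> sets borel" "emeasure \<mu> A \<noteq> 0"
  shows "psupp S (uniform_measure \<mu> A)" "een h R (uniform_measure \<mu> A) (uniform_measure \<mu> A) < \<infinity>"
proof -
  interpret m: prob_space \<mu> using psuppD[OF \<mu>(1)] by simp
  have s: "sets \<mu> = sets borel" "space \<mu> = UNIV" using psuppD[OF \<mu>(1)] by auto
  define c where "c = measure \<mu> A"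
  have c: "0 < c" using A(2) by (simp add: c_def zero_less_measure_iff m.emeasure_eq_measure)
  have "AE x in uniform_measure \<mu> A. x \<in> S"
    using psuppD(6)[OF \<mu>(1)] by (intro AE_uniform_measureI) (auto simp: A s elim: eventually_mono)
  then show ps: "psupp S (uniform_measure \<mu> A)" unfolding psupp_def using A s by (auto intro!: prob_space_uniform_measure)
  note [measurable] = seg_measurable[OF psuppD(4,2)[OF \<mu>(1)]]
  have seg: "seg (uniform_measure \<mu> A) p \<le> seg \<mu> p / c" for p
  proof -
    have "seg (uniform_measure \<mu> A) p = measure \<mu> (A \<inter> {snd p..<snd p + fst p}) / c"
      unfolding seg_def c_def using A s by (subst measure_uniform_measure) auto
    also have "... \<le> seg \<mu> p / c" unfolding seg_def using c A s by (intro divide_right_mono m.finite_measure_mono) auto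
    finally show ?thesis .
  qed
  have "een h R (uniform_measure \<mu> A) (uniform_measure \<mu> A) \<le> (\<integral>\<^sup>+p. ennreal (1 / c\<^sup>2) * ennreal (seg \<mu> p * seg \<mu> p) \<partial>emeas h R)"
    unfolding een_def
  proof (rule nn_integral_mono)
    fix p
    have "seg (uniform_measure \<mu> A) p * seg (uniform_measure \<mu> A) p \<le> (seg \<mu> p / c) * (seg \<mu> p / c)"
      by (intro mult_mono seg seg_nonneg) (simp add: c less_imp_le seg_nonneg)
    also have "... = 1 / c\<^sup>2 * (seg \<mu> p * seg \<mu> p)" by (simp add: power2_eq_square)
    finally show "ennreal (seg (uniform_measure \<mu> A) p * seg (uniform_measure \<mu> A) p) \<le> ennreal (1 / c\<^sup>2) * ennreal (seg \<mu> p * seg \<mu> p)"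
      by (subst ennreal_mult[symmetric]) (auto simp: seg_nonneg intro!: ennreal_leI)
  qed
  also have "... = ennreal (1 / c\<^sup>2) * een h R \<mu> \<mu>" unfolding een_def by (rule nn_integral_cmult) measurable
  also have "... < \<infinity>" using \<mu>(2) by (simp add: ennreal_mult_less_top)
  finally show "een h R (uniform_measure \<mu> A) (uniform_measure \<mu> A) < \<infinity>" .
qed

text \<open>At the minimizer the potential is constant almost everywhere: otherwise conditioning on a
  sublevel set would violate the first-order condition. By lower semicontinuity it is
  then finite on the whole support, so that the individual integrals in the limit formula converge.\<close>

lemma equilibrium_log_integrable:
  assumes ab: "1 < a" "a < b" and F: "F \<subseteq> {a..b}" and \<eta>: "psupp F \<eta>" "fin_en (tlen a b) \<eta>"
    and min: "\<And>\<kappa>. psupp F \<kappa> \<Longrightarrow> fin_en (tlen a b) \<kappa> \<Longrightarrow> Jen \<eta> \<le> Jen \<kappa>" and x: "x \<in> {a..b}"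
  shows "integrable \<eta> (\<lambda>t. ln \<bar>x - t\<bar>)"
proof -
  define R where "R = tau b - tau a"
  note R = length_le_tau[OF ab, folded R_def]
  note e\<eta> = \<eta>(2)[folded R_def] and min' = min[folded R_def]
  note l = psupp_mono[OF \<eta>(1) F]
  note pl = psupp_ptau[OF ab l]
  interpret m: prob_space \<eta> using psuppD[OF \<eta>(1)] by simp
  interpret pm: prob_space "ptau \<eta>" using psuppD[OF pl] by simp
  note [measurable_cong] = psuppD(2)[OF \<eta>(1)] psuppD(2)[OF pl]
  note [measurable] = hl_measurable[OF ab]
  have epl: "fin_en R (ptau \<eta>)" using een_ptau[OF ab l, of R] e\<eta> by (rule le_less_trans)
  have at: "emeasure \<eta> {y} = 0" for y by (rule no_atoms_of_finite_energy[OF l e\<eta> R])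
  define P where "P y = (\<integral>\<^sup>+t. kern 0 R y t \<partial>\<eta>)" for y
  define Q where "Q y = (\<integral>\<^sup>+t. kern 0 R y t \<partial>ptau \<eta>)" for y
  have PQm [measurable]: "P \<in> borel_measurable borel" "Q \<in> borel_measurable borel" unfolding P_def Q_def by measurable
  \<comment> \<open>Half the derivative of \<open>Jen\<close> at \<eta>, up to a constant, as a
    function of the point at which mass is added; \<open>cc\<close> is its integral.\<close>
  define U where "U y = P y + Q (tau y) + ennreal (2 * hl a b y)" for y
  have Um [measurable]: "U \<in> borel_measurable borel" unfolding U_def by measurable
  define cc where "cc \<kappa> = ip R \<kappa> \<eta> + ip R (ptau \<kappa>) (ptau \<eta>) + 2 * (LINT y|\<kappa>. hl a b y)" for \<kappa>
  have ipn: "0 \<le> ip R \<kappa> \<kappa>'" for \<kappa> \<kappa>' by (rule integral_nonneg_AE) (simp add: seg_nonneg)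
  have U_int: "(\<integral>\<^sup>+y. U y \<partial>\<kappa>) = ennreal (cc \<kappa>)" "0 \<le> cc \<kappa>" if \<kappa>: "psupp F \<kappa>" "fin_en R \<kappa>" for \<kappa>
  proof -
    note k = psupp_mono[OF \<kappa>(1) F]
    note pk = psupp_ptau[OF ab k]
    have epk: "fin_en R (ptau \<kappa>)" using een_ptau[OF ab k, of R] \<kappa>(2) by (rule le_less_trans)
    note [measurable_cong] = psuppD(2)[OF \<kappa>(1)]
    have t: "tau \<in> measurable \<kappa> borel" by measurable
    have "(\<integral>\<^sup>+y. P y \<partial>\<kappa>) = ennreal (ip R \<kappa> \<eta>)"
      unfolding P_def een_eq_ip[OF \<kappa>(1,2) \<eta>(1) e\<eta>, symmetric] by (rule een_kern[symmetric]) (use psuppD[OF k] psuppD[OF l] in auto)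
    moreover have "(\<integral>\<^sup>+y. Q (tau y) \<partial>\<kappa>) = ennreal (ip R (ptau \<kappa>) (ptau \<eta>))"
    proof -
      have "(\<integral>\<^sup>+y. Q (tau y) \<partial>\<kappa>) = (\<integral>\<^sup>+y. Q y \<partial>ptau \<kappa>)"
        unfolding ptau_def[of \<kappa>] by (rule nn_integral_distr[OF t, symmetric]) (simp add: PQm)
      also have "... = ennreal (ip R (ptau \<kappa>) (ptau \<eta>))"
        unfolding Q_def een_eq_ip[OF pk epk pl epl, symmetric] by (rule een_kern[symmetric]) (use psuppD[OF pk] psuppD[OF pl] in auto)
      finally show ?thesis .
    qed
    moreover have "(\<integral>\<^sup>+y. ennreal (2 * hl a b y) \<partial>\<kappa>) = ennreal (2 * (LINT y|\<kappa>. hl a b y))"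
    proof -
      have "integrable \<kappa> (hl a b)" by (rule integrable_psupp_bounded[OF \<kappa>(1) hl_measurable[OF ab] hl_bounds(3)[OF ab]])
      then have "integrable \<kappa> (\<lambda>y. 2 * hl a b y)" by simp
      from nn_integral_eq_integral[OF this] show ?thesis using hl_bounds(1)[OF ab] by simp
    qed
    moreover have hn: "0 \<le> (LINT y|\<kappa>. hl a b y)" by (rule integral_nonneg_AE) (simp add: hl_bounds(1)[OF ab])
    moreover have "(\<integral>\<^sup>+y. U y \<partial>\<kappa>) = (\<integral>\<^sup>+y. P y \<partial>\<kappa>) + (\<integral>\<^sup>+y. Q (tau y) \<partial>\<kappa>) + (\<integral>\<^sup>+y. ennreal (2 * hl a b y) \<partial>\<kappa>)"
    proof -
      have m: "P \<in> borel_measurable \<kappa>" "(\<lambda>y. Q (tau y)) \<in> borel_measurable \<kappa>" by measurable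
      have "(\<lambda>y. ennreal (2 * hl a b y)) \<in> borel_measurable borel" using hl_measurable[OF ab] by simp
      then have "(\<lambda>y. ennreal (2 * hl a b y)) \<in> borel_measurable \<kappa>" using psuppD(2)[OF \<kappa>(1)] by (simp cong: measurable_cong_sets)
      with m show ?thesis unfolding U_def by (simp add: nn_integral_add)
    qed
    ultimately show "(\<integral>\<^sup>+y. U y \<partial>\<kappa>) = ennreal (cc \<kappa>)" unfolding cc_def by (simp add: ipn)
    show "0 \<le> cc \<kappa>" unfolding cc_def using hn ipn[of \<kappa> \<eta>] ipn[of "ptau \<kappa>" "ptau \<eta>"] by simp
  qed
  have cc_min: "cc \<eta> \<le> cc \<kappa>" if \<kappa>: "psupp F \<kappa>" "fin_en R \<kappa>" for \<kappa>
  proof -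
    have c: "ip R \<eta> \<kappa> = ip R \<kappa> \<eta>" "ip R (ptau \<eta>) (ptau \<kappa>) = ip R (ptau \<kappa>) (ptau \<eta>)" by (simp_all only: mult.commute)
    have "0 \<le> (ip R \<eta> \<kappa> - ip R \<eta> \<eta>) + (ip R (ptau \<eta>) (ptau \<kappa>) - ip R (ptau \<eta>) (ptau \<eta>))
      + 2 * ((LINT y|\<kappa>. hl a b y) - (LINT y|\<eta>. hl a b y))"
      using equilibrium_first_order[OF ab F \<eta>(1) e\<eta>[unfolded R_def] \<kappa>(1) \<kappa>(2)[unfolded R_def] min] unfolding R_def by blast
    then show ?thesis unfolding cc_def c by (smt (verit))
  qed
  define c where "c = cc \<eta>"
  have c0: "0 \<le> c" and Uc: "(\<integral>\<^sup>+y. U y \<partial>\<eta>) = ennreal c" using U_int[OF \<eta>(1) e\<eta>] by (simp_all add: c_def)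
  define v where "v y = enn2real (U y)" for y
  have vm [measurable]: "v \<in> borel_measurable borel" unfolding v_def by measurable
  have "AE y in \<eta>. U y \<noteq> \<infinity>" using Uc by (intro nn_integral_PInf_AE) auto
  then have Uv: "AE y in \<eta>. U y = ennreal (v y)" by eventually_elim (simp add: v_def ennreal_enn2real_if)
  have iv: "(\<integral>\<^sup>+y. ennreal (v y) \<partial>\<eta>) = ennreal c"
    using Uv unfolding Uc[symmetric] by (intro nn_integral_cong_AE) (auto elim: eventually_mono)
  have vi: "integrable \<eta> v" using iv by (intro integrableI_nonneg) (auto simp: v_def)
  have vc: "(LINT y|\<eta>. v y) = c" using iv c0 by (subst integral_eq_nn_integral) (auto simp: v_def)
  \<comment> \<open>By \<open>cc_min\<close> the mean of v over \<eta> conditioned on A is at least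
    c, while v <= c on A. So v = c almost everywhere on A, and since the total mean is c, almost
    everywhere.\<close>
  define A where "A = {y. v y \<le> c}"
  have A: "A \<in> sets borel" unfolding A_def by measurable
  have "integrable \<eta> (\<lambda>y. v y * indicator A y)" "integrable \<eta> (\<lambda>y. c * indicator A y)"
    by (rule integrable_real_mult_indicator; use A vi psuppD(2)[OF \<eta>(1)] in simp)+
  then have iA: "integrable \<eta> (\<lambda>y. indicator A y * v y)" "integrable \<eta> (\<lambda>y. indicator A y * c)"
    by (simp_all only: mult.commute)
  have "c * measure \<eta> A \<le> (LINT y|\<eta>. indicator A y * v y)"
  proof (cases "emeasure \<eta> A = 0")
    case True
    then have "measure \<eta> A = 0" by (simp add: measure_def)
    then show ?thesis by (simp add: v_def)
  next
    case False
    note u = een_uniform_measure[OF \<eta>(1) e\<eta> A False]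
    have mA: "0 < measure \<eta> A" using False by (simp add: zero_less_measure_iff m.emeasure_eq_measure)
    have "ennreal c \<le> (\<integral>\<^sup>+y. U y \<partial>uniform_measure \<eta> A)"
      unfolding U_int(1)[OF u] c_def using cc_min[OF u] by (rule ennreal_leI)
    also have "... = (\<integral>\<^sup>+y. U y * indicator A y \<partial>\<eta>) / emeasure \<eta> A"
      using A psuppD(2)[OF \<eta>(1)] by (intro nn_integral_uniform_measure) auto
    also have "(\<integral>\<^sup>+y. U y * indicator A y \<partial>\<eta>) = (\<integral>\<^sup>+y. ennreal (indicator A y * v y) \<partial>\<eta>)"
      using Uv by (intro nn_integral_cong_AE) (auto elim!: eventually_mono split: split_indicator)
    also have "... = ennreal (LINT y|\<eta>. indicator A y * v y)" by (rule nn_integral_eq_integral[OF iA(1)]) (simp add: v_def)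
    also have "... / emeasure \<eta> A = ennreal ((LINT y|\<eta>. indicator A y * v y) / measure \<eta> A)"
      unfolding m.emeasure_eq_measure using mA by (intro divide_ennreal) (auto intro!: integral_nonneg_AE simp: v_def)
    finally have "c \<le> (LINT y|\<eta>. indicator A y * v y) / measure \<eta> A"
      using mA by (subst (asm) ennreal_le_iff) (auto intro!: divide_nonneg_pos integral_nonneg_AE simp: v_def)
    then show ?thesis using mA by (simp add: pos_le_divide_eq)
  qed
  also have "c * measure \<eta> A = (LINT y|\<eta>. indicator A y * c)" using A psuppD(2,3)[OF \<eta>(1)] by simp
  finally have ge: "(LINT y|\<eta>. indicator A y * c) \<le> (LINT y|\<eta>. indicator A y * v y)" .
  define d where "d y = indicator A y * c - indicator A y * v y" for y
  have d0: "0 \<le> d y" for y by (simp add: d_def A_def indicator_def)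
  have di: "integrable \<eta> d" unfolding d_def using iA by (rule Bochner_Integration.integrable_diff[rotated])
  have "(LINT y|\<eta>. d y) \<le> 0" using ge iA by (simp add: d_def)
  moreover have "0 \<le> (LINT y|\<eta>. d y)" using d0 by simp
  ultimately have "(LINT y|\<eta>. d y) = 0" by linarith
  then have "AE y in \<eta>. d y = 0" using integral_nonneg_eq_0_iff_AE[OF di] d0 by simp
  then have ge: "AE y in \<eta>. 0 \<le> v y - c" by eventually_elim (auto simp: d_def A_def indicator_def split: if_splits)
  have "(LINT y|\<eta>. v y - c) = 0" using vi vc m.prob_space by simp
  then have "AE y in \<eta>. v y - c = 0" using integral_nonneg_eq_0_iff_AE[OF _ ge] vi by simp
  with Uv have Pc: "AE y in \<eta>. P y \<le> ennreal c"
  proof eventually_elim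
    case (elim y)
    have "P y \<le> U y" unfolding U_def add.assoc by (rule add_increasing2) simp_all
    then show ?case using elim by simp
  qed
  show ?thesis
  \<comment> \<open>If a neighbourhood of x is null, the logarithm is bounded almost everywhere.
    Otherwise points with P <= c accumulate at x.\<close>
  proof (cases "\<exists>e>0. emeasure \<eta> (ball x e) = 0")
    case True
    then obtain e where e: "0 < e" "emeasure \<eta> (ball x e) = 0" by blast
    then have "AE t in \<eta>. t \<notin> ball x e" using psuppD(2,3)[OF \<eta>(1)] by (intro AE_I[of _ _ "ball x e"]) auto
    with psuppD(6)[OF l] have "AE t in \<eta>. norm (ln \<bar>x - t\<bar>) \<le> \<bar>ln e\<bar> + \<bar>ln (b - a)\<bar>"
    proof eventually_elim
      case (elim t)
      then have t: "e \<le> \<bar>x - t\<bar>" "\<bar>x - t\<bar> \<le> b - a" using x by (auto simp: dist_real_def)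
      have "ln e \<le> ln \<bar>x - t\<bar>" "ln \<bar>x - t\<bar> \<le> ln (b - a)" using t e(1) by (auto intro!: ln_mono)
      then show ?case unfolding real_norm_def by linarith
    qed
    then show ?thesis by (intro m.integrable_const_bound[of _ "\<bar>ln e\<bar> + \<bar>ln (b - a)\<bar>"]) measurable
  next
    case False
    have "\<exists>y. y \<in> ball x (1 / real (Suc k)) \<and> P y \<le> ennreal c" for k
    proof (rule ccontr)
      assume no: "\<nexists>y. y \<in> ball x (1 / real (Suc k)) \<and> P y \<le> ennreal c"
      have "AE y in \<eta>. y \<notin> ball x (1 / real (Suc k))" using Pc by eventually_elim (use no in blast)
      then have "emeasure \<eta> (ball x (1 / real (Suc k))) = 0"
        using psuppD(2,3)[OF \<eta>(1)] by (subst (asm) AE_iff_measurable[of "ball x (1 / real (Suc k))"]) auto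
      moreover have "0 < 1 / real (Suc k)" by simp
      ultimately show False using False by blast
    qed
    then obtain y where y: "\<And>k. y k \<in> ball x (1 / real (Suc k))" "\<And>k. P (y k) \<le> ennreal c" by metis
    have "y \<longlonglongrightarrow> x"
    proof (rule Lim_null_comparison[THEN LIM_zero_cancel])
      show "\<forall>\<^sub>F k in sequentially. norm (y k - x) \<le> 1 / real (Suc k)"
        using y(1) by (intro always_eventually allI less_imp_le) (auto simp: dist_real_def abs_minus_commute)
      show "(\<lambda>k. 1 / real (Suc k)) \<longlonglongrightarrow> 0" using LIMSEQ_inverse_real_of_nat by (simp add: inverse_eq_divide)
    qed
    from kern_potential_lsc[OF this \<eta>(1)] have "P x \<le> liminf (\<lambda>k. P (y k))" by (simp add: P_def)
    also have "... \<le> liminf (\<lambda>k. ennreal c)" by (rule Liminf_mono) (use y(2) in simp)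
    also have "... = ennreal c" by (simp add: Liminf_const)
    finally have "(\<integral>\<^sup>+t. kern 0 R x t \<partial>\<eta>) < \<infinity>" by (simp add: P_def le_less_trans)
    then show ?thesis by (rule integrable_log_of_kern[OF l at x R])
  qed
qed

lemma complex_log_integrable:
  assumes ab: "a < b" and \<eta>: "psupp {a..b} \<eta>" and real: "\<And>x. x \<in> {a..b} \<Longrightarrow> integrable \<eta> (\<lambda>t. ln \<bar>x - t\<bar>)"
  shows "integrable \<eta> (\<lambda>t. ln (cmod (z - of_real t)))"
proof (cases "z \<in> complex_of_real ` {a..b}")
  case True
  then obtain x where x: "z = complex_of_real x" "x \<in> {a..b}" by auto
  have "cmod (z - of_real t) = \<bar>x - t\<bar>" for t unfolding x(1) of_real_diff[symmetric] norm_of_real ..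
  then show ?thesis using real[OF x(2)] by simp
next
  case False
  interpret m: prob_space \<eta> using psuppD[OF \<eta>] by simp
  note [measurable_cong] = psuppD(2)[OF \<eta>]
  have "continuous_on {a..b} (\<lambda>t. ln (cmod (z - of_real t)))" using False by (intro continuous_intros) auto
  then have "compact ((\<lambda>t. ln (cmod (z - complex_of_real t))) ` {a..b})" by (rule compact_continuous_image) simp
  then obtain B where B: "\<And>t. t \<in> {a..b} \<Longrightarrow> \<bar>ln (cmod (z - of_real t))\<bar> \<le> B"
    using compact_imp_bounded bounded_iff by (metis imageI real_norm_def)
  show ?thesis by (rule m.integrable_const_bound[of _ B]) (use psuppD(6)[OF \<eta>] B in \<open>auto elim: eventually_mono\<close>)
qed

text \<open>By \<open>phi_diff\<close>, ln |z - t| = ln |phi z - phi t| +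
  \<open>lk a b (1 / phi z) t\<close> - ln 2 almost everywhere, so the singular parts cancel and a
  bounded integrand remains. Splitting the integral is legitimate only if each part converges; this
  is the purpose of the assumption \<open>real\<close>.\<close>

lemma limit_function_eq:
  assumes ab: "1 < a" "a < b" and \<eta>: "psupp {a..b} \<eta>" and real: "\<And>x. x \<in> {a..b} \<Longrightarrow> integrable \<eta> (\<lambda>t. ln \<bar>x - t\<bar>)"
    and at: "\<And>x. emeasure \<eta> {x} = 0"
  shows "logpot \<eta> z - (LINT t|\<eta>. ln (1 / cmod (phi z - phi (of_real t)))) = ln 2 - (LINT t|\<eta>. lk a b (1 / phi z) t)"
proof -
  interpret m: prob_space \<eta> using psuppD[OF \<eta>] by simp
  note [measurable_cong] = psuppD(2)[OF \<eta>]
  have "1 / cmod (phi z) \<le> 1 / 1" using norm_phi_ge_1[of z] by (intro divide_left_mono) auto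
  then have v: "cmod (1 / phi z) \<le> 1" by (simp add: norm_divide)
  note i = complex_log_integrable[OF ab(2) \<eta> real, of z]
  note il = integrable_psupp_bounded[OF \<eta> lk_measurable[OF ab v] lk_bounded[OF ab v]]
  have lkm: "lk a b (1 / phi z) \<in> borel_measurable \<eta>" using lk_measurable[OF ab v] by measurable
  have ne: "AE t in \<eta>. complex_of_real t \<noteq> z"
  proof (cases "z \<in> \<real>")
    case True
    then obtain x where x: "z = complex_of_real x" by (auto elim: Reals_cases)
    show ?thesis using at[of x] psuppD(2,3)[OF \<eta>] by (intro AE_I[of _ _ "{x}"]) (auto simp: x)
  qed auto
  have "(LINT t|\<eta>. ln (1 / cmod (phi z - phi (of_real t))))
    = (LINT t|\<eta>. lk a b (1 / phi z) t - ln (cmod (z - of_real t)) - ln 2)"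
  proof (rule integral_cong_AE)
    show "AE t in \<eta>. ln (1 / cmod (phi z - phi (of_real t))) = lk a b (1 / phi z) t - ln (cmod (z - of_real t)) - ln 2"
      using psuppD(6)[OF \<eta>] ne
    proof eventually_elim
      case (elim t)
      define A B where "A = cmod (phi z - phi (of_real t))" and "B = cmod (1 - 1 / (phi z * phi (of_real t)))"
      have zt: "z - of_real t = (phi z - phi (of_real t)) * (1 - 1 / (phi z * phi (of_real t))) / 2" by (rule phi_diff)
      have pt: "phi (of_real t) = of_real (tau (cl a b t))" using elim ab by (simp add: phi_real cl_id)
      have c: "cmod (z - of_real t) = A * B / 2" unfolding zt A_def B_def by (simp add: norm_mult)
      have "A * B \<noteq> 0" using c elim by auto
      then have AB: "0 < A" "0 < B" by (auto simp: A_def B_def)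
      have "ln (A * B / 2) = ln A + ln B - ln 2" using AB by (simp add: ln_div ln_mult_pos)
      moreover have "lk a b (1 / phi z) t = ln B" unfolding lk_def B_def pt by (simp add: divide_simps)
      moreover have "ln (1 / A) = - ln A" using AB by (simp add: ln_div)
      ultimately show ?case unfolding c A_def[symmetric] by simp
    qed
  qed (use lkm in measurable)
  also have "... = (LINT t|\<eta>. lk a b (1 / phi z) t) - (LINT t|\<eta>. ln (cmod (z - of_real t))) - ln 2"
    using i il m.prob_space by simp
  finally have 1: "(LINT t|\<eta>. ln (1 / cmod (phi z - phi (of_real t))))
    = (LINT t|\<eta>. lk a b (1 / phi z) t) - (LINT t|\<eta>. ln (cmod (z - of_real t))) - ln 2" .
  have 2: "logpot \<eta> z = - (LINT t|\<eta>. ln (cmod (z - of_real t)))"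
  proof -
    have "ln (1 / cmod w) = - ln (cmod w)" for w by (cases "w = 0") (simp_all add: ln_div)
    then show ?thesis unfolding logpot_def by simp
  qed
  show ?thesis unfolding 1 2 by simp
qed

text \<open>The tail of the logarithmic series is dominated by a geometric series of ratio 1 / 2,
  whence the factor 2. The term n = 0 of the sum is \<open>1 / 0 = 0\<close>.\<close>

lemma ln_one_minus_remainder:
  fixes x :: real
  assumes "\<bar>x\<bar> \<le> 1 / 2"
  shows "\<bar>ln (1 - x) + (\<Sum>n<Suc K. x ^ n / n)\<bar> \<le> 2 * \<bar>x\<bar> ^ Suc K"
proof -
  have "(\<lambda>n. - ((- (- x)) ^ n) / of_nat n) sums ln (1 + (- x))" by (rule ln_series') (use assms in simp)
  then have "(\<lambda>n. - (- ((- (- x)) ^ n) / of_nat n)) sums - ln (1 + (- x))" by (rule sums_minus)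
  then have "(\<lambda>n. x ^ n / n) sums - ln (1 - x)" by simp
  then have 1: "(\<lambda>i. x ^ (i + Suc K) / real (i + Suc K)) sums (- ln (1 - x) - (\<Sum>n<Suc K. x ^ n / n))"
    by (rule sums_split_initial_segment)
  have 2: "(\<lambda>i. \<bar>x\<bar> ^ Suc K * (1 / 2) ^ i) sums (\<bar>x\<bar> ^ Suc K * 2)"
    using sums_mult[OF geometric_sums[of "1 / 2 :: real"], of "\<bar>x\<bar> ^ Suc K"] by simp
  have "norm (- ln (1 - x) - (\<Sum>n<Suc K. x ^ n / n)) \<le> \<bar>x\<bar> ^ Suc K * 2"
  proof (rule norm_sums_le[OF 1 2])
    fix i
    have "norm (x ^ (i + Suc K) / real (i + Suc K)) = \<bar>x\<bar> ^ Suc K * (\<bar>x\<bar> ^ i / real (i + Suc K))"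
      by (simp add: power_add power_abs abs_mult)
    also have "\<bar>x\<bar> ^ i / real (i + Suc K) \<le> (1 / 2) ^ i / 1" using assms by (intro frac_le power_mono) auto
    finally show "norm (x ^ (i + Suc K) / real (i + Suc K)) \<le> \<bar>x\<bar> ^ Suc K * (1 / 2) ^ i" by (simp add: mult_left_mono)
  qed
  then show ?thesis unfolding real_norm_def by (simp add: abs_le_iff)
qed

text \<open>With z = 1 / y, ln (z - t) is ln (1 - y t) up to a constant, and the coefficient of y^K
  in its expansion is - t^K / K. If the lower moments agree, the difference of the K-th moments is
  O(y), hence 0.\<close>

lemma moments_eq_of_log_potential_eq:
  assumes ab: "0 < a" "a < b" and \<nu>: "psupp {a..b} \<nu>" and \<omega>: "psupp {a..b} \<omega>"
    and eq: "\<And>z. b < z \<Longrightarrow> (LINT t|\<nu>. ln (z - cl a b t)) = (LINT t|\<omega>. ln (z - cl a b t))"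
  shows "(LINT t|\<nu>. cl a b t ^ k) = (LINT t|\<omega>. cl a b t ^ k)"
proof (induction k rule: less_induct)
  case (less K)
  interpret n: prob_space \<nu> using psuppD[OF \<nu>] by simp
  interpret o: prob_space \<omega> using psuppD[OF \<omega>] by simp
  define D where "D f = (LINT t|\<nu>. f t) - (LINT t|\<omega>. f t)" for f :: "real \<Rightarrow> real"
  define m where "m k = D (\<lambda>t. cl a b t ^ k)" for k
  have m0: "m j = 0" if "j < K" for j using less[OF that] by (simp add: m_def D_def)
  have clb: "0 \<le> cl a b t" "cl a b t \<le> b" for t using cl_in[of a b t] ab by auto
  show ?case
  proof (cases "K = 0")
    case True
    then show ?thesis using n.prob_space o.prob_space by simp
  next
    case False
    \<comment> \<open>The remainder contributes 2 (y b)^(K+1) for each of the two measures; dividing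
      by y^K / K leaves C y.\<close>
    define C where "C = 4 * real K * b ^ Suc K"
    have C: "0 < C" using False ab by (simp add: C_def)
    have key: "\<bar>m K\<bar> \<le> C * y" if y: "0 < y" "y \<le> 1 / (2 * b)" for y
    proof -
      define p where "p t = y * cl a b t" for t
      have pm [measurable]: "p \<in> borel_measurable borel" unfolding p_def by measurable
      have pb: "0 \<le> p t" "p t \<le> y * b" for t unfolding p_def using clb[of t] y by (auto intro: mult_left_mono)
      have yb: "y * b \<le> 1 / 2" using y ab by (simp add: field_simps)
      have ph: "\<bar>p t\<bar> \<le> 1 / 2" for t using pb[of t] yb by simp
      have ip: "integrable \<kappa> (\<lambda>t. p t ^ n / n)" if "psupp {a..b} \<kappa>" for \<kappa> and n :: nat
      proof (rule integrable_psupp_bounded[OF that])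
        show "\<bar>p t ^ n / n\<bar> \<le> 1 ^ n / n" for t
        proof -
          have "\<bar>p t\<bar> ^ n \<le> 1 ^ n" using ph[of t] by (intro power_mono) auto
          from divide_right_mono[OF this, of "real n"] show ?thesis by (simp add: abs_divide power_abs)
        qed
      qed measurable
      have il: "integrable \<kappa> (\<lambda>t. ln (1 - p t))" if "psupp {a..b} \<kappa>" for \<kappa>
      proof (rule integrable_psupp_bounded[OF that])
        fix t
        have "ln (1 / 2) \<le> ln (1 - p t)" "ln (1 - p t) \<le> ln 1" using pb(1)[of t] ph[of t] by (auto intro!: ln_mono)
        then show "\<bar>ln (1 - p t)\<bar> \<le> - ln (1 / 2 :: real)" unfolding ln_one by linarith
      qed measurable
      have DL: "D (\<lambda>t. ln (1 - p t)) = 0"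
      proof -
        have z: "b < 1 / y" using y ab by (simp add: field_simps)
        have "ln (1 - p t) = ln y + ln (1 / y - cl a b t)" for t
        proof -
          have "0 < 1 / y - cl a b t" using clb[of t] z by linarith
          then have "ln y + ln (1 / y - cl a b t) = ln (y * (1 / y - cl a b t))" using y by (simp add: ln_mult_pos)
          also have "y * (1 / y - cl a b t) = 1 - p t" using y by (simp add: p_def right_diff_distrib)
          finally show ?thesis ..
        qed
        then have e: "(\<lambda>t. ln (1 / y - cl a b t)) = (\<lambda>t. ln (1 - p t) - ln y)" by auto
        have "(LINT t|\<nu>. ln (1 - p t) - ln y) = (LINT t|\<omega>. ln (1 - p t) - ln y)" using eq[OF z] unfolding e .
        then show ?thesis unfolding D_def using il[OF \<nu>] il[OF \<omega>] n.prob_space o.prob_space by simp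
      qed
      define rem where "rem t = ln (1 - p t) + (\<Sum>n<Suc K. p t ^ n / n)" for t
      have ri: "integrable \<kappa> rem" "(LINT t|\<kappa>. rem t) = (LINT t|\<kappa>. ln (1 - p t)) + (\<Sum>n<Suc K. LINT t|\<kappa>. p t ^ n / n)"
        if "psupp {a..b} \<kappa>" for \<kappa> unfolding rem_def using il[OF that] ip[OF that] by (simp_all del: sum.lessThan_Suc)
      have rb: "\<bar>rem t\<bar> \<le> 2 * (y * b) ^ Suc K" for t
      proof -
        have "\<bar>rem t\<bar> \<le> 2 * \<bar>p t\<bar> ^ Suc K" unfolding rem_def by (rule ln_one_minus_remainder[OF ph])
        also have "... \<le> 2 * (y * b) ^ Suc K" using pb[of t] by (intro mult_left_mono power_mono) auto
        finally show ?thesis .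
      qed
      have "D rem = (\<Sum>n<Suc K. (LINT t|\<nu>. p t ^ n / n) - (LINT t|\<omega>. p t ^ n / n))"
        using DL unfolding D_def ri(2)[OF \<nu>] ri(2)[OF \<omega>] by (simp add: sum_subtractf del: sum.lessThan_Suc)
      also have "... = (\<Sum>n<Suc K. y ^ n / n * m n)"
        unfolding p_def m_def D_def by (intro sum.cong refl) (simp add: power_mult_distrib right_diff_distrib)
      also have "... = y ^ K / K * m K" using m0 by simp
      finally have Dr: "D rem = y ^ K / K * m K" .
      have rm: "rem \<in> borel_measurable borel" unfolding rem_def by measurable
      have "\<bar>D rem\<bar> \<le> 4 * (y * b) ^ Suc K"
        using integral_psupp_abs_le[OF \<nu> rm rb] integral_psupp_abs_le[OF \<omega> rm rb] unfolding D_def by linarith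
      then have "y ^ K * (\<bar>m K\<bar> / K) \<le> y ^ K * (4 * y * b ^ Suc K)"
        unfolding Dr using y by (simp add: abs_mult power_mult_distrib mult_ac)
      then have "\<bar>m K\<bar> / K \<le> 4 * y * b ^ Suc K" using y by (simp only: mult_le_cancel_left_pos zero_less_power)
      then show ?thesis using False by (simp add: C_def pos_divide_le_eq mult_ac)
    qed
    have "m K = 0"
    proof (rule ccontr)
      assume ne: "m K \<noteq> 0"
      \<comment> \<open>Small enough for the expansion, and such that C y is at most half of |m
        K|.\<close>
      define y where "y = min (1 / (2 * b)) (\<bar>m K\<bar> / (2 * C))"
      have "0 < y" "y \<le> 1 / (2 * b)" "y \<le> \<bar>m K\<bar> / (2 * C)" using ab C ne by (auto simp: y_def)
      then have "\<bar>m K\<bar> \<le> C * y" "C * y \<le> C * (\<bar>m K\<bar> / (2 * C))" using key C by (blast, intro mult_left_mono) auto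
      then show False using C ne by simp
    qed
    then show ?thesis by (simp add: m_def D_def)
  qed
qed

text \<open>The Weierstrass theorem extends equality from powers to continuous functions on [a, b],
  in particular to cosines and sines; equal characteristic functions determine the measure.\<close>

lemma measure_eq_of_moments_eq:
  assumes ab: "a < b" and \<nu>: "psupp {a..b} \<nu>" and \<omega>: "psupp {a..b} \<omega>"
    and eq: "\<And>k. (LINT t|\<nu>. cl a b t ^ k) = (LINT t|\<omega>. cl a b t ^ k)"
  shows "\<nu> = \<omega>"
proof -
  interpret n: prob_space \<nu> using psuppD[OF \<nu>] by simp
  interpret o: prob_space \<omega> using psuppD[OF \<omega>] by simp
  have clr: "cl a b t \<in> {a..b}" for t using ab by (intro cl_in) simp
  have cont: "(LINT t|\<nu>. f t) = (LINT t|\<omega>. f t)" if f: "continuous_on UNIV f" for f :: "real \<Rightarrow> real"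
  proof -
    note fm [measurable] = borel_measurable_continuous_onI[OF f]
    have tocl: "(LINT t|\<kappa>. f t) = (LINT t|\<kappa>. f (cl a b t))" if \<kappa>: "psupp {a..b} \<kappa>" for \<kappa>
    proof (rule integral_cong_AE)
      note [measurable_cong] = psuppD(2)[OF \<kappa>]
      show "f \<in> borel_measurable \<kappa>" "(\<lambda>t. f (cl a b t)) \<in> borel_measurable \<kappa>" by measurable
      show "AE t in \<kappa>. f t = f (cl a b t)" using psuppD(6)[OF \<kappa>] by eventually_elim (simp add: cl_id)
    qed
    have bnd: "\<exists>B. \<forall>t. \<bar>g (cl a b t)\<bar> \<le> B" if "continuous_on {a..b} g" for g :: "real \<Rightarrow> real"
    proof -
      have "compact (g ` {a..b})" using that by (rule compact_continuous_image) simp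
      then obtain B where "\<forall>y\<in>g ` {a..b}. norm y \<le> B" using compact_imp_bounded bounded_iff by blast
      then show ?thesis using clr by (intro exI[of _ B]) auto
    qed
    define D where "D = (LINT t|\<nu>. f (cl a b t)) - (LINT t|\<omega>. f (cl a b t))"
    have "\<bar>D\<bar> \<le> 2 * e" if e: "0 < e" for e
    proof -
      obtain g where g: "real_polynomial_function g" "\<And>x. x \<in> {a..b} \<Longrightarrow> \<bar>f x - g x\<bar> < e"
        using Stone_Weierstrass_real_polynomial_function[of "{a..b}" f e] f e by (auto intro: continuous_on_subset)
      then obtain c and N :: nat where gs: "g = (\<lambda>x. \<Sum>i\<le>N. c i * x ^ i)" unfolding real_polynomial_function_iff_sum by blast
      have gc: "continuous_on A g" for A unfolding gs by (intro continuous_intros)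
      note gm [measurable] = borel_measurable_continuous_onI[OF gc]
      obtain Bf where Bf: "\<forall>t. \<bar>f (cl a b t)\<bar> \<le> Bf" using bnd[of f] f continuous_on_subset by blast
      obtain Bg where Bg: "\<forall>t. \<bar>g (cl a b t)\<bar> \<le> Bg" using bnd[OF gc] by blast
      have i: "integrable \<kappa> (\<lambda>t. f (cl a b t))" "integrable \<kappa> (\<lambda>t. g (cl a b t))" if "psupp {a..b} \<kappa>" for \<kappa>
      proof -
        show "integrable \<kappa> (\<lambda>t. f (cl a b t))" by (rule integrable_psupp_bounded[OF that, of _ Bf]) (use Bf in auto)
        show "integrable \<kappa> (\<lambda>t. g (cl a b t))" by (rule integrable_psupp_bounded[OF that, of _ Bg]) (use Bg in auto)
      qed
      have ik: "integrable \<kappa> (\<lambda>t. cl a b t ^ k)" if "psupp {a..b} \<kappa>" for \<kappa> k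
      proof -
        have "\<exists>B. \<forall>t. \<bar>cl a b t ^ k\<bar> \<le> B" by (rule bnd) (intro continuous_intros)
        then obtain B where "\<forall>t. \<bar>cl a b t ^ k\<bar> \<le> B" by blast
        then show ?thesis by (intro integrable_psupp_bounded[OF that, of _ B]) auto
      qed
      have "(LINT t|\<nu>. g (cl a b t)) = (LINT t|\<omega>. g (cl a b t))" unfolding gs using ik[OF \<nu>] ik[OF \<omega>] eq by simp
      then have D: "D = (LINT t|\<nu>. f (cl a b t) - g (cl a b t)) - (LINT t|\<omega>. f (cl a b t) - g (cl a b t))"
        unfolding D_def using i[OF \<nu>] i[OF \<omega>] by simp
      have dm: "(\<lambda>t. f (cl a b t) - g (cl a b t)) \<in> borel_measurable borel" by measurable
      have d: "\<bar>f (cl a b t) - g (cl a b t)\<bar> \<le> e" for t using g(2)[OF clr[of t]] by linarith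
      show ?thesis unfolding D using integral_psupp_abs_le[OF \<nu> dm d] integral_psupp_abs_le[OF \<omega> dm d] by linarith
    qed
    from this[of "\<bar>D\<bar> / 4"] have "D = 0" by (cases "D = 0") auto
    then show ?thesis unfolding tocl[OF \<nu>] tocl[OF \<omega>] D_def by simp
  qed
  have "char \<nu> s = char \<omega> s" for s
  proof (rule complex_eqI)
    have "Re (char \<kappa> s) = (LINT t|\<kappa>. cos (s * t))" "Im (char \<kappa> s) = (LINT t|\<kappa>. sin (s * t))" if \<kappa>: "psupp {a..b} \<kappa>" for \<kappa>
    proof -
      interpret k: prob_space \<kappa> using psuppD[OF \<kappa>] by simp
      note [measurable_cong] = psuppD(2)[OF \<kappa>]
      have i: "integrable \<kappa> (\<lambda>t. iexp (s * t))" by (rule k.integrable_const_bound[of _ 1]) auto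
      show "Re (char \<kappa> s) = (LINT t|\<kappa>. cos (s * t))" "Im (char \<kappa> s) = (LINT t|\<kappa>. sin (s * t))"
      proof -
        have "Re (char \<kappa> s) = (LINT t|\<kappa>. Re (iexp (s * t)))" unfolding char_def by (rule integral_Re[OF i, symmetric])
        then show "Re (char \<kappa> s) = (LINT t|\<kappa>. cos (s * t))" by (simp add: Re_exp)
        have "Im (char \<kappa> s) = (LINT t|\<kappa>. Im (iexp (s * t)))" unfolding char_def by (rule integral_Im[OF i, symmetric])
        then show "Im (char \<kappa> s) = (LINT t|\<kappa>. sin (s * t))" by (simp add: Im_exp)
      qed
    qed
    moreover have "(LINT t|\<nu>. cos (s * t)) = (LINT t|\<omega>. cos (s * t))" by (rule cont) (intro continuous_intros)
    moreover have "(LINT t|\<nu>. sin (s * t)) = (LINT t|\<omega>. sin (s * t))" by (rule cont) (intro continuous_intros)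
    ultimately show "Re (char \<nu> s) = Re (char \<omega> s)" "Im (char \<nu> s) = Im (char \<omega> s)" using \<nu> \<omega> by simp_all
  qed
  then have "char \<nu> = char \<omega>" by (rule ext)
  then show ?thesis by (rule Levy_uniqueness[OF psuppD(7)[OF \<nu>] psuppD(7)[OF \<omega>]])
qed

section \<open>Support of \<sigma>, geometry of F and translation of the definitions\<close>

lemma AE_in_msupport:
  assumes s: "sets \<sigma> = sets borel"
  shows "AE t in \<sigma>. t \<in> msupport \<sigma>"
proof -
  define U where "U = {ball x e | x e. 0 < e \<and> emeasure \<sigma> (ball x e) = 0}"
  obtain V where V: "V \<subseteq> U" "countable V" "\<Union>V = \<Union>U" by (rule Lindelof[of U]) (auto simp: U_def)
  have "- msupport \<sigma> \<subseteq> \<Union>U"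
  proof
    fix x assume "x \<in> - msupport \<sigma>"
    then obtain e where e: "0 < e" "emeasure \<sigma> (ball x e) = 0" by (auto simp: msupport_def zero_less_iff_neq_zero)
    then have "ball x e \<in> U" unfolding U_def by blast
    then show "x \<in> \<Union>U" using e(1) by (auto intro: centre_in_ball[THEN iffD2])
  qed
  moreover have "(\<Union>S\<in>V. S) \<in> null_sets \<sigma>" using V(1,2) s by (intro null_sets_UN') (auto simp: U_def null_sets_def)
  moreover have "{t \<in> space \<sigma>. t \<notin> msupport \<sigma>} \<subseteq> (\<Union>S\<in>V. S)" using calculation(1) V(3) by auto
  ultimately show ?thesis by (intro AE_I'[of "\<Union>S\<in>V. S"])
qed

lemma infinite_msupport_AE:
  assumes s: "sets \<sigma> = sets borel" and inf: "infinite (msupport \<sigma>)" and A: "finite A"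
  shows "\<not> (AE t in \<sigma>. t \<in> A)"
proof
  assume ae: "AE t in \<sigma>. t \<in> A"
  obtain x where x: "x \<in> msupport \<sigma>" "x \<notin> A" using inf A by (meson finite_subset subsetI)
  have "open (- A)" using A by (simp add: finite_imp_closed open_Compl)
  then obtain e where e: "0 < e" "ball x e \<subseteq> - A" using x(2) by (auto elim: openE)
  have "AE t in \<sigma>. t \<notin> ball x e" using ae by eventually_elim (use e(2) in auto)
  then have "emeasure \<sigma> (ball x e) = 0"
    using s sets_eq_imp_space_eq[OF s] by (subst (asm) AE_iff_measurable[of "ball x e"]) auto
  then show False using x(1) e(1) by (auto simp: msupport_def)
qed

text \<open>The geometry of F enters the proof only through these properties. Finiteness of the
  boundary makes the inner parallel sets exhaust F up to a null set of any measure without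
  atoms.\<close>

lemma admissible_F_structure:
  assumes "admissible_F F"
  obtains a b where "1 < a" "a < b" "compact F" "F \<subseteq> {a..b}" "finite (F - interior F)" "infinite F"
proof -
  obtain p :: nat and A B :: "nat \<Rightarrow> real" where p: "p \<ge> 1" and AB: "\<And>j. j < p \<Longrightarrow> A j < B j"
    and BA: "\<And>j. Suc j < p \<Longrightarrow> B j < A (Suc j)" and A0: "1 < A 0" and F: "F = (\<Union>j<p. {A j..B j})"
    using assms unfolding admissible_F_def by blast
  have A1: "1 < A j" if "j < p" for j using that
  proof (induction j)
    case (Suc j)
    then show ?case using AB[of j] BA[of j] by auto
  qed (rule A0)
  define a b where "a = Min (A ` {..<p})" and "b = Max (B ` {..<p})"
  have "0 \<in> {..<p}" using p by simp
  then have ne: "A ` {..<p} \<noteq> {}" "B ` {..<p} \<noteq> {}" by blast+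
  have aj: "a \<le> A j" "B j \<le> b" if "j < p" for j using that by (auto simp: a_def b_def)
  have "1 < a" unfolding a_def using ne A1 by (subst Min_gr_iff) auto
  moreover have "a < b" using aj[of 0] AB[of 0] p by auto
  moreover have "compact F" unfolding F by (intro compact_UN) auto
  moreover have "F \<subseteq> {a..b}" unfolding F using aj by force
  moreover have "finite (F - interior F)"
  proof (rule finite_subset)
    have "{A j<..<B j} \<subseteq> interior F" if "j < p" for j using that unfolding F by (intro interior_maximal) auto
    then show "F - interior F \<subseteq> A ` {..<p} \<union> B ` {..<p}" unfolding F by force
  qed simp
  moreover have "infinite F"
  proof
    assume "finite F"
    moreover have "{A 0..B 0} \<subseteq> F" unfolding F using p by (auto intro!: bexI[of _ 0])
    ultimately have "finite {A 0..B 0}" by (rule rev_finite_subset)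
    then show False using AB[of 0] p by (simp add: infinite_Icc)
  qed
  ultimately show ?thesis by (rule that)
qed

lemma prob_on_iff_psupp:
  assumes "F \<in> sets borel"
  shows "prob_on F \<mu> \<longleftrightarrow> psupp F \<mu>"
proof (cases "sets \<mu> = sets borel")
  case True
  then have sp: "space \<mu> = UNIV" using sets_eq_imp_space_eq[OF True] by simp
  have "(AE x in \<mu>. x \<in> F) \<longleftrightarrow> emeasure \<mu> (- F) = 0" using assms True sp by (intro AE_iff_measurable) auto
  moreover have "prob_space \<mu> \<longleftrightarrow> emeasure \<mu> UNIV = 1" using sp prob_space.emeasure_space_1[of \<mu>] by (auto intro: prob_spaceI)
  ultimately show ?thesis using True by (auto simp: prob_on_def psupp_def)
qed (auto simp: prob_on_def psupp_def)

lemma finite_log_energy_iff: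
  assumes \<mu>: "psupp {a..b} \<mu>" and R: "0 < R" "b - a \<le> R"
  shows "finite_log_energy \<mu> \<longleftrightarrow> fin_en R \<mu>"
proof
  assume "finite_log_energy \<mu>"
  then show "fin_en R \<mu>" unfolding finite_log_energy_def by (intro finite_een_of_integrable_log[OF \<mu> _ _ R]) auto
next
  assume e: "fin_en R \<mu>"
  then show "finite_log_energy \<mu>"
    unfolding finite_log_energy_def using no_atoms_of_finite_energy[OF \<mu> e R] log_energy(2)[OF \<mu> e \<mu> e R] by auto
qed

subsection \<open>Asymptotics\<close>

text \<open>The exponent is - n times the field generated by the empirical measure of S itself, plus
  a bounded term that depends neither on n nor on S. This is the form of weight that
  \<open>heine_limit\<close> accepts.\<close>

lemma weight_eq_exp:
  assumes ab: "1 < a" "a < b" and n: "n \<ge> 1" and S: "finite S" "S \<subseteq> {a..b}" and x: "bij_betw x {..<n} S" and t: "t \<in> {a..b}"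
  shows "zero_weight n S t = exp (- (real n * (2 * hl a b t + (LINT s|emp n x. lgk a b t s))) - ln (sqrt ((cl a b t)\<^sup>2 - 1)))"
proof -
  have m: "lgk a b t \<in> borel_measurable borel" by (intro lgk_measurable[OF ab]) measurable
  have "real n * (LINT s|emp n x. lgk a b t s) = (\<Sum>i<n. lgk a b t (x i))" using n by (simp add: integral_emp[OF n m])
  also have "... = (\<Sum>s\<in>S. lgk a b t s)" by (rule sum.reindex_bij_betw[OF x])
  finally have I: "real n * (LINT s|emp n x. lgk a b t s) = (\<Sum>s\<in>S. lgk a b t s)" .
  have tt: "1 < tau t" using t ab by (auto intro!: tau_gt1)
  have "exp (\<Sum>s\<in>S. lgk a b t s) = (\<Prod>s\<in>S. (1 - 1 / (tau t * tau s)))" unfolding exp_sum[OF S(1)]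
  proof (rule prod.cong[OF refl])
    fix s assume s: "s \<in> S"
    then have "1 < tau s" using S(2) ab by (auto intro!: tau_gt1)
    then have "1 < tau t * tau s" using tt by (simp add: less_1_mult)
    then have "0 < 1 - 1 / (tau t * tau s)" by simp
    moreover have "cl a b t = t" "cl a b s = s" using t s S(2) by (auto intro!: cl_id)
    ultimately show "exp (lgk a b t s) = 1 - 1 / (tau t * tau s)" unfolding lgk_def by (simp only: exp_ln)
  qed
  moreover have "exp (real (2 * n) * hl a b t) = tau t ^ (2 * n)"
    unfolding exp_of_nat_mult using tt t by (simp add: hl_def cl_id)
  moreover have "exp (ln (sqrt ((cl a b t)\<^sup>2 - 1))) = sqrt (t\<^sup>2 - 1)"
  proof -
    have "1 < t\<^sup>2" using t ab by (auto intro!: one_less_power)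
    then show ?thesis using t by (simp add: cl_id)
  qed
  moreover have "- (real n * (2 * hl a b t + (LINT s|emp n x. lgk a b t s))) - ln (sqrt ((cl a b t)\<^sup>2 - 1))
    = - (real (2 * n) * hl a b t) - (\<Sum>s\<in>S. lgk a b t s) - ln (sqrt ((cl a b t)\<^sup>2 - 1))"
    unfolding I[symmetric] by (simp add: algebra_simps)
  moreover have "exp (- A - B - C) = 1 / (exp A * exp B * exp C)" for A B C :: real by (simp add: exp_diff exp_minus exp_add field_simps)
  ultimately show ?thesis unfolding zero_weight_def by (simp only: power_one_over) (simp add: mult_ac)
qed

lemma monic_product_degree:
  fixes S :: "real set"
  assumes "finite S"
  shows "degree (\<Prod>s\<in>S. [:- s, 1:]) = card S" "lead_coeff (\<Prod>s\<in>S. [:- s, 1:]) = 1"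
proof -
  show "degree (\<Prod>s\<in>S. [:- s, 1:]) = card S" by (subst degree_prod_eq_sum_degree) auto
  show "lead_coeff (\<Prod>s\<in>S. [:- s, 1:]) = 1" by (simp add: lead_coeff_prod)
qed

context
  fixes F :: "real set" and \<sigma> \<eta> :: "real measure" and a b :: real
  assumes ab: "1 < a" "a < b" and F: "compact F" "F \<subseteq> {a..b}" "finite (F - interior F)" and \<sigma>: "psupp F \<sigma>"
    and dens: "AE t in lborel. t \<in> F \<longrightarrow> pos_density_at \<sigma> t"
    and \<eta>: "psupp F \<eta>" "fin_en (tlen a b) \<eta>"
    and min: "\<And>\<kappa>. psupp F \<kappa> \<Longrightarrow> fin_en (tlen a b) \<kappa> \<Longrightarrow> Jen \<eta> \<le> Jen \<kappa>"
begin

text \<open>A weak limit of the zero distributions minimizes the energy in the external field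
  generated by the limit itself.\<close>

lemma zero_distribution_subsequence:
  fixes S :: "nat \<Rightarrow> real set" and x :: "nat \<Rightarrow> nat \<Rightarrow> real"
  assumes N: "filterlim N at_top sequentially" "\<And>m. N m \<ge> 1"
    and S: "\<And>m. finite (S m)" "\<And>m. card (S m) = N m" "\<And>m. S m \<subseteq> {a..b}" and x: "\<And>m. bij_betw (x m) {..<N m} (S m)"
    and orth: "\<And>m k. k < N m \<Longrightarrow> (LINT t|\<sigma>. (\<Prod>s\<in>S m. (t - s)) * t ^ k *
        zero_weight (N m) (S m) t) = 0"
    and wc: "weak_conv_m (\<lambda>m. emp (N m) (x m)) M" and M: "real_distribution M"
  shows "M = \<eta>"
proof -
  define R where "R = tau b - tau a"
  note R = length_le_tau[OF ab, folded R_def]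
  have cF: "closed F" using F(1) by (rule compact_imp_closed)
  have xS: "x m i \<in> {a..b}" if "i < N m" for m i
  proof -
    have "x m i \<in> S m" by (rule bij_betw_apply[OF x]) (use that in simp)
    then show ?thesis using S(3) by blast
  qed
  define \<mu> where "\<mu> m = emp (N m) (x m)" for m
  have \<mu>: "psupp {a..b} (\<mu> m)" for m unfolding \<mu>_def by (rule emp_psupp[OF N(2) xS]) simp_all
  have wc': "weak_conv_m \<mu> M" using wc by (simp add: \<mu>_def[abs_def])
  have pM: "psupp {a..b} M" by (rule psupp_weak_limit[OF _ \<mu> M wc']) simp
  define W where "W \<kappa> t = 2 * hl a b t + (LINT s|\<kappa>. lgk a b t s)" for \<kappa> t
  define B where "B = 2 * ln (tau b) + (\<bar>ln (1 - 1 / tau a)\<bar> + ln 2)"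
  define v where "v t = complex_of_real (1 / tau (cl a b t))" for t
  have v1: "cmod (v t) \<le> 1" for t unfolding v_def by (rule inverse_tau_cl_le_1[OF ab])
  have Wlk: "W \<kappa> t = 2 * hl a b t + (LINT s|\<kappa>. lk a b (v t) s)" for \<kappa> t unfolding W_def v_def lgk_eq_lk[OF ab] ..
  have Wb: "\<bar>W \<kappa> t\<bar> \<le> B" if \<kappa>: "psupp {a..b} \<kappa>" for \<kappa> t
    using integral_psupp_abs_le[OF \<kappa> lk_measurable[OF ab v1] lk_bounded[OF ab v1], of t] hl_bounds(3)[OF ab, of t]
    unfolding Wlk B_def by linarith
  have Wc: "continuous_on UNIV (W \<kappa>)" if \<kappa>: "psupp {a..b} \<kappa>" for \<kappa>
  proof -
    have lip: "continuous_on (cball 0 1) (\<lambda>w. LINT s|\<kappa>. lk a b w s)"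
    proof (rule continuous_onI)
      fix w :: complex and e :: real assume w: "w \<in> cball 0 1" and e: "0 < e"
      define c where "c = 1 - 1 / tau a"
      have c: "0 < c" unfolding c_def by (rule inverse_tau_less_1[OF ab])
      show "\<exists>d>0. \<forall>w'\<in>cball 0 1. dist w' w < d \<longrightarrow> dist (LINT s|\<kappa>. lk a b w' s) (LINT s|\<kappa>. lk a b w s) \<le> e"
      proof (intro exI[of _ "e * c"] conjI ballI impI)
        show "0 < e * c" using e c by simp
        fix w' :: complex assume w': "w' \<in> cball 0 1" "dist w' w < e * c"
        have "\<bar>(LINT s|\<kappa>. lk a b w' s) - (LINT s|\<kappa>. lk a b w s)\<bar> \<le> cmod (w' - w) / c"
          unfolding c_def using w w' by (intro integral_lk_lipschitz[OF ab \<kappa>]) auto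
        also have "... \<le> e" using w'(2) c by (simp add: dist_norm pos_divide_le_eq)
        finally show "dist (LINT s|\<kappa>. lk a b w' s) (LINT s|\<kappa>. lk a b w s) \<le> e" by (simp add: dist_real_def)
      qed
    qed
    have vc: "continuous_on UNIV v"
    proof -
      have "tau (cl a b t) \<noteq> 0" for t using tau_cl(3)[OF ab, of t] by auto
      then show ?thesis unfolding v_def by (intro continuous_intros) auto
    qed
    have "continuous_on UNIV (\<lambda>t. LINT s|\<kappa>. lk a b (v t) s)" by (rule continuous_on_compose2[OF lip vc]) (use v1 in auto)
    then show ?thesis unfolding Wlk[abs_def] by (intro continuous_intros continuous_on_hl[OF ab])
  qed
  \<comment> \<open>This is where freezing becomes legitimate: the fields generated by the empirical
    measures approach the field of their weak limit uniformly.\<close>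
  have unif: "uniform_limit UNIV (\<lambda>m. W (\<mu> m)) (W M) sequentially"
  proof (rule uniform_limitI)
    fix e :: real assume "0 < e"
    from uniform_limitD[OF lk_uniform_limit[OF ab \<mu> pM wc'] this]
    show "\<forall>\<^sub>F m in sequentially. \<forall>t\<in>UNIV. dist (W (\<mu> m) t) (W M t) < e"
    proof eventually_elim
      case (elim m)
      show ?case
      proof
        fix t :: real
        have "v t \<in> cball 0 1" using v1 by simp
        with elim have "dist (LINT s|(\<mu> m). lk a b (v t) s) (LINT s|M. lk a b (v t) s) < e" by blast
        then show "dist (W (\<mu> m) t) (W M t) < e" unfolding Wlk by (simp add: dist_real_def)
      qed
    qed
  qed
  obtain \<omega> where \<omega>: "psupp F \<omega>" "fin_en R \<omega>"
    and \<omega>min: "\<And>\<kappa>. psupp F \<kappa> \<Longrightarrow> fin_en R \<kappa> \<Longrightarrow> ip R \<omega> \<omega> + (LINT x|\<omega>. W M x) \<le> ip R \<kappa> \<kappa> + (LINT x|\<kappa>. W M x)"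
    by (rule energy_minimizer_exists[OF cF F(2) R(1) Wc[OF pM] Wb[OF pM] \<eta>(1) \<eta>(2)[folded R_def]]; (assumption | (rule that; assumption)))
  define k where "k t = ln (sqrt ((cl a b t)\<^sup>2 - 1))" for t
  define Bk where "Bk = \<bar>ln (sqrt (a\<^sup>2 - 1))\<bar> + \<bar>ln (sqrt (b\<^sup>2 - 1))\<bar>"
  have km: "k \<in> borel_measurable borel" unfolding k_def by measurable
  have kb: "\<bar>k t\<bar> \<le> Bk" for t
  proof -
    have c: "a \<le> cl a b t" "cl a b t \<le> b" using cl_in[of a b t] ab by auto
    have a1: "1 < a\<^sup>2" using ab by (auto intro!: one_less_power)
    have "a\<^sup>2 \<le> (cl a b t)\<^sup>2" "(cl a b t)\<^sup>2 \<le> b\<^sup>2" using c ab by (auto intro!: power_mono)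
    then have "ln (sqrt (a\<^sup>2 - 1)) \<le> k t" "k t \<le> ln (sqrt (b\<^sup>2 - 1))" unfolding k_def using a1 by (auto intro!: ln_mono)
    then show ?thesis unfolding Bk_def by linarith
  qed
  define Q where "Q m = (\<Prod>s\<in>S m. [:- s, 1:])" for m
  have Q: "degree (Q m) = N m" "lead_coeff (Q m) = 1" "poly (Q m) t = (\<Prod>s\<in>S m. (t - s))" for m t
    using monic_product_degree[OF S(1), of m] S(2) by (simp_all add: Q_def poly_prod)
  have orth': "(LINT t|\<sigma>. poly (Q m) t * t ^ j * (exp (- (real (N m) * W (\<mu> m) t) - k t) * indicator {a..b} t)) = 0"
    if j: "j < N m" for m j
  proof -
    note [measurable_cong] = psuppD(2)[OF \<sigma>]
    note [measurable] = km borel_measurable_continuous_onI[OF Wc[OF \<mu>]]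
    have "(LINT t|\<sigma>. poly (Q m) t * t ^ j * (exp (- (real (N m) * W (\<mu> m) t) - k t) * indicator {a..b} t))
      = (LINT t|\<sigma>. (\<Prod>s\<in>S m. (t - s)) * t ^ j * zero_weight (N m) (S m) t)"
    proof (rule integral_cong_AE)
      show "AE t in \<sigma>. poly (Q m) t * t ^ j * (exp (- (real (N m) * W (\<mu> m) t) - k t) * indicator {a..b} t)
        = (\<Prod>s\<in>S m. (t - s)) * t ^ j * zero_weight (N m) (S m) t" using psuppD(6)[OF \<sigma>]
      proof eventually_elim
        case (elim t)
        then have t: "t \<in> {a..b}" using F(2) by blast
        show ?case unfolding weight_eq_exp[OF ab N(2) S(1,3) x t] Q(3) W_def \<mu>_def k_def using t by simp
      qed
    qed (unfold Q(3) zero_weight_def, measurable)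
    then show ?thesis using orth[OF j] by simp
  qed
  \<comment> \<open>To the right of b, ln (Q z) / N has two descriptions of its limit: the Heine
    asymptotics give the potential of \<omega>, weak convergence gives that of M.\<close>
  have pot: "(LINT t|M. ln (z - cl a b t)) = (LINT t|\<omega>. ln (z - cl a b t))" if z: "b < z" for z
  proof (rule LIMSEQ_unique)
    show "(\<lambda>m. ln (poly (Q m) z) / N m) \<longlonglongrightarrow> (LINT t|\<omega>. ln (z - cl a b t))"
      by (rule heine_limit[OF F(1,2) ab(2) F(3) \<sigma> dens R borel_measurable_continuous_onI[OF Wc[OF \<mu>]] Wb[OF \<mu>] km kb Wc[OF pM] Wb[OF pM] unif \<omega>(1,2) _ N Q(1,2) orth' z])
        (rule \<omega>min; assumption)
    have clr: "z - b \<le> z - cl a b t \<and> z - cl a b t \<le> z - a" for t using cl_in[of a b t] ab by auto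
    have fc: "continuous_on UNIV (\<lambda>t. ln (z - cl a b t))"
    proof -
      have "z - cl a b t \<noteq> 0" for t using clr[of t] z by linarith
      then show ?thesis by (intro continuous_intros) auto
    qed
    have fb: "\<bar>ln (z - cl a b t)\<bar> \<le> \<bar>ln (z - b)\<bar> + \<bar>ln (z - a)\<bar>" for t
    proof -
      have "ln (z - b) \<le> ln (z - cl a b t)" "ln (z - cl a b t) \<le> ln (z - a)" using clr[of t] z by (auto intro!: ln_mono)
      then show ?thesis by linarith
    qed
    have "(LINT t|(\<mu> m). ln (z - cl a b t)) = ln (poly (Q m) z) / N m" for m
    proof -
      have "(LINT t|(\<mu> m). ln (z - cl a b t)) = (\<Sum>i<N m. ln (z - cl a b (x m i))) / N m"
        unfolding \<mu>_def by (rule integral_emp[OF N(2)]) measurable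
      also have "(\<Sum>i<N m. ln (z - cl a b (x m i))) = (\<Sum>s\<in>S m. ln (z - cl a b s))" by (rule sum.reindex_bij_betw[OF x])
      also have "... = (\<Sum>s\<in>S m. ln (z - s))" using S(3)[of m] by (intro sum.cong refl) (auto simp: cl_id subset_eq)
      also have "... = ln (\<Prod>s\<in>S m. (z - s))" using S(3)[of m] z by (intro ln_prod[symmetric] S(1)) (auto simp: subset_eq)
      finally show ?thesis unfolding Q(3) .
    qed
    then show "(\<lambda>m. ln (poly (Q m) z) / N m) \<longlonglongrightarrow> (LINT t|M. ln (z - cl a b t))"
      using integral_weak_conv_psupp[OF \<mu> pM wc' fc fb] by simp
  qed
  have a0: "0 < a" using ab by simp
  have p\<omega>: "psupp {a..b} \<omega>" by (rule psupp_mono[OF \<omega>(1) F(2)])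
  have M\<omega>: "M = \<omega>" by (rule measure_eq_of_moments_eq[OF ab(2) pM p\<omega> moments_eq_of_log_potential_eq[OF a0 ab(2) pM p\<omega> pot]])
  have "\<omega> = \<eta>" by (rule self_consistent_eq_equilibrium[OF ab F(2) \<eta> \<omega>[unfolded R_def] min _ \<omega>min[unfolded R_def]])
      (simp_all add: W_def[abs_def] M\<omega>)
  with M\<omega> show ?thesis by simp
qed

text \<open>All measures live on [a, b], so the sequence is tight, and every subsequential limit is
  \<eta>. The shift by \<open>Suc\<close> avoids n = 0, for which there is no empirical
  measure.\<close>

lemma zero_distribution_weak_limit:
  fixes S :: "nat \<Rightarrow> real set" and x :: "nat \<Rightarrow> nat \<Rightarrow> real"
  assumes S: "\<And>n. n \<ge> 1 \<Longrightarrow> finite (S n)" "\<And>n. n \<ge> 1 \<Longrightarrow> card (S n) = n" "\<And>n. n \<ge> 1 \<Longrightarrow> S n \<subseteq> {a..b}"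
    and x: "\<And>n. n \<ge> 1 \<Longrightarrow> bij_betw (x n) {..<n} (S n)"
    and orth: "\<And>n k. n \<ge> 1 \<Longrightarrow> k < n \<Longrightarrow> (LINT t|\<sigma>. (\<Prod>s\<in>S n. (t - s)) * t ^ k *
        zero_weight n (S n) t) = 0"
  shows "weak_conv_m (\<lambda>n. emp (Suc n) (x (Suc n))) \<eta>"
proof (rule tight_subseq_weak_converge)
  have xS: "x (Suc n) i \<in> {a..b}" if "i < Suc n" for n i
  proof -
    have "x (Suc n) i \<in> S (Suc n)" by (rule bij_betw_apply[OF x]) (use that in simp_all)
    then show ?thesis using S(3)[of "Suc n"] by auto
  qed
  have ps: "psupp {a..b} (emp (Suc n) (x (Suc n)))" for n by (rule emp_psupp[OF _ xS]) simp_all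
  show "real_distribution (emp (Suc n) (x (Suc n)))" for n by (rule psuppD(7)[OF ps])
  show "real_distribution \<eta>" by (rule psuppD(7)[OF \<eta>(1)])
  show "tight (\<lambda>n. emp (Suc n) (x (Suc n)))" by (rule tight_psupp[OF ps])
  fix s :: "nat \<Rightarrow> nat" and M assume s: "strict_mono s" and M: "real_distribution M"
    and wc: "weak_conv_m ((\<lambda>n. emp (Suc n) (x (Suc n))) \<circ> s) M"
  have wc': "weak_conv_m (\<lambda>m. emp (Suc (s m)) (x (Suc (s m)))) M" using wc by (simp add: comp_def)
  have N: "filterlim (\<lambda>m. Suc (s m)) at_top sequentially"
    by (rule filterlim_compose[OF filterlim_Suc filterlim_subseq[OF s]])
  have "M = \<eta>" by (rule zero_distribution_subsequence[OF N _ _ _ _ _ _ wc' M, where S = "\<lambda>m. S (Suc (s m))"];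
      (rule S x orth; simp)?) simp_all
  with wc show "weak_conv_m ((\<lambda>n. emp (Suc n) (x (Suc n))) \<circ> s) \<eta>" by simp
qed

end

section \<open>Zeros and growth of the Bernstein--Szego polynomials\<close>

lemma norm_one_divide_le_1: "1 \<le> cmod u \<Longrightarrow> cmod (1 / u) \<le> 1"
  by (cases "u = 0") (simp_all add: norm_divide)

text \<open>A Blaschke factor estimate for each zero T = tau s > 1: |u T - 1|^2 - |T - u|^2 = (|u|^2
  - 1) (T^2 - 1) is nonnegative for |u| >= 1.\<close>

lemma norm_Hpoly_reflect:
  assumes S: "\<And>s. s \<in> S \<Longrightarrow> 1 < s" and u: "1 \<le> cmod u"
  shows "cmod (cpoly (Hpoly S) u) \<le> cmod u ^ card S * cmod (cpoly (Hpoly S) (1 / u))"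
proof -
  have u0: "u \<noteq> 0" using u by auto
  have *: "cmod (1 - u / of_real T) \<le> cmod u * cmod (1 - 1 / u / of_real T)" if T: "1 < T" for T
  proof -
    have "(cmod (of_real T - u))\<^sup>2 \<le> (cmod (u * of_real T - 1))\<^sup>2"
    proof -
      have "(cmod (u * of_real T - 1))\<^sup>2 - (cmod (of_real T - u))\<^sup>2 = ((cmod u)\<^sup>2 - 1) * (T\<^sup>2 - 1)"
        unfolding cmod_power2 by (simp add: power2_eq_square algebra_simps)
      moreover have "0 \<le> ((cmod u)\<^sup>2 - 1) * (T\<^sup>2 - 1)" using u T by (intro mult_nonneg_nonneg) (auto simp: one_le_power)
      ultimately show ?thesis by linarith
    qed
    then have le: "cmod (of_real T - u) \<le> cmod (u * of_real T - 1)" by (rule power2_le_imp_le) simp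
    have "1 - u / complex_of_real T = (complex_of_real T - u) / complex_of_real T" using T by (simp add: field_simps)
    then have "cmod (1 - u / of_real T) = cmod (of_real T - u) / T" using T by (simp only: norm_divide norm_of_real)
    also have "... \<le> cmod (u * of_real T - 1) / T" using le T by (intro divide_right_mono) auto
    also have "... = cmod ((u * of_real T - 1) / of_real T)" using T by (simp only: norm_divide norm_of_real)
    also have "(u * complex_of_real T - 1) / complex_of_real T = u * (1 - 1 / u / complex_of_real T)" using T u0 by (simp add: field_simps)
    finally show ?thesis by (simp only: norm_mult)
  qed
  have "cmod (cpoly (Hpoly S) u) = (\<Prod>s\<in>S. cmod (1 - u / of_real (tau s)))" unfolding cpoly_Hpoly by (simp only: prod_norm)
  also have "... \<le> (\<Prod>s\<in>S. cmod u * cmod (1 - 1 / u / of_real (tau s)))"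
    by (intro prod_mono conjI * norm_ge_zero) (use S in \<open>auto intro!: tau_gt1\<close>)
  also have "... = cmod u ^ card S * cmod (cpoly (Hpoly S) (1 / u))" unfolding cpoly_Hpoly by (simp only: prod.distrib prod_constant prod_norm)
  finally show ?thesis .
qed

lemma Hpoly_inverse_nonzero:
  assumes S: "finite S" "\<And>s. s \<in> S \<Longrightarrow> 1 < s" and v: "cmod v \<le> 1"
  shows "cpoly (Hpoly S) v \<noteq> 0"
proof -
  have "1 - v / complex_of_real (tau s) \<noteq> 0" if "s \<in> S" for s
  proof
    assume "1 - v / complex_of_real (tau s) = 0"
    then have "v = complex_of_real (tau s)" by (auto simp: divide_eq_1_iff)
    then have "\<bar>tau s\<bar> \<le> 1" using v by simp
    then show False using tau_gt1[OF S(2)[OF that]] by simp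
  qed
  then show ?thesis unfolding cpoly_Hpoly using S(1) by simp
qed

text \<open>\<rho> is the ratio of the two summands u^(-2n) H(u) and u^(2n) H(1/u). Reflection
  bounds |H(u)| by |u|^n |H(1/u)|, so the exponents add up to - 2 n + n - 2 n = - 3 n.\<close>

lemma bspoly_factor:
  assumes S: "finite S" "card S = n" "\<And>s. s \<in> S \<Longrightarrow> 1 < s" and u: "1 \<le> cmod u"
  obtains \<rho> where "cmod (cpoly (bspoly n S) ((u + 1 / u) / 2)) = cmod u ^ (2 * n) * cmod (cpoly (Hpoly S) (1 / u)) * cmod (1 + \<rho>)"
    "cmod \<rho> \<le> (1 / cmod u) ^ (3 * n)"
proof
  have u0: "u \<noteq> 0" using u by auto
  have v: "cmod (1 / u) \<le> 1" by (rule norm_one_divide_le_1[OF u])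
  define H where "H = cpoly (Hpoly S) (1 / u)"
  have H0: "H \<noteq> 0" unfolding H_def by (rule Hpoly_inverse_nonzero[OF S(1,3) v])
  define \<rho> where "\<rho> = (1 / u) ^ (2 * n) * cpoly (Hpoly S) u / (u ^ (2 * n) * H)"
  have "cpoly (bspoly n S) ((u + 1 / u) / 2) = u ^ (2 * n) * H * (1 + \<rho>)"
    unfolding cpoly_bspoly[OF u0 S(1,2)] H_def[symmetric] \<rho>_def using H0 u0 by (simp add: field_simps)
  then show "cmod (cpoly (bspoly n S) ((u + 1 / u) / 2)) = cmod u ^ (2 * n) * cmod (cpoly (Hpoly S) (1 / u)) * cmod (1 + \<rho>)"
    by (simp only: norm_mult norm_power H_def)
  have "cmod \<rho> = (1 / cmod u) ^ (2 * n) * cmod (cpoly (Hpoly S) u) / (cmod u ^ (2 * n) * cmod H)"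
    unfolding \<rho>_def by (simp only: norm_mult norm_power norm_divide norm_one)
  also have "... \<le> (1 / cmod u) ^ (2 * n) * (cmod u ^ n * cmod H) / (cmod u ^ (2 * n) * cmod H)"
    using norm_Hpoly_reflect[of S u] S u by (intro divide_right_mono mult_left_mono) (auto simp: H_def)
  also have "... = (1 / cmod u) ^ (3 * n)"
  proof -
    have "cmod u ^ (2 * n) = cmod u ^ n * cmod u ^ n" "cmod u ^ (3 * n) = cmod u ^ n * cmod u ^ n * cmod u ^ n"
    proof -
      have "2 * n = n + n" "3 * n = n + n + n" by simp_all
      then show "cmod u ^ (2 * n) = cmod u ^ n * cmod u ^ n" "cmod u ^ (3 * n) = cmod u ^ n * cmod u ^ n * cmod u ^ n"
        by (simp_all only: power_add)
    qed
    then show ?thesis using H0 u0 by (simp add: power_divide)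
  qed
  finally show "cmod \<rho> \<le> (1 / cmod u) ^ (3 * n)" .
qed

text \<open>Off E the first summand strictly dominates the second, so the polynomial cannot vanish.
  At the end points u = 1 / u, the two summands coincide, and the value is twice H at 1 or -1, which
  is nonzero.\<close>

lemma bspoly_zeros:
  assumes S: "finite S" "card S = n" "\<And>s. s \<in> S \<Longrightarrow> 1 < s" and n: "n \<ge> 1" and z: "cpoly (bspoly n S) z = 0"
  shows "z \<in> complex_of_real ` {-1<..<1}"
proof -
  have zphi: "z = (phi z + 1 / phi z) / 2" using phi_add_inverse[of z] by simp
  have "z \<in> Eint"
  proof (rule ccontr)
    assume "z \<notin> Eint"
    then have u: "1 < cmod (phi z)" by (rule norm_phi_gt_1)
    then have u1: "1 \<le> cmod (phi z)" by simp
    obtain \<rho> where \<rho>: "cmod (cpoly (bspoly n S) ((phi z + 1 / phi z) / 2)) = cmod (phi z) ^ (2 * n) * cmod (cpoly (Hpoly S) (1 / phi z)) * cmod (1 + \<rho>)"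
      "cmod \<rho> \<le> (1 / cmod (phi z)) ^ (3 * n)" by (rule bspoly_factor[OF S u1]; (assumption | (rule that; assumption)))
    have "cpoly (Hpoly S) (1 / phi z) \<noteq> 0" by (rule Hpoly_inverse_nonzero[OF S(1) _ norm_one_divide_le_1[OF u1]]) (rule S(3))
    then have "1 + \<rho> = 0" using \<rho>(1) z phi_nonzero[of z] unfolding zphi[symmetric] by simp
    then have "\<rho> = - 1" by (simp add: eq_neg_iff_add_eq_0 add.commute)
    then have "cmod \<rho> = 1" by simp
    moreover have "(1 / cmod (phi z)) ^ (3 * n) < (1 / cmod (phi z)) ^ 0" using u n by (intro power_strict_decreasing) (auto simp: phi_nonzero)
    ultimately show False using \<rho>(2) by simp
  qed
  then obtain y where y: "z = complex_of_real y" "-1 \<le> y" "y \<le> 1" unfolding Eint_def by auto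
  have e: "cpoly (bspoly n S) e \<noteq> 0" if e: "e = 1 \<or> e = -1" for e
  proof -
    have e1: "e \<noteq> 0" "1 / e = e" "cmod e \<le> 1" "e ^ (2 * n) = 1" using e by auto
    have "cpoly (Hpoly S) e \<noteq> 0" by (rule Hpoly_inverse_nonzero[OF S(1,3) e1(3)])
    then show ?thesis using cpoly_bspoly[OF e1(1) S(1,2)] e1 by simp
  qed
  have "y \<noteq> 1" "y \<noteq> -1" using e[of 1] e[of "-1"] z y(1) by auto
  with y show ?thesis by auto
qed

lemma integral_lk_emp:
  assumes ab: "1 < a" "a < b" and n: "n \<ge> 1" and S: "finite S" "S \<subseteq> {a..b}" and x: "bij_betw x {..<n} S" and v: "cmod v \<le> 1"
  shows "ln (cmod (cpoly (Hpoly S) v)) = n * (LINT s|emp n x. lk a b v s)"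
proof -
  have "real n * (LINT s|emp n x. lk a b v s) = (\<Sum>i<n. lk a b v (x i))"
    using n by (simp add: integral_emp[OF n lk_measurable[OF ab v]])
  also have "... = (\<Sum>s\<in>S. lk a b v s)" by (rule sum.reindex_bij_betw[OF x])
  also have "... = (\<Sum>s\<in>S. ln (cmod (1 - v / of_real (tau s))))"
    using S(2) by (intro sum.cong refl) (auto simp: lk_def cl_id subset_eq)
  also have "... = ln (\<Prod>s\<in>S. cmod (1 - v / of_real (tau s)))"
  proof (rule ln_prod[symmetric, OF S(1)])
    fix s assume s: "s \<in> S"
    then have c: "cl a b s = s" using S(2) by (auto intro!: cl_id)
    have "0 < cmod (1 - v / of_real (tau s))"
      using lk_arg(1)[OF ab v, of s, unfolded c] inverse_tau_less_1[OF ab] by linarith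
    then show "cmod (1 - v / of_real (tau s)) \<noteq> 0" by simp
  qed
  also have "(\<Prod>s\<in>S. cmod (1 - v / of_real (tau s))) = cmod (cpoly (Hpoly S) v)" unfolding cpoly_Hpoly by (simp only: prod_norm)
  finally show ?thesis by simp
qed

lemma ln_norm_one_plus_bounded:
  fixes \<rho> :: complex
  assumes "cmod \<rho> \<le> 1 / 2"
  shows "\<bar>ln (cmod (1 + \<rho>))\<bar> < 1"
proof -
  have "cmod (1 + \<rho>) \<le> 2" using norm_triangle_ineq[of 1 \<rho>] assms by simp
  moreover have l: "1 / 2 \<le> cmod (1 + \<rho>)" using norm_triangle_ineq2[of 1 "- \<rho>"] assms by simp
  ultimately have "ln (1 / 2) \<le> ln (cmod (1 + \<rho>))" "ln (cmod (1 + \<rho>)) \<le> ln 2" by (intro ln_mono; linarith)+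
  moreover have "ln (1 / 2) = - ln (2 :: real)" by (simp add: ln_div)
  ultimately show ?thesis using ln_2_less_1 by linarith
qed

text \<open>With u = phi z the modulus of q is 4^(-n) |u|^(2n) |H(1/u)| |1 + \<rho>|. Hence - (1/n)
  ln |q| is 2 ln 2 - 2 ln |u| minus the mean of \<open>lk\<close> at v = 1 / u over the zeros, up to
  an error below 1 / n. Uniformity in z is uniformity in v on the closed unit disc.\<close>

lemma hermite_pade_asymptotics:
  fixes S :: "nat \<Rightarrow> real set" and x :: "nat \<Rightarrow> nat \<Rightarrow> real"
  assumes ab: "1 < a" "a < b" and \<eta>: "psupp {a..b} \<eta>"
    and S: "\<And>n. n \<ge> 1 \<Longrightarrow> finite (S n)" "\<And>n. n \<ge> 1 \<Longrightarrow> card (S n) = n" "\<And>n. n \<ge> 1 \<Longrightarrow> S n \<subseteq> {a..b}"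
    and x: "\<And>n. n \<ge> 1 \<Longrightarrow> bij_betw (x n) {..<n} (S n)"
    and q: "\<And>n. n \<ge> 1 \<Longrightarrow> q n = smult (1 / 4 ^ n) (bspoly n (S n))"
    and wc: "weak_conv_m (\<lambda>n. emp (Suc n) (x (Suc n))) \<eta>" and K: "compact K" "K \<subseteq> - Eint"
  shows "uniform_limit K (\<lambda>n z. ln (1 / cmod (cpoly (q n) z) powr (1 / real n)))
    (\<lambda>z. ln 2 - (LINT t|\<eta>. lk a b (1 / phi z) t) - 2 * ln (cmod (phi z)) + ln 2) sequentially"
proof (rule uniform_limitI)
  fix e :: real assume e: "0 < e"
  define L where "L z = ln 2 - (LINT t|\<eta>. lk a b (1 / phi z) t) - 2 * ln (cmod (phi z)) + ln 2" for z
  have xS: "x (Suc n) i \<in> {a..b}" if "i < Suc n" for n i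
  proof -
    have "x (Suc n) i \<in> S (Suc n)" by (rule bij_betw_apply[OF x]) (use that in simp_all)
    then show ?thesis using S(3)[of "Suc n"] by auto
  qed
  have ps: "psupp {a..b} (emp (Suc n) (x (Suc n)))" for n by (rule emp_psupp[OF _ xS]) simp_all
  have "compact Eint" unfolding Eint_def by (intro compact_continuous_image continuous_intros) simp
  then obtain d where d: "0 < d" "\<And>z w. z \<in> K \<Longrightarrow> w \<in> Eint \<Longrightarrow> d \<le> dist z w"
    using separate_compact_closed[OF K(1) compact_imp_closed, of Eint] K(2) by blast
  have phi_ge: "1 + d \<le> cmod (phi z)" if "z \<in> K" for z
  proof -
    obtain w where "w \<in> Eint" "cmod (z - w) \<le> cmod (phi z) - 1" by (rule dist_Eint_le[of z]; (rule that; assumption))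
    with d(2)[OF that] show ?thesis by (force simp: dist_norm)
  qed
  have e2: "0 < e / 2" using e by simp
  have ev1: "\<forall>\<^sub>F n in sequentially. \<forall>v\<in>cball 0 1. dist (LINT s|(emp (Suc n) (x (Suc n))). lk a b v s) (LINT s|\<eta>. lk a b v s) < e / 2"
    by (rule uniform_limitD[OF lk_uniform_limit[OF ab ps \<eta> wc] e2])
  have ev2: "\<forall>\<^sub>F n in sequentially. 2 / e < real (Suc n)"
    using filterlim_at_top_dense[THEN iffD1, OF filterlim_compose[OF filterlim_real_sequentially filterlim_Suc]] by blast
  have ev3: "\<forall>\<^sub>F n in sequentially. (1 / (1 + d)) ^ n < 1 / 2"
  proof -
    have "(\<lambda>n. (1 / (1 + d)) ^ n) \<longlonglongrightarrow> 0" using d(1) by (intro LIMSEQ_power_zero) simp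
    then show ?thesis by (rule order_tendstoD) simp
  qed
  have "\<forall>\<^sub>F n in sequentially. \<forall>z\<in>K. dist (ln (1 / cmod (cpoly (q (Suc n)) z) powr (1 / real (Suc n)))) (L z) < e"
    using ev1 ev2 ev3
  proof eventually_elim
    case (elim n)
    show ?case
    proof
      fix z assume z: "z \<in> K"
      define N where "N = Suc n"
      have N: "N \<ge> 1" by (simp add: N_def)
      define u where "u = phi z"
      have u: "1 + d \<le> cmod u" unfolding u_def by (rule phi_ge[OF z])
      have u1: "1 \<le> cmod u" "0 < cmod u" using u d(1) by linarith+
      have v: "cmod (1 / u) \<le> 1" by (rule norm_one_divide_le_1[OF u1(1)])
      have S1: "1 < s" if "s \<in> S N" for s using S(3)[OF N] that ab by auto
      have zu: "z = (u + 1 / u) / 2" using phi_add_inverse[of z] by (simp add: u_def)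
      obtain \<rho> where \<rho>: "cmod (cpoly (bspoly N (S N)) ((u + 1 / u) / 2)) = cmod u ^ (2 * N) * cmod (cpoly (Hpoly (S N)) (1 / u)) * cmod (1 + \<rho>)"
        "cmod \<rho> \<le> (1 / cmod u) ^ (3 * N)"
        by (rule bspoly_factor[OF S(1,2)[OF N] S1 u1(1)]; (assumption | (rule that; assumption)))
      have "(1 / cmod u) ^ (3 * N) \<le> (1 / (1 + d)) ^ (3 * N)" using u d(1) by (intro power_mono divide_left_mono mult_pos_pos) auto
      also have "... \<le> (1 / (1 + d)) ^ n" using d(1) by (intro power_decreasing) (auto simp: N_def)
      finally have r: "cmod \<rho> \<le> 1 / 2" using \<rho>(2) elim(3) by linarith
      define A where "A = cmod (cpoly (Hpoly (S N)) (1 / u))"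
      have A: "0 < A" unfolding A_def using Hpoly_inverse_nonzero[OF S(1)[OF N] S1 v] by simp
      have "1 - cmod \<rho> \<le> cmod (1 + \<rho>)" using norm_triangle_ineq2[of 1 "- \<rho>"] by simp
      then have B: "0 < cmod (1 + \<rho>)" using r by linarith
      have qz: "cmod (cpoly (q N) z) = (1 / 4) ^ N * (cmod u ^ (2 * N) * A * cmod (1 + \<rho>))"
        unfolding q[OF N] cpoly_smult A_def \<rho>(1)[symmetric] zu[symmetric] by (simp add: norm_mult norm_divide norm_power power_divide)
      have "ln (cmod (cpoly (q N) z)) = ln ((1 / 4) ^ N) + (ln (cmod u ^ (2 * N)) + ln A + ln (cmod (1 + \<rho>)))"
        unfolding qz using A B u1 by (simp only: ln_mult_pos mult_pos_pos zero_less_power)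
      also have "... = N * (- (2 * ln 2) + 2 * ln (cmod u)) + ln A + ln (cmod (1 + \<rho>))"
      proof -
        have "ln ((1 / 4) ^ N) = - (N * (2 * ln 2) :: real)"
        proof -
          have "ln ((1 / 4) ^ N) = N * ln (1 / 4 :: real)" by (rule ln_realpow)
          also have "ln (1 / 4 :: real) = - ln (2 ^ 2)" by (simp add: ln_div)
          also have "ln (2 ^ 2 :: real) = 2 * ln 2" by (subst ln_realpow) auto
          finally show ?thesis by simp
        qed
        moreover have "ln (cmod u ^ (2 * N)) = real (2 * N) * ln (cmod u)" by (rule ln_realpow)
        ultimately show ?thesis by (simp add: algebra_simps)
      qed
      also have "ln A = N * (LINT s|(emp N (x N)). lk a b (1 / u) s)"
        unfolding A_def by (rule integral_lk_emp[OF ab N S(1,3)[OF N] x[OF N] v])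
      finally have ln: "ln (cmod (cpoly (q N) z)) / N = - (2 * ln 2) + 2 * ln (cmod u) + (LINT s|(emp N (x N)). lk a b (1 / u) s) + ln (cmod (1 + \<rho>)) / N"
        using N by (simp add: field_simps)
      have pos: "0 < cmod (cpoly (q N) z)" unfolding qz using A B u1 by simp
      have "ln (1 / cmod (cpoly (q N) z) powr (1 / real N)) = - (ln (cmod (cpoly (q N) z)) / N)"
        using pos by (simp add: ln_div ln_powr)
      then have diff: "ln (1 / cmod (cpoly (q N) z) powr (1 / real N)) - L z
        = ((LINT s|\<eta>. lk a b (1 / u) s) - (LINT s|(emp N (x N)). lk a b (1 / u) s)) - ln (cmod (1 + \<rho>)) / N"
        unfolding ln L_def u_def[symmetric] by simp
      have "1 / u \<in> cball 0 1" using v by simp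
      with elim(1) have 1: "\<bar>(LINT s|\<eta>. lk a b (1 / u) s) - (LINT s|(emp N (x N)). lk a b (1 / u) s)\<bar> < e / 2"
        unfolding N_def dist_real_def by (subst abs_minus_commute) blast
      have 2: "\<bar>ln (cmod (1 + \<rho>)) / N\<bar> < e / 2"
      proof -
        have "\<bar>ln (cmod (1 + \<rho>)) / N\<bar> = \<bar>ln (cmod (1 + \<rho>))\<bar> / N" using N by (simp add: abs_divide)
        also have "... < 1 / N" using ln_norm_one_plus_bounded[OF r] N by (intro divide_strict_right_mono) auto
        also have "1 / N < e / 2" using elim(2) e N unfolding N_def[symmetric] by (simp add: field_simps)
        finally show ?thesis .
      qed
      have "dist (ln (1 / cmod (cpoly (q N) z) powr (1 / real N))) (L z) < e"
        unfolding dist_real_def diff using 1 2 by linarith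
      then show "dist (ln (1 / cmod (cpoly (q (Suc n)) z) powr (1 / real (Suc n)))) (L z) < e" by (simp only: N_def)
    qed
  qed
  then show "\<forall>\<^sub>F n in sequentially. \<forall>z\<in>K. dist (ln (1 / cmod (cpoly (q n) z) powr (1 / real n)))
      (ln 2 - (LINT t|\<eta>. lk a b (1 / phi z) t) - 2 * ln (cmod (phi z)) + ln 2) < e"
    unfolding L_def by (rule eventually_sequentially_Suc[THEN iffD1])
qed

text \<open>The product spaces in Heine's formula are built from probability measures; the
  orthogonality relations and the positivity of the density survive division by the total
  mass.\<close>

lemma normalized_measure:
  fixes \<sigma> :: "real measure"
  assumes s: "sets \<sigma> = sets borel" and fin: "finite_measure \<sigma>" and F: "AE t in \<sigma>. t \<in> F" and m: "0 < measure \<sigma> UNIV"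
  defines "\<sigma>' \<equiv> density \<sigma> (\<lambda>_. ennreal (1 / measure \<sigma> UNIV))"
  shows "psupp F \<sigma>'" "pos_density_at \<sigma> t \<Longrightarrow> pos_density_at \<sigma>' t"
    "f \<in> borel_measurable borel \<Longrightarrow> (LINT t|\<sigma>'. f t) = (LINT t|\<sigma>. f t) / measure \<sigma> UNIV"
proof -
  interpret s: finite_measure \<sigma> by fact
  note [measurable_cong] = s
  have sp: "space \<sigma> = UNIV" using sets_eq_imp_space_eq[OF s] by simp
  define c where "c = 1 / measure \<sigma> UNIV"
  have c: "0 < c" using m by (simp add: c_def)
  have em: "emeasure \<sigma>' A = ennreal c * emeasure \<sigma> A" if "A \<in> sets borel" for A
    unfolding \<sigma>'_def c_def using that s by (intro emeasure_density_const) simp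
  have mm: "measure \<sigma>' A = c * measure \<sigma> A" if "A \<in> sets borel" for A
    using em[OF that] c by (simp add: measure_def enn2real_mult)
  have "prob_space \<sigma>'"
  proof (rule prob_spaceI)
    have "emeasure \<sigma>' UNIV = ennreal c * ennreal (measure \<sigma> UNIV)" by (simp add: em s.emeasure_eq_measure)
    also have "... = 1" using m by (simp add: c_def flip: ennreal_mult)
    finally show "emeasure \<sigma>' (space \<sigma>') = 1" by (simp add: \<sigma>'_def sp)
  qed
  moreover have "AE t in \<sigma>'. t \<in> F" unfolding \<sigma>'_def using F by (subst AE_density) (auto elim: eventually_mono)
  ultimately show "psupp F \<sigma>'" unfolding psupp_def by (simp add: \<sigma>'_def s)
  show "pos_density_at \<sigma>' t" if pd: "pos_density_at \<sigma> t"
  proof -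
    obtain D where D: "D > 0" "((\<lambda>e. measure \<sigma> {t - e..t + e} / (2 * e)) \<longlongrightarrow> D) (at_right 0)"
      using pd unfolding pos_density_at_def by blast
    have "((\<lambda>e. c * (measure \<sigma> {t - e..t + e} / (2 * e))) \<longlongrightarrow> c * D) (at_right 0)" by (intro tendsto_intros D)
    then have "((\<lambda>e. measure \<sigma>' {t - e..t + e} / (2 * e)) \<longlongrightarrow> c * D) (at_right 0)" by (simp add: mm)
    then show ?thesis unfolding pos_density_at_def using c D(1) by (intro exI[of _ "c * D"]) auto
  qed
  show "(LINT t|\<sigma>'. f t) = (LINT t|\<sigma>. f t) / measure \<sigma> UNIV" if [measurable]: "f \<in> borel_measurable borel"
    unfolding \<sigma>'_def by (subst integral_density) auto
qed

theorem theorem1: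
  fixes F :: "real set" and \<sigma> :: "real measure" and lamF :: "real measure"
    and q :: "nat \<Rightarrow> real poly"
  assumes F: "admissible_F F"
    and sig_sets: "sets \<sigma> = sets borel"
    and sig_fin: "finite_measure \<sigma>"
    and sig_supp: "msupport \<sigma> = F"
    and sig_dens: "AE t in lborel. t \<in> F \<longrightarrow> pos_density_at \<sigma> t"
    and lam: "is_equilibrium F lamF"
    and q_deg: "\<And>n. n \<ge> 1 \<Longrightarrow> degree (q n) \<le> 2 * n"
    and q_monic: "\<And>n. n \<ge> 1 \<Longrightarrow> lead_coeff (q n) = 1"
    and q_HP: "\<And>n. n \<ge> 1 \<Longrightarrow> \<exists>p1 p2 :: real poly.
                 degree p1 \<le> 2 * n - 1 \<and> degree p2 \<le> 2 * n - 1 \<and>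
                 (\<lambda>z. cpoly (q n) z * f1 z - cpoly p1 z) \<in> O[at_infinity](\<lambda>z. 1 / z ^ (n + 1)) \<and>
                 (\<lambda>z. cpoly (q n) z * f2 \<sigma> z - cpoly p2 z) \<in> O[at_infinity](\<lambda>z. 1 / z ^ (n + 1))"
  shows "(\<forall>\<^sub>F n in sequentially. degree (q n) = 2 * n \<and>
            (\<forall>z. cpoly (q n) z = 0 \<longrightarrow> z \<in> complex_of_real ` {-1<..<1}))
       \<and> (\<forall>K. compact K \<and> K \<subseteq> - Eint \<longrightarrow>
            uniform_limit K (\<lambda>n z. ln (1 / cmod (cpoly (q n) z) powr (1 / real n)))
              (\<lambda>z. logpot lamF z
                   - (\<integral>t. ln (1 / cmod (phi z - phi (complex_of_real t))) \<partial>lamF)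
                   - 2 * ln (cmod (phi z)) + ln 2) sequentially)"
proof -
  interpret s: finite_measure \<sigma> by fact
  obtain a b where ab: "1 < a" "a < b" and cF: "compact F" "F \<subseteq> {a..b}" "finite (F - interior F)" and infF: "infinite F"
    by (rule admissible_F_structure[OF F]; (rule that; assumption))
  have sp: "space \<sigma> = UNIV" using sets_eq_imp_space_eq[OF sig_sets] by simp
  have Fb: "F \<in> sets borel" using cF(1) by (rule borel_compact)
  have sF: "AE t in \<sigma>. t \<in> F" using AE_in_msupport[OF sig_sets] unfolding sig_supp .
  have infsupp: "\<not> (AE t in \<sigma>. t \<in> A)" if "finite A" for A
    using infinite_msupport_AE[OF sig_sets _ that] infF unfolding sig_supp by blast
  have m: "0 < measure \<sigma> UNIV"
  proof (rule ccontr)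
    assume "\<not> 0 < measure \<sigma> UNIV"
    then have "emeasure \<sigma> UNIV = 0" using measure_nonneg[of \<sigma> UNIV] by (simp add: s.emeasure_eq_measure)
    then have "AE t in \<sigma>. t \<in> {}" by (intro AE_I[of _ _ UNIV]) (auto simp: sig_sets)
    then show False using infsupp[of "{}"] by blast
  qed
  have sab: "AE t in \<sigma>. a \<le> t \<and> t \<le> b" using sF by eventually_elim (use cF(2) in auto)
  have sa: "AE t in \<sigma>. a \<le> t" using sab by eventually_elim simp
  define R where "R = tau b - tau a"
  note R = length_le_tau[OF ab, folded R_def]
  have lamF: "psupp F lamF" using lam unfolding is_equilibrium_def prob_on_iff_psupp[OF Fb] by blast
  note lamab = psupp_mono[OF lamF cF(2)]
  have lam_fe: "fin_en R lamF" using lam finite_log_energy_iff[OF lamab R] unfolding is_equilibrium_def by blast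
  have lam_min: "Jen lamF \<le> Jen \<kappa>" if "psupp F \<kappa>" "fin_en R \<kappa>" for \<kappa>
    using lam that finite_log_energy_iff[OF psupp_mono[OF that(1) cF(2)] R]
    unfolding is_equilibrium_def prob_on_iff_psupp[OF Fb] by blast
  \<comment> \<open>All properties of the zero set are bundled, so that a single choice of S for
    each n provides them together.\<close>
  define P where "P n S \<longleftrightarrow> finite S \<and> card S = n \<and> S \<subseteq> {a..b} \<and> q n = smult (1 / 4 ^ n) (bspoly n S) \<and>
      (\<forall>k<n. (LINT t|\<sigma>. (\<Prod>s\<in>S. (t - s)) * t ^ k *
        zero_weight n S t) = 0)" for n S
  have "\<exists>S. P n S" if n: "n \<ge> 1" for n
  proof -
    obtain p1 p2 :: "real poly" where hp: "(\<lambda>z. cpoly (q n) z * f1 z - cpoly p1 z) \<in> O[at_infinity](\<lambda>z. 1 / z ^ (n + 1))"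
      "(\<lambda>z. cpoly (q n) z * f2 \<sigma> z - cpoly p2 z) \<in> O[at_infinity](\<lambda>z. 1 / z ^ (n + 1))" using q_HP[OF n] by blast
    note o = hermite_pade_orthogonality[OF sig_sets sig_fin ab(1) sa hp]
    obtain S where S: "finite S" "card S = n" "S \<subseteq> {a..b}" "q n = smult (1 / 4 ^ n) (bspoly n S)"
      "\<And>k. k < n \<Longrightarrow> (LINT t|\<sigma>. (\<Prod>s\<in>S. (t - s)) * t ^ k *
        zero_weight n S t) = 0"
      by (rule nikishin_structure[OF sig_sets sig_fin ab(1) less_imp_le[OF ab(2)] sab infsupp n q_deg[OF n] q_monic[OF n] o];
          (assumption | (rule that; assumption)))
    have "P n S" unfolding P_def using S by blast
    then show ?thesis ..
  qed
  then obtain S where "\<And>n. n \<ge> 1 \<Longrightarrow> P n (S n)" by metis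
  then have S: "\<And>n. n \<ge> 1 \<Longrightarrow> finite (S n)" "\<And>n. n \<ge> 1 \<Longrightarrow> card (S n) = n" "\<And>n. n \<ge> 1 \<Longrightarrow> S n \<subseteq> {a..b}"
    and qS: "\<And>n. n \<ge> 1 \<Longrightarrow> q n = smult (1 / 4 ^ n) (bspoly n (S n))"
    and orth: "\<And>n k. n \<ge> 1 \<Longrightarrow> k < n \<Longrightarrow> (LINT t|\<sigma>. (\<Prod>s\<in>S n. (t - s)) * t ^ k *
        zero_weight n (S n) t) = 0" unfolding P_def by blast+
  have "\<exists>x. bij_betw x {..<n} (S n)" if "n \<ge> 1" for n
    using ex_bij_betw_nat_finite[OF S(1)[OF that]] S(2)[OF that] by (simp add: lessThan_atLeast0)
  then obtain x where x: "\<And>n. n \<ge> 1 \<Longrightarrow> bij_betw (x n) {..<n} (S n)" by metis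
  define \<sigma>' where "\<sigma>' = density \<sigma> (\<lambda>_. ennreal (1 / measure \<sigma> UNIV))"
  note norm = normalized_measure[OF sig_sets sig_fin sF m, folded \<sigma>'_def]
  have dens: "AE t in lborel. t \<in> F \<longrightarrow> pos_density_at \<sigma>' t" using sig_dens by eventually_elim (use norm(2) in blast)
  have orth': "(LINT t|\<sigma>'. (\<Prod>s\<in>S n. (t - s)) * t ^ k *
        zero_weight n (S n) t) = 0" if "n \<ge> 1" "k < n" for n k
    using orth[OF that] by (subst norm(3)) (auto simp: zero_weight_def)
  have wc: "weak_conv_m (\<lambda>n. emp (Suc n) (x (Suc n))) lamF"
    by (rule zero_distribution_weak_limit[OF ab cF norm(1) dens lamF lam_fe[unfolded R_def] lam_min[unfolded R_def] S x orth'])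
  have S1: "1 < s" if "n \<ge> 1" "s \<in> S n" for n s using S(3)[OF that(1)] that(2) ab by auto
  have deg: "degree (q n) = 2 * n" if n: "n \<ge> 1" for n
  proof -
    have "coeff (q n) (2 * n) = 1" unfolding qS[OF n] using bspoly_degree_lead(2)[OF n] by simp
    then have "2 * n \<le> degree (q n)" by (intro le_degree) simp
    with q_deg[OF n] show ?thesis by simp
  qed
  have zeros: "z \<in> complex_of_real ` {-1<..<1}" if n: "n \<ge> 1" and z: "cpoly (q n) z = 0" for n z
  proof (rule bspoly_zeros[OF S(1,2)[OF n] S1[OF n] n])
    show "cpoly (bspoly n (S n)) z = 0" using z unfolding qS[OF n] cpoly_smult by simp
  qed
  have real: "integrable lamF (\<lambda>t. ln \<bar>y - t\<bar>)" if "y \<in> {a..b}" for y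
    by (rule equilibrium_log_integrable[OF ab cF(2) lamF lam_fe[unfolded R_def] lam_min[unfolded R_def] that])
  have at: "emeasure lamF {y} = 0" for y by (rule no_atoms_of_finite_energy[OF lamab lam_fe R])
  \<comment> \<open>Valid for every z, in particular on F, where both integrals on the left are
    singular.\<close>
  have lim: "logpot lamF z - (LINT t|lamF. ln (1 / cmod (phi z - phi (of_real t)))) = ln 2 - (LINT t|lamF. lk a b (1 / phi z) t)" for z
    by (rule limit_function_eq[OF ab lamab real at])
  show ?thesis
  proof (intro conjI allI impI)
    show "\<forall>\<^sub>F n in sequentially. degree (q n) = 2 * n \<and> (\<forall>z. cpoly (q n) z = 0 \<longrightarrow> z \<in> complex_of_real ` {-1<..<1})"
      using eventually_ge_at_top[of 1] by eventually_elim (use deg zeros in blast)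
    fix K assume K: "compact K \<and> K \<subseteq> - Eint"
    show "uniform_limit K (\<lambda>n z. ln (1 / cmod (cpoly (q n) z) powr (1 / real n)))
      (\<lambda>z. logpot lamF z - (LINT t|lamF. ln (1 / cmod (phi z - phi (of_real t))))
        - 2 * ln (cmod (phi z)) + ln 2) sequentially"
      unfolding lim by (rule hermite_pade_asymptotics[OF ab lamab S x qS wc]; (assumption | (use K in blast)))
  qed
qed

end
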